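(* Suppose that $(\mathcal S_1,\mu_1)$ and $(\mathcal S_2,\mu_2)$ are two Borel probability spaces and that $W_1:\mathcal S_1^2\to[0,1]$ and $W_2:\mathcal S_2^2\to[0,1]$ are two symmetric measurable functions, and let $\Gamma_1,\Gamma_2\in\mathcal U_\infty$ be the corresponding graph limits. Then the following are equivalent. (i) $\Gamma_1=\Gamma_2$ in $\mathcal U_\infty$. (ii) $t(F,\Gamma_1)=t(F,\Gamma_2)$ for every graph $F$. (iii) The exchangeable random infinite graphs $G(\infty,W_1)$ and $G(\infty,W_2)$ have the same distribution. (iv) The random graphs $G(n,W_1)$ and $G(n,W_2)$ have the same distribution for every finite $n$. (v) There exist measure preserving maps $\varphi_j:[0,1]\to\mathcal S_j$, $j=1,2$, such that $W_1^{\varphi_1}=W_2^{\varphi_2}$ a.e., i.e. $W_1(\varphi_1(x),\varphi_1(y))=W_2(\varphi_2(x),\varphi_2(y))$ a.e. on $[0,1]^2$. (vi) There exists a measurable mapping $\psi:\mathcal S_1\times[0,1]\to\mathcal S_2$ that maps $\mu_1\times\lambda$ to $\mu_2$ such that $W_1(x,y)=W_2(\psi(x,t_1),\psi(y,t_2))$ for a.e. $x,y\in\mathcal S_1$ and $t_1,t_2\in[0,1]$. (vii) $\delta_\square(W_1,W_2)=0$, where $\delta_\square$ is the cut metric. If further $W_2$ is almost twin-free, then these are also equivalent to: (viii) There exists a measure preserving map $\varphi:\mathcal S_1\to\mathcal S_2$ such that $W_1=W_2^{\varphi}$ a.s., i.e. $W_1(x,y)=W_2(\varphi(x),\varphi(y))$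 a.e. on $\mathcal S_1^2$. If both $W_1$ and $W_2$ are almost twin-free, then these are also equivalent to: (ix) There exists a measure preserving map $\varphi:\mathcal S_1\to\mathcal S_2$ such that $\varphi$ is a bimeasurable bijection of $\mathcal S_1\setminus N_1$ onto $\mathcal S_2\setminus N_2$ for some null sets $N_1\subset\mathcal S_1$ and $N_2\subset\mathcal S_2$, and $W_1=W_2^\varphi$ a.s., i.e. $W_1(x,y)=W_2(\varphi(x),\varphi(y))$ a.e. on $\mathcal S_1^2$. If further $(\mathcal S_2,\mu_2)$ has no atoms, for example if $\mathcal S_2=[0,1]$, then we may take $N_1=N_2=\emptyset$.
   Context: Graphs $F$ are finite, simple and undirected; $|F|$ is the number of vertices. For graphs $F,G$, $t(F,G)$ is the probability that a uniformly random map $V(F)\to V(G)$ is a graph homomorphism. A graph limit $\Gamma$ is the limit of a sequence of graphs $G_n$ with $|G_n|\to\infty$ for which $t(F,G_n)$ converges for every $F$; it is determined by the numbers $t(F,\Gamma)=\lim_n t(F,G_n)$. $\mathcal U_\infty$ is the set of all graph limits. For a probability space $(\mathcal S,\mu)$ and a symmetric measurable $W:\mathcal S^2\to[0,1]$, the corresponding graph limit $\Gamma$ is the unique element of $\mathcal U_\infty$ with $t(F,\Gamma)=\int_{\mathcal S^{|F|}}\prod_{ij\in E(F)}W(x_i,x_j)\,d\mu(x_1)\cdots d\mu(x_{|F|})$ for every graph $F$. For $n\le\infty$, $G(n,W)=G(n,W,\mu)$ is the random graph on vertex set $\{1,\dots,n\}$ (on $\{1,2,\dots\}$ if $n=\infty$)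 obtained by taking i.i.d. $X_1,X_2,\dots$ in $\mathcal S$ with distribution $\mu$ and then, conditionally on these, letting each edge $ij$, $i<j$, appear with probability $W(X_i,X_j)$, independently for all pairs. A Borel space is a measurable space isomorphic to a Borel subset of $[0,1]$; a Borel probability space is a probability space whose underlying measurable space is Borel. $[0,1]$ carries Lebesgue measure $\lambda$ and $\mathcal S_j$ carries $\mu_j$; "a.e.", "null set" and "measure preserving" refer to these measures (and their products). For $\varphi:\mathcal S\to\mathcal S_j$, $W_j^{\varphi}(x,y)=W_j(\varphi(x),\varphi(y))$. For a symmetric $W':\mathcal S^2\to[0,1]$ on a probability space $\mathcal S$, points $x_1,x_2\in\mathcal S$ are twins if $W'(x_1,y)=W'(x_2,y)$ for a.e. $y\in\mathcal S$. $W'$ is almost twin-free if there is a null set $N\subset\mathcal S$ such that there are no twins $x_1,x_2\in\mathcal S\setminus N$ with $x_1\ne x_2$. Cut metric: $\delta_\square(W_1,W_2)=\inf_\pi\sup_{A,B}\left|\int_{A\times B}\bigl(W_1(x_1,y_1)-W_2(x_2,y_2)\bigr)\,d\pi(x_1,x_2)\,d\pi(y_1,y_2)\right|$, where the infimum is over all couplings $\pi$ of $\mu_1$ and $\mu_2$ (probability measures on $\mathcal S_1\times\mathcal S_2$ with marginals $\mu_1,\mu_2$) and the supremum is over all measurable $A,B\subseteq\mathcal S_1\times\mathcal S_2$. *)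

theory Defs
  imports "HOL-Probability.Probability" "Graph_Theory.Pair_Digraph"
begin

text \<open>
  A finite simple graph is a \<^const>\<open>pair_graph\<close> with vertices in \<^typ>\<open>nat\<close>; every finite simple
  graph is isomorphic to one of these, and homomorphism densities are isomorphism invariant. The arc
  relation of such a graph is symmetric, so each undirected edge occurs as two arcs.
\<close>

type_synonym ngraph = "nat pair_pre_digraph"

definition graph_edges :: "ngraph \<Rightarrow> (nat \<times> nat) set" where
  "graph_edges F = {(i, j). (i, j) \<in> parcs F \<and> i < j}"

definition graph_homs :: "ngraph \<Rightarrow> ngraph \<Rightarrow> (nat \<Rightarrow> nat) set" where
  "graph_homs F G =
     {f \<in> pverts F \<rightarrow>\<^sub>E pverts G. \<forall>(i, j) \<in> parcs F. (f i, f j) \<in> parcs G}"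

definition hom_density :: "ngraph \<Rightarrow> ngraph \<Rightarrow> real" where
  "hom_density F G =
     real (card (graph_homs F G)) / real (card (pverts F \<rightarrow>\<^sub>E pverts G))"


text \<open>
  Graph limits are formal limits of convergent graph sequences: two such sequences have the same
  limit iff all their limiting homomorphism densities agree.
\<close>

definition convergent_graph_seqs :: "(nat \<Rightarrow> ngraph) set" where
  "convergent_graph_seqs =
     {G. (\<forall>n. pair_graph (G n)) \<and>
         filterlim (\<lambda>n. card (pverts (G n))) at_top sequentially \<and>
         (\<forall>F. pair_graph F \<longrightarrow> convergent (\<lambda>n. hom_density F (G n)))}"

definition same_graph_limit :: "((nat \<Rightarrow> ngraph) \<times> (nat \<Rightarrow> ngraph)) set" where
  "same_graph_limit =
     {(G, H). G \<in> convergent_graph_seqs \<and> H \<in> convergent_graph_seqs \<and>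
        (\<forall>F. pair_graph F \<longrightarrow>
           lim (\<lambda>n. hom_density F (G n)) = lim (\<lambda>n. hom_density F (H n)))}"

type_synonym graph_limit = "(nat \<Rightarrow> ngraph) set"

definition graph_limits :: "graph_limit set" where
  "graph_limits = convergent_graph_seqs // same_graph_limit"

definition limit_density :: "ngraph \<Rightarrow> graph_limit \<Rightarrow> real" where
  "limit_density F \<Gamma> = (THE l. \<forall>G \<in> \<Gamma>. (\<lambda>n. hom_density F (G n)) \<longlonglongrightarrow> l)"

lemma equiv_same_graph_limit: "equiv convergent_graph_seqs same_graph_limit"
  by (rule equivI) (auto simp: same_graph_limit_def refl_on_def sym_def trans_def)

lemma limit_density_tendsto:
  assumes "\<Gamma> \<in> graph_limits" "G \<in> \<Gamma>" "pair_graph F"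
  shows "(\<lambda>n. hom_density F (G n)) \<longlonglongrightarrow> limit_density F \<Gamma>"
proof -
  obtain H where H: "H \<in> convergent_graph_seqs" "\<Gamma> = same_graph_limit `` {H}"
    using assms(1) unfolding graph_limits_def by (elim quotientE)
  have lim: "(\<lambda>n. hom_density F (K n)) \<longlonglongrightarrow> lim (\<lambda>n. hom_density F (H n))" if "K \<in> \<Gamma>" for K
  proof -
    have K: "K \<in> convergent_graph_seqs"
      "lim (\<lambda>n. hom_density F (H n)) = lim (\<lambda>n. hom_density F (K n))"
      using that H(2) assms(3) by (auto simp: same_graph_limit_def)
    then show ?thesis
      using assms(3) by (simp add: convergent_graph_seqs_def convergent_LIMSEQ_iff)
  qed
  have "limit_density F \<Gamma> = lim (\<lambda>n. hom_density F (H n))"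
    unfolding limit_density_def using lim assms(2) by (blast intro: the_equality LIMSEQ_unique)
  then show ?thesis using lim[OF assms(2)] by simp
qed


definition graphon :: "'a measure \<Rightarrow> ('a \<Rightarrow> 'a \<Rightarrow> real) \<Rightarrow> bool" where
  "graphon M W \<longleftrightarrow>
     (\<lambda>(x, y). W x y) \<in> borel_measurable (M \<Otimes>\<^sub>M M) \<and>
     (\<forall>x \<in> space M. \<forall>y \<in> space M. W x y = W y x \<and> W x y \<in> {0..1})"

definition graphon_density :: "ngraph \<Rightarrow> 'a measure \<Rightarrow> ('a \<Rightarrow> 'a \<Rightarrow> real) \<Rightarrow> real" where
  "graphon_density F M W =
     (\<integral>x. (\<Prod>(i, j) \<in> graph_edges F. W (x i) (x j)) \<partial>(\<Pi>\<^sub>M i \<in> pverts F. M))"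

definition graphon_limit :: "'a measure \<Rightarrow> ('a \<Rightarrow> 'a \<Rightarrow> real) \<Rightarrow> graph_limit" where
  "graphon_limit M W =
     (THE \<Gamma>. \<Gamma> \<in> graph_limits \<and>
        (\<forall>F. pair_graph F \<longrightarrow> limit_density F \<Gamma> = graphon_density F M W))"


text \<open>
  A graph on \<open>{1, \<dots>, n}\<close> (on \<open>{1, 2, \<dots>}\<close> if \<open>n = \<infinity>\<close>) is encoded by its edge indicators, a
  Boolean family indexed by the pairs \<open>i < j\<close> of vertices; the space of such families carries the
  product \<open>\<sigma>\<close>-algebra. \<open>random_graph n M W\<close> is the distribution of the random graph: the types
  \<open>x\<close> are i.i.d. and the edges are, conditionally on the types, independent Bernoulli variables.
\<close>

definition rg_vertices :: "enat \<Rightarrow> nat set" where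
  "rg_vertices n = {i. 1 \<le> i \<and> enat i \<le> n}"

definition rg_pairs :: "enat \<Rightarrow> (nat \<times> nat) set" where
  "rg_pairs n = {(i, j). i \<in> rg_vertices n \<and> j \<in> rg_vertices n \<and> i < j}"

definition random_graph ::
    "enat \<Rightarrow> 'a measure \<Rightarrow> ('a \<Rightarrow> 'a \<Rightarrow> real) \<Rightarrow> (nat \<times> nat \<Rightarrow> bool) measure" where
  "random_graph n M W =
     (\<Pi>\<^sub>M i \<in> rg_vertices n. M) \<bind>
       (\<lambda>x. \<Pi>\<^sub>M e \<in> rg_pairs n. measure_pmf (bernoulli_pmf (W (x (fst e)) (x (snd e)))))"

text \<open>Measurability of the edge kernel, without which \<^const>\<open>bind\<close> would be degenerate.\<close>

lemma edge_kernel_measurable: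
  assumes W: "graphon M W"
  shows "(\<lambda>x. \<Pi>\<^sub>M e \<in> rg_pairs n. measure_pmf (bernoulli_pmf (W (x (fst e)) (x (snd e)))))
    \<in> measurable (\<Pi>\<^sub>M i \<in> rg_vertices n. M)
        (prob_algebra (\<Pi>\<^sub>M e \<in> rg_pairs n. count_space UNIV))"
proof -
  let ?K = "\<lambda>x. \<Pi>\<^sub>M e \<in> rg_pairs n. measure_pmf (bernoulli_pmf (W (x (fst e)) (x (snd e))))"
  let ?N = "\<Pi>\<^sub>M e \<in> rg_pairs n. count_space (UNIV :: bool set)"
  let ?X = "\<Pi>\<^sub>M i \<in> rg_vertices n. M"
  have sets_K: "sets (?K x) = sets ?N" for x
    by (intro sets_PiM_cong) auto
  have prob_K: "prob_space (?K x)" for x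
    by (intro prob_space_PiM measure_pmf.prob_space_axioms)
  have Wm: "(\<lambda>x. pmf (bernoulli_pmf (W (x (fst e)) (x (snd e)))) b) \<in> borel_measurable ?X"
    if "e \<in> rg_pairs n" for e b
  proof -
    have e: "fst e \<in> rg_vertices n" "snd e \<in> rg_vertices n"
      using that by (auto simp: rg_pairs_def)
    have "(\<lambda>x. (x (fst e), x (snd e))) \<in> measurable ?X (M \<Otimes>\<^sub>M M)"
      using e by measurable
    from measurable_compose[OF this, of "\<lambda>(x, y). W x y" borel]
    have m: "(\<lambda>x. W (x (fst e)) (x (snd e))) \<in> borel_measurable ?X"
      using W by (simp add: graphon_def)
    have "pmf (bernoulli_pmf (W (x (fst e)) (x (snd e)))) b =
        (if b then W (x (fst e)) (x (snd e)) else 1 - W (x (fst e)) (x (snd e)))"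
      if "x \<in> space ?X" for x
    proof -
      have "W (x (fst e)) (x (snd e)) \<in> {0..1}"
        using W that e unfolding graphon_def by (auto simp: space_PiM PiE_iff)
      then show ?thesis by (cases b) auto
    qed
    then show ?thesis
      using m by (cases b) (simp_all cong: measurable_cong)
  qed
  show ?thesis
  proof (rule measurable_prob_algebra_generated[OF sets_PiM Int_stable_prod_algebra prod_algebra_sets_into_space])
    show "prob_space (?K x)" for x by (rule prob_K)
    show "sets (?K x) = sets ?N" for x by (rule sets_K)
    fix A assume "A \<in> prod_algebra (rg_pairs n) (\<lambda>e. count_space (UNIV :: bool set))"
    then obtain J E where A: "A = prod_emb (rg_pairs n) (\<lambda>e. count_space UNIV) J (\<Pi>\<^sub>E j\<in>J. E j)"
      and J: "finite J" "J \<subseteq> rg_pairs n"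
      by (auto elim!: prod_algebraE)
    have "emeasure (?K x) A =
      (\<Prod>e\<in>J. ennreal (\<Sum>b\<in>E e. pmf (bernoulli_pmf (W (x (fst e)) (x (snd e)))) b))" for x
    proof -
      let ?B = "\<lambda>e. measure_pmf (bernoulli_pmf (W (x (fst e)) (x (snd e))))"
      interpret product_prob_space ?B "rg_pairs n"
        by unfold_locales
      have "A = prod_emb (rg_pairs n) ?B J (\<Pi>\<^sub>E j\<in>J. E j)"
        by (simp add: A prod_emb_def)
      then have "emeasure (?K x) A = (\<Prod>e\<in>J. emeasure (?B e) (E e))"
        using emeasure_PiM_emb[OF J(2,1), of E] by simp
      also have "\<dots> = (\<Prod>e\<in>J. ennreal (\<Sum>b\<in>E e. pmf (bernoulli_pmf (W (x (fst e)) (x (snd e)))) b))"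
        by (intro prod.cong refl emeasure_measure_pmf_finite) (auto intro: finite_subset[OF subset_UNIV])
      finally show ?thesis .
    qed
    moreover have "(\<lambda>x. \<Prod>e\<in>J. ennreal (\<Sum>b\<in>E e. pmf (bernoulli_pmf (W (x (fst e)) (x (snd e)))) b))
        \<in> borel_measurable ?X"
    proof (rule borel_measurable_prod_ennreal, rule measurable_compose[OF _ measurable_ennreal])
      fix e assume "e \<in> J"
      then show "(\<lambda>x. \<Sum>b\<in>E e. pmf (bernoulli_pmf (W (x (fst e)) (x (snd e)))) b) \<in> borel_measurable ?X"
        using J(2) by (intro borel_measurable_sum Wm) auto
    qed
    ultimately show "(\<lambda>x. emeasure (?K x) A) \<in> borel_measurable ?X"
      by presburger
  qed
qed


text \<open>\<open>[0, 1]\<close> carries its Borel \<open>\<sigma>\<close>-algebra.\<close>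

definition unit_interval :: "real measure" where
  "unit_interval = restrict_space lborel {0..1}"

definition measure_preserving :: "'a measure \<Rightarrow> 'b measure \<Rightarrow> ('a \<Rightarrow> 'b) \<Rightarrow> bool" where
  "measure_preserving M N \<phi> \<longleftrightarrow> \<phi> \<in> measurable M N \<and> distr M N \<phi> = N"

definition bimeasurable_bij :: "'a measure \<Rightarrow> 'b measure \<Rightarrow> ('a \<Rightarrow> 'b) \<Rightarrow> bool" where
  "bimeasurable_bij M N \<phi> \<longleftrightarrow>
     bij_betw \<phi> (space M) (space N) \<and> \<phi> \<in> measurable M N \<and>
     inv_into (space M) \<phi> \<in> measurable N M"

definition Borel_prob_space :: "'a measure \<Rightarrow> bool" where
  "Borel_prob_space M \<longleftrightarrow> prob_space M \<and>
     (\<exists>(B :: real set) f. B \<in> sets borel \<and> B \<subseteq> {0..1} \<and> bimeasurable_bij M (restrict_space borel B) f)"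

definition atomless :: "'a measure \<Rightarrow> bool" where
  "atomless M \<longleftrightarrow>
     \<not> (\<exists>A \<in> sets M. emeasure M A > 0 \<and>
          (\<forall>B \<in> sets M. B \<subseteq> A \<longrightarrow> emeasure M B = 0 \<or> emeasure M B = emeasure M A))"

definition twins :: "'a measure \<Rightarrow> ('a \<Rightarrow> 'a \<Rightarrow> real) \<Rightarrow> 'a \<Rightarrow> 'a \<Rightarrow> bool" where
  "twins M W x1 x2 \<longleftrightarrow> (AE y in M. W x1 y = W x2 y)"

definition almost_twin_free :: "'a measure \<Rightarrow> ('a \<Rightarrow> 'a \<Rightarrow> real) \<Rightarrow> bool" where
  "almost_twin_free M W \<longleftrightarrow>
     (\<exists>N \<in> null_sets M. \<not> (\<exists>x1 \<in> space M - N. \<exists>x2 \<in> space M - N. x1 \<noteq> x2 \<and> twins M W x1 x2))"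

definition couplings :: "'a measure \<Rightarrow> 'b measure \<Rightarrow> ('a \<times> 'b) measure set" where
  "couplings M1 M2 =
     {P. prob_space P \<and> sets P = sets (M1 \<Otimes>\<^sub>M M2) \<and> distr P M1 fst = M1 \<and> distr P M2 snd = M2}"

definition cut_distance ::
    "'a measure \<Rightarrow> ('a \<Rightarrow> 'a \<Rightarrow> real) \<Rightarrow> 'b measure \<Rightarrow> ('b \<Rightarrow> 'b \<Rightarrow> real) \<Rightarrow> real" where
  "cut_distance M1 W1 M2 W2 =
     (INF P \<in> couplings M1 M2. SUP (A, B) \<in> sets (M1 \<Otimes>\<^sub>M M2) \<times> sets (M1 \<Otimes>\<^sub>M M2).
        \<bar>LINT ((x1, x2), (y1, y2)) : A \<times> B | P \<Otimes>\<^sub>M P. W1 x1 y1 - W2 x2 y2\<bar>)"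

end

theory Submission
  imports Defs "HOL-Real_Asymp.Real_Asymp" "HOL-Library.Diagonal_Subsequence"
begin

text \<open>If two graphons have the same densities, the random graphs on \<open>n\<close> vertices sampled from them have
  the same law, so some graph \<open>g\<close> is a typical sample of both, with types \<open>x\<close> and \<open>y\<close>. Edges are
  conditionally independent, so \<open>g\<close> is close in the cut norm both to \<open>W1 (x i) (x j)\<close> and to
  \<open>W2 (y i) (y j)\<close>. Along a subsequence the empirical measures of the pairs \<open>(x i, y i)\<close> converge to a
  coupling of the two type spaces on which \<open>W1\<close> and \<open>W2\<close> agree almost everywhere. Disintegrating the coupling
  over the first coordinate gives \<open>\<psi>\<close> in (vi); all points \<open>\<psi> (x, t)\<close> with the same \<open>x\<close> are
  twins, so \<open>\<psi>\<close> does not depend on \<open>t\<close> if \<open>W2\<close> is twin-free. Conversely, a small cut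
  distance makes the densities close by the counting lemma.\<close>

section \<open>Sampling from a graphon\<close>

text \<open>Both graphons are coded on the real line, so that a coupling is determined by its
  distribution function at countably many rational points. The obstacle is that \<open>W1\<close>
  and \<open>W2\<close> are only measurable: convergence of the empirical measures says nothing
  about averages of \<open>W1 (x i) (x j)\<close>. The samples are therefore chosen to be typical
  also for the functions |W - U|, where U runs through step functions on rational quadrants that
  approximate W in L1. Averages of U do converge, and the error |W - U| is small both along the
  samples and under the limit coupling, since the latter has the right marginals. The marginal
  frequencies converge at every rational point, jumps included, so no mass is displaced in the
  limit. Maps out of [0,1] arise from the kernel \<psi> through a measure preserving map from [0,1]
  to the product of \<open>M1\<close> with [0,1]. An isomorphism up to null sets becomes a bijection
  of the whole spaces by a Hilbert hotel inside a null set that contains a copy of the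
  plane.\<close>

lemma (in prob_space) integrable_bounded:
  assumes "f \<in> borel_measurable M" "\<And>x. x \<in> space M \<Longrightarrow> \<bar>f x\<bar> \<le> (C::real)"
  shows "integrable M f"
  by (rule integrable_const_bound[where B=C]) (use assms in auto)

lemma (in prob_space) integral_abs_le:
  assumes "f \<in> borel_measurable M" "\<And>x. x \<in> space M \<Longrightarrow> \<bar>f x\<bar> \<le> (C::real)"
  shows "\<bar>\<integral>x. f x \<partial>M\<bar> \<le> C"
proof -
  have i: "integrable M f" using assms by (rule integrable_bounded)
  have "\<bar>\<integral>x. f x \<partial>M\<bar> \<le> (\<integral>x. \<bar>f x\<bar> \<partial>M)" by (rule integral_abs_bound)
  also have "\<dots> \<le> (\<integral>x. C \<partial>M)"
    using i assms(2) by (intro integral_mono) auto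
  finally show ?thesis by (simp add: prob_space)
qed

lemma graphon_bounds:
  assumes "graphon M W" "x \<in> space M" "y \<in> space M"
  shows "0 \<le> W x y" "W x y \<le> 1" "\<bar>W x y\<bar> \<le> 1" "W x y = W y x"
  using assms by (auto simp: graphon_def)

lemma graphon_measurable:
  assumes W: "graphon M W" and fg: "f \<in> measurable N M" "g \<in> measurable N M"
  shows "(\<lambda>x. W (f x) (g x)) \<in> borel_measurable N"
proof -
  have "(\<lambda>x. (f x, g x)) \<in> measurable N (M \<Otimes>\<^sub>M M)" using fg by measurable
  from measurable_compose[OF this, of "\<lambda>(x, y). W x y" borel] show ?thesis
    using W by (simp add: graphon_def)
qed

section \<open>Independence of disjoint coordinates in product measures\<close>

lemma distr_PiM_pair:
  assumes M: "prob_space M" and ij: "i \<in> I" "j \<in> I" "i \<noteq> j"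
  shows "distr (PiM I (\<lambda>_. M)) (M \<Otimes>\<^sub>M M) (\<lambda>x. (x i, x j)) = M \<Otimes>\<^sub>M M"
proof -
  interpret prob_space M by fact
  \<comment> \<open>A binary product is a product indexed by \<open>bool\<close>, so the claim
    becomes a reindexing along the injection \<open>?h\<close>.\<close>
  let ?h = "\<lambda>b. if b then i else j"
  have 1: "distr (PiM I (\<lambda>_. M)) (PiM UNIV (\<lambda>_::bool. M)) (\<lambda>x. \<lambda>n\<in>UNIV. x (?h n))
    = PiM UNIV (\<lambda>_::bool. M)"
    using distr_PiM_reindex[of I "\<lambda>_. M" ?h UNIV] M ij by (auto simp: inj_on_def)
  have 2: "M \<Otimes>\<^sub>M M = distr (PiM UNIV (\<lambda>_::bool. M)) (M \<Otimes>\<^sub>M M) (\<lambda>x. (x True, x False))"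
  proof -
    have "case_bool M M = (\<lambda>_. M)" by (auto split: bool.splits)
    then show ?thesis
      using pair_measure_eq_distr_PiM[OF sigma_finite_measure_axioms sigma_finite_measure_axioms] by simp
  qed
  have m: "(\<lambda>x. \<lambda>n\<in>UNIV. x (?h n)) \<in> measurable (PiM I (\<lambda>_. M)) (PiM UNIV (\<lambda>_::bool. M))"
    using ij by (intro measurable_restrict measurable_component_singleton) auto
  have m': "(\<lambda>x. (x True, x False)) \<in> measurable (PiM UNIV (\<lambda>_::bool. M)) (M \<Otimes>\<^sub>M M)"
    by measurable
  show ?thesis
    by (subst (2) 2, subst 1[symmetric], subst distr_distr[OF m' m]) (simp add: comp_def)
qed

text \<open>Restriction to the finite set \<open>J \<union> K\<close> comes first. On that index set
  \<open>merge\<close> is measure preserving, and restricting to \<open>J\<close> and to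
  \<open>K\<close> undoes it.\<close>

lemma distr_PiM_split:
  assumes M: "prob_space M" and fin: "finite J" "finite K" and JK: "J \<inter> K = {}" "J \<union> K \<subseteq> I"
  shows "distr (PiM I (\<lambda>_. M)) (PiM J (\<lambda>_. M) \<Otimes>\<^sub>M PiM K (\<lambda>_. M)) (\<lambda>x. (restrict x J, restrict x K))
    = PiM J (\<lambda>_. M) \<Otimes>\<^sub>M PiM K (\<lambda>_. M)"
proof -
  interpret prob_space M by fact
  interpret product_prob_space "\<lambda>_. M" by unfold_locales
  let ?N = "PiM (J \<union> K) (\<lambda>_. M)" and ?I = "PiM I (\<lambda>_. M)"
  let ?P = "PiM J (\<lambda>_. M) \<Otimes>\<^sub>M PiM K (\<lambda>_. M)"
  have 1: "distr ?I ?N (\<lambda>x. restrict x (J \<union> K)) = ?N"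
    using fin JK by (intro distr_PiM_restrict_finite) auto
  have 2: "distr ?P ?N (merge J K) = ?N"
    using fin JK by (intro distr_merge) auto
  have mr: "(\<lambda>x. restrict x (J \<union> K)) \<in> measurable ?I ?N"
    using JK by (intro measurable_restrict_subset) auto
  have mp: "(\<lambda>x. (restrict x J, restrict x K)) \<in> measurable ?N ?P"
    by (intro measurable_Pair measurable_restrict_subset) auto
  have "distr ?I ?P (\<lambda>x. (restrict x J, restrict x K)) =
      distr (distr ?I ?N (\<lambda>x. restrict x (J \<union> K))) ?P (\<lambda>x. (restrict x J, restrict x K))"
    by (subst distr_distr[OF mp mr]) (simp add: comp_def Int_absorb1 Int_absorb2 inf_commute)
  also have "\<dots> = distr (distr ?P ?N (merge J K)) ?P (\<lambda>x. (restrict x J, restrict x K))"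
    by (simp only: 1 2)
  also have "\<dots> = distr ?P ?P ((\<lambda>x. (restrict x J, restrict x K)) \<circ> merge J K)"
    by (rule distr_distr[OF mp]) simp
  also have "\<dots> = distr ?P ?P (\<lambda>x. x)"
  proof (rule distr_cong[OF refl refl])
    fix x assume "x \<in> space ?P"
    then obtain a b where x: "x = (a, b)" "a \<in> extensional J" "b \<in> extensional K"
      by (auto simp: space_pair_measure space_PiM PiE_def)
    show "((\<lambda>x. (restrict x J, restrict x K)) \<circ> merge J K) x = x"
      using x JK by (simp add: extensional_restrict Int_commute)
  qed
  finally show ?thesis by (simp add: distr_id)
qed

text \<open>Independence: functions of disjoint sets of coordinates are uncorrelated. This makes
  most terms of the second moments below vanish. The index types are free because the lemma serves
  both for single pairs of vertices, indexed by \<open>bool\<close>, and for all vertices of a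
  graph.\<close>

lemma integral_PiM_disjoint:
  fixes F :: "('v \<Rightarrow> 'a) \<Rightarrow> real" and F' :: "('w \<Rightarrow> 'a) \<Rightarrow> real"
  assumes M: "prob_space M" and fin: "finite V" "finite V'"
    and inj: "inj_on \<phi> V" "inj_on \<phi>' V'" and disj: "\<phi> ` V \<inter> \<phi>' ` V' = {}"
    and sub: "\<phi> ` V \<subseteq> I" "\<phi>' ` V' \<subseteq> I"
    and F: "F \<in> borel_measurable (PiM V (\<lambda>_. M))" "\<And>x. x \<in> space (PiM V (\<lambda>_. M)) \<Longrightarrow> \<bar>F x\<bar> \<le> C"
    and F': "F' \<in> borel_measurable (PiM V' (\<lambda>_. M))" "\<And>x. x \<in> space (PiM V' (\<lambda>_. M)) \<Longrightarrow> \<bar>F' x\<bar> \<le> C'"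
  shows "(\<integral>x. F (\<lambda>v\<in>V. x (\<phi> v)) * F' (\<lambda>v\<in>V'. x (\<phi>' v)) \<partial>PiM I (\<lambda>_. M)) =
    (\<integral>x. F x \<partial>PiM V (\<lambda>_. M)) * (\<integral>x. F' x \<partial>PiM V' (\<lambda>_. M))"
proof -
  interpret prob_space M by fact
  let ?I = "PiM I (\<lambda>_. M)" and ?V = "PiM V (\<lambda>_. M)" and ?V' = "PiM V' (\<lambda>_. M)"
  let ?J = "PiM (\<phi> ` V) (\<lambda>_. M)" and ?K = "PiM (\<phi>' ` V') (\<lambda>_. M)"
  interpret V: prob_space ?V by (intro prob_space_PiM M)
  interpret V': prob_space ?V' by (intro prob_space_PiM M)
  interpret J: prob_space ?J by (intro prob_space_PiM M)
  interpret K: prob_space ?K by (intro prob_space_PiM M)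
  interpret VV: pair_prob_space ?V ?V' ..
  let ?r = "\<lambda>x. \<lambda>v\<in>V. x (\<phi> v)" and ?r' = "\<lambda>x. \<lambda>v\<in>V'. x (\<phi>' v)"
  have 1: "distr ?J ?V ?r = ?V"
    using distr_PiM_reindex[of "\<phi> ` V" "\<lambda>_. M" \<phi> V] M inj by simp
  have 2: "distr ?K ?V' ?r' = ?V'"
    using distr_PiM_reindex[of "\<phi>' ` V'" "\<lambda>_. M" \<phi>' V'] M inj by simp
  have m1: "?r \<in> measurable ?J ?V" and m2: "?r' \<in> measurable ?K ?V'"
    by (intro measurable_restrict measurable_component_singleton; simp)+
  have s: "distr ?I (?J \<Otimes>\<^sub>M ?K) (\<lambda>x. (restrict x (\<phi> ` V), restrict x (\<phi>' ` V'))) = ?J \<Otimes>\<^sub>M ?K"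
    using fin disj sub by (intro distr_PiM_split[OF M]) auto
  have ms: "(\<lambda>x. (restrict x (\<phi> ` V), restrict x (\<phi>' ` V'))) \<in> measurable ?I (?J \<Otimes>\<^sub>M ?K)"
    using sub by (intro measurable_Pair measurable_restrict_subset) auto
  have "?V \<Otimes>\<^sub>M ?V' = distr (?J \<Otimes>\<^sub>M ?K) (?V \<Otimes>\<^sub>M ?V') (\<lambda>(x, y). (?r x, ?r' y))"
    using pair_measure_distr[OF m1 m2] by (simp add: 1 2 V'.sigma_finite_measure_axioms)
  also have "\<dots> = distr ?I (?V \<Otimes>\<^sub>M ?V') (\<lambda>x. (?r x, ?r' x))"
  proof -
    have mm: "(\<lambda>(x, y). (?r x, ?r' y)) \<in> measurable (?J \<Otimes>\<^sub>M ?K) (?V \<Otimes>\<^sub>M ?V')"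
      using m1 m2 by measurable
    show ?thesis
      by (subst s[symmetric], subst distr_distr[OF mm ms]) (auto intro!: distr_cong simp: comp_def cong: restrict_cong)
  qed
  finally have eq: "?V \<Otimes>\<^sub>M ?V' = distr ?I (?V \<Otimes>\<^sub>M ?V') (\<lambda>x. (?r x, ?r' x))" .
  have mI: "(\<lambda>x. (?r x, ?r' x)) \<in> measurable ?I (?V \<Otimes>\<^sub>M ?V')"
    using sub by (intro measurable_Pair measurable_restrict measurable_component_singleton) auto
  have mF: "(\<lambda>z. F (fst z) * F' (snd z)) \<in> borel_measurable (?V \<Otimes>\<^sub>M ?V')"
    using F(1) F'(1) by measurable
  have iF: "integrable (?V \<Otimes>\<^sub>M ?V') (\<lambda>z. F (fst z) * F' (snd z))"
  proof (rule VV.integrable_bounded[OF mF])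
    fix z assume "z \<in> space (?V \<Otimes>\<^sub>M ?V')"
    then have "\<bar>F (fst z)\<bar> \<le> C" "\<bar>F' (snd z)\<bar> \<le> C'"
      using F(2) F'(2) by (auto simp: space_pair_measure)
    then show "\<bar>F (fst z) * F' (snd z)\<bar> \<le> C * C'"
      unfolding abs_mult by (intro mult_mono) auto
  qed
  have "(\<integral>x. F (?r x) * F' (?r' x) \<partial>?I) = (\<integral>z. F (fst z) * F' (snd z) \<partial>(?V \<Otimes>\<^sub>M ?V'))"
    by (subst eq, subst integral_distr[OF mI mF]) simp
  also have "\<dots> = (\<integral>x. \<integral>y. F x * F' y \<partial>?V' \<partial>?V)"
    using VV.integral_fst'[OF iF] by simp
  finally show ?thesis by simp
qed

section \<open>The random graph together with its types\<close>

definition vertex_pairs :: "nat \<Rightarrow> (nat \<times> nat) set" where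
  "vertex_pairs n = {(i, j). i < j \<and> j < n}"

text \<open>The edge indicators are encoded as in \<open>random_graph\<close>, but vertices are
  counted from 0 instead of 1. As \<open>n\<close> is finite there are finitely many graphs, and
  conditional expectations given the types are finite sums.\<close>

definition graphs_on :: "nat \<Rightarrow> (nat \<times> nat \<Rightarrow> bool) set" where
  "graphs_on n = (vertex_pairs n \<rightarrow>\<^sub>E UNIV)"

definition edge_weight :: "('a \<Rightarrow> 'a \<Rightarrow> real) \<Rightarrow> (nat \<Rightarrow> 'a) \<Rightarrow> nat \<times> nat \<Rightarrow> bool \<Rightarrow> real" where
  "edge_weight W x e b = (if b then W (x (fst e)) (x (snd e)) else 1 - W (x (fst e)) (x (snd e)))"

definition graph_weight :: "nat \<Rightarrow> ('a \<Rightarrow> 'a \<Rightarrow> real) \<Rightarrow> (nat \<Rightarrow> 'a) \<Rightarrow> (nat \<times> nat \<Rightarrow> bool) \<Rightarrow> real" where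
  "graph_weight n W x g = (\<Prod>e\<in>vertex_pairs n. edge_weight W x e (g e))"

text \<open>The joint law of the random graph and of the types of its vertices.\<close>

definition sampled_graph ::
    "nat \<Rightarrow> 'a measure \<Rightarrow> ('a \<Rightarrow> 'a \<Rightarrow> real) \<Rightarrow> ((nat \<times> nat \<Rightarrow> bool) \<times> (nat \<Rightarrow> 'a)) measure" where
  "sampled_graph n M W =
     density (count_space (graphs_on n) \<Otimes>\<^sub>M PiM {..<n} (\<lambda>_. M)) (\<lambda>(g, x). ennreal (graph_weight n W x g))"

lemma finite_vertex_pairs [simp, intro]: "finite (vertex_pairs n)"
  by (rule finite_subset[of _ "{..<n} \<times> {..<n}"]) (auto simp: vertex_pairs_def)

lemma finite_graphs_on [simp, intro]: "finite (graphs_on n)"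
  unfolding graphs_on_def by (intro finite_PiE) auto

text \<open>Graphs that differ only in the edge \<open>e\<close> are paired, which isolates the
  randomness of this edge.\<close>

lemma sum_graphs_on_split:
  assumes e: "e \<in> vertex_pairs n"
  shows "(\<Sum>g\<in>graphs_on n. h g) =
    (\<Sum>g\<in>(vertex_pairs n - {e}) \<rightarrow>\<^sub>E UNIV. h (g(e := True)) + h (g(e := False)))"
proof -
  let ?S = "vertex_pairs n - {e}"
  have ins: "vertex_pairs n = insert e ?S" using e by auto
  have "(\<Sum>g\<in>graphs_on n. h g) =
      (\<Sum>p\<in>UNIV \<times> (?S \<rightarrow>\<^sub>E UNIV). h ((snd p)(e := fst p)))"
    unfolding graphs_on_def
    by (subst ins, subst PiE_insert_eq, subst sum.reindex)
       (use inj_combinator[of e ?S "\<lambda>_. UNIV :: bool set"] in \<open>auto simp: comp_def case_prod_unfold\<close>)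
  also have "\<dots> = (\<Sum>b\<in>UNIV. \<Sum>g\<in>?S \<rightarrow>\<^sub>E UNIV. h (g(e := b)))"
    by (simp add: sum.cartesian_product case_prod_unfold)
  finally show ?thesis by (simp add: UNIV_bool sum.distrib add.commute)
qed

lemma graph_weight_update:
  assumes e: "e \<in> vertex_pairs n"
  shows "graph_weight n W x (g(e := b)) =
    edge_weight W x e b * (\<Prod>e\<in>vertex_pairs n - {e}. edge_weight W x e (g e))"
  unfolding graph_weight_def
  by (subst prod.remove[OF _ e]) (auto intro!: prod.cong)

text \<open>Given the types, the indicator of \<open>e\<close> has mean W and is independent of the
  other edges, so its centred version is orthogonal to every \<open>R\<close> that does not look at
  \<open>e\<close>. Each pair of graphs differing only in \<open>e\<close> contributes a multiple of
  w (1 - w) - (1 - w) w.\<close>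

lemma sum_graph_weight_centered:
  assumes e: "e \<in> vertex_pairs n" and R: "\<And>g. R (g(e := True)) = R (g(e := False))"
  shows "(\<Sum>g\<in>graphs_on n. graph_weight n W x g *
    ((of_bool (g e) - W (x (fst e)) (x (snd e))) * R g)) = 0"
  by (subst sum_graphs_on_split[OF e])
     (simp add: graph_weight_update[OF e] R edge_weight_def algebra_simps)

lemma prod_if_subset:
  assumes "finite T" "S \<subseteq> T"
  shows "(\<Prod>e\<in>T. if e \<in> S then f e else 1) = prod f S"
  using assms by (intro prod.mono_neutral_cong_right) auto

text \<open>The sum over all graphs factorizes over the vertex pairs. A pair outside
  \<open>S\<close> contributes the total Bernoulli mass 1, a pair in \<open>S\<close> the
  probability of the edge.\<close>

lemma sum_graph_weight_subset:
  assumes S: "S \<subseteq> vertex_pairs n"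
  shows "(\<Sum>g\<in>graphs_on n. graph_weight n W x g * (\<Prod>e\<in>S. of_bool (g e))) =
    (\<Prod>e\<in>S. W (x (fst e)) (x (snd e)))"
proof -
  have "(\<Sum>g\<in>graphs_on n. graph_weight n W x g * (\<Prod>e\<in>S. of_bool (g e))) =
    (\<Sum>g\<in>graphs_on n. \<Prod>e\<in>vertex_pairs n. edge_weight W x e (g e) * (if e \<in> S then of_bool (g e) else 1))"
    unfolding graph_weight_def prod.distrib
    using S by (simp add: prod_if_subset)
  also have "\<dots> = (\<Prod>e\<in>vertex_pairs n. \<Sum>b\<in>UNIV. edge_weight W x e b * (if e \<in> S then of_bool b else 1))"
    unfolding graphs_on_def by (rule prod_sum_PiE[symmetric]) auto
  also have "\<dots> = (\<Prod>e\<in>vertex_pairs n. if e \<in> S then W (x (fst e)) (x (snd e)) else 1)"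
    by (intro prod.cong) (auto simp: UNIV_bool edge_weight_def)
  also have "\<dots> = (\<Prod>e\<in>S. W (x (fst e)) (x (snd e)))"
    using S by (simp add: prod_if_subset)
  finally show ?thesis .
qed

lemma sum_graph_weight: "(\<Sum>g\<in>graphs_on n. graph_weight n W x g) = 1"
  using sum_graph_weight_subset[of "{}" n W x] by simp

lemma edge_weight_bounds:
  assumes "graphon M W" "x \<in> space (PiM {..<n} (\<lambda>_. M))" "e \<in> vertex_pairs n"
  shows "0 \<le> edge_weight W x e b" "edge_weight W x e b \<le> 1"
proof -
  have "x (fst e) \<in> space M" "x (snd e) \<in> space M"
    using assms(2,3) by (auto simp: space_PiM vertex_pairs_def PiE_iff)
  from graphon_bounds[OF assms(1) this]
  show "0 \<le> edge_weight W x e b" "edge_weight W x e b \<le> 1"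
    by (auto simp: edge_weight_def)
qed

lemma graph_weight_bounds:
  assumes "graphon M W" "x \<in> space (PiM {..<n} (\<lambda>_. M))"
  shows "0 \<le> graph_weight n W x g" "graph_weight n W x g \<le> 1"
proof -
  show "0 \<le> graph_weight n W x g"
    unfolding graph_weight_def by (rule prod_nonneg) (rule edge_weight_bounds(1)[OF assms])
  show "graph_weight n W x g \<le> 1"
    unfolding graph_weight_def by (rule prod_le_1) (simp add: edge_weight_bounds[OF assms])
qed

lemma edge_weight_measurable:
  assumes "graphon M W" "e \<in> vertex_pairs n"
  shows "(\<lambda>x. edge_weight W x e b) \<in> borel_measurable (PiM {..<n} (\<lambda>_. M))"
proof -
  have "(\<lambda>x. W (x (fst e)) (x (snd e))) \<in> borel_measurable (PiM {..<n} (\<lambda>_. M))"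
    using assms(2) by (intro graphon_measurable[OF assms(1)] measurable_component_singleton)
      (auto simp: vertex_pairs_def)
  then show ?thesis by (cases b) (simp_all add: edge_weight_def)
qed

lemma graph_weight_measurable:
  assumes "graphon M W"
  shows "(\<lambda>x. graph_weight n W x g) \<in> borel_measurable (PiM {..<n} (\<lambda>_. M))"
  unfolding graph_weight_def by (rule borel_measurable_prod) (rule edge_weight_measurable[OF assms])

section \<open>Second moments and the cut norm of the edge noise\<close>

lemma (in prob_space) second_moment_sum:
  fixes Z :: "'s \<Rightarrow> 'a \<Rightarrow> real"
  assumes T: "finite T" and Z: "\<And>s. s \<in> T \<Longrightarrow> Z s \<in> borel_measurable M"
    and C: "\<And>s x. s \<in> T \<Longrightarrow> x \<in> space M \<Longrightarrow> \<bar>Z s x\<bar> \<le> C"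
    and B: "B \<subseteq> T \<times> T" and zero: "\<And>s t. s \<in> T \<Longrightarrow> t \<in> T \<Longrightarrow> (s, t) \<notin> B \<Longrightarrow> (\<integral>x. Z s x * Z t x \<partial>M) = 0"
  shows "(\<integral>x. (\<Sum>s\<in>T. Z s x)\<^sup>2 \<partial>M) \<le> C\<^sup>2 * card B"
proof -
  have bnd: "\<bar>Z s x * Z t x\<bar> \<le> C\<^sup>2" if "s \<in> T" "t \<in> T" "x \<in> space M" for s t x
    unfolding abs_mult power2_eq_square using C[OF that(1,3)] C[OF that(2,3)] by (intro mult_mono) auto
  have int: "integrable M (\<lambda>x. Z s x * Z t x)" if "s \<in> T" "t \<in> T" for s t
    by (rule integrable_bounded[where C="C\<^sup>2"]) (use Z bnd that in auto)
  have "(\<integral>x. (\<Sum>s\<in>T. Z s x)\<^sup>2 \<partial>M) = (\<integral>x. (\<Sum>p\<in>T \<times> T. Z (fst p) x * Z (snd p) x) \<partial>M)"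
    by (simp add: power2_eq_square sum_product sum.cartesian_product case_prod_unfold)
  also have "\<dots> = (\<Sum>p\<in>T \<times> T. \<integral>x. Z (fst p) x * Z (snd p) x \<partial>M)"
    by (rule Bochner_Integration.integral_sum) (auto intro: int)
  \<comment> \<open>Only the pairs that may be correlated survive. Every application consists in
    counting them: \<open>B\<close> has to be of smaller order than all of
    \<open>T \<times> T\<close>.\<close>
  also have "\<dots> = (\<Sum>p\<in>B. \<integral>x. Z (fst p) x * Z (snd p) x \<partial>M)"
    using T B zero by (intro sum.mono_neutral_right) auto
  also have "\<dots> \<le> (\<Sum>p\<in>B. C\<^sup>2)"
  proof (rule sum_mono)
    fix p assume "p \<in> B"
    then have p: "fst p \<in> T" "snd p \<in> T" using B by auto
    have "\<bar>\<integral>x. Z (fst p) x * Z (snd p) x \<partial>M\<bar> \<le> C\<^sup>2"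
      by (rule integral_abs_le) (use Z bnd p in auto)
    then show "(\<integral>x. Z (fst p) x * Z (snd p) x \<partial>M) \<le> C\<^sup>2" by linarith
  qed
  finally show ?thesis by (simp add: mult.commute)
qed

text \<open>Given the types, the edge noises are independent and centred. Hence the products of two rows are
  small, which bounds the cut norm of the noise by the following use of Cauchy--Schwarz.\<close>

definition edge_noise ::
    "('a \<Rightarrow> 'a \<Rightarrow> real) \<Rightarrow> (nat \<times> nat \<Rightarrow> bool) \<Rightarrow> (nat \<Rightarrow> 'a) \<Rightarrow> nat \<Rightarrow> nat \<Rightarrow> real" where
  "edge_noise W g x i j = (if i = j then 0 else of_bool (g (min i j, max i j)) - W (x i) (x j))"

lemma edge_noise_update:
  "(min i j, max i j) \<noteq> e \<Longrightarrow> edge_noise W (g(e := b)) x i j = edge_noise W g x i j"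
  by (simp add: edge_noise_def)

text \<open>The right side is free of \<open>a\<close> and \<open>b\<close>. A single bound in
  expectation therefore controls all cuts at once, and no union bound over exponentially many vertex
  sets is needed.\<close>

lemma bilinear_square_le:
  fixes A :: "nat \<Rightarrow> nat \<Rightarrow> real"
  assumes a: "\<And>i. \<bar>a i\<bar> \<le> 1" and b: "\<And>i. \<bar>b i\<bar> \<le> 1"
  shows "(\<Sum>i<n. \<Sum>j<n. a i * b j * A i j)\<^sup>2 \<le> n * (\<Sum>i<n. \<Sum>i'<n. \<bar>\<Sum>j<n. A i j * A i' j\<bar>)"
proof -
  let ?c = "\<lambda>j. \<Sum>i<n. a i * A i j"
  have "(\<Sum>i<n. \<Sum>j<n. a i * b j * A i j) = (\<Sum>j<n. b j * ?c j)"
    by (subst sum.swap) (simp add: sum_distrib_left mult_ac)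
  then have "(\<Sum>i<n. \<Sum>j<n. a i * b j * A i j)\<^sup>2 \<le> (\<Sum>j<n. (b j)\<^sup>2) * (\<Sum>j<n. (?c j)\<^sup>2)"
    by (simp add: Cauchy_Schwarz_ineq_sum)
  also have "\<dots> \<le> n * (\<Sum>j<n. (?c j)\<^sup>2)"
  proof (rule mult_right_mono)
    have "(\<Sum>j<n. (b j)\<^sup>2) \<le> (\<Sum>j<n. 1)"
      using b by (intro sum_mono) (simp add: abs_square_le_1)
    then show "(\<Sum>j<n. (b j)\<^sup>2) \<le> n" by simp
  qed (simp add: sum_nonneg)
  also have "(\<Sum>j<n. (?c j)\<^sup>2) = (\<Sum>i<n. \<Sum>i'<n. a i * a i' * (\<Sum>j<n. A i j * A i' j))"
  proof -
    have "(\<Sum>j<n. (?c j)\<^sup>2) = (\<Sum>j<n. \<Sum>i<n. \<Sum>i'<n. a i * a i' * (A i j * A i' j))"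
      by (simp add: power2_eq_square sum_product mult_ac)
    also have "\<dots> = (\<Sum>i<n. \<Sum>i'<n. \<Sum>j<n. a i * a i' * (A i j * A i' j))"
      by (subst sum.swap) (rule sum.cong[OF refl], rule sum.swap)
    finally show ?thesis by (simp add: sum_distrib_left)
  qed
  also have "real n * \<dots> \<le> n * (\<Sum>i<n. \<Sum>i'<n. \<bar>\<Sum>j<n. A i j * A i' j\<bar>)"
  proof (intro mult_left_mono sum_mono)
    fix i i'
    have "\<bar>a i * a i'\<bar> \<le> 1" unfolding abs_mult using a[of i] a[of i'] by (intro mult_le_one) auto
    then have "\<bar>a i * a i'\<bar> * \<bar>\<Sum>j<n. A i j * A i' j\<bar> \<le> 1 * \<bar>\<Sum>j<n. A i j * A i' j\<bar>"
      by (intro mult_right_mono) auto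
    then show "a i * a i' * (\<Sum>j<n. A i j * A i' j) \<le> \<bar>\<Sum>j<n. A i j * A i' j\<bar>"
      unfolding abs_mult[symmetric] by linarith
  qed simp
  finally show ?thesis .
qed

context
  fixes M :: "'a measure" and W :: "'a \<Rightarrow> 'a \<Rightarrow> real" and n :: nat
  assumes M: "prob_space M" and W: "graphon M W"
begin

text \<open>Fubini with the graph as the inner variable. Since the graph component is finite and
  discrete, measurability is checked for one graph at a time.\<close>

lemma integral_sampled_graph:
  assumes f: "\<And>g. g \<in> graphs_on n \<Longrightarrow> (\<lambda>x. f (g, x)) \<in> borel_measurable (PiM {..<n} (\<lambda>_. M))"
    and C: "\<And>g x. g \<in> graphs_on n \<Longrightarrow> x \<in> space (PiM {..<n} (\<lambda>_. M)) \<Longrightarrow> \<bar>f (g, x)\<bar> \<le> (C::real)"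
  shows "(\<integral>z. f z \<partial>sampled_graph n M W) =
      (\<integral>x. (\<Sum>g\<in>graphs_on n. graph_weight n W x g * f (g, x)) \<partial>(PiM {..<n} (\<lambda>_. M)))"
    and "f \<in> borel_measurable (sampled_graph n M W)"
proof -
  let ?X = "PiM {..<n} (\<lambda>_. M)" and ?G = "count_space (graphs_on n)"
  interpret X: prob_space ?X by (intro prob_space_PiM M)
  interpret G: finite_measure ?G by (rule finite_measure_count_space) simp
  interpret GX: pair_sigma_finite ?G ?X ..
  have wm: "(\<lambda>z. graph_weight n W (snd z) (fst z)) \<in> borel_measurable (?G \<Otimes>\<^sub>M ?X)"
    by (rule measurable_pair_measure_countable1)
       (auto intro!: graph_weight_measurable[OF W] countable_finite)
  have fm: "f \<in> borel_measurable (?G \<Otimes>\<^sub>M ?X)"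
    by (rule measurable_pair_measure_countable1) (auto intro!: f countable_finite)
  show "f \<in> borel_measurable (sampled_graph n M W)"
    unfolding sampled_graph_def by (simp add: fm)
  have i1: "integrable ?X (\<lambda>x. graph_weight n W x g * f (g, x))" if "g \<in> graphs_on n" for g
  proof (rule X.integrable_bounded)
    show "(\<lambda>x. graph_weight n W x g * f (g, x)) \<in> borel_measurable ?X"
      by (intro borel_measurable_times graph_weight_measurable[OF W] f that)
    fix x assume "x \<in> space ?X"
    then have "\<bar>graph_weight n W x g\<bar> * \<bar>f (g, x)\<bar> \<le> 1 * C"
      using graph_weight_bounds[OF W, of x n g] C[OF that] by (intro mult_mono) auto
    then show "\<bar>graph_weight n W x g * f (g, x)\<bar> \<le> C" by (simp add: abs_mult)
  qed
  have i2: "integrable (?G \<Otimes>\<^sub>M ?X) (\<lambda>z. graph_weight n W (snd z) (fst z) * f z)"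
  proof (rule finite_measure.integrable_const_bound[where B=C])
    show "finite_measure (?G \<Otimes>\<^sub>M ?X)" 
      by (rule finite_measure_pair_measure) (rule G.finite_measure_axioms X.finite_measure_axioms)+
    show "AE z in ?G \<Otimes>\<^sub>M ?X. norm (graph_weight n W (snd z) (fst z) * f z) \<le> C"
    proof (rule AE_I2)
      fix z assume z: "z \<in> space (?G \<Otimes>\<^sub>M ?X)"
      then have "\<bar>graph_weight n W (snd z) (fst z)\<bar> * \<bar>f (fst z, snd z)\<bar> \<le> 1 * C"
        using graph_weight_bounds[OF W, of "snd z" n "fst z"] C
        by (intro mult_mono) (auto simp: space_pair_measure)
      then show "norm (graph_weight n W (snd z) (fst z) * f z) \<le> C" by (simp add: abs_mult)
    qed
  qed (use wm fm in measurable)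
  have "(\<integral>z. f z \<partial>sampled_graph n M W) = (\<integral>z. graph_weight n W (snd z) (fst z) * f z \<partial>(?G \<Otimes>\<^sub>M ?X))"
    unfolding sampled_graph_def case_prod_unfold
    using fm wm graph_weight_bounds[OF W]
    by (subst integral_real_density) (auto simp: space_pair_measure intro!: AE_I2)
  also have "\<dots> = (\<integral>g. \<integral>x. graph_weight n W x g * f (g, x) \<partial>?X \<partial>?G)"
    using GX.integral_fst'[OF i2] by simp
  also have "\<dots> = (\<Sum>g\<in>graphs_on n. \<integral>x. graph_weight n W x g * f (g, x) \<partial>?X)"
    by (subst lebesgue_integral_count_space_finite) auto
  also have "\<dots> = (\<integral>x. (\<Sum>g\<in>graphs_on n. graph_weight n W x g * f (g, x)) \<partial>?X)"
    by (rule Bochner_Integration.integral_sum[symmetric]) (rule i1)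
  finally show "(\<integral>z. f z \<partial>sampled_graph n M W) =
      (\<integral>x. (\<Sum>g\<in>graphs_on n. graph_weight n W x g * f (g, x)) \<partial>?X)" .
qed

lemma space_sampled_graph:
  "space (sampled_graph n M W) = graphs_on n \<times> space (PiM {..<n} (\<lambda>_. M))"
  by (simp add: sampled_graph_def space_pair_measure)

lemma prob_space_sampled_graph: "prob_space (sampled_graph n M W)"
proof
  let ?X = "PiM {..<n} (\<lambda>_. M)" and ?G = "count_space (graphs_on n)"
  interpret X: prob_space ?X by (intro prob_space_PiM M)
  interpret G: finite_measure ?G by (rule finite_measure_count_space) simp
  interpret GX: pair_sigma_finite ?G ?X ..
  have wm: "(\<lambda>z. ennreal (graph_weight n W (snd z) (fst z))) \<in> borel_measurable (?G \<Otimes>\<^sub>M ?X)"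
    by (rule measurable_pair_measure_countable1)
       (auto intro!: measurable_compose[OF graph_weight_measurable[OF W] measurable_ennreal] countable_finite)
  have "emeasure (sampled_graph n M W) (space (sampled_graph n M W)) =
    (\<integral>\<^sup>+z. ennreal (graph_weight n W (snd z) (fst z)) \<partial>(?G \<Otimes>\<^sub>M ?X))"
    unfolding sampled_graph_def case_prod_unfold
    by (subst emeasure_density[OF wm]) (auto intro!: nn_integral_cong)
  also have "\<dots> = (\<integral>\<^sup>+g. \<integral>\<^sup>+x. ennreal (graph_weight n W x g) \<partial>?X \<partial>?G)"
    using X.nn_integral_fst[OF wm] by simp
  also have "\<dots> = (\<Sum>g\<in>graphs_on n. \<integral>\<^sup>+x. ennreal (graph_weight n W x g) \<partial>?X)"
    by (simp add: nn_integral_count_space_finite)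
  also have "\<dots> = (\<integral>\<^sup>+x. (\<Sum>g\<in>graphs_on n. ennreal (graph_weight n W x g)) \<partial>?X)"
    by (rule nn_integral_sum[symmetric])
       (intro measurable_compose[OF graph_weight_measurable[OF W] measurable_ennreal])
  also have "\<dots> = (\<integral>\<^sup>+x. 1 \<partial>?X)"
    by (rule nn_integral_cong) (simp add: sum_ennreal graph_weight_bounds[OF W] sum_graph_weight)
  finally show "emeasure (sampled_graph n M W) (space (sampled_graph n M W)) = 1"
    by (simp add: X.emeasure_space_1)
qed


lemma integral_sampled_graph_types:
  assumes f: "f \<in> borel_measurable (PiM {..<n} (\<lambda>_. M))"
    and C: "\<And>x. x \<in> space (PiM {..<n} (\<lambda>_. M)) \<Longrightarrow> \<bar>f x\<bar> \<le> (C::real)"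
  shows "(\<integral>z. f (snd z) \<partial>sampled_graph n M W) = (\<integral>x. f x \<partial>(PiM {..<n} (\<lambda>_. M)))"
  using f C
  by (subst integral_sampled_graph(1)[where C=C])
     (auto simp: sum_graph_weight sum_distrib_right[symmetric])

lemma snd_measurable_sampled_graph:
  "snd \<in> measurable (sampled_graph n M W) (PiM {..<n} (\<lambda>_. M))"
  unfolding sampled_graph_def by simp

text \<open>Pairs of vertices without a common vertex are independent, so of the n^4 terms of the
  square only O(n^3) can be nonzero. The diagonal is set to 0 because the law of (x i, x i) is not
  the product measure, so that subtracting the mean would not centre it.\<close>

lemma integral_offdiag_square_le:
  fixes h :: "'a \<times> 'a \<Rightarrow> real"
  assumes h: "h \<in> borel_measurable (M \<Otimes>\<^sub>M M)" and C: "\<And>z. z \<in> space (M \<Otimes>\<^sub>M M) \<Longrightarrow> \<bar>h z\<bar> \<le> C"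
  defines "Z \<equiv> \<lambda>s x. if fst s \<noteq> snd s then h (x (fst s), x (snd s)) - (\<integral>z. h z \<partial>(M \<Otimes>\<^sub>M M)) else 0"
  shows "(\<integral>x. (\<Sum>s\<in>{..<n} \<times> {..<n}. Z s x)\<^sup>2 \<partial>(PiM {..<n} (\<lambda>_. M))) \<le> (2 * C)\<^sup>2 * (4 * real n ^ 3)"
    and "\<And>s. s \<in> {..<n} \<times> {..<n} \<Longrightarrow> Z s \<in> borel_measurable (PiM {..<n} (\<lambda>_. M))"
    and "\<And>s x. s \<in> {..<n} \<times> {..<n} \<Longrightarrow> x \<in> space (PiM {..<n} (\<lambda>_. M)) \<Longrightarrow> \<bar>Z s x\<bar> \<le> 2 * C"
proof -
  let ?X = "PiM {..<n} (\<lambda>_. M)" and ?m = "\<integral>z. h z \<partial>(M \<Otimes>\<^sub>M M)"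
  interpret M: prob_space M by (rule M)
  interpret X: prob_space ?X by (intro prob_space_PiM M)
  interpret MM: pair_prob_space M M ..
  have m: "\<bar>?m\<bar> \<le> C" by (rule MM.integral_abs_le[OF h C])
  have C0: "0 \<le> C" using m by linarith
  show meas: "Z s \<in> borel_measurable ?X" if "s \<in> {..<n} \<times> {..<n}" for s
  proof -
    have "(\<lambda>x. (x (fst s), x (snd s))) \<in> measurable ?X (M \<Otimes>\<^sub>M M)"
      using that by (intro measurable_Pair measurable_component_singleton) auto
    from measurable_compose[OF this h] show ?thesis by (simp add: Z_def)
  qed
  show bnd: "\<bar>Z s x\<bar> \<le> 2 * C" if "s \<in> {..<n} \<times> {..<n}" "x \<in> space ?X" for s x
  proof -
    have "(x (fst s), x (snd s)) \<in> space (M \<Otimes>\<^sub>M M)"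
      using that by (auto simp: space_pair_measure space_PiM PiE_iff)
    from C[OF this] show ?thesis using m C0 by (auto simp: Z_def)
  qed
  \<comment> \<open>The possibly correlated terms: the two vertex pairs share a vertex.\<close>
  let ?B = "{(s, s'). s \<in> {..<n} \<times> {..<n} \<and> s' \<in> {..<n} \<times> {..<n} \<and> {fst s, snd s} \<inter> {fst s', snd s'} \<noteq> {}}"
  have zero: "(\<integral>x. Z s x * Z s' x \<partial>?X) = 0"
    if ss: "s \<in> {..<n} \<times> {..<n}" "s' \<in> {..<n} \<times> {..<n}" "(s, s') \<notin> ?B" for s s'
  proof (cases "fst s = snd s \<or> fst s' = snd s'")
    case True then show ?thesis by (auto simp: Z_def)
  next
    case False
    let ?F = "\<lambda>y. h (y True, y False) - ?m"
    let ?Y = "PiM (UNIV :: bool set) (\<lambda>_. M)"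
    interpret Y: prob_space ?Y by (intro prob_space_PiM M)
    have my: "(\<lambda>y. (y True, y False)) \<in> measurable ?Y (M \<Otimes>\<^sub>M M)" by measurable
    have hm: "(\<lambda>y. h (y True, y False)) \<in> borel_measurable ?Y"
      using measurable_compose[OF my h] by simp
    have hb: "\<bar>h (y True, y False)\<bar> \<le> C" if "y \<in> space ?Y" for y
      using that by (intro C) (auto simp: space_pair_measure space_PiM PiE_iff)
    have d: "distr ?Y (M \<Otimes>\<^sub>M M) (\<lambda>y. (y True, y False)) = M \<Otimes>\<^sub>M M"
      by (rule distr_PiM_pair[OF M]) auto
    have "(\<integral>y. h (y True, y False) \<partial>?Y) = ?m"
      using integral_distr[OF my h] by (simp only: d)
    then have F0: "(\<integral>y. ?F y \<partial>?Y) = 0"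
      using Y.integrable_bounded[OF hm hb] by (simp add: Y.prob_space)
    let ?\<phi> = "\<lambda>b. if b then fst s else snd s" and ?\<phi>' = "\<lambda>b. if b then fst s' else snd s'"
    have "(\<integral>x. Z s x * Z s' x \<partial>?X) =
      (\<integral>x. ?F (\<lambda>v\<in>UNIV. x (?\<phi> v)) * ?F (\<lambda>v\<in>UNIV. x (?\<phi>' v)) \<partial>?X)"
      using False by (simp add: Z_def)
    also have "\<dots> = (\<integral>y. ?F y \<partial>?Y) * (\<integral>y. ?F y \<partial>?Y)"
    proof (rule integral_PiM_disjoint[OF M, where C="2*C" and C'="2*C"])
      show "\<bar>?F y\<bar> \<le> 2 * C" if "y \<in> space ?Y" for y
        using hb[OF that] m by linarith
      show "\<bar>?F y\<bar> \<le> 2 * C" if "y \<in> space ?Y" for y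
        using hb[OF that] m by linarith
    qed (use False ss hm in \<open>auto simp: inj_on_def split: if_splits\<close>)
    finally show ?thesis by (simp add: F0)
  qed
  have cardB: "card ?B \<le> 4 * n ^ 3"
  proof -
    let ?N = "{..<n} \<times> {..<n} \<times> {..<n}"
    \<comment> \<open>In each of the four images \<open>i\<close> is the shared vertex; they differ
      in the positions that it takes in the two pairs.\<close>
    have "?B \<subseteq> (\<lambda>(i, j, k). ((i, j), (i, k))) ` ?N \<union> (\<lambda>(i, j, k). ((i, j), (k, i))) ` ?N
      \<union> (\<lambda>(i, j, k). ((j, i), (i, k))) ` ?N \<union> (\<lambda>(i, j, k). ((j, i), (k, i))) ` ?N"
      (is "_ \<subseteq> ?f1 ` _ \<union> ?f2 ` _ \<union> ?f3 ` _ \<union> ?f4 ` _")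
      by (auto simp: image_iff)
    then have "card ?B \<le> card (?f1 ` ?N \<union> ?f2 ` ?N \<union> ?f3 ` ?N \<union> ?f4 ` ?N)"
      by (intro card_mono) auto
    also have "\<dots> \<le> card (?f1 ` ?N) + card (?f2 ` ?N) + card (?f3 ` ?N) + card (?f4 ` ?N)"
      by (intro order_trans[OF card_Un_le] add_mono order_refl)
    also have "\<dots> \<le> card ?N + card ?N + card ?N + card ?N"
      by (intro add_mono card_image_le) auto
    finally show ?thesis by (simp add: power3_eq_cube)
  qed
  have "(\<integral>x. (\<Sum>s\<in>{..<n} \<times> {..<n}. Z s x)\<^sup>2 \<partial>?X) \<le> (2 * C)\<^sup>2 * card ?B"
    by (rule X.second_moment_sum) (use meas bnd zero in auto)
  also have "\<dots> \<le> (2 * C)\<^sup>2 * (4 * real n ^ 3)"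
    using cardB by (intro mult_left_mono) (auto simp: of_nat_mono[of _ "4 * n ^ 3", simplified] dest: of_nat_mono)
  finally show "(\<integral>x. (\<Sum>s\<in>{..<n} \<times> {..<n}. Z s x)\<^sup>2 \<partial>?X) \<le> (2 * C)\<^sup>2 * (4 * real n ^ 3)" .
qed

lemma edge_noise_measurable:
  assumes "i < n" "j < n"
  shows "(\<lambda>x. edge_noise W g x i j) \<in> borel_measurable (PiM {..<n} (\<lambda>_. M))"
proof -
  have "(\<lambda>x. W (x i) (x j)) \<in> borel_measurable (PiM {..<n} (\<lambda>_. M))"
    using assms by (intro graphon_measurable[OF W] measurable_component_singleton) auto
  then show ?thesis by (simp add: edge_noise_def)
qed

lemma edge_noise_bound:
  assumes "i < n" "j < n" "x \<in> space (PiM {..<n} (\<lambda>_. M))"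
  shows "\<bar>edge_noise W g x i j\<bar> \<le> 1"
proof -
  have "x i \<in> space M" "x j \<in> space M" using assms by (auto simp: space_PiM PiE_iff)
  from graphon_bounds[OF W this] show ?thesis by (auto simp: edge_noise_def)
qed

text \<open>In the expanded square a mixed term with j \<noteq> k contains the noise of the edge ij
  exactly once, so it vanishes after averaging over this edge alone. The n terms with j = k remain,
  each at most 1.\<close>

lemma integral_edge_noise_square_le:
  assumes ii: "i < n" "i' < n" "i \<noteq> i'"
  shows "(\<integral>z. (\<Sum>j<n. edge_noise W (fst z) (snd z) i j * edge_noise W (fst z) (snd z) i' j)\<^sup>2
    \<partial>sampled_graph n M W) \<le> n"
proof -
  let ?A = "\<lambda>z i j. edge_noise W (fst z) (snd z) i j" and ?X = "PiM {..<n} (\<lambda>_. M)"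
  interpret S: prob_space "sampled_graph n M W" by (rule prob_space_sampled_graph)
  let ?Z = "\<lambda>j z. ?A z i j * ?A z i' j" and ?B = "(\<lambda>j. (j, j)) ` {..<n}"
  have bnd: "\<bar>edge_noise W g x i j * edge_noise W g x i' j\<bar> \<le> 1"
    if "j < n" "x \<in> space ?X" for g x j
    unfolding abs_mult using edge_noise_bound[OF ii(1) that] edge_noise_bound[OF ii(2) that]
    by (intro mult_le_one) auto
  have meas: "?Z j \<in> borel_measurable (sampled_graph n M W)" if "j < n" for j
    by (rule integral_sampled_graph(2)[where C=1])
       (use bnd that ii in \<open>auto intro!: borel_measurable_times edge_noise_measurable\<close>)
  have "(\<integral>z. (\<Sum>j\<in>{..<n}. ?Z j z)\<^sup>2 \<partial>sampled_graph n M W) \<le> (1::real)\<^sup>2 * real (card ?B)"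
  proof (rule S.second_moment_sum)
    fix j k assume jk: "j \<in> {..<n}" "k \<in> {..<n}" "(j, k) \<notin> ?B"
    have "(\<integral>z. ?Z j z * ?Z k z \<partial>sampled_graph n M W) =
      (\<integral>x. (\<Sum>g\<in>graphs_on n. graph_weight n W x g * ((edge_noise W g x i j * edge_noise W g x i' j) *
        (edge_noise W g x i k * edge_noise W g x i' k))) \<partial>?X)"
    proof (subst integral_sampled_graph(1)[where C=1])
      fix g x assume x: "g \<in> graphs_on n" "x \<in> space ?X"
      show "\<bar>?Z j (g, x) * ?Z k (g, x)\<bar> \<le> 1"
        using bnd[of j x g] bnd[of k x g] jk x by (auto simp: abs_mult[of "_ * _" "_ * _"] intro!: mult_le_one)
    qed (use jk ii in \<open>auto intro!: borel_measurable_times edge_noise_measurable\<close>)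
    also have "\<dots> = (\<integral>x. 0 \<partial>?X)"
    proof (rule Bochner_Integration.integral_cong[OF refl])
      fix x assume x: "x \<in> space ?X"
      show "(\<Sum>g\<in>graphs_on n. graph_weight n W x g * ((edge_noise W g x i j * edge_noise W g x i' j) *
        (edge_noise W g x i k * edge_noise W g x i' k))) = 0"
      proof (cases "i = j \<or> i' = j \<or> i = k \<or> i' = k")
        \<comment> \<open>A factor on the diagonal is 0 by definition of the noise.\<close>
        case True then show ?thesis by (auto simp: edge_noise_def)
      next
        case False
        let ?e = "(min i j, max i j)"
        \<comment> \<open>The other three factors belong to the edges i'j, ik and i'k, all different
          from ij, so \<open>?R\<close> ignores the state of the edge \<open>?e\<close>.\<close>
        let ?R = "\<lambda>g. edge_noise W g x i' j * (edge_noise W g x i k * edge_noise W g x i' k)"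
        have e: "?e \<in> vertex_pairs n" using False ii jk by (auto simp: vertex_pairs_def min_def max_def)
        have w: "W (x (fst ?e)) (x (snd ?e)) = W (x i) (x j)"
          using graphon_bounds(4)[OF W, of "x i" "x j"] x ii jk
          by (auto simp: min_def max_def space_PiM PiE_iff)
        have "(\<Sum>g\<in>graphs_on n. graph_weight n W x g *
            ((of_bool (g ?e) - W (x (fst ?e)) (x (snd ?e))) * ?R g)) = 0"
        proof (rule sum_graph_weight_centered[OF e])
          fix g
          have ne: "(min i' j, max i' j) \<noteq> ?e" "(min i k, max i k) \<noteq> ?e" "(min i' k, max i' k) \<noteq> ?e"
            using False ii jk by (auto simp: min_def max_def split: if_splits)
          show "?R (g(?e := True)) = ?R (g(?e := False))"
            by (simp only: ne[THEN edge_noise_update])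
        qed
        moreover have "edge_noise W g x i j = of_bool (g ?e) - W (x (fst ?e)) (x (snd ?e))" for g
          unfolding w using False by (simp add: edge_noise_def)
        ultimately show ?thesis by (simp add: mult.assoc)
      qed
    qed
    finally show "(\<integral>z. ?Z j z * ?Z k z \<partial>sampled_graph n M W) = 0" by simp
  qed (use meas bnd in \<open>auto simp: space_sampled_graph\<close>)
  then show ?thesis by (simp add: card_image inj_on_def)
qed

text \<open>Two different rows have an inner product of order sqrt n on average, while the n
  coincidences i = i' are bounded trivially by n each. The total is of smaller order than n^3, which
  is what \<open>bilinear_square_le\<close> requires: there it is multiplied by n and compared with
  n^4.\<close>

lemma integral_edge_noise_le:
  assumes "0 < n"
  shows "(\<integral>z. (\<Sum>i<n. \<Sum>i'<n. \<bar>\<Sum>j<n. edge_noise W (fst z) (snd z) i j * edge_noise W (fst z) (snd z) i' j\<bar>)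
    \<partial>sampled_graph n M W) \<le> real n ^ 2 * sqrt n + real n ^ 2"
    and "(\<lambda>z. \<Sum>i<n. \<Sum>i'<n. \<bar>\<Sum>j<n. edge_noise W (fst z) (snd z) i j * edge_noise W (fst z) (snd z) i' j\<bar>)
      \<in> borel_measurable (sampled_graph n M W)"
    and "integrable (sampled_graph n M W)
     (\<lambda>z. \<Sum>i<n. \<Sum>i'<n. \<bar>\<Sum>j<n. edge_noise W (fst z) (snd z) i j * edge_noise W (fst z) (snd z) i' j\<bar>)"
proof -
  let ?A = "\<lambda>z i j. edge_noise W (fst z) (snd z) i j" and ?X = "PiM {..<n} (\<lambda>_. M)"
  let ?Y = "\<lambda>i i' z. \<Sum>j<n. ?A z i j * ?A z i' j"
  interpret S: prob_space "sampled_graph n M W" by (rule prob_space_sampled_graph)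
  have bnd: "\<bar>\<Sum>j<n. edge_noise W g x i j * edge_noise W g x i' j\<bar> \<le> n"
    if "i < n" "i' < n" "x \<in> space ?X" for g x i i'
  proof -
    have "\<bar>\<Sum>j<n. edge_noise W g x i j * edge_noise W g x i' j\<bar> \<le>
      (\<Sum>j<n. \<bar>edge_noise W g x i j * edge_noise W g x i' j\<bar>)" by (rule sum_abs)
    also have "\<dots> \<le> (\<Sum>j<n. 1)"
      unfolding abs_mult using edge_noise_bound[OF that(1) _ that(3)] edge_noise_bound[OF that(2) _ that(3)]
      by (intro sum_mono mult_le_one) auto
    finally show ?thesis by simp
  qed
  have meas: "?Y i i' \<in> borel_measurable (sampled_graph n M W)" if "i < n" "i' < n" for i i'
    by (rule integral_sampled_graph(2)[where C="real n"])
       (use bnd that in \<open>auto intro!: borel_measurable_sum borel_measurable_times edge_noise_measurable\<close>)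
  have int: "integrable (sampled_graph n M W) (\<lambda>z. \<bar>?Y i i' z\<bar>)" if "i < n" "i' < n" for i i'
    by (rule S.integrable_bounded[where C="real n"]) (use meas bnd that in \<open>auto simp: space_sampled_graph\<close>)
  have int2: "integrable (sampled_graph n M W) (\<lambda>z. (?Y i i' z)\<^sup>2)" if "i < n" "i' < n" for i i'
    by (rule S.integrable_bounded[where C="(real n)\<^sup>2"])
       (use meas bnd that in \<open>auto simp: space_sampled_graph abs_le_square_iff[symmetric]\<close>)
  have one: "(\<integral>z. \<bar>?Y i i' z\<bar> \<partial>sampled_graph n M W) \<le> (if i = i' then real n else 0) + sqrt n"
    if ii: "i < n" "i' < n" for i i'
  proof (cases "i = i'")
    case True
    have "(\<integral>z. \<bar>?Y i i' z\<bar> \<partial>sampled_graph n M W) \<le> (\<integral>z. real n \<partial>sampled_graph n M W)"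
      by (rule integral_mono) (use int[OF ii] bnd[OF ii] in \<open>auto simp: space_sampled_graph\<close>)
    also have "\<dots> \<le> real n + sqrt n" by (simp add: S.prob_space)
    finally show ?thesis using True by simp
  next
    case False
    have "(\<integral>z. \<bar>?Y i i' z\<bar> \<partial>sampled_graph n M W) \<le>
      (\<integral>z. (?Y i i' z)\<^sup>2 / (2 * sqrt n) + sqrt n / 2 \<partial>sampled_graph n M W)"
    proof (rule integral_mono[OF int[OF ii]])
      fix z
      \<comment> \<open>The weight sqrt n balances the two terms of the arithmetic-geometric mean
        inequality, because the second moment is at most n. This bounds the first moment by sqrt
        n.\<close>
      have "0 \<le> (\<bar>?Y i i' z\<bar> - sqrt n)\<^sup>2" by simp
      then have "2 * \<bar>?Y i i' z\<bar> * sqrt n \<le> (?Y i i' z)\<^sup>2 + sqrt n * sqrt n"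
        unfolding power2_diff by (simp add: power2_eq_square)
      then show "\<bar>?Y i i' z\<bar> \<le> (?Y i i' z)\<^sup>2 / (2 * sqrt n) + sqrt n / 2"
        using assms by (simp add: field_simps)
    qed (use int2[OF ii] in auto)
    also have "\<dots> = (\<integral>z. (?Y i i' z)\<^sup>2 \<partial>sampled_graph n M W) / (2 * sqrt n) + sqrt n / 2"
      using int2[OF ii] by (simp add: S.prob_space)
    also have "\<dots> \<le> n / (2 * sqrt n) + sqrt n / 2"
      using integral_edge_noise_square_le[OF ii False] by (intro add_right_mono divide_right_mono) auto
    also have "\<dots> = sqrt n" using assms by (simp add: field_simps)
    finally show ?thesis using False by simp
  qed
  show "(\<lambda>z. \<Sum>i<n. \<Sum>i'<n. \<bar>?Y i i' z\<bar>) \<in> borel_measurable (sampled_graph n M W)"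
    using meas by (auto intro!: borel_measurable_sum borel_measurable_abs)
  show "integrable (sampled_graph n M W) (\<lambda>z. \<Sum>i<n. \<Sum>i'<n. \<bar>?Y i i' z\<bar>)"
    using int by (auto intro!: Bochner_Integration.integrable_sum)
  have "(\<integral>z. (\<Sum>i<n. \<Sum>i'<n. \<bar>?Y i i' z\<bar>) \<partial>sampled_graph n M W) =
      (\<Sum>i<n. \<Sum>i'<n. \<integral>z. \<bar>?Y i i' z\<bar> \<partial>sampled_graph n M W)"
  proof -
    have "(\<integral>z. (\<Sum>i<n. \<Sum>i'<n. \<bar>?Y i i' z\<bar>) \<partial>sampled_graph n M W) =
        (\<Sum>i<n. \<integral>z. (\<Sum>i'<n. \<bar>?Y i i' z\<bar>) \<partial>sampled_graph n M W)"
      by (rule Bochner_Integration.integral_sum) (rule Bochner_Integration.integrable_sum, simp add: int)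
    also have "\<dots> = (\<Sum>i<n. \<Sum>i'<n. \<integral>z. \<bar>?Y i i' z\<bar> \<partial>sampled_graph n M W)"
      by (rule sum.cong[OF refl], rule Bochner_Integration.integral_sum) (simp add: int)
    finally show ?thesis .
  qed
  also have "\<dots> \<le> (\<Sum>i<n. \<Sum>i'<n. (if i = i' then real n else 0) + sqrt n)"
    using one by (intro sum_mono) auto
  also have "\<dots> = real n ^ 2 * sqrt n + real n ^ 2"
    by (simp add: sum.distrib power2_eq_square algebra_simps)
  finally show "(\<integral>z. (\<Sum>i<n. \<Sum>i'<n. \<bar>?Y i i' z\<bar>) \<partial>sampled_graph n M W) \<le> real n ^ 2 * sqrt n + real n ^ 2" .
qed

end

section \<open>Probabilities of sampled graphs in terms of densities\<close>

definition symmetric_graph :: "nat set \<Rightarrow> (nat \<times> nat) set \<Rightarrow> ngraph" where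
  "symmetric_graph V S = \<lparr>pverts = V, parcs = S \<union> S\<inverse>\<rparr>"

lemma symmetric_graph:
  assumes "finite V" "S \<subseteq> {(i, j). i \<in> V \<and> j \<in> V \<and> i < j}"
  shows "pair_graph (symmetric_graph V S)" "pverts (symmetric_graph V S) = V"
    "graph_edges (symmetric_graph V S) = S"
proof -
  have "finite S" by (rule finite_subset[of _ "V \<times> V"]) (use assms in auto)
  then show "pair_graph (symmetric_graph V S)"
    using assms by unfold_locales (auto simp: symmetric_graph_def symmetric_def sym_def)
  show "graph_edges (symmetric_graph V S) = S"
    using assms(2) by (fastforce simp: graph_edges_def symmetric_graph_def)
qed (simp add: symmetric_graph_def)

definition same_densities ::
    "'a measure \<Rightarrow> ('a \<Rightarrow> 'a \<Rightarrow> real) \<Rightarrow> 'b measure \<Rightarrow> ('b \<Rightarrow> 'b \<Rightarrow> real) \<Rightarrow> bool" where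
  "same_densities M1 W1 M2 W2 \<longleftrightarrow>
     (\<forall>F. pair_graph F \<longrightarrow> graphon_density F M1 W1 = graphon_density F M2 W2)"

lemma graphon_density_symmetric_graph:
  assumes "S \<subseteq> vertex_pairs n"
  shows "graphon_density (symmetric_graph {..<n} S) M W =
    (\<integral>x. (\<Prod>e\<in>S. W (x (fst e)) (x (snd e))) \<partial>(PiM {..<n} (\<lambda>_. M)))"
proof -
  have S: "S \<subseteq> {(i, j). i \<in> {..<n} \<and> j \<in> {..<n} \<and> i < j}"
    using assms by (auto simp: vertex_pairs_def)
  show ?thesis
    unfolding graphon_density_def symmetric_graph(2,3)[OF finite_lessThan S]
    by (simp add: case_prod_unfold)
qed

lemma prod_edges_measurable_bounded:
  assumes W: "graphon M W" and S: "finite S" "\<And>e. e \<in> S \<Longrightarrow> fst e \<in> I \<and> snd e \<in> I"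
  shows "(\<lambda>x. \<Prod>e\<in>S. W (x (fst e)) (x (snd e))) \<in> borel_measurable (PiM I (\<lambda>_. M))"
    and "x \<in> space (PiM I (\<lambda>_. M)) \<Longrightarrow> 0 \<le> (\<Prod>e\<in>S. W (x (fst e)) (x (snd e)))"
    and "x \<in> space (PiM I (\<lambda>_. M)) \<Longrightarrow> (\<Prod>e\<in>S. W (x (fst e)) (x (snd e))) \<le> 1"
proof -
  show "(\<lambda>x. \<Prod>e\<in>S. W (x (fst e)) (x (snd e))) \<in> borel_measurable (PiM I (\<lambda>_. M))"
  proof (rule borel_measurable_prod)
    fix e assume "e \<in> S"
    with S show "(\<lambda>x. W (x (fst e)) (x (snd e))) \<in> borel_measurable (PiM I (\<lambda>_. M))"
      by (intro graphon_measurable[OF W] measurable_component_singleton) auto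
  qed
  assume x: "x \<in> space (PiM I (\<lambda>_. M))"
  have "0 \<le> W (x (fst e)) (x (snd e)) \<and> W (x (fst e)) (x (snd e)) \<le> 1" if "e \<in> S" for e
    using graphon_bounds[OF W, of "x (fst e)" "x (snd e)"] x S(2)[OF that]
    by (auto simp: space_PiM PiE_iff)
  then show "0 \<le> (\<Prod>e\<in>S. W (x (fst e)) (x (snd e)))" "(\<Prod>e\<in>S. W (x (fst e)) (x (snd e))) \<le> 1"
    by (auto intro!: prod_nonneg prod_le_1)
qed

text \<open>Inclusion-exclusion over the non-edges of \<open>g\<close>: expanding the factors 1 - W
  expresses the probability of \<open>g\<close> through the densities of the graphs that contain it.
  Hence the densities determine the law of the sampled graph.\<close>

lemma integral_graph_weight:
  assumes M: "prob_space M" and W: "graphon M W" and g: "g \<in> graphs_on n"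
  shows "(\<integral>x. graph_weight n W x g \<partial>(PiM {..<n} (\<lambda>_. M))) =
    (\<Sum>X\<in>Pow {e \<in> vertex_pairs n. \<not> g e}. (-1) ^ card X *
      graphon_density (symmetric_graph {..<n} ({e \<in> vertex_pairs n. g e} \<union> X)) M W)"
proof -
  let ?X = "PiM {..<n} (\<lambda>_. M)"
  let ?E1 = "{e \<in> vertex_pairs n. g e}" and ?E0 = "{e \<in> vertex_pairs n. \<not> g e}"
  let ?w = "\<lambda>x e. W (x (fst e)) (x (snd e))"
  interpret X: prob_space ?X by (intro prob_space_PiM M)
  have fin: "finite ?E1" "finite ?E0" by auto
  have "graph_weight n W x g = (\<Sum>X\<in>Pow ?E0. (-1) ^ card X * (\<Prod>e\<in>?E1 \<union> X. ?w x e))" for x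
  proof -
    have "graph_weight n W x g = (\<Prod>e\<in>?E1 \<union> ?E0. edge_weight W x e (g e))"
      unfolding graph_weight_def by (rule prod.cong) auto
    also have "\<dots> = (\<Prod>e\<in>?E1. edge_weight W x e (g e)) * (\<Prod>e\<in>?E0. edge_weight W x e (g e))"
      by (rule prod.union_disjoint) auto
    also have "\<dots> = (\<Prod>e\<in>?E1. ?w x e) * (\<Prod>e\<in>?E0. - ?w x e + 1)"
      by (intro arg_cong2[where f="(*)"] prod.cong) (auto simp: edge_weight_def)
    also have "(\<Prod>e\<in>?E0. - ?w x e + 1) = (\<Sum>X\<in>Pow ?E0. (\<Prod>e\<in>X. - ?w x e) * (\<Prod>e\<in>?E0 - X. 1))"
      by (rule prod_add[OF fin(2)])
    also have "(\<Prod>e\<in>?E1. ?w x e) * \<dots> = (\<Sum>X\<in>Pow ?E0. (-1) ^ card X * (\<Prod>e\<in>?E1 \<union> X. ?w x e))"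
      unfolding sum_distrib_left
    proof (rule sum.cong[OF refl])
      fix X assume X: "X \<in> Pow ?E0"
      then have "finite X" using fin by (auto intro: finite_subset)
      then have "(\<Prod>e\<in>?E1 \<union> X. ?w x e) = (\<Prod>e\<in>?E1. ?w x e) * (\<Prod>e\<in>X. ?w x e)"
        using X fin by (intro prod.union_disjoint) auto
      moreover have "(\<Prod>e\<in>X. - ?w x e) = (-1) ^ card X * (\<Prod>e\<in>X. ?w x e)"
        by (rule prod_uminus)
      ultimately show "(\<Prod>e\<in>?E1. ?w x e) * ((\<Prod>e\<in>X. - ?w x e) * (\<Prod>e\<in>?E0 - X. 1)) =
          (-1) ^ card X * (\<Prod>e\<in>?E1 \<union> X. ?w x e)" by simp
    qed
    finally show ?thesis .
  qed
  then have "(\<integral>x. graph_weight n W x g \<partial>?X) =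
      (\<integral>x. (\<Sum>X\<in>Pow ?E0. (-1) ^ card X * (\<Prod>e\<in>?E1 \<union> X. ?w x e)) \<partial>?X)" by simp
  also have "\<dots> = (\<Sum>X\<in>Pow ?E0. (-1) ^ card X * (\<integral>x. (\<Prod>e\<in>?E1 \<union> X. ?w x e) \<partial>?X))"
  proof (subst Bochner_Integration.integral_sum)
    fix X assume "X \<in> Pow ?E0"
    then have sub: "?E1 \<union> X \<subseteq> vertex_pairs n" by auto
    then have S: "finite (?E1 \<union> X)" "\<And>e. e \<in> ?E1 \<union> X \<Longrightarrow> fst e \<in> {..<n} \<and> snd e \<in> {..<n}"
      using finite_subset[OF sub finite_vertex_pairs] subsetD[OF sub] by (auto simp: vertex_pairs_def)
    have "integrable ?X (\<lambda>x. \<Prod>e\<in>?E1 \<union> X. ?w x e)"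
      by (rule X.integrable_bounded[where C=1, OF prod_edges_measurable_bounded(1)[OF W S]])
         (use prod_edges_measurable_bounded(2,3)[OF W S] in auto)
    then show "integrable ?X (\<lambda>x. (-1) ^ card X * (\<Prod>e\<in>?E1 \<union> X. ?w x e))" by simp
  qed simp
  also have "\<dots> = (\<Sum>X\<in>Pow ?E0. (-1) ^ card X * graphon_density (symmetric_graph {..<n} (?E1 \<union> X)) M W)"
    by (intro sum.cong refl, subst graphon_density_symmetric_graph) auto
  finally show ?thesis .
qed

lemma integral_graph_weight_cong:
  assumes "prob_space M1" "graphon M1 W1" "prob_space M2" "graphon M2 W2"
    and same: "same_densities M1 W1 M2 W2" and g: "g \<in> graphs_on n"
  shows "(\<integral>x. graph_weight n W1 x g \<partial>(PiM {..<n} (\<lambda>_. M1))) = (\<integral>x. graph_weight n W2 x g \<partial>(PiM {..<n} (\<lambda>_. M2)))"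
  unfolding integral_graph_weight[OF assms(1,2) g] integral_graph_weight[OF assms(3,4) g]
proof (intro sum.cong refl arg_cong2[where f="(*)"])
  fix X assume "X \<in> Pow {e \<in> vertex_pairs n. \<not> g e}"
  then have S: "{e \<in> vertex_pairs n. g e} \<union> X \<subseteq> {(i, j). i \<in> {..<n} \<and> j \<in> {..<n} \<and> i < j}"
    by (auto simp: vertex_pairs_def)
  show "graphon_density (symmetric_graph {..<n} ({e \<in> vertex_pairs n. g e} \<union> X)) M1 W1 =
    graphon_density (symmetric_graph {..<n} ({e \<in> vertex_pairs n. g e} \<union> X)) M2 W2"
    using same symmetric_graph(1)[OF finite_lessThan S] by (simp add: same_densities_def)
qed

lemma sampled_graph_prob:
  assumes M: "prob_space M" and W: "graphon M W" and A: "A \<subseteq> graphs_on n"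
  shows "measure (sampled_graph n M W) {z \<in> space (sampled_graph n M W). fst z \<in> A} =
    (\<Sum>g\<in>A. \<integral>x. graph_weight n W x g \<partial>(PiM {..<n} (\<lambda>_. M)))"
    and "{z \<in> space (sampled_graph n M W). fst z \<in> A} \<in> sets (sampled_graph n M W)"
proof -
  let ?X = "PiM {..<n} (\<lambda>_. M)" and ?S = "sampled_graph n M W"
  interpret X: prob_space ?X by (intro prob_space_PiM M)
  interpret S: prob_space ?S by (rule prob_space_sampled_graph[OF M W])
  let ?f = "\<lambda>z :: (nat \<times> nat \<Rightarrow> bool) \<times> (nat \<Rightarrow> 'a). of_bool (fst z \<in> A) :: real"
  have fm: "?f \<in> borel_measurable ?S"
    by (rule integral_sampled_graph(2)[OF M W, where C=1]) auto
  then have "{z \<in> space ?S. 0 < ?f z} \<in> sets ?S"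
    by measurable
  then show s: "{z \<in> space ?S. fst z \<in> A} \<in> sets ?S"
    by simp
  have "measure ?S {z \<in> space ?S. fst z \<in> A} = (\<integral>z. indicator {z \<in> space ?S. fst z \<in> A} z \<partial>?S)"
    using s by simp
  also have "\<dots> = (\<integral>z. ?f z \<partial>?S)"
    by (rule Bochner_Integration.integral_cong) (auto simp: indicator_def)
  also have "\<dots> = (\<integral>x. (\<Sum>g\<in>graphs_on n. graph_weight n W x g * of_bool (g \<in> A)) \<partial>?X)"
    by (subst integral_sampled_graph(1)[OF M W, where C=1]) auto
  also have "\<dots> = (\<integral>x. (\<Sum>g\<in>A. graph_weight n W x g) \<partial>?X)"
  proof (rule Bochner_Integration.integral_cong[OF refl])
    fix x
    show "(\<Sum>g\<in>graphs_on n. graph_weight n W x g * of_bool (g \<in> A)) = (\<Sum>g\<in>A. graph_weight n W x g)"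
      by (rule sum.mono_neutral_cong_right) (use A in auto)
  qed
  also have "\<dots> = (\<Sum>g\<in>A. \<integral>x. graph_weight n W x g \<partial>?X)"
  proof (rule Bochner_Integration.integral_sum)
    fix g
    show "integrable ?X (\<lambda>x. graph_weight n W x g)"
      by (rule X.integrable_bounded[where C=1, OF graph_weight_measurable[OF W]])
         (use graph_weight_bounds[OF W] in auto)
  qed
  finally show "measure ?S {z \<in> space ?S. fst z \<in> A} = (\<Sum>g\<in>A. \<integral>x. graph_weight n W x g \<partial>?X)" .
qed

text \<open>The projections of the two events to the graph component both have probability above 1/2
  under the same law, so they cannot be disjoint. The threshold 1/2 has no other origin.\<close>

lemma common_graph:
  assumes M: "prob_space M1" "graphon M1 W1" "prob_space M2" "graphon M2 W2"
    and same: "same_densities M1 W1 M2 W2"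
    and G1: "G1 \<in> sets (sampled_graph n M1 W1)" "measure (sampled_graph n M1 W1) G1 > 1/2"
    and G2: "G2 \<in> sets (sampled_graph n M2 W2)" "measure (sampled_graph n M2 W2) G2 > 1/2"
  obtains g x y where "(g, x) \<in> G1" "(g, y) \<in> G2"
proof -
  interpret S1: prob_space "sampled_graph n M1 W1" by (rule prob_space_sampled_graph[OF M(1,2)])
  interpret S2: prob_space "sampled_graph n M2 W2" by (rule prob_space_sampled_graph[OF M(3,4)])
  let ?p = "\<lambda>g. \<integral>x. graph_weight n W1 x g \<partial>(PiM {..<n} (\<lambda>_. M1))"
  let ?A = "fst ` G1" and ?B = "fst ` G2"
  have A: "?A \<subseteq> graphs_on n" and B: "?B \<subseteq> graphs_on n"
    using sets.sets_into_space[OF G1(1)] sets.sets_into_space[OF G2(1)]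
    by (auto simp: space_sampled_graph[OF M(1,2)] space_sampled_graph[OF M(3,4)])
  have p2: "(\<Sum>g\<in>C. \<integral>x. graph_weight n W2 x g \<partial>(PiM {..<n} (\<lambda>_. M2))) = (\<Sum>g\<in>C. ?p g)"
    if "C \<subseteq> graphs_on n" for C
    using that by (intro sum.cong refl integral_graph_weight_cong[symmetric, OF M same]) auto
  have "1/2 < (\<Sum>g\<in>?A. ?p g)"
  proof -
    have "measure (sampled_graph n M1 W1) G1 \<le> measure (sampled_graph n M1 W1) {z \<in> space (sampled_graph n M1 W1). fst z \<in> ?A}"
      using sampled_graph_prob(2)[OF M(1,2) A] sets.sets_into_space[OF G1(1)]
      by (intro S1.finite_measure_mono) auto
    then show ?thesis using G1(2) by (simp only: sampled_graph_prob(1)[OF M(1,2) A])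
  qed
  moreover have "1/2 < (\<Sum>g\<in>?B. ?p g)"
  proof -
    have "measure (sampled_graph n M2 W2) G2 \<le> measure (sampled_graph n M2 W2) {z \<in> space (sampled_graph n M2 W2). fst z \<in> ?B}"
      using sampled_graph_prob(2)[OF M(3,4) B] sets.sets_into_space[OF G2(1)]
      by (intro S2.finite_measure_mono) auto
    then show ?thesis using G2(2) by (simp only: sampled_graph_prob(1)[OF M(3,4) B] p2[OF B])
  qed
  moreover have "(\<Sum>g\<in>?A \<union> ?B. ?p g) \<le> 1"
    using A B by (subst sampled_graph_prob(1)[OF M(1,2), symmetric]) auto
  moreover have "(\<Sum>g\<in>?A \<union> ?B. ?p g) = (\<Sum>g\<in>?A. ?p g) + (\<Sum>g\<in>?B. ?p g)" if "?A \<inter> ?B = {}"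
    using that A B by (intro sum.union_disjoint) (auto intro: finite_subset[OF _ finite_graphs_on])
  ultimately have "?A \<inter> ?B \<noteq> {}" by auto
  then obtain g where "g \<in> ?A" "g \<in> ?B" by blast
  then show thesis using that by auto
qed

section \<open>Typical samples of two graphons with a common graph\<close>

definition offdiag_sum :: "nat \<Rightarrow> (nat \<Rightarrow> nat \<Rightarrow> real) \<Rightarrow> real" where
  "offdiag_sum n f = (\<Sum>i<n. \<Sum>j<n. if i \<noteq> j then f i j else 0)"

text \<open>Chebyshev for each test function and Markov for the noise. The noise is allowed to be of
  order n^3, since it enters a Cauchy-Schwarz bound as n times itself, against the square of
  n^2.\<close>

lemma good_samples:
  fixes H :: "('a \<times> 'a \<Rightarrow> real) set" and \<delta> \<delta>' :: real
  assumes M: "prob_space M" and W: "graphon M W" and H: "finite H"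
    and h: "\<forall>h\<in>H. h \<in> borel_measurable (M \<Otimes>\<^sub>M M) \<and> (\<forall>z\<in>space (M \<Otimes>\<^sub>M M). \<bar>h z\<bar> \<le> C)"
    and \<delta>: "\<delta> > 0" "\<delta>' > 0"
  shows "eventually (\<lambda>n. \<exists>G\<in>sets (sampled_graph n M W). measure (sampled_graph n M W) G > 1/2 \<and>
    (\<forall>(g, x)\<in>G. x \<in> space (PiM {..<n} (\<lambda>_. M)) \<and>
      (\<forall>h\<in>H. \<bar>offdiag_sum n (\<lambda>i j. h (x i, x j) - (\<integral>z. h z \<partial>(M \<Otimes>\<^sub>M M)))\<bar> \<le> \<delta> * real n ^ 2) \<and>
      (\<Sum>i<n. \<Sum>i'<n. \<bar>\<Sum>j<n. edge_noise W g x i j * edge_noise W g x i' j\<bar>) \<le> \<delta>' * real n ^ 3)) sequentially"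
proof -
  \<comment> \<open>An upper bound for the probability of a bad sample: the Chebyshev terms are of
    order 1/n and the Markov term of order 1/sqrt n.\<close>
  let ?r = "\<lambda>n::nat. (\<Sum>h\<in>H. (2 * C)\<^sup>2 * (4 * real n ^ 3) / (\<delta> * real n ^ 2)\<^sup>2) + (real n ^ 2 * sqrt n + real n ^ 2) / (\<delta>' * real n ^ 3)"
  have "?r \<longlonglongrightarrow> (\<Sum>h\<in>H. 0) + 0"
  proof (intro tendsto_add tendsto_sum)
    show "(\<lambda>n::nat. (2 * C)\<^sup>2 * (4 * real n ^ 3) / (\<delta> * real n ^ 2)\<^sup>2) \<longlonglongrightarrow> 0"
      using \<delta> by real_asymp
    show "(\<lambda>n::nat. (real n ^ 2 * sqrt n + real n ^ 2) / (\<delta>' * real n ^ 3)) \<longlonglongrightarrow> 0"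
      using \<delta> by real_asymp
  qed
  then have "eventually (\<lambda>n. ?r n < 1/2) sequentially"
    by (intro order_tendstoD(2)) auto
  with eventually_gt_at_top[of 0] show ?thesis
  proof eventually_elim
    case (elim n)
    let ?X = "PiM {..<n} (\<lambda>_. M)" and ?S = "sampled_graph n M W" and ?T = "{..<n} \<times> {..<n}"
    interpret X: prob_space ?X by (intro prob_space_PiM M)
    interpret S: prob_space ?S by (rule prob_space_sampled_graph[OF M W])
    define Z where "Z h x = offdiag_sum n (\<lambda>i j. h (x i, x j) - (\<integral>z. h z \<partial>(M \<Otimes>\<^sub>M M)))" for h :: "'a \<times> 'a \<Rightarrow> real" and x
    define Q where "Q z = (\<Sum>i<n. \<Sum>i'<n. \<bar>\<Sum>j<n. edge_noise W (fst z) (snd z) i j * edge_noise W (fst z) (snd z) i' j\<bar>)"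
      for z :: "(nat \<times> nat \<Rightarrow> bool) \<times> (nat \<Rightarrow> 'a)"
    define badh where "badh h = {z \<in> space ?S. \<delta> * real n ^ 2 \<le> \<bar>Z h (snd z)\<bar>}" for h
    define badQ where "badQ = {z \<in> space ?S. \<delta>' * real n ^ 3 \<le> Q z}"
    have badh: "badh h \<in> sets ?S" "measure ?S (badh h) \<le> (2 * C)\<^sup>2 * (4 * real n ^ 3) / (\<delta> * real n ^ 2)\<^sup>2"
      if "h \<in> H" for h
    proof -
      from h that have hm: "h \<in> borel_measurable (M \<Otimes>\<^sub>M M)"
        and hC: "\<And>z. z \<in> space (M \<Otimes>\<^sub>M M) \<Longrightarrow> \<bar>h z\<bar> \<le> C" by auto
      let ?Z = "\<lambda>s x. if fst s \<noteq> snd s then h (x (fst s), x (snd s)) - (\<integral>z. h z \<partial>(M \<Otimes>\<^sub>M M)) else 0"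
      note * = integral_offdiag_square_le[OF M W hm hC, where n=n]
      have Z: "Z h x = (\<Sum>s\<in>?T. ?Z s x)" for x
        unfolding Z_def offdiag_sum_def by (simp add: sum.cartesian_product case_prod_unfold)
      have Zm: "Z h \<in> borel_measurable ?X"
        unfolding Z using *(2) by (intro borel_measurable_sum) auto
      have Zb: "\<bar>Z h x\<bar> \<le> card ?T * (2 * C)" if "x \<in> space ?X" for x
      proof -
        have "\<bar>Z h x\<bar> \<le> (\<Sum>s\<in>?T. \<bar>?Z s x\<bar>)" unfolding Z by (rule sum_abs)
        also have "\<dots> \<le> (\<Sum>s\<in>?T. 2 * C)" using *(3) that by (intro sum_mono) auto
        finally show ?thesis by simp
      qed
      let ?D = "card ?T * (2 * C)"
      have Zs: "\<bar>(Z h x)\<^sup>2\<bar> \<le> ?D\<^sup>2" if "x \<in> space ?X" for x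
        using power_mono[OF Zb[OF that], of 2] by simp
      have m: "(\<lambda>z. Z h (snd z)) \<in> borel_measurable ?S"
        by (rule measurable_compose[OF snd_measurable_sampled_graph[OF M W] Zm])
      then show "badh h \<in> sets ?S" unfolding badh_def by measurable
      have i: "integrable ?S (\<lambda>z. (Z h (snd z))\<^sup>2)"
        by (rule S.integrable_bounded[where C="?D\<^sup>2"])
           (use m Zs in \<open>auto simp: space_sampled_graph[OF M W]\<close>)
      have "measure ?S (badh h) \<le> (\<integral>z. (Z h (snd z))\<^sup>2 \<partial>?S) / (\<delta> * real n ^ 2)\<^sup>2"
        unfolding badh_def by (rule S.second_moment_method[OF m i]) (use \<delta> elim in auto)
      also have "(\<integral>z. (Z h (snd z))\<^sup>2 \<partial>?S) = (\<integral>x. (Z h x)\<^sup>2 \<partial>?X)"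
        by (rule integral_sampled_graph_types[OF M W, where C="?D\<^sup>2"]) (use Zm Zs in auto)
      also have "\<dots> \<le> (2 * C)\<^sup>2 * (4 * real n ^ 3)"
        unfolding Z by (rule *(1)) 
      finally show "measure ?S (badh h) \<le> (2 * C)\<^sup>2 * (4 * real n ^ 3) / (\<delta> * real n ^ 2)\<^sup>2"
        by (simp add: divide_right_mono)
    qed
    note q = integral_edge_noise_le[OF M W elim(1), folded Q_def]
    have badQ: "badQ \<in> sets ?S" "measure ?S badQ \<le> (real n ^ 2 * sqrt n + real n ^ 2) / (\<delta>' * real n ^ 3)"
    proof -
      show "badQ \<in> sets ?S" unfolding badQ_def using q(2) by measurable
      have "measure ?S badQ \<le> (\<integral>z. Q z \<partial>?S) / (\<delta>' * real n ^ 3)"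
        unfolding badQ_def
        by (rule integral_Markov_inequality_measure[where A="{}"])
           (use q(3) \<delta> elim in \<open>auto simp: Q_def intro!: AE_I2 sum_nonneg\<close>)
      also have "\<dots> \<le> (real n ^ 2 * sqrt n + real n ^ 2) / (\<delta>' * real n ^ 3)"
        using q(1) \<delta> by (intro divide_right_mono) auto
      finally show "measure ?S badQ \<le> (real n ^ 2 * sqrt n + real n ^ 2) / (\<delta>' * real n ^ 3)" .
    qed
    let ?B = "(\<Union>h\<in>H. badh h) \<union> badQ"
    have Bs: "?B \<in> sets ?S" by (intro sets.Un sets.finite_UN H badh(1) badQ(1))
    have "measure ?S ?B \<le> measure ?S (\<Union>h\<in>H. badh h) + measure ?S badQ"
      by (rule measure_Un_le[OF sets.finite_UN[OF H badh(1)] badQ(1)])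
    also have "\<dots> \<le> (\<Sum>h\<in>H. measure ?S (badh h)) + measure ?S badQ"
      by (intro add_right_mono measure_UNION_le H badh(1))
    also have "\<dots> \<le> ?r n"
      using badh(2) badQ(2) by (intro add_mono sum_mono) auto
    also have "\<dots> < 1/2" by (rule elim)
    finally have "measure ?S (space ?S - ?B) > 1/2"
      using S.prob_compl[OF Bs] by simp
    moreover have "x \<in> space ?X \<and> (\<forall>h\<in>H. \<bar>Z h x\<bar> \<le> \<delta> * real n ^ 2) \<and> Q (g, x) \<le> \<delta>' * real n ^ 3"
      if "(g, x) \<in> space ?S - ?B" for g x
      using that by (auto simp: space_sampled_graph[OF M W] badh_def badQ_def not_le intro: less_imp_le)
    ultimately show ?case
      using Bs by (intro bexI[of _ "space ?S - ?B"]) (auto simp: Z_def Q_def)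
  qed
qed

text \<open>The vertices of the common graph pair the type \<open>x i\<close> with the type
  \<open>y i\<close>, and this pairing is the finite precursor of the coupling. The weights
  \<open>a\<close> and \<open>b\<close> depend on the index only, so they may later be indicators of
  sets of pairs \<open>(x i, y i)\<close>, which neither graphon sees on its own.\<close>

lemma coupled_samples:
  fixes H1 :: "('a \<times> 'a \<Rightarrow> real) set" and H2 :: "('b \<times> 'b \<Rightarrow> real) set" and \<delta> :: real
  assumes M: "prob_space M1" "graphon M1 W1" "prob_space M2" "graphon M2 W2"
    and same: "same_densities M1 W1 M2 W2"
    and H1: "finite H1" "\<forall>h\<in>H1. h \<in> borel_measurable (M1 \<Otimes>\<^sub>M M1) \<and> (\<forall>z\<in>space (M1 \<Otimes>\<^sub>M M1). \<bar>h z\<bar> \<le> C)"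
    and H2: "finite H2" "\<forall>h\<in>H2. h \<in> borel_measurable (M2 \<Otimes>\<^sub>M M2) \<and> (\<forall>z\<in>space (M2 \<Otimes>\<^sub>M M2). \<bar>h z\<bar> \<le> C)"
    and \<delta>: "\<delta> > 0"
  shows "eventually (\<lambda>n. \<exists>x\<in>space (PiM {..<n} (\<lambda>_. M1)). \<exists>y\<in>space (PiM {..<n} (\<lambda>_. M2)).
    (\<forall>h\<in>H1. \<bar>offdiag_sum n (\<lambda>i j. h (x i, x j) - (\<integral>z. h z \<partial>(M1 \<Otimes>\<^sub>M M1)))\<bar> \<le> \<delta> * real n ^ 2) \<and>
    (\<forall>h\<in>H2. \<bar>offdiag_sum n (\<lambda>i j. h (y i, y j) - (\<integral>z. h z \<partial>(M2 \<Otimes>\<^sub>M M2)))\<bar> \<le> \<delta> * real n ^ 2) \<and>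
    (\<forall>a b. (\<forall>i. \<bar>a i\<bar> \<le> 1) \<longrightarrow> (\<forall>i. \<bar>b i\<bar> \<le> 1) \<longrightarrow>
      \<bar>offdiag_sum n (\<lambda>i j. a i * b j * (W1 (x i) (x j) - W2 (y i) (y j)))\<bar> \<le> \<delta> * real n ^ 2)) sequentially"
proof -
  \<comment> \<open>With this tolerance Cauchy-Schwarz bounds the cut norm of each noise by
    \<open>\<delta> / 2\<close> times n^2; the two noises together use up
    \<open>\<delta>\<close>.\<close>
  have \<delta>2: "(\<delta> / 2)\<^sup>2 > 0" using \<delta> by simp
  from good_samples[OF M(1,2) H1 \<delta> \<delta>2] good_samples[OF M(3,4) H2 \<delta> \<delta>2]
  show ?thesis
  proof eventually_elim
    case (elim n)
    let ?Q = "\<lambda>A::nat\<Rightarrow>nat\<Rightarrow>real. (\<Sum>i<n. \<Sum>i'<n. \<bar>\<Sum>j<n. A i j * A i' j\<bar>)"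
    obtain G1 where G1: "G1 \<in> sets (sampled_graph n M1 W1)" "measure (sampled_graph n M1 W1) G1 > 1/2"
      "\<And>g x. (g, x) \<in> G1 \<Longrightarrow> x \<in> space (PiM {..<n} (\<lambda>_. M1)) \<and>
      (\<forall>h\<in>H1. \<bar>offdiag_sum n (\<lambda>i j. h (x i, x j) - (\<integral>z. h z \<partial>(M1 \<Otimes>\<^sub>M M1)))\<bar> \<le> \<delta> * real n ^ 2) \<and>
      ?Q (edge_noise W1 g x) \<le> (\<delta> / 2)\<^sup>2 * real n ^ 3"
      using elim(1) by blast
    obtain G2 where G2: "G2 \<in> sets (sampled_graph n M2 W2)" "measure (sampled_graph n M2 W2) G2 > 1/2"
      "\<And>g y. (g, y) \<in> G2 \<Longrightarrow> y \<in> space (PiM {..<n} (\<lambda>_. M2)) \<and>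
      (\<forall>h\<in>H2. \<bar>offdiag_sum n (\<lambda>i j. h (y i, y j) - (\<integral>z. h z \<partial>(M2 \<Otimes>\<^sub>M M2)))\<bar> \<le> \<delta> * real n ^ 2) \<and>
      ?Q (edge_noise W2 g y) \<le> (\<delta> / 2)\<^sup>2 * real n ^ 3"
      using elim(2) by blast
    obtain g x y where g: "(g, x) \<in> G1" "(g, y) \<in> G2"
      using common_graph[OF M same G1(1,2) G2(1,2)] .
    have noise: "\<bar>\<Sum>i<n. \<Sum>j<n. a i * b j * A i j\<bar> \<le> \<delta> / 2 * real n ^ 2"
      if "\<forall>i. \<bar>a i\<bar> \<le> 1" "\<forall>i. \<bar>b i\<bar> \<le> 1" "?Q A \<le> (\<delta> / 2)\<^sup>2 * real n ^ 3" for a b A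
    proof (rule power2_le_imp_le)
      have "(\<Sum>i<n. \<Sum>j<n. a i * b j * A i j)\<^sup>2 \<le> n * ?Q A"
        using that by (intro bilinear_square_le) auto
      also have "\<dots> \<le> n * ((\<delta> / 2)\<^sup>2 * real n ^ 3)"
        using that(3) by (intro mult_left_mono) auto
      also have "\<dots> = (\<delta> / 2 * real n ^ 2)\<^sup>2"
        by (simp add: power2_eq_square power3_eq_cube)
      finally show "\<bar>\<Sum>i<n. \<Sum>j<n. a i * b j * A i j\<bar>\<^sup>2 \<le> (\<delta> / 2 * real n ^ 2)\<^sup>2" by simp
    qed (use \<delta> in simp)
    have "\<bar>offdiag_sum n (\<lambda>i j. a i * b j * (W1 (x i) (x j) - W2 (y i) (y j)))\<bar> \<le> \<delta> * real n ^ 2"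
      if ab: "\<forall>i. \<bar>a i\<bar> \<le> 1" "\<forall>i. \<bar>b i\<bar> \<le> 1" for a b
    proof -
      \<comment> \<open>The edge indicators cancel because both noises are taken with respect to the
        same graph \<open>g\<close>.\<close>
      have "offdiag_sum n (\<lambda>i j. a i * b j * (W1 (x i) (x j) - W2 (y i) (y j))) =
        (\<Sum>i<n. \<Sum>j<n. a i * b j * edge_noise W2 g y i j) - (\<Sum>i<n. \<Sum>j<n. a i * b j * edge_noise W1 g x i j)"
        unfolding offdiag_sum_def sum_subtractf[symmetric]
        by (intro sum.cong refl) (simp add: edge_noise_def algebra_simps)
      with noise[OF ab, of "edge_noise W1 g x"] noise[OF ab, of "edge_noise W2 g y"]
      show ?thesis using G1(3)[OF g(1)] G2(3)[OF g(2)] by linarith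
    qed
    then show ?case using G1(3)[OF g(1)] G2(3)[OF g(2)] by blast
  qed
qed

section \<open>Conditional distributions\<close>

lemma space_unit_interval [simp]: "space unit_interval = {0..1}"
  by (simp add: unit_interval_def space_restrict_space)

lemma sets_unit_interval: "sets unit_interval = sets (restrict_space borel {0..1})"
  unfolding unit_interval_def by (intro sets_restrict_space_cong) simp

lemma emeasure_unit_interval:
  assumes "A \<in> sets borel" "A \<subseteq> {0..1}"
  shows "emeasure unit_interval A = emeasure lborel A"
  unfolding unit_interval_def using assms by (intro emeasure_restrict_space) auto

lemma prob_space_unit_interval: "prob_space unit_interval"
  by (rule prob_spaceI) (simp add: emeasure_unit_interval)

lemma measurable_ident_unit_interval: "(\<lambda>t. t) \<in> borel_measurable unit_interval"
  unfolding measurable_cong_sets[OF sets_unit_interval refl] by (rule measurable_restrict_space1) simp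

lemma AE_unit_interval_open: "AE t in unit_interval. 0 < t \<and> t < 1"
proof -
  have "AE t in lborel. t \<in> {0..1::real} \<longrightarrow> 0 < t \<and> t < 1"
    using AE_lborel_singleton[of "0::real"] AE_lborel_singleton[of "1::real"] by eventually_elim auto
  then show ?thesis unfolding unit_interval_def by (subst AE_restrict_space_iff) auto
qed

lemma emeasure_unit_interval_le:
  assumes "0 \<le> d" "d \<le> 1"
  shows "emeasure unit_interval {t \<in> {0..1}. t \<le> d} = ennreal d"
proof -
  have "{t \<in> {0..1}. t \<le> d} = {0..d}" using assms by auto
  then show ?thesis using assms by (simp add: emeasure_unit_interval)
qed

text \<open>Rational endpoints make the generator countable, so that properties of distribution
  functions can be required simultaneously outside a single null set.\<close>

lemma borel_eq_rat_atMost: "sets borel = sigma_sets UNIV (range (\<lambda>q. {..of_rat q :: real}))"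
proof -
  let ?E = "range (\<lambda>q. {..of_rat q :: real})"
  have "sets (borel :: real measure) = sigma_sets UNIV (range (\<lambda>a. {..a :: real}))"
    by (subst borel_eq_atMost) simp
  also have "\<dots> = sigma_sets UNIV ?E"
  proof (rule sigma_sets_eqI)
    fix A assume "A \<in> range (\<lambda>a. {..a :: real})"
    then obtain a where A: "A = {..a}" by auto
    interpret sigma_algebra UNIV "sigma_sets UNIV ?E" by (rule sigma_algebra_sigma_sets) auto
    have eq: "A = (\<Inter>q\<in>{q. a < of_rat q}. {..of_rat q})"
    proof (intro equalityI subsetI)
      fix x assume x: "x \<in> (\<Inter>q\<in>{q. a < of_rat q}. {..of_rat q :: real})"
      have "\<not> a < x"
      proof
        assume "a < x"
        from of_rat_dense[OF this] obtain q where "a < of_rat q" "of_rat q < x" by blast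
        with x show False by force
      qed
      then show "x \<in> A" by (simp add: A)
    qed (auto simp: A)
    have "a < of_rat (of_int (\<lfloor>a\<rfloor> + 1))" unfolding of_rat_of_int_eq using floor_correct[of a] by simp
    then have ne: "{q. a < of_rat q} \<noteq> {}" by blast
    show "A \<in> sigma_sets UNIV ?E"
      unfolding eq by (rule countable_INT'[OF _ ne]) auto
  qed auto
  finally show ?thesis .
qed

section \<open>Conditional quantile functions and disintegration\<close>

lemma AE_le_of_nn_integral_le:
  fixes f g :: "'a \<Rightarrow> ennreal"
  assumes f: "f \<in> borel_measurable M" and g: "g \<in> borel_measurable M"
    and fin: "(\<integral>\<^sup>+x. g x \<partial>M) < \<infinity>"
    and le: "\<And>A. A \<in> sets M \<Longrightarrow> (\<integral>\<^sup>+x\<in>A. f x \<partial>M) \<le> (\<integral>\<^sup>+x\<in>A. g x \<partial>M)"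
  shows "AE x in M. f x \<le> g x"
proof -
  let ?A = "{x \<in> space M. g x < f x}"
  have A: "?A \<in> sets M" using f g by measurable
  have finA: "(\<integral>\<^sup>+x\<in>?A. g x \<partial>M) \<noteq> \<infinity>"
  proof -
    have "(\<integral>\<^sup>+x\<in>?A. g x \<partial>M) \<le> (\<integral>\<^sup>+x. g x \<partial>M)"
      by (intro nn_integral_mono) (auto simp: indicator_def)
    with fin show ?thesis by auto
  qed
  have "(\<integral>\<^sup>+x. f x * indicator ?A x - g x * indicator ?A x \<partial>M) =
      (\<integral>\<^sup>+x\<in>?A. f x \<partial>M) - (\<integral>\<^sup>+x\<in>?A. g x \<partial>M)"
    by (rule nn_integral_diff) (use f g A finA in \<open>auto simp: indicator_def intro!: AE_I2\<close>)
  also have "\<dots> = 0" using le[OF A] finA by (intro diff_eq_0_ennreal) (auto simp: less_top intro: le_less_trans)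
  finally have "AE x in M. f x * indicator ?A x - g x * indicator ?A x = 0"
    using f g A by (subst (asm) nn_integral_0_iff_AE) auto
  then show ?thesis
    using AE_space by eventually_elim (rule ccontr, auto simp: indicator_def diff_eq_0_iff_ennreal not_le)
qed

text \<open>The value \<open>\<nu> q A\<close> stands for the probability that a first coordinate
  lies in \<open>A\<close> and a second one is at most \<open>q\<close>. The continuity and limit
  hypotheses concern total masses only; with Radon-Nikodym derivatives they become, almost
  everywhere in x, the axioms of a distribution function in \<open>q\<close>. Applying its quantile
  function to a uniform t realizes the joint law as that of (x, \<psi> (x, t)). The lemma serves
  both for an existing pair of variables and for a joint distribution function obtained as a
  limit.\<close>

lemma conditional_quantile:
  fixes \<nu> :: "rat \<Rightarrow> 'a measure"
  assumes M: "prob_space M" and sets: "\<And>q. sets (\<nu> q) = sets M"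
    and mono: "\<And>q r A. q \<le> r \<Longrightarrow> A \<in> sets M \<Longrightarrow> emeasure (\<nu> q) A \<le> emeasure (\<nu> r) A"
    and le: "\<And>q A. A \<in> sets M \<Longrightarrow> emeasure (\<nu> q) A \<le> emeasure M A"
    and right: "\<And>q e. 0 < e \<Longrightarrow> \<exists>r>q. emeasure (\<nu> r) (space M) \<le> emeasure (\<nu> q) (space M) + ennreal e"
    and bot: "\<And>e. 0 < e \<Longrightarrow> \<exists>q. emeasure (\<nu> q) (space M) \<le> ennreal e"
    and top: "\<And>e. 0 < e \<Longrightarrow> \<exists>q. 1 \<le> emeasure (\<nu> q) (space M) + ennreal e"
  shows "\<exists>\<psi>\<in>borel_measurable (M \<Otimes>\<^sub>M unit_interval). \<forall>q. \<forall>A\<in>sets M.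
    emeasure (M \<Otimes>\<^sub>M unit_interval) {z \<in> space (M \<Otimes>\<^sub>M unit_interval). fst z \<in> A \<and> \<psi> z \<le> real_of_rat q} = emeasure (\<nu> q) A"
proof -
  interpret M: prob_space M by fact
  interpret U: prob_space unit_interval by (rule prob_space_unit_interval)
  note measurable_ident_unit_interval [measurable]
  let ?P = "M \<Otimes>\<^sub>M unit_interval"
  \<comment> \<open>\<open>D q x\<close> is the conditional distribution function at \<open>q\<close> given \<open>x\<close>, and \<open>\<psi>\<close> is its quantile function.\<close>
  define D where "D q = RN_deriv M (\<nu> q)" for q
  have Dm [measurable]: "D q \<in> borel_measurable M" for q unfolding D_def by simp
  have dens: "density M (D q) = \<nu> q" for q
    unfolding D_def
  proof (rule M.density_RN_deriv[OF _ sets])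
    show "absolutely_continuous M (\<nu> q)"
      unfolding absolutely_continuous_def
    proof
      fix A assume A: "A \<in> null_sets M"
      then have "emeasure (\<nu> q) A \<le> 0" using le[of A q] by (simp add: null_setsD1 null_setsD2)
      with A sets show "A \<in> null_sets (\<nu> q)" by auto
    qed
  qed
  have nu: "emeasure (\<nu> q) A = (\<integral>\<^sup>+x\<in>A. D q x \<partial>M)" if "A \<in> sets M" for q A
    unfolding dens[symmetric] using that by (simp add: emeasure_density)
  have nuS: "emeasure (\<nu> q) (space M) = (\<integral>\<^sup>+x. D q x \<partial>M)" for q
    unfolding nu[OF sets.top] by (intro nn_integral_cong) simp
  have finD: "(\<integral>\<^sup>+x. D q x \<partial>M) < \<infinity>" for q
    using le[OF sets.top, of q] M.emeasure_space_1 unfolding nuS by (auto intro: le_less_trans)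
  have mono_AE: "AE x in M. D q x \<le> D r x" if "q \<le> r" for q r
    by (rule AE_le_of_nn_integral_le[OF Dm Dm finD]) (use mono[OF that] nu in auto)
  have one_AE: "AE x in M. D q x \<le> 1" for q
    by (rule AE_le_of_nn_integral_le) (use le[of _ q] nu in \<open>auto simp: M.emeasure_space_1\<close>)
  \<comment> \<open>This and the next two facts compare integrals: the limit or right limit is
    bounded through a single rational point, for which the integral of the defect is at most
    e.\<close>
  have bot_AE: "AE x in M. (INF q. D q x) = 0"
  proof -
    have "(\<integral>\<^sup>+x. (INF q. D q x) \<partial>M) \<le> 0"
    proof (rule ennreal_le_epsilon)
      fix e :: real assume "0 < e"
      then obtain q where q: "emeasure (\<nu> q) (space M) \<le> ennreal e" using bot by blast
      have "(\<integral>\<^sup>+x. (INF q. D q x) \<partial>M) \<le> (\<integral>\<^sup>+x. D q x \<partial>M)"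
        by (intro nn_integral_mono INF_lower) simp
      with q show "(\<integral>\<^sup>+x. (INF q. D q x) \<partial>M) \<le> 0 + ennreal e" by (simp add: nuS)
    qed
    then show ?thesis by (subst (asm) le_zero_eq, subst (asm) nn_integral_0_iff_AE) auto
  qed
  have top_AE: "AE x in M. 1 \<le> (SUP q. D q x)"
  proof -
    have "(\<integral>\<^sup>+x. 1 - (SUP q. D q x) \<partial>M) \<le> 0"
    proof (rule ennreal_le_epsilon)
      fix e :: real assume "0 < e"
      then obtain q where q: "1 \<le> emeasure (\<nu> q) (space M) + ennreal e" using top by blast
      have "(\<integral>\<^sup>+x. 1 - (SUP q. D q x) \<partial>M) \<le> (\<integral>\<^sup>+x. 1 - D q x \<partial>M)"
        by (intro nn_integral_mono ennreal_mono_minus SUP_upper) simp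
      also have "\<dots> = (\<integral>\<^sup>+x. 1 \<partial>M) - (\<integral>\<^sup>+x. D q x \<partial>M)"
        by (rule nn_integral_diff) (use finD[of q] one_AE[of q] in auto)
      also have "\<dots> \<le> ennreal e"
        using q finD[of q] by (subst ennreal_minus_le_iff) (auto simp: nuS M.emeasure_space_1 add.commute)
      finally show "(\<integral>\<^sup>+x. 1 - (SUP q. D q x) \<partial>M) \<le> 0 + ennreal e" by simp
    qed
    then have "AE x in M. 1 - (SUP q. D q x) = 0"
      by (subst (asm) le_zero_eq, subst (asm) nn_integral_0_iff_AE) auto
    then show ?thesis by eventually_elim (simp add: diff_eq_0_iff_ennreal)
  qed
  have right_AE: "AE x in M. (INF r\<in>{q<..}. D r x) \<le> D q x" for q
  proof -
    have "(\<integral>\<^sup>+x. (INF r\<in>{q<..}. D r x) - D q x \<partial>M) \<le> 0"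
    proof (rule ennreal_le_epsilon)
      fix e :: real assume "0 < e"
      then obtain r where r: "q < r" "emeasure (\<nu> r) (space M) \<le> emeasure (\<nu> q) (space M) + ennreal e"
        using right by blast
      have "(\<integral>\<^sup>+x. (INF r\<in>{q<..}. D r x) - D q x \<partial>M) \<le> (\<integral>\<^sup>+x. D r x - D q x \<partial>M)"
        using r(1) by (intro nn_integral_mono ennreal_minus_mono INF_lower) auto
      also have "\<dots> = (\<integral>\<^sup>+x. D r x \<partial>M) - (\<integral>\<^sup>+x. D q x \<partial>M)"
        by (rule nn_integral_diff) (use finD[of q] mono_AE[of q r] r(1) in auto)
      also have "\<dots> \<le> ennreal e"
        using r(2) finD[of q] by (subst ennreal_minus_le_iff) (auto simp: nuS)
      finally show "(\<integral>\<^sup>+x. (INF r\<in>{q<..}. D r x) - D q x \<partial>M) \<le> 0 + ennreal e" by simp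
    qed
    then have "AE x in M. (INF r\<in>{q<..}. D r x) - D q x = 0"
      by (subst (asm) le_zero_eq, subst (asm) nn_integral_0_iff_AE) auto
    then show ?thesis by eventually_elim (simp add: diff_eq_0_iff_ennreal)
  qed
  \<comment> \<open>The infimum is taken in the extended reals over all rationals, so it is defined
    and measurable everywhere. Where it is infinite, \<open>real_of_ereal\<close> yields the
    harmless default 0.\<close>
  define I where "I z = (INF q. if ennreal (snd z) \<le> D q (fst z) then ereal (real_of_rat q) else \<infinity>)" for z :: "'a \<times> real"
  define \<psi> where "\<psi> z = real_of_ereal (I z)" for z
  have [measurable]: "I \<in> borel_measurable ?P"
    unfolding I_def by measurable
  have \<psi>m [measurable]: "\<psi> \<in> borel_measurable ?P" unfolding \<psi>_def by measurable
  \<comment> \<open>The Galois connection of the quantile function. The endpoints are excluded: at t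
    = 0 every rational qualifies and the infimum is minus infinity, at t = 1 possibly none
    does.\<close>
  have good: "AE x in M. (\<forall>q. D q x \<le> 1) \<and> (\<forall>q t. 0 < t \<and> t < 1 \<longrightarrow> (\<psi> (x, t) \<le> real_of_rat q \<longleftrightarrow> ennreal t \<le> D q x))"
  proof -
    have "AE x in M. \<forall>q. D q x \<le> 1" using one_AE by (simp add: AE_all_countable)
    moreover have "AE x in M. \<forall>q. (INF r\<in>{q<..}. D r x) \<le> D q x" using right_AE by (simp add: AE_all_countable)
    moreover have "AE x in M. \<forall>q r. q \<le> r \<longrightarrow> D q x \<le> D r x" using mono_AE by (simp add: AE_all_countable AE_impI)
    ultimately show ?thesis using bot_AE top_AE
    proof eventually_elim
      case (elim x)
      have "\<psi> (x, t) \<le> real_of_rat q \<longleftrightarrow> ennreal t \<le> D q x" if t: "0 < t" "t < 1" for q t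
      proof -
        have "(INF q. D q x) < ennreal t" using elim(4) t by simp
        \<comment> \<open>The rationals \<open>q0\<close> and \<open>q1\<close> bracket the infimum,
          so it is finite and passing to real numbers loses nothing.\<close>
        then obtain q0 where q0: "D q0 x < ennreal t" by (auto simp: INF_less_iff)
        have "ennreal t < (SUP q. D q x)" using elim(5) t by (intro less_le_trans[OF _ elim(5)]) simp
        then obtain q1 where q1: "ennreal t < D q1 x" by (auto simp: less_SUP_iff)
        have lower: "q0 \<le> r" if "ennreal t \<le> D r x" for r
        proof (rule ccontr)
          assume "\<not> q0 \<le> r"
          then have "D r x \<le> D q0 x" using elim(3) by auto
          with that q0 show False by auto
        qed
        have "I (x, t) \<le> ereal (real_of_rat q1)"
          unfolding I_def by (rule INF_lower2[of q1]) (use q1 in auto)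
        moreover have "ereal (real_of_rat q0) \<le> I (x, t)"
          unfolding I_def by (rule INF_greatest) (auto simp: of_rat_less_eq intro: lower)
        ultimately have fin: "\<bar>I (x, t)\<bar> \<noteq> \<infinity>" by auto
        have "\<psi> (x, t) \<le> real_of_rat q \<longleftrightarrow> I (x, t) \<le> ereal (real_of_rat q)"
          unfolding \<psi>_def using fin by (cases "I (x, t)") auto
        also have "\<dots> \<longleftrightarrow> ennreal t \<le> D q x"
        proof
          assume le: "I (x, t) \<le> ereal (real_of_rat q)"
          have "ennreal t \<le> D r x" if "q < r" for r
          proof -
            have "I (x, t) < ereal (real_of_rat r)"
              using le that by (auto simp: of_rat_less intro: le_less_trans)
            then have "\<exists>s. (if ennreal t \<le> D s x then ereal (real_of_rat s) else \<infinity>) < ereal (real_of_rat r)"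
              unfolding I_def INF_less_iff by simp
            then obtain s where "ennreal t \<le> D s x" "real_of_rat s < real_of_rat r"
              by (auto split: if_splits)
            then show ?thesis using elim(3) by (auto simp: of_rat_less intro: order_trans)
          qed
          then have "ennreal t \<le> (INF r\<in>{q<..}. D r x)" by (intro INF_greatest) auto
          also have "\<dots> \<le> D q x" using elim(2) by simp
          finally show "ennreal t \<le> D q x" .
        next
          assume "ennreal t \<le> D q x"
          then show "I (x, t) \<le> ereal (real_of_rat q)"
            unfolding I_def by (intro INF_lower2[of q]) auto
        qed
        finally show ?thesis .
      qed
      with elim(1) show ?case by blast
    qed
  qed
  have "emeasure ?P {z \<in> space ?P. fst z \<in> A \<and> \<psi> z \<le> real_of_rat q} = emeasure (\<nu> q) A" if A: "A \<in> sets M" for q A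
  proof -
    let ?S = "{z \<in> space ?P. fst z \<in> A \<and> \<psi> z \<le> real_of_rat q}"
    have S: "?S \<in> sets ?P" using A by measurable
    have "emeasure ?P ?S = (\<integral>\<^sup>+x. emeasure unit_interval (Pair x -` ?S) \<partial>M)"
      by (rule U.emeasure_pair_measure_alt[OF S])
    also have "\<dots> = (\<integral>\<^sup>+x\<in>A. D q x \<partial>M)"
    proof (rule nn_integral_cong_AE)
      show "AE x in M. emeasure unit_interval (Pair x -` ?S) = D q x * indicator A x"
        using good AE_space
      proof eventually_elim
      case (elim x)
      note * = elim(1) and x = elim(2)
      show "emeasure unit_interval (Pair x -` ?S) = D q x * indicator A x"
      proof (cases "x \<in> A")
        case True
        let ?d = "enn2real (D q x)"
        have D1: "D q x \<le> 1" using * by blast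
        then have d: "ennreal ?d = D q x" by (intro ennreal_enn2real) (auto intro: le_less_trans)
        have d01: "0 \<le> ?d" "?d \<le> 1" using D1 by (auto simp: enn2real_leI)
        have "emeasure unit_interval (Pair x -` ?S) = emeasure unit_interval {t \<in> {0..1}. t \<le> ?d}"
        proof (rule emeasure_eq_AE)
          show "AE t in unit_interval. t \<in> Pair x -` ?S \<longleftrightarrow> t \<in> {t \<in> {0..1}. t \<le> ?d}"
            using AE_unit_interval_open
          proof eventually_elim
            case (elim t)
            have "\<psi> (x, t) \<le> real_of_rat q \<longleftrightarrow> ennreal t \<le> ennreal ?d" using * elim d by auto
            then show ?case using elim True x d01 by (auto simp: space_pair_measure)
          qed
          show "Pair x -` ?S \<in> sets unit_interval" by (rule sets_Pair1[OF S])
          show "{t \<in> {0..1}. t \<le> ?d} \<in> sets unit_interval"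
            unfolding sets_unit_interval sets_restrict_space by (auto intro!: image_eqI[of _ _ "{..?d}"])
        qed
        also have "\<dots> = D q x" using emeasure_unit_interval_le[OF d01] d by simp
        finally show ?thesis using True by simp
      qed simp
      qed
    qed
    finally show ?thesis by (simp add: nu[OF A])
  qed
  then show ?thesis using \<psi>m by blast
qed


lemma joint_measure_eqI:
  assumes P: "prob_space P" "sets P = sets (M \<Otimes>\<^sub>M (borel :: real measure))"
    and Q: "sets Q = sets (M \<Otimes>\<^sub>M (borel :: real measure))"
    and eq: "\<And>A q. A \<in> sets M \<Longrightarrow> emeasure P (A \<times> {..of_rat q}) = emeasure Q (A \<times> {..of_rat q})"
  shows "P = Q"
proof (rule measure_eqI_generator_eq)
  interpret P: prob_space P by fact
  let ?E = "{a \<times> b | a b. a \<in> sets M \<and> b \<in> range (\<lambda>q. {..of_rat q :: real})}"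
  let ?\<Omega> = "space M \<times> (UNIV :: real set)"
  show "Int_stable ?E"
  proof (rule Int_stableI, clarsimp)
    fix a q a' q' assume a: "a \<in> sets M" "a' \<in> sets M"
    have "{..real_of_rat q} \<inter> {..real_of_rat q'} = {..real_of_rat (min q q')}"
      by (auto simp: min_def of_rat_less_eq)
    then have "a \<times> {..real_of_rat q} \<inter> a' \<times> {..real_of_rat q'} = (a \<inter> a') \<times> {..real_of_rat (min q q')}"
      by (simp add: Times_Int_Times)
    then show "\<exists>b c. a \<times> {..real_of_rat q} \<inter> a' \<times> {..real_of_rat q'} = b \<times> c \<and> b \<in> sets M \<and> c \<in> range (\<lambda>x. {..real_of_rat x})"
      using a by blast
  qed
  show "?E \<subseteq> Pow ?\<Omega>" using sets.sets_into_space by blast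
  have cover: "\<Union> (range (\<lambda>q. {..of_rat q :: real})) = UNIV"
  proof (intro equalityI subsetI UNIV_I)
    fix x :: real
    obtain q where "x < of_rat q" using of_rat_dense[of x "x + 1"] by auto
    then show "x \<in> \<Union> (range (\<lambda>q. {..of_rat q :: real}))" by (auto intro!: exI[of _ q])
  qed
  have gen: "sets (M \<Otimes>\<^sub>M (borel :: real measure)) = sigma_sets ?\<Omega> ?E"
  proof -
    have "sets (M \<Otimes>\<^sub>M (borel :: real measure)) = sets (sigma (space M \<times> space (borel :: real measure)) ?E)"
      by (rule sets_pair_eq[where Ca="{space M}" and Cb="range (\<lambda>q. {..of_rat q})"])
         (use sets.space_closed[of M] cover borel_eq_rat_atMost in \<open>auto simp: sets.sigma_sets_eq\<close>)
    also have "\<dots> = sigma_sets ?\<Omega> ?E"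
      using sets.sets_into_space by (subst sets_measure_of) auto
    finally show ?thesis .
  qed
  then show "sets P = sigma_sets ?\<Omega> ?E" "sets Q = sigma_sets ?\<Omega> ?E" using P Q by auto
  show "emeasure P X = emeasure Q X" if "X \<in> ?E" for X using that eq by auto
  show "range (\<lambda>i::nat. space M \<times> {..real_of_rat (of_nat i)}) \<subseteq> ?E"
  proof (rule image_subsetI)
    fix i :: nat
    show "space M \<times> {..real_of_rat (of_nat i)} \<in> ?E" using sets.top[of M] by blast
  qed
  show "(\<Union>i::nat. space M \<times> {..real_of_rat (of_nat i)}) = ?\<Omega>"
    by (auto simp: real_arch_simple)
  show "emeasure P (space M \<times> {..real_of_rat (of_nat i)}) \<noteq> \<infinity>" for i :: nat by simp
qed

lemma emeasure_joint_distr: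
  assumes "X \<in> measurable K M" "Y \<in> borel_measurable K" "A \<in> sets M"
  shows "emeasure (distr K (M \<Otimes>\<^sub>M borel) (\<lambda>k. (X k, Y k))) (A \<times> {..c::real}) =
    emeasure K {k \<in> space K. X k \<in> A \<and> Y k \<le> c}"
proof -
  have "(\<lambda>k. (X k, Y k)) \<in> measurable K (M \<Otimes>\<^sub>M borel)" using assms by measurable
  then show ?thesis using assms(3)
    by (subst emeasure_distr) (auto intro!: arg_cong[where f="emeasure K"])
qed

text \<open>Given X, the variable Y can be generated from X and an independent uniform variable
  without changing the joint law. The hypotheses of \<open>conditional_quantile\<close> reduce to
  the standard properties of the distribution function of Y.\<close>

lemma disintegration:
  fixes Y :: "'k \<Rightarrow> real"
  assumes K: "prob_space K" and X: "X \<in> measurable K M" "distr K M X = M"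
    and Y: "Y \<in> borel_measurable K"
  shows "\<exists>\<psi>\<in>borel_measurable (M \<Otimes>\<^sub>M unit_interval).
    distr (M \<Otimes>\<^sub>M unit_interval) (M \<Otimes>\<^sub>M borel) (\<lambda>z. (fst z, \<psi> z)) = distr K (M \<Otimes>\<^sub>M borel) (\<lambda>k. (X k, Y k))"
proof -
  interpret K: prob_space K by fact
  have M: "prob_space M" using K.prob_space_distr[OF X(1)] by (simp add: X(2))
  interpret M: prob_space M by fact
  interpret U: prob_space unit_interval by (rule prob_space_unit_interval)
  interpret MU: pair_prob_space M unit_interval ..
  \<comment> \<open>The law of X on the event that Y is at most \<open>q\<close>, not
    normalized.\<close>
  define \<nu> where "\<nu> q = distr (density K (indicator {k \<in> space K. Y k \<le> of_rat q})) M X" for q :: rat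
  have Ys: "{k \<in> space K. Y k \<le> c} \<in> sets K" for c using Y by measurable
  have nu: "emeasure (\<nu> q) A = emeasure K {k \<in> space K. X k \<in> A \<and> Y k \<le> of_rat q}" if "A \<in> sets M" for q A
  proof -
    have XA: "X -` A \<inter> space K \<in> sets K" using X(1) that by (rule measurable_sets)
    have "emeasure (\<nu> q) A = emeasure (density K (indicator {k \<in> space K. Y k \<le> of_rat q})) (X -` A \<inter> space K)"
      unfolding \<nu>_def using X(1) that by (subst emeasure_distr) auto
    also have "\<dots> = (\<integral>\<^sup>+k. indicator {k \<in> space K. X k \<in> A \<and> Y k \<le> of_rat q} k \<partial>K)"
      using Ys[of "of_rat q"] XA
      by (subst emeasure_density) (auto intro!: nn_integral_cong simp: indicator_def)
    also have "\<dots> = emeasure K {k \<in> space K. X k \<in> A \<and> Y k \<le> of_rat q}"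
    proof (rule nn_integral_indicator)
      have "{k \<in> space K. X k \<in> A \<and> Y k \<le> of_rat q} = (X -` A \<inter> space K) \<inter> {k \<in> space K. Y k \<le> of_rat q}"
        by auto
      then show "{k \<in> space K. X k \<in> A \<and> Y k \<le> of_rat q} \<in> sets K" using XA Ys by simp
    qed
    finally show ?thesis .
  qed
  have Xm [measurable]: "X \<in> measurable K M" and Ym [measurable]: "Y \<in> borel_measurable K" by fact+
  have nuS: "emeasure (\<nu> q) (space M) = ennreal (cdf (distr K borel Y) (of_rat q))" for q
  proof -
    have "{k \<in> space K. X k \<in> space M \<and> Y k \<le> of_rat q} = Y -` {..of_rat q} \<inter> space K"
      using measurable_space[OF X(1)] by auto
    then show ?thesis
      unfolding nu[OF sets.top] cdf_def by (simp add: measure_distr K.emeasure_eq_measure)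
  qed
  interpret Y: real_distribution "distr K borel Y" by (rule K.real_distribution_distr) fact
  have cdf0: "0 \<le> cdf (distr K borel Y) c" for c by (simp add: cdf_def)
  have "\<exists>\<psi>\<in>borel_measurable (M \<Otimes>\<^sub>M unit_interval). \<forall>q. \<forall>A\<in>sets M.
    emeasure (M \<Otimes>\<^sub>M unit_interval) {z \<in> space (M \<Otimes>\<^sub>M unit_interval). fst z \<in> A \<and> \<psi> z \<le> real_of_rat q} = emeasure (\<nu> q) A"
  proof (rule conditional_quantile[OF M])
    show "sets (\<nu> q) = sets M" for q by (simp add: \<nu>_def)
    show "emeasure (\<nu> q) A \<le> emeasure (\<nu> r) A" if "q \<le> r" "A \<in> sets M" for q r A
      unfolding nu[OF that(2)] using that
      by (intro emeasure_mono) (auto simp: of_rat_less_eq intro: order_trans)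
    show "emeasure (\<nu> q) A \<le> emeasure M A" if A: "A \<in> sets M" for q A
    proof -
      have "emeasure M A = emeasure K (X -` A \<inter> space K)"
        using X A by (metis emeasure_distr)
      then show ?thesis
        unfolding nu[OF A] using measurable_sets[OF X(1) A] by (auto intro!: emeasure_mono)
    qed
    fix e :: real assume e: "0 < e"
    show "\<exists>r>q. emeasure (\<nu> r) (space M) \<le> emeasure (\<nu> q) (space M) + ennreal e" for q
    proof -
      have "(cdf (distr K borel Y) \<longlongrightarrow> cdf (distr K borel Y) (of_rat q)) (at_right (of_rat q))"
        using Y.cdf_is_right_cont[of "of_rat q"] by (simp add: continuous_within)
      then have "eventually (\<lambda>x. cdf (distr K borel Y) x < cdf (distr K borel Y) (of_rat q) + e) (at_right (of_rat q))"
        using e by (intro order_tendstoD(2)) auto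
      then obtain b where b: "of_rat q < b" "\<And>x. of_rat q < x \<Longrightarrow> x < b \<Longrightarrow> cdf (distr K borel Y) x < cdf (distr K borel Y) (of_rat q) + e"
        unfolding eventually_at_right_field by auto
      obtain r where r: "real_of_rat q < of_rat r" "of_rat r < b" using of_rat_dense[OF b(1)] by blast
      have "cdf (distr K borel Y) (of_rat r) \<le> cdf (distr K borel Y) (of_rat q) + e" using b(2)[OF r] by simp
      then have "emeasure (\<nu> r) (space M) \<le> emeasure (\<nu> q) (space M) + ennreal e"
        unfolding nuS using e cdf0 by (simp add: ennreal_plus[symmetric] ennreal_leI del: ennreal_plus)
      with r(1) show ?thesis by (auto simp: of_rat_less)
    qed
    show "\<exists>q. emeasure (\<nu> q) (space M) \<le> ennreal e"
    proof -
      have "eventually (\<lambda>x. cdf (distr K borel Y) x < e) at_bot"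
        using Y.cdf_lim_at_bot e by (rule order_tendstoD(2))
      then obtain N where N: "\<And>x. x \<le> N \<Longrightarrow> cdf (distr K borel Y) x < e" unfolding eventually_at_bot_linorder by auto
      obtain q where "real_of_rat q < N" using of_rat_dense[of "N - 1" N] by auto
      then show ?thesis unfolding nuS using N[of "of_rat q"] by (auto intro!: exI[of _ q] ennreal_leI)
    qed
    show "\<exists>q. 1 \<le> emeasure (\<nu> q) (space M) + ennreal e"
    proof -
      have "eventually (\<lambda>x. 1 - e < cdf (distr K borel Y) x) at_top"
        using Y.cdf_lim_at_top_prob e by (intro order_tendstoD(1)) auto
      then obtain N where N: "\<And>x. N \<le> x \<Longrightarrow> 1 - e < cdf (distr K borel Y) x" unfolding eventually_at_top_linorder by auto
      obtain q where "N < real_of_rat q" using of_rat_dense[of N "N + 1"] by auto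
      then have "1 \<le> cdf (distr K borel Y) (of_rat q) + e" using N[of "of_rat q"] by simp
      then have "1 \<le> emeasure (\<nu> q) (space M) + ennreal e"
        unfolding nuS using e cdf0 by (simp add: ennreal_plus[symmetric] ennreal_1[symmetric] ennreal_leI del: ennreal_plus ennreal_1)
      then show ?thesis by blast
    qed
  qed
  then obtain \<psi> where \<psi>: "\<psi> \<in> borel_measurable (M \<Otimes>\<^sub>M unit_interval)"
    "\<And>q A. A \<in> sets M \<Longrightarrow> emeasure (M \<Otimes>\<^sub>M unit_interval) {z \<in> space (M \<Otimes>\<^sub>M unit_interval). fst z \<in> A \<and> \<psi> z \<le> real_of_rat q} = emeasure (\<nu> q) A"
    by blast
  have "distr (M \<Otimes>\<^sub>M unit_interval) (M \<Otimes>\<^sub>M borel) (\<lambda>z. (fst z, \<psi> z)) = distr K (M \<Otimes>\<^sub>M borel) (\<lambda>k. (X k, Y k))"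
  proof (rule joint_measure_eqI)
    have "(\<lambda>z. (fst z, \<psi> z)) \<in> measurable (M \<Otimes>\<^sub>M unit_interval) (M \<Otimes>\<^sub>M borel)"
      using \<psi>(1) by measurable
    then show "prob_space (distr (M \<Otimes>\<^sub>M unit_interval) (M \<Otimes>\<^sub>M borel) (\<lambda>z. (fst z, \<psi> z)))"
      by (rule MU.prob_space_distr)
    show "emeasure (distr (M \<Otimes>\<^sub>M unit_interval) (M \<Otimes>\<^sub>M borel) (\<lambda>z. (fst z, \<psi> z))) (A \<times> {..real_of_rat q}) =
      emeasure (distr K (M \<Otimes>\<^sub>M borel) (\<lambda>k. (X k, Y k))) (A \<times> {..real_of_rat q})" if "A \<in> sets M" for A q
      using \<psi> that X Y by (subst (1 2) emeasure_joint_distr) (auto simp: nu)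
  qed simp_all
  with \<psi>(1) show ?thesis by blast
qed

section \<open>Couplings of graphons on the line\<close>

text \<open>The exhausting sequence replaces membership of the whole space: half-lines generate the
  Borel sets, but the line itself is not one of them.\<close>

definition pi_generator :: "'a measure \<Rightarrow> 'a set set \<Rightarrow> bool" where
  "pi_generator M E \<longleftrightarrow> E \<subseteq> Pow (space M) \<and> Int_stable E \<and> sets M = sigma_sets (space M) E \<and>
     (\<exists>A :: nat \<Rightarrow> 'a set. range A \<subseteq> E \<and> incseq A \<and> \<Union> (range A) = space M)"

lemma pi_generator_pair:
  assumes M: "pi_generator M E" and N: "pi_generator N F"
  shows "pi_generator (M \<Otimes>\<^sub>M N) {a \<times> b | a b. a \<in> E \<and> b \<in> F}"
proof -
  from M obtain A :: "nat \<Rightarrow> 'a set" where E: "E \<subseteq> Pow (space M)" "Int_stable E" "sets M = sigma_sets (space M) E"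
    and A: "range A \<subseteq> E" "incseq A" "\<Union> (range A) = space M" by (auto simp: pi_generator_def)
  from N obtain B :: "nat \<Rightarrow> 'b set" where F: "F \<subseteq> Pow (space N)" "Int_stable F" "sets N = sigma_sets (space N) F"
    and B: "range B \<subseteq> F" "incseq B" "\<Union> (range B) = space N" by (auto simp: pi_generator_def)
  let ?G = "{a \<times> b | a b. a \<in> E \<and> b \<in> F}"
  have sub: "?G \<subseteq> Pow (space M \<times> space N)" using E(1) F(1) by blast
  have "sets (M \<Otimes>\<^sub>M N) = sets (sigma (space M \<times> space N) ?G)"
    by (rule sets_pair_eq[OF E(1,3) _ A(1,3) F(1,3) _ B(1,3)]) auto
  then have 1: "sets (M \<Otimes>\<^sub>M N) = sigma_sets (space (M \<Otimes>\<^sub>M N)) ?G"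
    using sub by (simp add: space_pair_measure)
  have 2: "Int_stable ?G"
  proof (rule Int_stableI)
    fix x y assume "x \<in> ?G" "y \<in> ?G"
    then obtain a b a' b' where xy: "x = a \<times> b" "y = a' \<times> b'" "a \<in> E" "a' \<in> E" "b \<in> F" "b' \<in> F" by blast
    then have "a \<inter> a' \<in> E" "b \<inter> b' \<in> F" using E(2) F(2) by (auto simp: Int_stable_def)
    with xy show "x \<inter> y \<in> ?G" by (auto simp: Times_Int_Times)
  qed
  have "(\<Union>i. A i \<times> B i) = space (M \<Otimes>\<^sub>M N)"
  proof (intro equalityI subsetI)
    fix z assume "z \<in> space (M \<Otimes>\<^sub>M N)"
    then have "fst z \<in> \<Union> (range A)" "snd z \<in> \<Union> (range B)"
      by (auto simp: space_pair_measure A(3) B(3))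
    then obtain i j where "fst z \<in> A i" "snd z \<in> B j" by auto
    then have "fst z \<in> A (max i j)" "snd z \<in> B (max i j)"
      using A(2) B(2) by (meson incseqD max.cobounded1 max.cobounded2 subsetD)+
    then show "z \<in> (\<Union>i. A i \<times> B i)" by (cases z) auto
  next
    fix z assume "z \<in> (\<Union>i. A i \<times> B i)"
    then obtain i where "z \<in> A i \<times> B i" by blast
    moreover have "A i \<subseteq> space M" "B i \<subseteq> space N" using A(3) B(3) by blast+
    ultimately show "z \<in> space (M \<Otimes>\<^sub>M N)" by (auto simp: space_pair_measure)
  qed
  moreover have "range (\<lambda>i. A i \<times> B i) \<subseteq> ?G" using A(1) B(1) by blast
  moreover have "incseq (\<lambda>i. A i \<times> B i)"
    using A(2) B(2) unfolding incseq_def by (meson Sigma_mono)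
  ultimately have "\<exists>C :: nat \<Rightarrow> _. range C \<subseteq> ?G \<and> incseq C \<and> \<Union> (range C) = space (M \<Otimes>\<^sub>M N)"
    by blast
  with 1 2 sub show ?thesis unfolding pi_generator_def by (simp add: space_pair_measure)
qed

text \<open>Linear combinations of indicators of members of \<open>E\<close>, which may overlap. The
  inductive form lets a property that is closed under linear combinations be checked on one
  indicator at a time.\<close>

inductive_set step_functions :: "'a set set \<Rightarrow> ('a \<Rightarrow> real) set" for E where
  zero: "(\<lambda>_. 0) \<in> step_functions E"
| add: "A \<in> E \<Longrightarrow> f \<in> step_functions E \<Longrightarrow> (\<lambda>x. c * indicator A x + f x) \<in> step_functions E"

lemma step_functions_plus:
  assumes "f \<in> step_functions E" "g \<in> step_functions E"
  shows "(\<lambda>x. f x + g x) \<in> step_functions E"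
  using assms
proof induction
  case (add A f c)
  then have "(\<lambda>x. c * indicator A x + (f x + g x)) \<in> step_functions E"
    by (intro step_functions.add) auto
  then show ?case by (simp add: add.assoc)
qed simp

lemma step_functions_scale:
  assumes "f \<in> step_functions E"
  shows "(\<lambda>x. d * f x) \<in> step_functions E"
  using assms
proof induction
  case zero then show ?case by (simp add: step_functions.zero)
next
  case (add A f c)
  then have "(\<lambda>x. (d * c) * indicator A x + d * f x) \<in> step_functions E"
    by (intro step_functions.add) auto
  then show ?case by (simp add: algebra_simps)
qed

lemma step_functions_measurable:
  assumes "f \<in> step_functions E" "E \<subseteq> sets M"
  shows "f \<in> borel_measurable M"
  using assms(1) by induction (use assms(2) in \<open>auto intro!: borel_measurable_add borel_measurable_times\<close>)

lemma step_functions_bounded: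
  assumes "f \<in> step_functions E"
  shows "\<exists>C. \<forall>x. \<bar>f x\<bar> \<le> C"
  using assms
proof induction
  case (add A f c)
  then obtain C where C: "\<bar>f x\<bar> \<le> C" for x by blast
  have "\<bar>c * indicator A x + f x\<bar> \<le> \<bar>c\<bar> + C" for x
    using C[of x] by (auto simp: indicator_def)
  then show ?case by blast
qed auto

text \<open>Density of step functions in L1. The class \<open>approx\<close> is closed under linear
  combinations and L1 limits, which is enough to carry out Dynkin's induction for indicators and
  then the induction over integrable functions.\<close>

lemma (in prob_space) step_functions_approx:
  assumes gen: "pi_generator M E" and f: "integrable M f" and e: "0 < (e::real)"
  shows "\<exists>g\<in>step_functions E. (\<integral>x. \<bar>f x - g x\<bar> \<partial>M) \<le> e"
proof -
  from gen obtain A :: "nat \<Rightarrow> 'a set" where E: "E \<subseteq> Pow (space M)" "Int_stable E" "sets M = sigma_sets (space M) E"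
    and A: "range A \<subseteq> E" "incseq A" "\<Union> (range A) = space M" by (auto simp: pi_generator_def)
  have Es: "E \<subseteq> sets M" unfolding E(3) by auto
  have int_step: "integrable M g" if g: "g \<in> step_functions E" for g
  proof -
    obtain C where "\<forall>x. \<bar>g x\<bar> \<le> C" using step_functions_bounded[OF g] by blast
    then show ?thesis
      by (intro integrable_bounded[where C=C, OF step_functions_measurable[OF g Es]]) auto
  qed
  define approx where "approx f \<longleftrightarrow> (\<forall>e>0. \<exists>g\<in>step_functions E. (\<integral>x. \<bar>f x - g x\<bar> \<partial>M) \<le> e)" for f
  \<comment> \<open>Closure under L1 limits; both the increasing unions of sets and the passage from
    simple to integrable functions rest on it.\<close>
  have near: "approx f" if f: "integrable M f" and s: "\<And>e. 0 < e \<Longrightarrow> \<exists>h. integrable M h \<and> approx h \<and> (\<integral>x. \<bar>f x - h x\<bar> \<partial>M) \<le> e" for f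
    unfolding approx_def
  proof (intro allI impI)
    fix e :: real assume "0 < e"
    then obtain h where h: "integrable M h" "approx h" "(\<integral>x. \<bar>f x - h x\<bar> \<partial>M) \<le> e / 2"
      using s[of "e / 2"] by auto
    obtain g where g: "g \<in> step_functions E" "(\<integral>x. \<bar>h x - g x\<bar> \<partial>M) \<le> e / 2"
      using h(2) \<open>0 < e\<close> unfolding approx_def by (meson half_gt_zero)
    have "(\<integral>x. \<bar>f x - g x\<bar> \<partial>M) \<le> (\<integral>x. \<bar>f x - h x\<bar> + \<bar>h x - g x\<bar> \<partial>M)"
      using f h(1) int_step[OF g(1)] by (intro integral_mono) auto
    also have "\<dots> = (\<integral>x. \<bar>f x - h x\<bar> \<partial>M) + (\<integral>x. \<bar>h x - g x\<bar> \<partial>M)"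
      using f h(1) int_step[OF g(1)] by (intro Bochner_Integration.integral_add) auto
    finally show "\<exists>g\<in>step_functions E. (\<integral>x. \<bar>f x - g x\<bar> \<partial>M) \<le> e"
      using g h(3) by (intro bexI[of _ g]) auto
  qed
  have plus: "approx (\<lambda>x. f x + g x)" if fg: "integrable M f" "approx f" "integrable M g" "approx g" for f g
    unfolding approx_def
  proof (intro allI impI)
    fix e :: real assume e: "0 < e"
    obtain f' where f': "f' \<in> step_functions E" "(\<integral>x. \<bar>f x - f' x\<bar> \<partial>M) \<le> e / 2"
      using fg(2) e unfolding approx_def by (meson half_gt_zero)
    obtain g' where g': "g' \<in> step_functions E" "(\<integral>x. \<bar>g x - g' x\<bar> \<partial>M) \<le> e / 2"
      using fg(4) e unfolding approx_def by (meson half_gt_zero)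
    have "(\<integral>x. \<bar>f x + g x - (f' x + g' x)\<bar> \<partial>M) \<le> (\<integral>x. \<bar>f x - f' x\<bar> + \<bar>g x - g' x\<bar> \<partial>M)"
      using fg int_step[OF f'(1)] int_step[OF g'(1)] by (intro integral_mono) auto
    also have "\<dots> = (\<integral>x. \<bar>f x - f' x\<bar> \<partial>M) + (\<integral>x. \<bar>g x - g' x\<bar> \<partial>M)"
      using fg int_step[OF f'(1)] int_step[OF g'(1)] by (intro Bochner_Integration.integral_add) auto
    finally show "\<exists>h\<in>step_functions E. (\<integral>x. \<bar>f x + g x - h x\<bar> \<partial>M) \<le> e"
      using f' g' step_functions_plus[OF f'(1) g'(1)] by (intro bexI[of _ "\<lambda>x. f' x + g' x"]) auto
  qed
  have scale: "approx (\<lambda>x. c * f x)" if f: "integrable M f" "approx f" for c f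
    unfolding approx_def
  proof (intro allI impI)
    fix e :: real assume e: "0 < e"
    then have e': "0 < e / (\<bar>c\<bar> + 1)" by simp
    then obtain g where g: "g \<in> step_functions E" "(\<integral>x. \<bar>f x - g x\<bar> \<partial>M) \<le> e / (\<bar>c\<bar> + 1)"
      using f(2) unfolding approx_def by blast
    have "(\<integral>x. \<bar>c * f x - c * g x\<bar> \<partial>M) = \<bar>c\<bar> * (\<integral>x. \<bar>f x - g x\<bar> \<partial>M)"
      by (simp add: right_diff_distrib[symmetric] abs_mult)
    also have "\<dots> \<le> \<bar>c\<bar> * (e / (\<bar>c\<bar> + 1))" using g(2) by (intro mult_left_mono) auto
    also have "\<dots> \<le> e" using e by (simp add: field_simps)
    finally show "\<exists>h\<in>step_functions E. (\<integral>x. \<bar>c * f x - h x\<bar> \<partial>M) \<le> e"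
      using step_functions_scale[OF g(1)] by (intro bexI[of _ "\<lambda>x. c * g x"]) auto
  qed
  have step: "approx g" if "g \<in> step_functions E" for g
    unfolding approx_def using that by (auto intro!: bexI[of _ g])
  have ind: "(\<lambda>x. indicator B x) \<in> step_functions E" if "B \<in> E" for B
    using step_functions.add[OF that step_functions.zero, of 1] by simp
  have ind_int: "integrable M (\<lambda>x. indicator B x :: real)" if "B \<in> sets M" for B
    using that by (intro integrable_bounded[where C=1]) (auto simp: indicator_def)
  have limit_sets: "approx (indicator S)" if "S \<in> sets M" "\<And>n. B n \<in> sets M" "\<And>n. approx (indicator (B n))"
    "incseq B" "(\<Union>n. B n) = S" for S and B :: "nat \<Rightarrow> 'a set"
  proof (rule near)
    fix e :: real assume e: "0 < e"
    have "(\<lambda>n. prob (B n)) \<longlonglongrightarrow> prob S"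
      using finite_Lim_measure_incseq[of B] that by auto
    then have "eventually (\<lambda>n. prob S - e < prob (B n)) sequentially"
      using e by (intro order_tendstoD(1)) auto
    then obtain n where n: "prob S - e < prob (B n)" by (auto simp: eventually_sequentially)
    have BS: "B n \<subseteq> S" using that(5) by auto
    have "(\<integral>x. \<bar>indicator S x - indicator (B n) x :: real\<bar> \<partial>M) = (\<integral>x. indicator (S - B n) x \<partial>M)"
      using BS by (intro Bochner_Integration.integral_cong) (auto simp: indicator_def)
    also have "\<dots> = prob S - prob (B n)"
      using that BS by (simp add: finite_measure_Diff)
    finally have "(\<integral>x. \<bar>indicator S x - indicator (B n) x :: real\<bar> \<partial>M) \<le> e" using n by simp
    with that show "\<exists>h. integrable M h \<and> approx h \<and> (\<integral>x. \<bar>indicator S x - h x\<bar> \<partial>M) \<le> e"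
      by (intro exI[of _ "indicator (B n)"]) (auto intro: ind_int)
  qed (use that in \<open>auto intro: ind_int\<close>)
  \<comment> \<open>The space need not belong to \<open>E\<close>, but it is an increasing union of
    members. Complements need its indicator.\<close>
  have ind_space: "approx (indicator (space M))"
    by (rule limit_sets[of _ A]) (use A Es in \<open>auto intro!: step ind\<close>)
  have ind_sets: "approx (indicator B)" if "B \<in> sets M" for B
    using E(2,1) that[unfolded E(3)]
  proof (induction rule: sigma_sets_induct_disjoint)
    case (basic B) then show ?case by (intro step ind)
  next
    case empty
    then show ?case using step[OF step_functions.zero] by (simp add: indicator_def[abs_def])
  next
    case (compl B)
    then have B: "B \<in> sets M" by (simp add: E(3))
    have "approx (\<lambda>x. indicator (space M) x + (-1) * indicator B x)"
      by (intro plus scale ind_space compl.IH ind_int B integrable_mult_right) auto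
    also have "(\<lambda>x. indicator (space M) x + (-1) * indicator B x) = (indicator (space M - B) :: _ \<Rightarrow> real)"
      using sets.sets_into_space[OF B] by (auto simp: indicator_def fun_eq_iff)
    finally show ?case .
  next
    case (union B)
    then have B: "B i \<in> sets M" for i unfolding E(3) by blast
    have fin: "approx (indicator (\<Union>i<n. B i))" for n
    proof (induction n)
      case 0 then show ?case using step[OF step_functions.zero] by (simp add: indicator_def[abs_def])
    next
      case (Suc n)
      have "approx (\<lambda>x. indicator (\<Union>i<n. B i) x + indicator (B n) x)"
        by (intro plus Suc union.IH ind_int B sets.finite_UN) auto
      also have "(\<lambda>x. indicator (\<Union>i<n. B i) x + indicator (B n) x) = (indicator (\<Union>i<Suc n. B i) :: _ \<Rightarrow> real)"
      proof -
        have "B i \<inter> B n = {}" if "i < n" for i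
          using disjoint_family_onD[OF union.hyps(1), of i n] that by simp
        then have disj: "(\<Union>i<n. B i) \<inter> B n = {}" by blast
        show ?thesis
          unfolding fun_eq_iff lessThan_Suc by (simp only: indicator_add[OF disj] UN_insert Un_commute) simp
      qed
      finally show ?case .
    qed
    show ?case
    proof (rule limit_sets[of _ "\<lambda>n. \<Union>i<n. B i"])
      show "incseq (\<lambda>n. \<Union>i<n. B i)" by (auto simp: incseq_def intro: less_le_trans)
    qed (use B fin in auto)
  qed
  have "approx f" using f
  proof (induction rule: integrable_induct)
    case (base B c)
    then show ?case using scale[OF ind_int[OF base(1)] ind_sets[OF base(1)]] by (simp add: mult.commute)
  next
    case (add f g) then show ?case by (intro plus) auto
  next
    case (lim f s)
    show ?case
    proof (rule near[OF lim.hyps(4)])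
      fix e :: real assume e: "0 < e"
      have "(\<lambda>i. \<integral>x. \<bar>f x - s i x\<bar> \<partial>M) \<longlonglongrightarrow> (\<integral>x. 0 \<partial>M)"
      proof (rule integral_dominated_convergence[where w="\<lambda>x. 3 * \<bar>f x\<bar>"])
        show "AE x in M. (\<lambda>i. \<bar>f x - s i x\<bar>) \<longlonglongrightarrow> 0"
        proof (rule AE_I2)
          fix x assume "x \<in> space M"
          from tendsto_diff[OF tendsto_const lim.hyps(2)[OF this], of "f x"]
          show "(\<lambda>i. \<bar>f x - s i x\<bar>) \<longlonglongrightarrow> 0" by (simp add: tendsto_rabs_zero)
        qed
        \<comment> \<open>The simple functions in the induction satisfy |s| \<le> 2 |f|, whence the
          factor 3.\<close>
        show "AE x in M. norm \<bar>f x - s i x\<bar> \<le> 3 * \<bar>f x\<bar>" for i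
          using lim.hyps(3)[of _ i] by (intro AE_I2) (force simp: abs_le_iff)
      qed (use lim.hyps in auto)
      then have "eventually (\<lambda>i. (\<integral>x. \<bar>f x - s i x\<bar> \<partial>M) < e) sequentially"
        using e by (intro order_tendstoD(2)) auto
      then obtain i where "(\<integral>x. \<bar>f x - s i x\<bar> \<partial>M) < e" by (auto simp: eventually_sequentially)
      then show "\<exists>h. integrable M h \<and> approx h \<and> (\<integral>x. \<bar>f x - h x\<bar> \<partial>M) \<le> e"
        using lim by (intro exI[of _ "s i"]) auto
    qed
  qed
  then show ?thesis using e by (simp add: approx_def)
qed

text \<open>The difference \<open>H\<close> of the two distribution functions is itself
  nondecreasing and right-continuous. The measure of \<open>G\<close> is the sum of those of
  \<open>F\<close> and \<open>H\<close>: this is clear on half-lines and extends by Dynkin's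
  induction. The limits at infinity make all three measures finite, so that complements can be
  subtracted.\<close>

lemma interval_measure_mono:
  fixes F G :: "real \<Rightarrow> real"
  assumes F: "\<And>x y. x \<le> y \<Longrightarrow> F x \<le> F y" "\<And>a. continuous (at_right a) F" "(F \<longlongrightarrow> 0) at_bot" "(F \<longlongrightarrow> m) at_top"
    and G: "\<And>x y. x \<le> y \<Longrightarrow> G x \<le> G y" "\<And>a. continuous (at_right a) G" "(G \<longlongrightarrow> 0) at_bot" "(G \<longlongrightarrow> k) at_top"
    and diff: "\<And>x y. x \<le> y \<Longrightarrow> F y - F x \<le> G y - G x"
    and A: "A \<in> sets borel"
  shows "emeasure (interval_measure F) A \<le> emeasure (interval_measure G) A"
proof -
  define H where "H x = G x - F x" for x
  have H: "\<And>x y. x \<le> y \<Longrightarrow> H x \<le> H y" "\<And>a. continuous (at_right a) H" "(H \<longlongrightarrow> 0) at_bot" "(H \<longlongrightarrow> k - m) at_top"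
    using diff tendsto_diff[OF G(3) F(3)] tendsto_diff[OF G(4) F(4)]
    unfolding H_def by (auto simp: algebra_simps intro!: continuous_intros F(2) G(2))
  have nonneg: "0 \<le> f x" if "\<And>x y. x \<le> y \<Longrightarrow> f x \<le> f y" "(f \<longlongrightarrow> 0) at_bot" for f :: "real \<Rightarrow> real" and x
    by (rule tendsto_upperbound[OF that(2)]) (auto simp: eventually_at_bot_linorder intro!: exI[of _ x] that(1))
  have le_top: "0 \<le> l" if "\<And>x y. x \<le> y \<Longrightarrow> f x \<le> f y" "(f \<longlongrightarrow> 0) at_bot" "(f \<longlongrightarrow> l) at_top" for f :: "real \<Rightarrow> real" and l
    by (rule tendsto_lowerbound[OF that(3)]) (auto intro!: always_eventually nonneg[OF that(1,2)])
  note UF = interval_measure_UNIV[OF F le_top[OF F(1,3,4)]]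
  note UG = interval_measure_UNIV[OF G le_top[OF G(1,3,4)]]
  note UH = interval_measure_UNIV[OF H le_top[OF H(1,3,4)]]
  have "emeasure (interval_measure G) A = emeasure (interval_measure F) A + emeasure (interval_measure H) A"
  proof (rule sigma_sets_induct_disjoint[of "range (\<lambda>a. {..a::real})" UNIV A])
    show "Int_stable (range (\<lambda>a. {..a::real}))" by (auto simp: Int_stable_def min_def intro!: image_eqI)
    show "A \<in> sigma_sets UNIV (range (\<lambda>a. {..a::real}))" using A by (subst (asm) borel_eq_atMost) simp
    fix B assume "B \<in> range (\<lambda>a. {..a::real})"
    then obtain a where B: "B = {..a}" by auto
    show "emeasure (interval_measure G) B = emeasure (interval_measure F) B + emeasure (interval_measure H) B"
    proof -
      have "emeasure (interval_measure F) {..a} = ennreal (F a)" "emeasure (interval_measure G) {..a} = ennreal (G a)"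
        "emeasure (interval_measure H) {..a} = ennreal (H a)"
        using F(1-3) G(1-3) H(1-3) by (auto intro!: emeasure_interval_measure_Iic)
      then show ?thesis
        using nonneg[OF F(1,3), of a] nonneg[OF H(1,3), of a]
        by (simp add: B ennreal_plus[symmetric] H_def del: ennreal_plus)
    qed
  next
    fix B assume "B \<in> sigma_sets UNIV (range (\<lambda>a. {..a::real}))"
      and IH: "emeasure (interval_measure G) B = emeasure (interval_measure F) B + emeasure (interval_measure H) B"
    then have B: "B \<in> sets borel" by (subst borel_eq_atMost) simp
    have mle: "measure (interval_measure f) B \<le> l"
      and me: "emeasure (interval_measure f) B = ennreal (measure (interval_measure f) B)"
      and mc: "emeasure (interval_measure f) (UNIV - B) = ennreal (l - measure (interval_measure f) B)"
      if "emeasure (interval_measure f) UNIV = ennreal l" "0 \<le> l" for f l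
    proof -
      interpret f: finite_measure "interval_measure f"
        by (rule finite_measureI) (simp add: that)
      have U: "measure (interval_measure f) UNIV = l" using that by (simp add: measure_def)
      show "measure (interval_measure f) B \<le> l" using f.bounded_measure[of B] U by simp
      show "emeasure (interval_measure f) B = ennreal (measure (interval_measure f) B)"
        by (rule f.emeasure_eq_measure)
      show "emeasure (interval_measure f) (UNIV - B) = ennreal (l - measure (interval_measure f) B)"
        using f.finite_measure_compl[of B] B U by (simp add: f.emeasure_eq_measure)
    qed
    note f = mle[OF UF le_top[OF F(1,3,4)]] me[OF UF le_top[OF F(1,3,4)]] mc[OF UF le_top[OF F(1,3,4)]]
    note g = mle[OF UG le_top[OF G(1,3,4)]] me[OF UG le_top[OF G(1,3,4)]] mc[OF UG le_top[OF G(1,3,4)]]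
    note h = mle[OF UH le_top[OF H(1,3,4)]] me[OF UH le_top[OF H(1,3,4)]] mc[OF UH le_top[OF H(1,3,4)]]
    let ?F = "measure (interval_measure F) B" and ?G = "measure (interval_measure G) B" and ?H = "measure (interval_measure H) B"
    have "ennreal ?G = ennreal ?F + ennreal ?H"
      using IH by (simp only: f(2) g(2) h(2))
    also have "\<dots> = ennreal (?F + ?H)" by simp
    finally have "?G = ?F + ?H" by (subst (asm) ennreal_inj) auto
    then have "k - ?G = (m - ?F) + (k - m - ?H)" by simp
    moreover have "ennreal ((m - ?F) + (k - m - ?H)) = ennreal (m - ?F) + ennreal (k - m - ?H)"
      using f(1) h(1) by (intro ennreal_plus) auto
    ultimately show "emeasure (interval_measure G) (UNIV - B) = emeasure (interval_measure F) (UNIV - B) + emeasure (interval_measure H) (UNIV - B)"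
      by (simp only: f(3) g(3) h(3))
  next
    fix B :: "nat \<Rightarrow> real set"
    assume B: "disjoint_family B" "range B \<subseteq> sigma_sets UNIV (range (\<lambda>a. {..a::real}))"
      and IH: "\<And>i. emeasure (interval_measure G) (B i) = emeasure (interval_measure F) (B i) + emeasure (interval_measure H) (B i)"
    have Bs: "range B \<subseteq> sets borel" using B(2) by (subst borel_eq_atMost) simp
    then show "emeasure (interval_measure G) (\<Union> (range B)) = emeasure (interval_measure F) (\<Union> (range B)) + emeasure (interval_measure H) (\<Union> (range B))"
      using B(1) by (simp add: suminf_emeasure[symmetric] IH suminf_add[symmetric] summableI)
  qed auto
  then show ?thesis by simp
qed

lemma diagonal_subsequence:
  fixes f :: "nat \<Rightarrow> 'i :: countable \<Rightarrow> real"
  assumes bdd: "\<And>k i. \<bar>f k i\<bar> \<le> C"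
  shows "\<exists>r. strict_mono r \<and> (\<forall>i. convergent (\<lambda>k. f (r k) i))"
proof -
  let ?P = "\<lambda>n s. convergent (\<lambda>k. f (s k) (from_nat n))"
  interpret subseqs ?P
  proof
    fix n and s :: "nat \<Rightarrow> nat" assume "strict_mono s"
    have "f (s k) (from_nat n) \<in> {-C..C}" for k
      using bdd[of "s k" "from_nat n"] by (simp add: abs_le_iff)
    then have "\<exists>l s'. strict_mono s' \<and> ((\<lambda>k. f (s k) (from_nat n)) \<circ> s') \<longlonglongrightarrow> l"
      using compact_Icc compact_imp_seq_compact seq_compactE by metis
    then show "\<exists>s'. strict_mono s' \<and> ?P n (s \<circ> s')" by (auto simp: comp_def convergent_def)
  qed
  have conv: "?P n diagseq" for n
  proof -
    have "?P n (seqseq (Suc n))" by (rule seqseq_holds)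
    moreover have "(\<lambda>k. f ((seqseq (Suc n) \<circ> (\<lambda>k. fold_reduce (Suc n) k (Suc n + k))) k) (from_nat n)) =
        (\<lambda>k. f (seqseq (Suc n) k) (from_nat n)) \<circ> (\<lambda>k. fold_reduce (Suc n) k (Suc n + k))"
      by auto
    \<comment> \<open>From index \<open>Suc n\<close> on, the diagonal sequence is a subsequence of
      \<open>seqseq (Suc n)\<close>; the shift does not affect convergence.\<close>
    ultimately have "?P n (diagseq \<circ> ((+) (Suc n)))"
      unfolding diagseq_seqseq by (simp only: convergent_subseq_convergent subseq_diagonal_rest)
    then obtain L where "(\<lambda>k. f (diagseq (k + Suc n)) (from_nat n)) \<longlonglongrightarrow> L"
      by (auto simp: add.commute dest: convergentD)
    then have "(\<lambda>k. f (diagseq k) (from_nat n)) \<longlonglongrightarrow> L" by (rule LIMSEQ_offset)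
    then show ?thesis by (auto simp: convergent_def)
  qed
  have "convergent (\<lambda>k. f (diagseq k) i)" for i
    using conv[of "to_nat i"] by simp
  then show ?thesis using subseq_diagseq by blast
qed

section \<open>Rational half-lines and joint distribution functions\<close>

lemma pi_generator_cong:
  assumes "sets M = sets N" "pi_generator N E" shows "pi_generator M E"
  using assms sets_eq_imp_space_eq[OF assms(1)] by (simp add: pi_generator_def)

definition rat_half_lines :: "real set set" where
  "rat_half_lines = range (\<lambda>q. {..of_rat q})"

lemma rat_half_line_Int:
  "{..real_of_rat q} \<inter> {..real_of_rat q'} = {..real_of_rat (min q q')}"
  by (auto simp: min_def of_rat_less_eq)

lemma pi_generator_rat_half_lines:
  assumes "sets M = sets borel"
  shows "pi_generator M rat_half_lines"
proof (rule pi_generator_cong[OF assms])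
  have "(\<Union>i::nat. {..real_of_rat (of_nat i)}) = UNIV"
    by (auto simp: real_arch_simple)
  moreover have "range (\<lambda>i::nat. {..real_of_rat (of_nat i)}) \<subseteq> rat_half_lines"
    unfolding rat_half_lines_def by blast
  moreover have "incseq (\<lambda>i::nat. {..real_of_rat (of_nat i)})" by (auto simp: incseq_def)
  ultimately have "\<exists>A :: nat \<Rightarrow> real set. range A \<subseteq> rat_half_lines \<and> incseq A \<and> \<Union> (range A) = UNIV" by blast
  moreover have "Int_stable rat_half_lines"
    unfolding rat_half_lines_def
  proof (rule Int_stableI)
    fix a b assume "a \<in> range (\<lambda>q. {..real_of_rat q})" "b \<in> range (\<lambda>q. {..real_of_rat q})"
    then obtain q q' where "a = {..real_of_rat q}" "b = {..real_of_rat q'}" by blast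
    then show "a \<inter> b \<in> range (\<lambda>q. {..real_of_rat q})" using rat_half_line_Int by blast
  qed
  ultimately show "pi_generator borel rat_half_lines"
    unfolding pi_generator_def using borel_eq_rat_atMost by (simp add: rat_half_lines_def)
qed

lemma measure_rat_half_lines_eqI:
  assumes M: "prob_space M" "sets M = sets borel" and N: "sets N = sets borel"
    and eq: "\<And>q. emeasure M {..real_of_rat q} = emeasure N {..real_of_rat q}"
  shows "M = N"
proof -
  interpret prob_space M by fact
  from pi_generator_rat_half_lines[OF M(2)] obtain A :: "nat \<Rightarrow> real set"
    where A: "range A \<subseteq> rat_half_lines" "\<Union> (range A) = space M" and I: "Int_stable rat_half_lines"
      and s: "sets M = sigma_sets (space M) rat_half_lines" "rat_half_lines \<subseteq> Pow (space M)"
    by (auto simp: pi_generator_def)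
  show ?thesis
  proof (rule measure_eqI_generator_eq[OF I s(2) _ _ _ A])
    show "sets M = sigma_sets (space M) rat_half_lines" by (rule s(1))
    show "sets N = sigma_sets (space M) rat_half_lines" using s(1) M N by simp
    show "emeasure M X = emeasure N X" if "X \<in> rat_half_lines" for X
      using that eq by (auto simp: rat_half_lines_def)
  qed simp
qed

text \<open>A rational strictly above \<open>s\<close> and within distance 2^-n, chosen
  monotonically in \<open>s\<close>. Limits along it are right limits, and inequalities between
  values at two points pass to them.\<close>

definition dyadic_above :: "nat \<Rightarrow> real \<Rightarrow> rat" where
  "dyadic_above n s = (of_int \<lfloor>2 ^ n * s\<rfloor> + 1) / 2 ^ n"

lemma of_rat_dyadic_above: "real_of_rat (dyadic_above n s) = (of_int \<lfloor>2 ^ n * s\<rfloor> + 1) / 2 ^ n"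
  by (simp add: dyadic_above_def of_rat_divide of_rat_add of_rat_power)

lemma dyadic_above_mono: "s \<le> t \<Longrightarrow> dyadic_above n s \<le> dyadic_above n t"
  unfolding dyadic_above_def by (intro divide_right_mono add_right_mono) (auto intro!: floor_mono)

lemma dyadic_above_bounds:
  "s < real_of_rat (dyadic_above n s)" "real_of_rat (dyadic_above n s) \<le> s + (1/2) ^ n"
proof -
  have "2 ^ n * s < of_int \<lfloor>2 ^ n * s\<rfloor> + 1" "of_int \<lfloor>2 ^ n * s\<rfloor> \<le> 2 ^ n * s" by linarith+
  then show "s < real_of_rat (dyadic_above n s)" "real_of_rat (dyadic_above n s) \<le> s + (1/2) ^ n"
    by (auto simp: of_rat_dyadic_above field_simps)
qed

lemma dyadic_above_at_right: "filterlim (\<lambda>n. real_of_rat (dyadic_above n s)) (at_right s) sequentially"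
proof (rule tendsto_imp_filterlim_at_right)
  have "(\<lambda>n. s + (1/2) ^ n) \<longlonglongrightarrow> s + 0" by (intro tendsto_intros LIMSEQ_power_zero) simp
  then have lim: "(\<lambda>n. s + (1/2) ^ n) \<longlonglongrightarrow> s" by simp
  have 1: "\<forall>\<^sub>F n in sequentially. s \<le> real_of_rat (dyadic_above n s)"
    by (rule always_eventually, rule allI, rule less_imp_le, rule dyadic_above_bounds)
  have 2: "\<forall>\<^sub>F n in sequentially. real_of_rat (dyadic_above n s) \<le> s + (1/2) ^ n"
    by (rule always_eventually, rule allI, rule dyadic_above_bounds)
  show "(\<lambda>n. real_of_rat (dyadic_above n s)) \<longlonglongrightarrow> s"
    by (rule tendsto_sandwich[OF 1 2 tendsto_const lim])
  show "\<forall>\<^sub>F n in sequentially. s < real_of_rat (dyadic_above n s)"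
    by (rule always_eventually, rule allI, rule dyadic_above_bounds)
qed

text \<open>As \<open>H\<close> will be a limit along a subsequence, right-continuity has to be
  recovered. In \<open>s\<close> it follows because the increments are dominated by those of
  \<open>cdf M1\<close>; in \<open>q\<close> it is required by \<open>conditional_quantile\<close>
  only for total masses, which are values of \<open>cdf M2\<close>. The assumption
  \<open>two\<close> says that rectangles have nonnegative mass, and \<open>top\<close> that cutting
  the first coordinate at \<open>s\<close> loses at most the mass of \<open>M1\<close> beyond
  \<open>s\<close>.\<close>

lemma coupling_of_joint_cdf:
  fixes H :: "rat \<Rightarrow> rat \<Rightarrow> real"
  assumes M1: "prob_space M1" "sets M1 = sets borel" and M2: "prob_space M2" "sets M2 = sets borel"
    and inc: "\<And>s s' q. s \<le> s' \<Longrightarrow> 0 \<le> H s' q - H s q" "\<And>s s' q. s \<le> s' \<Longrightarrow> H s' q - H s q \<le> cdf M1 (of_rat s') - cdf M1 (of_rat s)"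
    and bnd: "\<And>s q. 0 \<le> H s q" "\<And>s q. H s q \<le> cdf M1 (of_rat s)" "\<And>s q. H s q \<le> cdf M2 (of_rat q)"
    and two: "\<And>s s' q q'. s \<le> s' \<Longrightarrow> q \<le> q' \<Longrightarrow> H s' q - H s q \<le> H s' q' - H s q'"
    and top: "\<And>s q. cdf M2 (of_rat q) - H s q \<le> 1 - cdf M1 (of_rat s)"
  shows "\<exists>\<psi>\<in>borel_measurable (M1 \<Otimes>\<^sub>M unit_interval). distr (M1 \<Otimes>\<^sub>M unit_interval) borel \<psi> = M2 \<and>
    (\<forall>s q. emeasure (M1 \<Otimes>\<^sub>M unit_interval)
      {z \<in> space (M1 \<Otimes>\<^sub>M unit_interval). fst z \<le> of_rat s \<and> \<psi> z \<le> of_rat q} = ennreal (H s q))"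
proof -
  interpret M1: real_distribution M1 using M1 by (simp add: real_distribution_def real_distribution_axioms_def)
  interpret M2: real_distribution M2 using M2 by (simp add: real_distribution_def real_distribution_axioms_def)
  interpret U: prob_space unit_interval by (rule prob_space_unit_interval)
  interpret MU: pair_prob_space M1 unit_interval ..
  let ?F = "cdf M1" and ?a = "dyadic_above"
  have Fa: "(\<lambda>n. ?F (of_rat (?a n s))) \<longlonglongrightarrow> ?F s" for s
    using M1.cdf_is_right_cont[of s] unfolding continuous_within
    by (rule filterlim_compose[OF _ dyadic_above_at_right])
  have dist_le: "\<bar>H t q - H s q\<bar> \<le> \<bar>?F (of_rat t) - ?F (of_rat s)\<bar>" for s t q
    using inc[of s t q] inc[of t s q] by (cases "s \<le> t") auto
  have conv: "convergent (\<lambda>n. H (?a n s) q)" for s q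
  proof (rule Cauchy_convergent, rule CauchyI)
    fix e :: real assume "0 < e"
    have "Cauchy (\<lambda>n. ?F (of_rat (?a n s)))" using Fa by (rule LIMSEQ_imp_Cauchy)
    from CauchyD[OF this \<open>0 < e\<close>] obtain N
      where N: "\<forall>m\<ge>N. \<forall>n\<ge>N. \<bar>?F (of_rat (?a m s)) - ?F (of_rat (?a n s))\<bar> < e" by auto
    then show "\<exists>N. \<forall>m\<ge>N. \<forall>n\<ge>N. norm (H (?a m s) q - H (?a n s) q) < e"
    proof (intro exI allI impI)
      fix m n assume "N \<le> m" "N \<le> n"
      then have "\<bar>?F (of_rat (?a m s)) - ?F (of_rat (?a n s))\<bar> < e"
        using N by blast
      with dist_le[of "?a m s" q "?a n s"] show "norm (H (?a m s) q - H (?a n s) q) < e"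
        unfolding real_norm_def by (rule le_less_trans)
    qed
  qed
  \<comment> \<open>For fixed \<open>q\<close> this extends \<open>H\<close> in its first argument
    to all reals by right limits.\<close>
  define G where "G q s = lim (\<lambda>n. H (?a n s) q)" for q s
  have G: "(\<lambda>n. H (?a n s) q) \<longlonglongrightarrow> G q s" for q s
    using conv unfolding G_def by (simp add: convergent_LIMSEQ_iff)
  have Gmono: "G q s \<le> G q t" if "s \<le> t" for q s t
    by (rule LIMSEQ_le[OF G G]) (use inc(1) dyadic_above_mono[OF that] in \<open>auto intro!: exI[of _ 0]\<close>)
  have GF: "G q t - G q s \<le> ?F t - ?F s" if "s \<le> t" for q s t
    by (rule LIMSEQ_le[OF tendsto_diff[OF G G] tendsto_diff[OF Fa Fa]])
       (use inc(2) dyadic_above_mono[OF that] in \<open>auto intro!: exI[of _ 0]\<close>)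
  have Gq: "G q t - G q s \<le> G r t - G r s" if "s \<le> t" "q \<le> r" for q r s t
    by (rule LIMSEQ_le[OF tendsto_diff[OF G G] tendsto_diff[OF G G]])
       (use two[OF dyadic_above_mono[OF that(1)] that(2)] in \<open>auto intro!: exI[of _ 0]\<close>)
  have G0: "0 \<le> G q s" for q s
    by (rule tendsto_lowerbound[OF G]) (auto intro!: always_eventually bnd)
  have GleF: "G q s \<le> ?F s" for q s
    by (rule LIMSEQ_le[OF G Fa]) (use bnd in auto)
  have GleF2: "G q s \<le> cdf M2 (of_rat q)" for q s
    by (rule tendsto_upperbound[OF G]) (auto intro!: always_eventually bnd)
  have Gtop: "cdf M2 (of_rat q) - G q s \<le> 1 - ?F s" for q s
    by (rule LIMSEQ_le[OF tendsto_diff[OF tendsto_const G] tendsto_diff[OF tendsto_const Fa]]) (use top in auto)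
  \<comment> \<open>The right limit does not change the value at rational points, because
    \<open>cdf M1\<close> dominates the increments and is right-continuous.\<close>
  have Grat: "G q (of_rat s) = H s q" for q s
  proof -
    have "(\<lambda>n. \<bar>H (?a n (of_rat s)) q - H s q\<bar>) \<longlonglongrightarrow> 0"
    proof (rule tendsto_sandwich[of "\<lambda>_. 0"])
      show "(\<lambda>n. \<bar>?F (of_rat (?a n (of_rat s))) - ?F (of_rat s)\<bar>) \<longlonglongrightarrow> 0"
        using tendsto_diff[OF Fa tendsto_const, of "of_rat s" "?F (of_rat s)"] by (simp add: tendsto_rabs_zero)
    qed (auto intro!: always_eventually dist_le)
    moreover have "(\<lambda>n. \<bar>H (?a n (of_rat s)) q - H s q\<bar>) \<longlonglongrightarrow> \<bar>G q (of_rat s) - H s q\<bar>"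
      by (intro tendsto_intros G)
    ultimately have "\<bar>G q (of_rat s) - H s q\<bar> = 0" by (metis LIMSEQ_unique)
    then show ?thesis by simp
  qed
  have Gbot: "(G q \<longlongrightarrow> 0) at_bot" for q
    by (rule tendsto_sandwich[OF _ _ tendsto_const M1.cdf_lim_at_bot]) (auto intro!: always_eventually G0 GleF)
  \<comment> \<open>The total mass of \<open>G q\<close>. Domination from below is the assumption
    \<open>top\<close>, since \<open>?F s\<close> tends to 1.\<close>
  have Glim: "(G q \<longlongrightarrow> cdf M2 (of_rat q)) at_top" for q
  proof (rule tendsto_sandwich[OF _ _ _ tendsto_const])
    have "((\<lambda>s. cdf M2 (of_rat q) - (1 - ?F s)) \<longlongrightarrow> cdf M2 (of_rat q) - (1 - 1)) at_top"
      by (intro tendsto_intros M1.cdf_lim_at_top_prob)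
    then show "((\<lambda>s. cdf M2 (of_rat q) - (1 - ?F s)) \<longlongrightarrow> cdf M2 (of_rat q)) at_top" by simp
    show "\<forall>\<^sub>F s in at_top. cdf M2 (of_rat q) - (1 - ?F s) \<le> G q s"
      using Gtop[of q] by (intro always_eventually) (auto simp: algebra_simps)
  qed (auto intro!: always_eventually GleF2)
  have Gcont: "continuous (at_right s) (G q)" for q s
    unfolding continuous_within
  proof (rule tendsto_sandwich[of "\<lambda>_. G q s" _ _ "\<lambda>t. G q s + (?F t - ?F s)"])
    have "((\<lambda>t. G q s + (?F t - ?F s)) \<longlongrightarrow> G q s + (?F s - ?F s)) (at_right s)"
      using M1.cdf_is_right_cont[of s] unfolding continuous_within by (intro tendsto_intros)
    then show "((\<lambda>t. G q s + (?F t - ?F s)) \<longlongrightarrow> G q s) (at_right s)" by simp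
    show "\<forall>\<^sub>F t in at_right s. G q s \<le> G q t" "\<forall>\<^sub>F t in at_right s. G q t \<le> G q s + (?F t - ?F s)"
      using Gmono[of s] GF[of s] by (auto simp: eventually_at_right_field algebra_simps intro!: exI[of _ "s + 1"])
  qed simp
  define \<nu> where "\<nu> q = interval_measure (G q)" for q
  have Fcont: "continuous (at_right s) ?F" for s by (rule M1.cdf_is_right_cont)
  have Fmono: "s \<le> t \<Longrightarrow> ?F s \<le> ?F t" for s t by (rule M1.cdf_nondecreasing)
  have M1eq: "interval_measure ?F = M1"
    using Fmono Fcont M1.cdf_lim_at_bot M1.cdf_lim_at_top_prob
    by (intro cdf_unique real_distribution_interval_measure M1.real_distribution_axioms cdf_interval_measure)
  have nuS: "emeasure (\<nu> q) (space M1) = ennreal (cdf M2 (of_rat q))" for q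
    unfolding \<nu>_def M1.space_eq_univ
    by (rule interval_measure_UNIV) (use Gmono Gcont Gbot Glim in \<open>auto simp: cdf_def\<close>)
  have cdf20: "0 \<le> cdf M2 c" for c by (simp add: cdf_def)
  have "\<exists>\<psi>\<in>borel_measurable (M1 \<Otimes>\<^sub>M unit_interval). \<forall>q. \<forall>A\<in>sets M1.
    emeasure (M1 \<Otimes>\<^sub>M unit_interval) {z \<in> space (M1 \<Otimes>\<^sub>M unit_interval). fst z \<in> A \<and> \<psi> z \<le> real_of_rat q} = emeasure (\<nu> q) A"
  proof (rule conditional_quantile[OF M1(1)])
    show "sets (\<nu> q) = sets M1" for q by (simp add: \<nu>_def)
    show "emeasure (\<nu> q) A \<le> emeasure (\<nu> r) A" if "q \<le> r" "A \<in> sets M1" for q r A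
      unfolding \<nu>_def
      by (rule interval_measure_mono[of "G q" "cdf M2 (of_rat q)" "G r" "cdf M2 (of_rat r)"])
         (use Gmono Gcont Gbot Glim Gq that in auto)
    show "emeasure (\<nu> q) A \<le> emeasure M1 A" if "A \<in> sets M1" for q A
      unfolding \<nu>_def
      by (subst M1eq[symmetric], rule interval_measure_mono[of "G q" "cdf M2 (of_rat q)" ?F 1])
         (use Gmono Gcont Gbot Glim GF that Fmono Fcont M1.cdf_lim_at_bot M1.cdf_lim_at_top_prob in auto)
    fix e :: real assume e: "0 < e"
    show "\<exists>r>q. emeasure (\<nu> r) (space M1) \<le> emeasure (\<nu> q) (space M1) + ennreal e" for q
    proof -
      have "(cdf M2 \<longlongrightarrow> cdf M2 (of_rat q)) (at_right (of_rat q))"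
        using M2.cdf_is_right_cont[of "of_rat q"] by (simp add: continuous_within)
      then have "eventually (\<lambda>x. cdf M2 x < cdf M2 (of_rat q) + e) (at_right (of_rat q))"
        using e by (intro order_tendstoD(2)) auto
      then obtain b where b: "of_rat q < b" "\<And>x. of_rat q < x \<Longrightarrow> x < b \<Longrightarrow> cdf M2 x < cdf M2 (of_rat q) + e"
        unfolding eventually_at_right_field by auto
      obtain r where r: "real_of_rat q < of_rat r" "of_rat r < b" using of_rat_dense[OF b(1)] by blast
      have "cdf M2 (of_rat r) \<le> cdf M2 (of_rat q) + e" using b(2)[OF r] by simp
      then have "emeasure (\<nu> r) (space M1) \<le> emeasure (\<nu> q) (space M1) + ennreal e"
        unfolding nuS using e cdf20 by (simp add: ennreal_plus[symmetric] ennreal_leI del: ennreal_plus)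
      with r(1) show ?thesis by (auto simp: of_rat_less)
    qed
    show "\<exists>q. emeasure (\<nu> q) (space M1) \<le> ennreal e"
    proof -
      have "eventually (\<lambda>x. cdf M2 x < e) at_bot"
        using M2.cdf_lim_at_bot e by (rule order_tendstoD(2))
      then obtain N where N: "\<And>x. x \<le> N \<Longrightarrow> cdf M2 x < e" unfolding eventually_at_bot_linorder by auto
      obtain q where "real_of_rat q < N" using of_rat_dense[of "N - 1" N] by auto
      then show ?thesis unfolding nuS using N[of "of_rat q"] by (auto intro!: exI[of _ q] ennreal_leI)
    qed
    show "\<exists>q. 1 \<le> emeasure (\<nu> q) (space M1) + ennreal e"
    proof -
      have "eventually (\<lambda>x. 1 - e < cdf M2 x) at_top"
        using M2.cdf_lim_at_top_prob e by (intro order_tendstoD(1)) auto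
      then obtain N where N: "\<And>x. N \<le> x \<Longrightarrow> 1 - e < cdf M2 x" unfolding eventually_at_top_linorder by auto
      obtain q where "N < real_of_rat q" using of_rat_dense[of N "N + 1"] by auto
      then have "1 \<le> cdf M2 (of_rat q) + e" using N[of "of_rat q"] by simp
      then have "1 \<le> emeasure (\<nu> q) (space M1) + ennreal e"
        unfolding nuS using e cdf20 by (simp add: ennreal_plus[symmetric] ennreal_1[symmetric] ennreal_leI del: ennreal_plus ennreal_1)
      then show ?thesis by blast
    qed
  qed
  then obtain \<psi> where \<psi>: "\<psi> \<in> borel_measurable (M1 \<Otimes>\<^sub>M unit_interval)"
    "\<And>q A. A \<in> sets M1 \<Longrightarrow> emeasure (M1 \<Otimes>\<^sub>M unit_interval) {z \<in> space (M1 \<Otimes>\<^sub>M unit_interval). fst z \<in> A \<and> \<psi> z \<le> real_of_rat q} = emeasure (\<nu> q) A"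
    by blast
  have 1: "emeasure (M1 \<Otimes>\<^sub>M unit_interval) {z \<in> space (M1 \<Otimes>\<^sub>M unit_interval). fst z \<le> of_rat s \<and> \<psi> z \<le> of_rat q} = ennreal (H s q)" for s q
    using \<psi>(2)[of "{..of_rat s}" q] emeasure_interval_measure_Iic[of "G q" "of_rat s", OF Gmono Gcont Gbot]
    by (simp add: \<nu>_def Grat)
  have "distr (M1 \<Otimes>\<^sub>M unit_interval) borel \<psi> = M2"
  proof (rule measure_rat_half_lines_eqI)
    show "prob_space (distr (M1 \<Otimes>\<^sub>M unit_interval) borel \<psi>)" by (rule MU.prob_space_distr[OF \<psi>(1)])
    fix q
    have "emeasure (distr (M1 \<Otimes>\<^sub>M unit_interval) borel \<psi>) {..real_of_rat q} =
      emeasure (M1 \<Otimes>\<^sub>M unit_interval) {z \<in> space (M1 \<Otimes>\<^sub>M unit_interval). fst z \<in> space M1 \<and> \<psi> z \<le> real_of_rat q}"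
      using \<psi>(1) by (subst emeasure_distr) (auto simp: space_pair_measure intro!: arg_cong[where f="emeasure _"])
    also have "\<dots> = ennreal (cdf M2 (of_rat q))" by (simp only: \<psi>(2)[OF sets.top] nuS)
    finally show "emeasure (distr (M1 \<Otimes>\<^sub>M unit_interval) borel \<psi>) {..real_of_rat q} = emeasure M2 {..real_of_rat q}"
      by (simp add: cdf_def M2.emeasure_eq_measure)
  qed (use M2 in simp_all)
  with \<psi>(1) 1 show ?thesis by blast
qed

section \<open>The coupling obtained from a sequence of samples\<close>

lemma sample_sequence:
  fixes h1 :: "nat \<Rightarrow> 'a \<times> 'a \<Rightarrow> real" and h2 :: "nat \<Rightarrow> 'b \<times> 'b \<Rightarrow> real"
  assumes M: "prob_space M1" "graphon M1 W1" "prob_space M2" "graphon M2 W2"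
    and same: "same_densities M1 W1 M2 W2"
    and h1: "\<And>m. h1 m \<in> borel_measurable (M1 \<Otimes>\<^sub>M M1)" "\<And>m. \<exists>C. \<forall>z\<in>space (M1 \<Otimes>\<^sub>M M1). \<bar>h1 m z\<bar> \<le> C"
    and h2: "\<And>m. h2 m \<in> borel_measurable (M2 \<Otimes>\<^sub>M M2)" "\<And>m. \<exists>C. \<forall>z\<in>space (M2 \<Otimes>\<^sub>M M2). \<bar>h2 m z\<bar> \<le> C"
  shows "\<exists>(n :: nat \<Rightarrow> nat) x y. \<forall>k. k < n k \<and>
    (\<forall>m\<le>k. \<bar>offdiag_sum (n k) (\<lambda>i j. h1 m (x k i, x k j) - (\<integral>z. h1 m z \<partial>(M1 \<Otimes>\<^sub>M M1)))\<bar> \<le> 1 / (real k + 1) * real (n k) ^ 2) \<and>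
    (\<forall>m\<le>k. \<bar>offdiag_sum (n k) (\<lambda>i j. h2 m (y k i, y k j) - (\<integral>z. h2 m z \<partial>(M2 \<Otimes>\<^sub>M M2)))\<bar> \<le> 1 / (real k + 1) * real (n k) ^ 2) \<and>
    (\<forall>a b. (\<forall>i. \<bar>a i\<bar> \<le> 1) \<longrightarrow> (\<forall>i. \<bar>b i\<bar> \<le> 1) \<longrightarrow>
      \<bar>offdiag_sum (n k) (\<lambda>i j. a i * b j * (W1 (x k i) (x k j) - W2 (y k i) (y k j)))\<bar> \<le> 1 / (real k + 1) * real (n k) ^ 2)"
    (is "\<exists>n x y. \<forall>k. ?P k (n k) (x k) (y k)")
proof -
  obtain C1 where C1: "\<And>m z. z \<in> space (M1 \<Otimes>\<^sub>M M1) \<Longrightarrow> \<bar>h1 m z\<bar> \<le> C1 m" using h1(2) by metis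
  obtain C2 where C2: "\<And>m z. z \<in> space (M2 \<Otimes>\<^sub>M M2) \<Longrightarrow> \<bar>h2 m z\<bar> \<le> C2 m" using h2(2) by metis
  have "\<forall>k. \<exists>n x y. ?P k n x y"
  proof
    fix k
    \<comment> \<open>The k-th samples are accurate up to 1/(k + 1) for the first k + 1 test
      functions. Bounds depending on \<open>m\<close> are admissible because only finitely many of
      them enter \<open>?C\<close>.\<close>
    let ?C = "(\<Sum>m\<le>k. \<bar>C1 m\<bar>) + (\<Sum>m\<le>k. \<bar>C2 m\<bar>)"
    have le1: "C1 m \<le> ?C" and le2: "C2 m \<le> ?C" if "m \<le> k" for m
      using member_le_sum[of m "{..k}" "\<lambda>m. \<bar>C1 m\<bar>"] member_le_sum[of m "{..k}" "\<lambda>m. \<bar>C2 m\<bar>"] that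
        sum_nonneg[of "{..k}" "\<lambda>m. \<bar>C1 m\<bar>"] sum_nonneg[of "{..k}" "\<lambda>m. \<bar>C2 m\<bar>"] by auto
    have H1: "\<forall>h\<in>h1 ` {..k}. h \<in> borel_measurable (M1 \<Otimes>\<^sub>M M1) \<and> (\<forall>z\<in>space (M1 \<Otimes>\<^sub>M M1). \<bar>h z\<bar> \<le> ?C)"
      using h1(1) le1 C1 by (fastforce intro: order_trans)
    have H2: "\<forall>h\<in>h2 ` {..k}. h \<in> borel_measurable (M2 \<Otimes>\<^sub>M M2) \<and> (\<forall>z\<in>space (M2 \<Otimes>\<^sub>M M2). \<bar>h z\<bar> \<le> ?C)"
      using h2(1) le2 C2 by (fastforce intro: order_trans)
    have \<delta>: "0 < 1 / (real k + 1)" by simp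
    have "finite (h1 ` {..k})" "finite (h2 ` {..k})" by auto
    from eventually_happens'[OF sequentially_bot eventually_conj[OF eventually_gt_at_top[of k]
      coupled_samples[OF M same this(1) H1 this(2) H2 \<delta>]]]
    obtain n where n: "k < n" "\<exists>x\<in>space (PiM {..<n} (\<lambda>_. M1)). \<exists>y\<in>space (PiM {..<n} (\<lambda>_. M2)).
      (\<forall>h\<in>h1 ` {..k}. \<bar>offdiag_sum n (\<lambda>i j. h (x i, x j) - (\<integral>z. h z \<partial>(M1 \<Otimes>\<^sub>M M1)))\<bar> \<le> 1 / (real k + 1) * real n ^ 2) \<and>
      (\<forall>h\<in>h2 ` {..k}. \<bar>offdiag_sum n (\<lambda>i j. h (y i, y j) - (\<integral>z. h z \<partial>(M2 \<Otimes>\<^sub>M M2)))\<bar> \<le> 1 / (real k + 1) * real n ^ 2) \<and>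
      (\<forall>a b. (\<forall>i. \<bar>a i\<bar> \<le> 1) \<longrightarrow> (\<forall>i. \<bar>b i\<bar> \<le> 1) \<longrightarrow>
        \<bar>offdiag_sum n (\<lambda>i j. a i * b j * (W1 (x i) (x j) - W2 (y i) (y j)))\<bar> \<le> 1 / (real k + 1) * real n ^ 2)"
      by blast
    then obtain x y where
      "(\<forall>h\<in>h1 ` {..k}. \<bar>offdiag_sum n (\<lambda>i j. h (x i, x j) - (\<integral>z. h z \<partial>(M1 \<Otimes>\<^sub>M M1)))\<bar> \<le> 1 / (real k + 1) * real n ^ 2)"
      "(\<forall>h\<in>h2 ` {..k}. \<bar>offdiag_sum n (\<lambda>i j. h (y i, y j) - (\<integral>z. h z \<partial>(M2 \<Otimes>\<^sub>M M2)))\<bar> \<le> 1 / (real k + 1) * real n ^ 2)"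
      "(\<forall>a b. (\<forall>i. \<bar>a i\<bar> \<le> 1) \<longrightarrow> (\<forall>i. \<bar>b i\<bar> \<le> 1) \<longrightarrow>
        \<bar>offdiag_sum n (\<lambda>i j. a i * b j * (W1 (x i) (x j) - W2 (y i) (y j)))\<bar> \<le> 1 / (real k + 1) * real n ^ 2)"
      by blast
    with n(1) show "\<exists>n x y. ?P k n x y"
      by (intro exI[of _ n] exI[of _ x] exI[of _ y]) auto
  qed
  then obtain n where "\<forall>k. \<exists>x y. ?P k (n k) x y" using choice[of "\<lambda>k n. \<exists>x y. ?P k n x y"] by blast
  then obtain x where "\<forall>k. \<exists>y. ?P k (n k) (x k) y" using choice[of "\<lambda>k x. \<exists>y. ?P k (n k) x y"] by blast
  then obtain y where "\<forall>k. ?P k (n k) (x k) (y k)" using choice[of "\<lambda>k y. ?P k (n k) (x k) y"] by blast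
  then show ?thesis by blast
qed

lemma offdiag_sum_diff:
  assumes "\<And>i. i < n \<Longrightarrow> \<bar>f i i\<bar> \<le> C"
  shows "\<bar>(\<Sum>i<n. \<Sum>j<n. f i j) - offdiag_sum n f\<bar> \<le> real n * C"
proof -
  have "(\<Sum>i<n. \<Sum>j<n. f i j) - offdiag_sum n f = (\<Sum>i<n. \<Sum>j<n. if i = j then f i j else 0)"
    unfolding offdiag_sum_def sum_subtractf[symmetric] by (intro sum.cong refl) auto
  also have "\<dots> = (\<Sum>i<n. f i i)" by simp
  also have "\<bar>\<dots>\<bar> \<le> (\<Sum>i<n. \<bar>f i i\<bar>)" by (rule sum_abs)
  also have "\<dots> \<le> (\<Sum>i<n. C)" using assms by (intro sum_mono) auto
  finally show ?thesis by simp
qed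

lemma offdiag_sum_add: "offdiag_sum n (\<lambda>i j. f i j + g i j) = offdiag_sum n f + offdiag_sum n g"
  unfolding offdiag_sum_def sum.distrib[symmetric] by (intro sum.cong refl) auto

lemma offdiag_sum_abs_le:
  assumes "\<And>i j. \<bar>f i j\<bar> \<le> g i j"
  shows "\<bar>offdiag_sum n f\<bar> \<le> offdiag_sum n g"
proof -
  have "\<bar>offdiag_sum n f\<bar> \<le> (\<Sum>i<n. \<Sum>j<n. \<bar>if i \<noteq> j then f i j else 0\<bar>)"
    unfolding offdiag_sum_def by (rule order_trans[OF sum_abs]) (intro sum_mono sum_abs)
  also have "\<dots> \<le> offdiag_sum n g"
    unfolding offdiag_sum_def using assms by (intro sum_mono) auto
  finally show ?thesis .
qed

lemma offdiag_sum_const_le: "0 \<le> c \<Longrightarrow> offdiag_sum n (\<lambda>_ _. c) \<le> real n ^ 2 * c"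
proof -
  assume "0 \<le> c"
  then have "offdiag_sum n (\<lambda>_ _. c) \<le> (\<Sum>i<n. \<Sum>j<n. c)"
    unfolding offdiag_sum_def by (intro sum_mono) auto
  then show ?thesis by (simp add: power2_eq_square)
qed

text \<open>A test function of the first vertex alone turns the double sum into n times a simple
  one. The total error 2/(k + 1) consists of the tolerance of the samples and of the diagonal, which
  is n terms out of n^2, with n > k.\<close>

lemma frequency_tendsto:
  fixes b :: "nat \<Rightarrow> nat \<Rightarrow> real"
  assumes n: "\<And>k. k < n k" and b: "\<And>k i. 0 \<le> b k i \<and> b k i \<le> 1" and F: "0 \<le> F" "F \<le> 1"
    and le: "\<And>k. k0 \<le> k \<Longrightarrow> \<bar>offdiag_sum (n k) (\<lambda>i j. b k i - F)\<bar> \<le> 1 / (real k + 1) * real (n k) ^ 2"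
  shows "(\<lambda>k. (\<Sum>i<n k. b k i) / real (n k)) \<longlonglongrightarrow> F"
proof -
  have *: "\<bar>(\<Sum>i<n k. b k i) / real (n k) - F\<bar> \<le> 2 / (real k + 1)" if k: "k0 \<le> k" for k
  proof -
    let ?N = "real (n k)"
    have N: "real k + 1 \<le> ?N" using n[of k] by simp
    then have N0: "?N > 0" by linarith
    have "\<bar>b k i - F\<bar> \<le> 1" for i using b[of k i] F by (auto simp: abs_le_iff)
    then have "\<bar>(\<Sum>i<n k. \<Sum>j<n k. b k i - F) - offdiag_sum (n k) (\<lambda>i j. b k i - F)\<bar> \<le> ?N * 1"
      by (intro offdiag_sum_diff) auto
    then have "\<bar>\<Sum>i<n k. \<Sum>j<n k. b k i - F\<bar> \<le> ?N + 1 / (real k + 1) * ?N ^ 2" using le[OF k] by linarith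
    also have "(\<Sum>i<n k. \<Sum>j<n k. b k i - F) = ?N ^ 2 * ((\<Sum>i<n k. b k i) / ?N - F)"
      using N0 by (simp add: sum_subtractf sum_distrib_left[symmetric] power2_eq_square field_simps)
    also have "\<bar>?N ^ 2 * ((\<Sum>i<n k. b k i) / ?N - F)\<bar> = ?N ^ 2 * \<bar>(\<Sum>i<n k. b k i) / ?N - F\<bar>"
      by (simp add: abs_mult)
    also have "?N + c * ?N ^ 2 = ?N ^ 2 * (1 / ?N + c)" for c
      using N0 by (simp add: power2_eq_square algebra_simps)
    finally have "\<bar>(\<Sum>i<n k. b k i) / ?N - F\<bar> \<le> 1 / ?N + 1 / (real k + 1)"
      using N0 by (subst (asm) mult_le_cancel_left_pos) auto
    also have "1 / ?N \<le> 1 / (real k + 1)" using N by (intro divide_left_mono) auto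
    finally show ?thesis by simp
  qed
  show ?thesis
  proof (rule LIM_zero_cancel, rule tendsto_rabs_zero_cancel, rule tendsto_sandwich[of "\<lambda>_. 0"])
    show "(\<lambda>k. 2 / (real k + 1)) \<longlonglongrightarrow> 0" by real_asymp
    show "\<forall>\<^sub>F k in sequentially. \<bar>(\<Sum>i<n k. b k i) / real (n k) - F\<bar> \<le> 2 / (real k + 1)"
      using eventually_ge_at_top[of k0] by eventually_elim (rule *)
  qed auto
qed

lemma pi_generator_subset: "pi_generator M E \<Longrightarrow> E \<subseteq> sets M"
  by (simp add: pi_generator_def subset_iff)

text \<open>The integral of f^2 equals that of (f - g) f for every step function \<open>g\<close>,
  by orthogonality. Taking \<open>g\<close> close to \<open>f\<close> itself in L1 makes it
  arbitrarily small.\<close>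

lemma (in prob_space) AE_eq_0_of_orthogonal:
  fixes f :: "'a \<Rightarrow> real"
  assumes gen: "pi_generator M E" and f: "f \<in> borel_measurable M" "\<And>z. \<bar>f z\<bar> \<le> 1"
    and orth: "\<And>A. A \<in> E \<Longrightarrow> (\<integral>z. indicator A z * f z \<partial>M) = 0"
  shows "AE z in M. f z = 0"
proof -
  have E: "E \<subseteq> sets M" using gen by (rule pi_generator_subset)
  have fi: "integrable M f" by (rule integrable_bounded[OF f])
  have step0: "(\<integral>z. g z * f z \<partial>M) = 0 \<and> integrable M (\<lambda>z. g z * f z)" if "g \<in> step_functions E" for g
    using that
  proof induction
    case (add A g c)
    then have "A \<in> sets M" using E by blast
    then have "integrable M (\<lambda>z. indicator A z * f z)"
      using integrable_mult_indicator[OF _ fi] by simp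
    then show ?case using add.IH orth[OF add.hyps(1)] by (simp add: distrib_right mult.assoc)
  qed simp
  have "\<bar>f z * f z\<bar> \<le> 1" for z
    unfolding abs_mult using f(2)[of z] by (intro mult_le_one) auto
  then have ff: "integrable M (\<lambda>z. f z * f z)"
    by (intro integrable_bounded[where C=1] borel_measurable_times f(1))
  have "(\<integral>z. f z * f z \<partial>M) \<le> 0"
  proof (rule field_le_epsilon)
    fix e :: real assume "0 < e"
    then obtain g where g: "g \<in> step_functions E" "(\<integral>z. \<bar>f z - g z\<bar> \<partial>M) \<le> e"
      using step_functions_approx[OF gen fi] by blast
    obtain C where C: "\<And>z. \<bar>g z\<bar> \<le> C" using step_functions_bounded[OF g(1)] by blast
    have gi: "integrable M g"
      by (rule integrable_bounded[OF step_functions_measurable[OF g(1) E] C])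
    have "(\<integral>z. f z * f z \<partial>M) = (\<integral>z. f z * f z - g z * f z \<partial>M)"
      using step0[OF g(1)] ff by (subst Bochner_Integration.integral_diff) auto
    also have "\<dots> \<le> (\<integral>z. \<bar>f z - g z\<bar> \<partial>M)"
    proof (rule integral_mono)
      fix z
      have "f z * f z - g z * f z \<le> \<bar>(f z - g z) * f z\<bar>" by (simp add: left_diff_distrib)
      also have "\<dots> \<le> \<bar>f z - g z\<bar> * 1" unfolding abs_mult using f(2)[of z] by (intro mult_left_mono) auto
      finally show "f z * f z - g z * f z \<le> \<bar>f z - g z\<bar>" by simp
    qed (use ff step0[OF g(1)] fi gi in auto)
    finally show "(\<integral>z. f z * f z \<partial>M) \<le> 0 + e" using g(2) by simp
  qed
  moreover have "0 \<le> (\<integral>z. f z * f z \<partial>M)" by simp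
  ultimately have "(\<integral>z. f z * f z \<partial>M) = 0" by linarith
  with ff have "AE z in M. f z * f z = 0"
    by (subst (asm) integral_nonneg_eq_0_iff_AE) auto
  then show ?thesis by simp
qed

text \<open>Cutting a quadrant by a half-line in either coordinate gives a quadrant again. Hence
  products of quadrant indicators with step functions of one coordinate remain in the linear span of
  quadrant indicators.\<close>

lemma Int_rat_quadrant:
  "indicator ({..real_of_rat s} \<times> {..real_of_rat q}) w * indicator {..real_of_rat r} (fst w) =
    (indicator ({..real_of_rat (min s r)} \<times> {..real_of_rat q}) w :: real)"
  "indicator ({..real_of_rat s} \<times> {..real_of_rat q}) w * indicator {..real_of_rat r} (snd w) =
    (indicator ({..real_of_rat s} \<times> {..real_of_rat (min q r)}) w :: real)"
proof -
  have "{..real_of_rat s} \<times> {..real_of_rat q} \<inter> fst -` {..real_of_rat r} = {..real_of_rat (min s r)} \<times> {..real_of_rat q}"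
    "{..real_of_rat s} \<times> {..real_of_rat q} \<inter> snd -` {..real_of_rat r} = {..real_of_rat s} \<times> {..real_of_rat (min q r)}"
    unfolding rat_half_line_Int[symmetric] by auto
  then show "indicator ({..real_of_rat s} \<times> {..real_of_rat q}) w * indicator {..real_of_rat r} (fst w) =
    (indicator ({..real_of_rat (min s r)} \<times> {..real_of_rat q}) w :: real)"
    "indicator ({..real_of_rat s} \<times> {..real_of_rat q}) w * indicator {..real_of_rat r} (snd w) =
    (indicator ({..real_of_rat s} \<times> {..real_of_rat (min q r)}) w :: real)"
    by (metis indicator_inter_arith indicator_vimage)+
qed

text \<open>With P the law of (x, \<psi> (x, t)), it is enough that W1 - W2 is orthogonal to
  products of two rational quadrants under two independent copies of P. Along the samples this
  orthogonality is the closeness in cut norm. It passes to the limit after W1 and W2 have been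
  replaced by step functions.\<close>

theorem real_graphon_coupling:
  fixes M1 M2 :: "real measure"
  assumes M: "prob_space M1" "graphon M1 W1" "prob_space M2" "graphon M2 W2"
    and s1: "sets M1 = sets borel" and s2: "sets M2 = sets borel"
    and same: "same_densities M1 W1 M2 W2"
  shows "\<exists>\<psi>\<in>borel_measurable (M1 \<Otimes>\<^sub>M unit_interval). distr (M1 \<Otimes>\<^sub>M unit_interval) borel \<psi> = M2 \<and>
    (AE p in (M1 \<Otimes>\<^sub>M unit_interval) \<Otimes>\<^sub>M (M1 \<Otimes>\<^sub>M unit_interval).
      W1 (fst (fst p)) (fst (snd p)) = W2 (\<psi> (fst p)) (\<psi> (snd p)))"
proof -
  interpret M1: real_distribution M1 using M(1) s1 by (simp add: real_distribution_def real_distribution_axioms_def)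
  interpret M2: real_distribution M2 using M(3) s2 by (simp add: real_distribution_def real_distribution_axioms_def)
  interpret MM1: pair_prob_space M1 M1 ..
  interpret MM2: pair_prob_space M2 M2 ..
  interpret U: prob_space unit_interval by (rule prob_space_unit_interval)
  interpret MU: pair_prob_space M1 unit_interval ..
  let ?E = "rat_half_lines" and ?EE = "{a \<times> b | a b. a \<in> rat_half_lines \<and> b \<in> rat_half_lines}"
  have gen1: "pi_generator (M1 \<Otimes>\<^sub>M M1) ?EE" and gen2: "pi_generator (M2 \<Otimes>\<^sub>M M2) ?EE"
    by (intro pi_generator_pair pi_generator_rat_half_lines s1 s2)+
  have W1m: "(\<lambda>z. W1 (fst z) (snd z)) \<in> borel_measurable (M1 \<Otimes>\<^sub>M M1)"
    by (intro graphon_measurable[OF M(2)]) auto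
  have W2m: "(\<lambda>z. W2 (fst z) (snd z)) \<in> borel_measurable (M2 \<Otimes>\<^sub>M M2)"
    by (intro graphon_measurable[OF M(4)]) auto
  have W1b: "\<bar>W1 a b\<bar> \<le> 1" for a b using graphon_bounds(3)[OF M(2)] by (simp add: M1.space_eq_univ)
  have W2b: "\<bar>W2 a b\<bar> \<le> 1" for a b using graphon_bounds(3)[OF M(4)] by (simp add: M2.space_eq_univ)
  have W1i: "integrable (M1 \<Otimes>\<^sub>M M1) (\<lambda>z. W1 (fst z) (snd z))"
    by (rule MM1.integrable_bounded[OF W1m W1b])
  have W2i: "integrable (M2 \<Otimes>\<^sub>M M2) (\<lambda>z. W2 (fst z) (snd z))"
    by (rule MM2.integrable_bounded[OF W2m W2b])
  have "\<forall>m. \<exists>g. g \<in> step_functions ?EE \<and> (\<integral>z. \<bar>W1 (fst z) (snd z) - g z\<bar> \<partial>(M1 \<Otimes>\<^sub>M M1)) \<le> 1 / (real m + 1)"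
    using MM1.step_functions_approx[OF gen1 W1i] unfolding Bex_def by simp
  from choice[OF this] obtain U1 where U1: "\<And>m. U1 m \<in> step_functions ?EE"
    "\<And>m. (\<integral>z. \<bar>W1 (fst z) (snd z) - U1 m z\<bar> \<partial>(M1 \<Otimes>\<^sub>M M1)) \<le> 1 / (real m + 1)" by blast
  have "\<forall>m. \<exists>g. g \<in> step_functions ?EE \<and> (\<integral>z. \<bar>W2 (fst z) (snd z) - g z\<bar> \<partial>(M2 \<Otimes>\<^sub>M M2)) \<le> 1 / (real m + 1)"
    using MM2.step_functions_approx[OF gen2 W2i] unfolding Bex_def by simp
  from choice[OF this] obtain U2 where U2: "\<And>m. U2 m \<in> step_functions ?EE"
    "\<And>m. (\<integral>z. \<bar>W2 (fst z) (snd z) - U2 m z\<bar> \<partial>(M2 \<Otimes>\<^sub>M M2)) \<le> 1 / (real m + 1)" by blast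
  have EE1: "?EE \<subseteq> sets (M1 \<Otimes>\<^sub>M M1)" and EE2: "?EE \<subseteq> sets (M2 \<Otimes>\<^sub>M M2)"
    by (rule pi_generator_subset[OF gen1], rule pi_generator_subset[OF gen2])
  note U1m = step_functions_measurable[OF U1(1) EE1] and U2m = step_functions_measurable[OF U2(1) EE2]
  have "\<forall>m. \<exists>C. \<forall>z. \<bar>U1 m z\<bar> \<le> C" using step_functions_bounded[OF U1(1)] by blast
  from choice[OF this] obtain B1 where B1: "\<And>m z. \<bar>U1 m z\<bar> \<le> B1 m" by blast
  have "\<forall>m. \<exists>C. \<forall>z. \<bar>U2 m z\<bar> \<le> C" using step_functions_bounded[OF U2(1)] by blast
  from choice[OF this] obtain B2 where B2: "\<And>m z. \<bar>U2 m z\<bar> \<le> B2 m" by blast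
  \<comment> \<open>The even test functions control the marginals at rational points, the odd ones the errors of the
    approximations by step functions.\<close>
  define h1 where "h1 m = (if even m then (\<lambda>z. of_bool (fst z \<le> real_of_rat (from_nat (m div 2))))
    else (\<lambda>z. \<bar>W1 (fst z) (snd z) - U1 (m div 2) z\<bar>))" for m
  define h2 where "h2 m = (if even m then (\<lambda>z. of_bool (fst z \<le> real_of_rat (from_nat (m div 2))))
    else (\<lambda>z. \<bar>W2 (fst z) (snd z) - U2 (m div 2) z\<bar>))" for m
  have h1m: "h1 m \<in> borel_measurable (M1 \<Otimes>\<^sub>M M1)" for m
    unfolding h1_def using W1m U1m[of "m div 2"] s1 by (cases "even m") (simp_all, measurable)
  have h2m: "h2 m \<in> borel_measurable (M2 \<Otimes>\<^sub>M M2)" for m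
    unfolding h2_def using W2m U2m[of "m div 2"] s2 by (cases "even m") (simp_all, measurable)
  have h1b: "\<exists>C. \<forall>z\<in>space (M1 \<Otimes>\<^sub>M M1). \<bar>h1 m z\<bar> \<le> C" for m
  proof (intro exI ballI)
    fix z
    show "\<bar>h1 m z\<bar> \<le> 1 + B1 (m div 2)"
      using W1b[of "fst z" "snd z"] B1[of "m div 2" z] by (auto simp: h1_def)
  qed
  have h2b: "\<exists>C. \<forall>z\<in>space (M2 \<Otimes>\<^sub>M M2). \<bar>h2 m z\<bar> \<le> C" for m
  proof (intro exI ballI)
    fix z
    show "\<bar>h2 m z\<bar> \<le> 1 + B2 (m div 2)"
      using W2b[of "fst z" "snd z"] B2[of "m div 2" z] by (auto simp: h2_def)
  qed
  obtain n :: "nat \<Rightarrow> nat" and x y where samples: "\<And>k. k < n k"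
    "\<And>k m. m \<le> k \<Longrightarrow> \<bar>offdiag_sum (n k) (\<lambda>i j. h1 m (x k i, x k j) - (\<integral>z. h1 m z \<partial>(M1 \<Otimes>\<^sub>M M1)))\<bar> \<le> 1 / (real k + 1) * real (n k) ^ 2"
    "\<And>k m. m \<le> k \<Longrightarrow> \<bar>offdiag_sum (n k) (\<lambda>i j. h2 m (y k i, y k j) - (\<integral>z. h2 m z \<partial>(M2 \<Otimes>\<^sub>M M2)))\<bar> \<le> 1 / (real k + 1) * real (n k) ^ 2"
    "\<And>k a b. (\<forall>i. \<bar>a i\<bar> \<le> 1) \<Longrightarrow> (\<forall>i. \<bar>b i\<bar> \<le> 1) \<Longrightarrow>
      \<bar>offdiag_sum (n k) (\<lambda>i j. a i * b j * (W1 (x k i) (x k j) - W2 (y k i) (y k j)))\<bar> \<le> 1 / (real k + 1) * real (n k) ^ 2"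
    using sample_sequence[where ?h1.0=h1 and ?h2.0=h2, OF M same h1m h1b h2m h2b]
  proof (elim exE)
    fix n :: "nat \<Rightarrow> nat" and x y
    assume *: "\<forall>k. k < n k \<and>
      (\<forall>m\<le>k. \<bar>offdiag_sum (n k) (\<lambda>i j. h1 m (x k i, x k j) - (\<integral>z. h1 m z \<partial>(M1 \<Otimes>\<^sub>M M1)))\<bar> \<le> 1 / (real k + 1) * real (n k) ^ 2) \<and>
      (\<forall>m\<le>k. \<bar>offdiag_sum (n k) (\<lambda>i j. h2 m (y k i, y k j) - (\<integral>z. h2 m z \<partial>(M2 \<Otimes>\<^sub>M M2)))\<bar> \<le> 1 / (real k + 1) * real (n k) ^ 2) \<and>
      (\<forall>a b. (\<forall>i. \<bar>a i\<bar> \<le> 1) \<longrightarrow> (\<forall>i. \<bar>b i\<bar> \<le> 1) \<longrightarrow>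
        \<bar>offdiag_sum (n k) (\<lambda>i j. a i * b j * (W1 (x k i) (x k j) - W2 (y k i) (y k j)))\<bar> \<le> 1 / (real k + 1) * real (n k) ^ 2)"
    note 1 = *[THEN spec, THEN conjunct1] and 2 = *[THEN spec, THEN conjunct2]
    show thesis
      by (rule that[of n x y, OF 1 2[THEN conjunct1, THEN spec, THEN mp] 2[THEN conjunct2, THEN conjunct1, THEN spec, THEN mp]
          2[THEN conjunct2, THEN conjunct2, THEN spec, THEN spec, THEN mp, THEN mp]])
  qed
  have n0: "0 < n k" for k using samples(1)[of k] by simp
  have int_h: "(\<integral>z. of_bool (fst z \<le> c) \<partial>(N \<Otimes>\<^sub>M N)) = cdf N c" if "real_distribution N" for N and c :: real
  proof -
    interpret N: real_distribution N by fact
    interpret NN: pair_prob_space N N ..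
    have "(\<integral>z. of_bool (fst z \<le> c) \<partial>(N \<Otimes>\<^sub>M N)) = (\<integral>z. indicator ({..c} \<times> UNIV) z \<partial>(N \<Otimes>\<^sub>M N))"
      by (rule Bochner_Integration.integral_cong) (auto simp: indicator_def)
    also have "\<dots> = measure (N \<Otimes>\<^sub>M N) ({..c} \<times> UNIV)" by simp
    also have "\<dots> = cdf N c"
      using N.emeasure_space_1 by (simp add: measure_def cdf_def N.emeasure_pair_measure_Times)
    finally show ?thesis .
  qed
  have freq1: "(\<lambda>k. (\<Sum>i<n k. of_bool (x k i \<le> of_rat s)) / real (n k)) \<longlonglongrightarrow> cdf M1 (of_rat s)" for s
  proof (rule frequency_tendsto[of n, OF samples(1)])
    \<comment> \<open>The even index of the test function that belongs to the rational
      \<open>s\<close>; it takes part from this k on.\<close>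
    fix k assume "2 * to_nat s \<le> k"
    from samples(2)[OF this]
    show "\<bar>offdiag_sum (n k) (\<lambda>i j. of_bool (x k i \<le> of_rat s) - cdf M1 (of_rat s))\<bar> \<le> 1 / (real k + 1) * (real (n k))\<^sup>2"
      by (simp add: h1_def int_h[OF M1.real_distribution_axioms])
  qed (auto simp: cdf_def)
  have freq2: "(\<lambda>k. (\<Sum>i<n k. of_bool (y k i \<le> of_rat s)) / real (n k)) \<longlonglongrightarrow> cdf M2 (of_rat s)" for s
  proof (rule frequency_tendsto[of n, OF samples(1)])
    fix k assume "2 * to_nat s \<le> k"
    from samples(3)[OF this]
    show "\<bar>offdiag_sum (n k) (\<lambda>i j. of_bool (y k i \<le> of_rat s) - cdf M2 (of_rat s))\<bar> \<le> 1 / (real k + 1) * (real (n k))\<^sup>2"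
      by (simp add: h2_def int_h[OF M2.real_distribution_axioms])
  qed (auto simp: cdf_def)
  \<comment> \<open>The joint distribution functions of the empirical measures of the pairs \<open>(x k i, y k i)\<close>.\<close>
  define p where "p k s q = (\<Sum>i<n k. of_bool (x k i \<le> real_of_rat s \<and> y k i \<le> real_of_rat q)) / real (n k)" for k s q
  have "\<bar>p k s q\<bar> \<le> 1" for k s q
  proof -
    have "(\<Sum>i<n k. of_bool (x k i \<le> real_of_rat s \<and> y k i \<le> real_of_rat q)) \<le> (\<Sum>i<n k. 1 :: real)"
      by (intro sum_mono) auto
    moreover have "0 \<le> (\<Sum>i<n k. of_bool (x k i \<le> real_of_rat s \<and> y k i \<le> real_of_rat q) :: real)"
      by (intro sum_nonneg) auto
    ultimately show ?thesis using n0[of k] by (simp add: p_def)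
  qed
  then have "\<exists>r. strict_mono r \<and> (\<forall>i. convergent (\<lambda>k. p (r k) (fst i) (snd i)))"
    by (intro diagonal_subsequence[where C=1])
  then obtain r where r: "strict_mono r" "\<And>s q. convergent (\<lambda>k. p (r k) s q)" by auto
  define H where "H s q = lim (\<lambda>k. p (r k) s q)" for s q
  have H: "(\<lambda>k. p (r k) s q) \<longlonglongrightarrow> H s q" for s q
    using r(2) unfolding H_def by (simp add: convergent_LIMSEQ_iff)
  have rr: "filterlim r at_top sequentially" by (rule filterlim_subseq[OF r(1)])
  note F1 = filterlim_compose[OF freq1 rr] and F2 = filterlim_compose[OF freq2 rr]
  have le_lim: "L \<le> L'" if "f \<longlonglongrightarrow> L" "g \<longlonglongrightarrow> L'" "\<And>k. f k \<le> g k" for f g :: "nat \<Rightarrow> real" and L L'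
    using that by (intro LIMSEQ_le[of f L g L']) auto
  have "\<exists>\<psi>\<in>borel_measurable (M1 \<Otimes>\<^sub>M unit_interval). distr (M1 \<Otimes>\<^sub>M unit_interval) borel \<psi> = M2 \<and>
    (\<forall>s q. emeasure (M1 \<Otimes>\<^sub>M unit_interval)
      {z \<in> space (M1 \<Otimes>\<^sub>M unit_interval). fst z \<le> of_rat s \<and> \<psi> z \<le> of_rat q} = ennreal (H s q))"
  proof (rule coupling_of_joint_cdf[OF M(1) s1 M(3) s2])
    \<comment> \<open>Every hypothesis on \<open>H\<close> holds for the empirical measures, where
      it is an inequality between indicators for each index \<open>i\<close>, and survives the
      limit.\<close>
    have avg_le: "(\<Sum>i<n k. f i) / real (n k) \<le> (\<Sum>i<n k. g i) / real (n k)" if "\<And>i. f i \<le> g i" for f g k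
      using n0[of k] that by (intro divide_right_mono sum_mono) auto
    fix s s' q q' :: rat
    show "0 \<le> H s q"
      by (rule le_lim[OF tendsto_const H]) (auto simp: p_def intro!: divide_nonneg_nonneg sum_nonneg)
    show "H s q \<le> cdf M1 (of_rat s)"
      by (rule le_lim[OF H F1]) (unfold p_def, rule avg_le, auto)
    show "H s q \<le> cdf M2 (of_rat q)"
      by (rule le_lim[OF H F2]) (unfold p_def, rule avg_le, auto)
    show "cdf M2 (of_rat q) - H s q \<le> 1 - cdf M1 (of_rat s)"
    proof (rule le_lim[OF tendsto_diff[OF F2 H] tendsto_diff[OF tendsto_const F1]])
      fix k
      have one: "1 = (\<Sum>i<n (r k). 1) / real (n (r k))" using n0[of "r k"] by simp
      show "(\<Sum>i<n (r k). of_bool (y (r k) i \<le> real_of_rat q)) / real (n (r k)) - p (r k) s q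
         \<le> 1 - (\<Sum>i<n (r k). of_bool (x (r k) i \<le> real_of_rat s)) / real (n (r k))"
        unfolding p_def by (subst one, unfold diff_divide_distrib[symmetric] sum_subtractf[symmetric]) (rule avg_le, auto)
    qed
    assume ss: "s \<le> s'"
    have ss': "a \<le> real_of_rat s \<Longrightarrow> a \<le> real_of_rat s'" for a
      using ss by (meson of_rat_less_eq order_trans)
    show "0 \<le> H s' q - H s q"
      by (rule le_lim[OF tendsto_const tendsto_diff[OF H H]])
         (unfold p_def diff_ge_0_iff_ge, rule avg_le, auto dest: ss')
    show "H s' q - H s q \<le> cdf M1 (of_rat s') - cdf M1 (of_rat s)"
      by (rule le_lim[OF tendsto_diff[OF H H] tendsto_diff[OF F1 F1]])
         (unfold p_def diff_divide_distrib[symmetric] sum_subtractf[symmetric], rule avg_le, auto dest: ss')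
    assume "q \<le> q'"
    then have qq': "a \<le> real_of_rat q \<Longrightarrow> a \<le> real_of_rat q'" for a
      by (meson of_rat_less_eq order_trans)
    show "H s' q - H s q \<le> H s' q' - H s q'"
      by (rule le_lim[OF tendsto_diff[OF H H] tendsto_diff[OF H H]])
         (unfold p_def diff_divide_distrib[symmetric] sum_subtractf[symmetric], rule avg_le, auto dest: ss' qq')
  qed
  then obtain \<psi> where \<psi>: "\<psi> \<in> borel_measurable (M1 \<Otimes>\<^sub>M unit_interval)" "distr (M1 \<Otimes>\<^sub>M unit_interval) borel \<psi> = M2"
    "\<And>s q. emeasure (M1 \<Otimes>\<^sub>M unit_interval) {z \<in> space (M1 \<Otimes>\<^sub>M unit_interval). fst z \<le> of_rat s \<and> \<psi> z \<le> of_rat q} = ennreal (H s q)"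
    by blast
  have H0: "0 \<le> H s q" for s q
    by (rule le_lim[OF tendsto_const H]) (auto simp: p_def intro!: divide_nonneg_nonneg sum_nonneg)
  let ?K = "M1 \<Otimes>\<^sub>M unit_interval"
  let ?B = "(borel :: real measure) \<Otimes>\<^sub>M (borel :: real measure)"
  define P where "P = distr ?K ?B (\<lambda>z. (fst z, \<psi> z))"
  have fstm: "fst \<in> borel_measurable ?K" using s1 by (simp add: measurable_cong_sets[OF refl s1[symmetric]])
  have jm: "(\<lambda>z. (fst z, \<psi> z)) \<in> measurable ?K ?B" using fstm \<psi>(1) by measurable
  interpret P: prob_space P unfolding P_def by (rule MU.prob_space_distr[OF jm])
  interpret PP: pair_prob_space P P ..
  have sP: "sets P = sets ?B" by (simp add: P_def)
  have spP: "space P = UNIV" by (simp add: P_def space_pair_measure)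
  have fP: "fst \<in> borel_measurable P" and sndP: "snd \<in> borel_measurable P"
    unfolding measurable_cong_sets[OF sP refl] by simp_all
  have fP1: "fst \<in> measurable P M1" and sP2: "snd \<in> measurable P M2"
    using fP sndP by (simp_all add: measurable_cong_sets[OF refl s1] measurable_cong_sets[OF refl s2])
  have dfst: "distr P M1 fst = M1"
  proof -
    have "distr P M1 fst = distr ?K M1 fst"
      unfolding P_def using jm s1
      by (subst distr_distr) (auto simp: comp_def measurable_cong_sets[OF refl s1])
    also have "\<dots> = M1" by (rule U.distr_pair_fst)
    finally show ?thesis .
  qed
  have dsnd: "distr P M2 snd = M2"
  proof -
    have "distr P M2 snd = distr ?K M2 \<psi>"
      unfolding P_def using jm s2
      by (subst distr_distr) (auto simp: comp_def measurable_cong_sets[OF refl s2])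
    also have "\<dots> = distr ?K borel \<psi>" by (rule distr_cong) (simp_all add: s2)
    finally show ?thesis by (simp add: \<psi>(2))
  qed
  define Q where "Q s q = {..real_of_rat s} \<times> {..real_of_rat q}" for s q
  have Qs: "Q s q \<in> sets P" for s q unfolding sP Q_def by simp
  have PQ: "measure P (Q s q) = H s q" for s q
  proof -
    have "emeasure P (Q s q) = emeasure ?K {z \<in> space ?K. fst z \<le> of_rat s \<and> \<psi> z \<le> of_rat q}"
      unfolding P_def Q_def using jm by (subst emeasure_distr) (auto intro!: arg_cong[where f="emeasure _"])
    then show ?thesis using H0 by (simp add: \<psi>(3) measure_def)
  qed
  \<comment> \<open>The average includes the diagonal, so that for a product of two quadrants it is
    exactly a product of two frequencies and its limit is known. The diagonal is removed later at
    the cost of O(1/n).\<close>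
  define avg where "avg k f = (\<Sum>i<n k. \<Sum>j<n k. f (x k i, y k i) (x k j, y k j)) / (real (n k))\<^sup>2"
    for k and f :: "real \<times> real \<Rightarrow> real \<times> real \<Rightarrow> real"
  define conv where "conv f \<longleftrightarrow> integrable (P \<Otimes>\<^sub>M P) (\<lambda>z. f (fst z) (snd z)) \<and>
    (\<lambda>k. avg (r k) f) \<longlonglongrightarrow> (\<integral>z. f (fst z) (snd z) \<partial>(P \<Otimes>\<^sub>M P))" for f
  have conv_lin: "conv (\<lambda>w w'. c * f w w' + g w w')" if "conv f" "conv g" for c f g
  proof -
    have "avg k (\<lambda>w w'. c * f w w' + g w w') = c * avg k f + avg k g" for k
      by (simp add: avg_def sum.distrib sum_distrib_left add_divide_distrib)
    with that show ?thesis
      unfolding conv_def by (auto intro!: tendsto_intros)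
  qed
  have conv_zero: "conv (\<lambda>w w'. 0)" by (simp add: conv_def avg_def)
  have ind_prod: "(\<lambda>z. indicator A (fst z) * indicator B (snd z) :: real) = indicator (A \<times> B)"
    for A B :: "(real \<times> real) set"
    by (auto simp: indicator_def fun_eq_iff)
  have conv_quad: "conv (\<lambda>w w'. indicator (Q s q) w * indicator (Q s' q') w')" for s q s' q'
  proof -
    have "avg k (\<lambda>w w'. indicator (Q s q) w * indicator (Q s' q') w') = p k s q * p k s' q'" for k
    proof -
      have "p k s q = (\<Sum>i<n k. indicator (Q s q) (x k i, y k i)) / real (n k)" for s q
        unfolding p_def by (intro arg_cong2[where f="(/)"] sum.cong) (auto simp: Q_def indicator_def)
      then show ?thesis by (simp add: avg_def sum_product power2_eq_square)
    qed
    moreover have "integrable (P \<Otimes>\<^sub>M P) (indicator (Q s q \<times> Q s' q') :: _ \<Rightarrow> real)"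
      using Qs by (intro integrable_real_indicator) (auto simp: less_top[symmetric])
    moreover have "(\<integral>z. indicator (Q s q \<times> Q s' q') z \<partial>(P \<Otimes>\<^sub>M P)) = H s q * H s' q'"
    proof -
      have "measure (P \<Otimes>\<^sub>M P) (Q s q \<times> Q s' q') = measure P (Q s q) * measure P (Q s' q')"
        using Qs by (simp add: measure_def P.emeasure_pair_measure_Times enn2real_mult)
      then show ?thesis using Qs by (simp add: PQ spP space_pair_measure)
    qed
    ultimately show ?thesis unfolding conv_def ind_prod by (auto intro!: tendsto_intros H)
  qed
  have conv1: "conv (\<lambda>w w'. indicator (Q s q) w * indicator (Q s' q') w' * g (fst w, fst w'))"
    if "g \<in> step_functions ?EE" for g s q s' q'
    using that
  proof induction
    case zero then show ?case using conv_zero by simp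
  next
    case (add A g c)
    then obtain u u' where A: "A = {..real_of_rat u} \<times> {..real_of_rat u'}" by (auto simp: rat_half_lines_def)
    have ind: "indicator A (a, b) = (indicator {..real_of_rat u} a * indicator {..real_of_rat u'} b :: real)" for a b
      by (auto simp: A indicator_def)
    have "indicator (Q s q) w * indicator (Q s' q') w' * indicator A (fst w, fst w') =
      (indicator (Q (min s u) q) w * indicator (Q (min s' u') q') w' :: real)" for w w'
      unfolding ind Q_def Int_rat_quadrant[symmetric] by (simp add: mult_ac)
    then have "indicator (Q s q) w * indicator (Q s' q') w' * (c * indicator A (fst w, fst w') + g (fst w, fst w')) =
      c * (indicator (Q (min s u) q) w * indicator (Q (min s' u') q') w') + indicator (Q s q) w * indicator (Q s' q') w' * g (fst w, fst w')" for w w'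
      by (simp add: distrib_left mult.left_commute)
    then show ?case by (simp add: conv_lin[OF conv_quad add.IH])
  qed
  have conv2: "conv (\<lambda>w w'. indicator (Q s q) w * indicator (Q s' q') w' * g (snd w, snd w'))"
    if "g \<in> step_functions ?EE" for g s q s' q'
    using that
  proof induction
    case zero then show ?case using conv_zero by simp
  next
    case (add A g c)
    then obtain u u' where A: "A = {..real_of_rat u} \<times> {..real_of_rat u'}" by (auto simp: rat_half_lines_def)
    have ind: "indicator A (a, b) = (indicator {..real_of_rat u} a * indicator {..real_of_rat u'} b :: real)" for a b
      by (auto simp: A indicator_def)
    have "indicator (Q s q) w * indicator (Q s' q') w' * indicator A (snd w, snd w') =
      (indicator (Q s (min q u)) w * indicator (Q s' (min q' u')) w' :: real)" for w w'
      unfolding ind Q_def Int_rat_quadrant[symmetric] by (simp add: mult_ac)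
    then have "indicator (Q s q) w * indicator (Q s' q') w' * (c * indicator A (snd w, snd w') + g (snd w, snd w')) =
      c * (indicator (Q s (min q u)) w * indicator (Q s' (min q' u')) w') + indicator (Q s q) w * indicator (Q s' q') w' * g (snd w, snd w')" for w w'
      by (simp add: distrib_left mult.left_commute)
    then show ?case by (simp add: conv_lin[OF conv_quad add.IH])
  qed
  define f where "f z = W1 (fst (fst z)) (fst (snd z)) - W2 (snd (fst z)) (snd (snd z))" for z :: "(real \<times> real) \<times> (real \<times> real)"
  have m1: "(\<lambda>z. (fst (fst z), fst (snd z))) \<in> measurable (P \<Otimes>\<^sub>M P) (M1 \<Otimes>\<^sub>M M1)"
    using fP1 by measurable
  have m2: "(\<lambda>z. (snd (fst z), snd (snd z))) \<in> measurable (P \<Otimes>\<^sub>M P) (M2 \<Otimes>\<^sub>M M2)"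
    using sP2 by measurable
  have d1: "distr (P \<Otimes>\<^sub>M P) (M1 \<Otimes>\<^sub>M M1) (\<lambda>z. (fst (fst z), fst (snd z))) = M1 \<Otimes>\<^sub>M M1"
    using pair_measure_distr[OF fP1 fP1] by (simp add: dfst M1.sigma_finite_measure_axioms case_prod_unfold)
  have d2: "distr (P \<Otimes>\<^sub>M P) (M2 \<Otimes>\<^sub>M M2) (\<lambda>z. (snd (fst z), snd (snd z))) = M2 \<Otimes>\<^sub>M M2"
    using pair_measure_distr[OF sP2 sP2] by (simp add: dsnd M2.sigma_finite_measure_axioms case_prod_unfold)
  have fm: "f \<in> borel_measurable (P \<Otimes>\<^sub>M P)"
    unfolding f_def using measurable_compose[OF m1 W1m] measurable_compose[OF m2 W2m] by simp
  have fb: "\<bar>f z\<bar> \<le> 1" for z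
    using graphon_bounds[OF M(2), of "fst (fst z)" "fst (snd z)"] graphon_bounds[OF M(4), of "snd (fst z)" "snd (snd z)"]
    by (auto simp: f_def M1.space_eq_univ M2.space_eq_univ)
  have fi: "integrable (P \<Otimes>\<^sub>M P) f" by (rule PP.integrable_bounded[OF fm fb])
  \<comment> \<open>The bound 4/(m + 1) has two halves: the limit of the averages of U1 - U2 is at
    most 2/(m + 1), and replacing W1 and W2 by U1 and U2 under the integral costs 1/(m + 1)
    each.\<close>
  have quad0: "(\<integral>z. indicator (Q s q) (fst z) * indicator (Q s' q') (snd z) * f z \<partial>(P \<Otimes>\<^sub>M P)) = 0" (is "?I = 0") for s q s' q'
  proof -
    let ?ind = "\<lambda>w w'. indicator (Q s q) w * indicator (Q s' q') w' :: real"
    have "\<bar>?I\<bar> \<le> 4 / (real m + 1)" for m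
    proof -
      let ?V1 = "\<lambda>w w'. ?ind w w' * U1 m (fst w, fst w')" and ?V2 = "\<lambda>w w'. ?ind w w' * U2 m (snd w, snd w')"
      let ?D = "\<lambda>w w'. (-1) * ?V2 w w' + ?V1 w w'"
      note c1 = conv1[OF U1(1), of s q s' q' m] and c2 = conv2[OF U2(1), of s q s' q' m]
      note cD = conv_lin[OF c2 c1, of "-1"]
      let ?e = "1 / (real m + 1)"
      define d1 where "d1 = (\<integral>z. \<bar>W1 (fst z) (snd z) - U1 m z\<bar> \<partial>(M1 \<Otimes>\<^sub>M M1))"
      define d2 where "d2 = (\<integral>z. \<bar>W2 (fst z) (snd z) - U2 m z\<bar> \<partial>(M2 \<Otimes>\<^sub>M M2))"
      have d: "0 \<le> d1" "d1 \<le> ?e" "0 \<le> d2" "d2 \<le> ?e"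
        using U1(2)[of m] U2(2)[of m] by (auto simp: d1_def d2_def)
      \<comment> \<open>The three terms 1/(k + 1) are the cut norm bound and the sampling errors of
        the two test functions |W - U|; the L1 distances give 2/(m + 1) and the diagonal the last
        term. The restriction on k brings the odd test function with index 2m + 1 into play.\<close>
      have avg_bound: "\<bar>avg k ?D\<bar> \<le> 3 / (real k + 1) + 2 * ?e + (B1 m + B2 m) / (real k + 1)" if k: "2 * m + 1 \<le> k" for k
      proof -
        let ?N = "real (n k)"
        have N: "real k + 1 \<le> ?N" using samples(1)[of k] by simp
        then have N0: "?N > 0" by linarith
        let ?i = "\<lambda>i j. ?ind (x k i, y k i) (x k j, y k j)"
        let ?d = "\<lambda>i j. ?D (x k i, y k i) (x k j, y k j)"
        have i01: "\<bar>?i i j\<bar> \<le> 1" for i j by (auto simp: indicator_def)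
        have B: "\<bar>U1 m z\<bar> \<le> B1 m" "\<bar>U2 m z\<bar> \<le> B2 m" for z using B1 B2 by auto
        have B0: "0 \<le> B1 m" "0 \<le> B2 m" using order_trans[OF abs_ge_zero B(1)] order_trans[OF abs_ge_zero B(2)] by auto
        have off: "\<bar>offdiag_sum (n k) ?d\<bar> \<le> 3 / (real k + 1) * ?N ^ 2 + 2 * ?e * ?N ^ 2"
        proof -
          let ?w = "\<lambda>i j. ?i i j * (W1 (x k i) (x k j) - W2 (y k i) (y k j))"
          let ?u1 = "\<lambda>i j. ?i i j * (U1 m (x k i, x k j) - W1 (x k i) (x k j))"
          let ?u2 = "\<lambda>i j. ?i i j * (W2 (y k i) (y k j) - U2 m (y k i, y k j))"
          have "?d = (\<lambda>i j. ?w i j + (?u1 i j + ?u2 i j))" by (auto simp: fun_eq_iff algebra_simps)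
          then have "offdiag_sum (n k) ?d = offdiag_sum (n k) ?w + (offdiag_sum (n k) ?u1 + offdiag_sum (n k) ?u2)"
            by (simp only: offdiag_sum_add)
          \<comment> \<open>Here the weights in the cut norm bound are indicators of sets in the
            plane of pairs \<open>(x k i, y k i)\<close>.\<close>
          moreover have "\<bar>offdiag_sum (n k) ?w\<bar> \<le> 1 / (real k + 1) * ?N ^ 2"
            using samples(4)[of "\<lambda>i. indicator (Q s q) (x k i, y k i)" "\<lambda>j. indicator (Q s' q') (x k j, y k j)" k]
            by (simp add: indicator_def)
          moreover have "\<bar>offdiag_sum (n k) ?u1\<bar> \<le> 1 / (real k + 1) * ?N ^ 2 + ?e * ?N ^ 2"
          proof -
            have h: "h1 (2 * m + 1) = (\<lambda>z. \<bar>W1 (fst z) (snd z) - U1 m z\<bar>)" by (simp add: h1_def)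
            have "\<bar>offdiag_sum (n k) ?u1\<bar> \<le> offdiag_sum (n k) (\<lambda>i j. (h1 (2 * m + 1) (x k i, x k j) - d1) + d1)"
              using i01 unfolding h by (intro offdiag_sum_abs_le) (auto simp: abs_mult abs_minus_commute intro!: mult_left_le_one_le)
            also have "\<dots> = offdiag_sum (n k) (\<lambda>i j. h1 (2 * m + 1) (x k i, x k j) - d1) + offdiag_sum (n k) (\<lambda>_ _. d1)"
              by (rule offdiag_sum_add)
            also have "offdiag_sum (n k) (\<lambda>i j. h1 (2 * m + 1) (x k i, x k j) - d1) \<le> 1 / (real k + 1) * ?N ^ 2"
              using samples(2)[OF k] unfolding h d1_def[symmetric] by linarith
            also have "offdiag_sum (n k) (\<lambda>_ _. d1) \<le> ?N ^ 2 * d1" by (rule offdiag_sum_const_le[OF d(1)])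
            also have "\<dots> \<le> ?N ^ 2 * ?e" using d(2) by (intro mult_left_mono) auto
            finally show ?thesis by (simp add: mult.commute)
          qed
          moreover have "\<bar>offdiag_sum (n k) ?u2\<bar> \<le> 1 / (real k + 1) * ?N ^ 2 + ?e * ?N ^ 2"
          proof -
            have h: "h2 (2 * m + 1) = (\<lambda>z. \<bar>W2 (fst z) (snd z) - U2 m z\<bar>)" by (simp add: h2_def)
            have "\<bar>offdiag_sum (n k) ?u2\<bar> \<le> offdiag_sum (n k) (\<lambda>i j. (h2 (2 * m + 1) (y k i, y k j) - d2) + d2)"
              using i01 unfolding h by (intro offdiag_sum_abs_le) (auto simp: abs_mult intro!: mult_left_le_one_le)
            also have "\<dots> = offdiag_sum (n k) (\<lambda>i j. h2 (2 * m + 1) (y k i, y k j) - d2) + offdiag_sum (n k) (\<lambda>_ _. d2)"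
              by (rule offdiag_sum_add)
            also have "offdiag_sum (n k) (\<lambda>i j. h2 (2 * m + 1) (y k i, y k j) - d2) \<le> 1 / (real k + 1) * ?N ^ 2"
              using samples(3)[OF k] unfolding h d2_def[symmetric] by linarith
            also have "offdiag_sum (n k) (\<lambda>_ _. d2) \<le> ?N ^ 2 * d2" by (rule offdiag_sum_const_le[OF d(3)])
            also have "\<dots> \<le> ?N ^ 2 * ?e" using d(4) by (intro mult_left_mono) auto
            finally show ?thesis by (simp add: mult.commute)
          qed
          moreover have "3 / (real k + 1) * ?N ^ 2 = 3 * (1 / (real k + 1) * ?N ^ 2)" by simp
          ultimately show ?thesis by linarith
        qed
        have "\<bar>(\<Sum>i<n k. \<Sum>j<n k. ?d i j) - offdiag_sum (n k) ?d\<bar> \<le> ?N * (B1 m + B2 m)"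
        proof (rule offdiag_sum_diff)
          fix i
          have "?d i i = ?i i i * (U1 m (x k i, x k i) - U2 m (y k i, y k i))"
            by (simp add: algebra_simps)
          then have "\<bar>?d i i\<bar> = \<bar>?i i i\<bar> * \<bar>U1 m (x k i, x k i) - U2 m (y k i, y k i)\<bar>"
            by (simp only: abs_mult)
          also have "\<dots> \<le> \<bar>U1 m (x k i, x k i) - U2 m (y k i, y k i)\<bar>"
            using i01[of i i] by (intro mult_left_le_one_le) auto
          also have "\<dots> \<le> B1 m + B2 m" using B(1)[of "(x k i, x k i)"] B(2)[of "(y k i, y k i)"] by linarith
          finally show "\<bar>?d i i\<bar> \<le> B1 m + B2 m" .
        qed
        with off have "\<bar>\<Sum>i<n k. \<Sum>j<n k. ?d i j\<bar> \<le> ?N ^ 2 * (3 / (real k + 1) + 2 * ?e + (B1 m + B2 m) / ?N)"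
        proof -
          have "?N ^ 2 * ((B1 m + B2 m) / ?N) = ?N * (B1 m + B2 m)" using N0 by (simp add: power2_eq_square)
          then have "?N ^ 2 * (3 / (real k + 1) + 2 * ?e + (B1 m + B2 m) / ?N) =
              3 / (real k + 1) * ?N ^ 2 + 2 * ?e * ?N ^ 2 + ?N * (B1 m + B2 m)"
            unfolding distrib_left by (simp only: mult.commute)
          with off \<open>\<bar>(\<Sum>i<n k. \<Sum>j<n k. ?d i j) - offdiag_sum (n k) ?d\<bar> \<le> ?N * (B1 m + B2 m)\<close>
          show ?thesis by linarith
        qed
        then have "\<bar>avg k ?D\<bar> \<le> 3 / (real k + 1) + 2 * ?e + (B1 m + B2 m) / ?N"
          using N0 unfolding avg_def by (simp only: abs_divide) (simp add: divide_le_eq mult.commute)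
        moreover have "(B1 m + B2 m) / ?N \<le> (B1 m + B2 m) / (real k + 1)"
          using N B0 by (intro divide_left_mono) auto
        ultimately show ?thesis by linarith
      qed
      have "\<bar>\<integral>z. ?D (fst z) (snd z) \<partial>(P \<Otimes>\<^sub>M P)\<bar> \<le> 2 * ?e"
      proof (rule LIMSEQ_le)
        show "(\<lambda>k. \<bar>avg (r k) ?D\<bar>) \<longlonglongrightarrow> \<bar>\<integral>z. ?D (fst z) (snd z) \<partial>(P \<Otimes>\<^sub>M P)\<bar>"
          using cD unfolding conv_def by (intro tendsto_rabs) blast
        have "(\<lambda>k. 3 / (real k + 1) + 2 * ?e + (B1 m + B2 m) / (real k + 1)) \<longlonglongrightarrow> 0 + 2 * ?e + 0"
          by (intro tendsto_add tendsto_const) real_asymp+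
        from filterlim_compose[OF this rr]
        show "(\<lambda>k. 3 / (real (r k) + 1) + 2 * ?e + (B1 m + B2 m) / (real (r k) + 1)) \<longlonglongrightarrow> 2 * ?e" by simp
        have "2 * m + 1 \<le> r k" if "2 * m + 1 \<le> k" for k
          using seq_suble[OF r(1), of k] that by simp
        then show "\<exists>N. \<forall>k\<ge>N. \<bar>avg (r k) ?D\<bar> \<le> 3 / (real (r k) + 1) + 2 * ?e + (B1 m + B2 m) / (real (r k) + 1)"
          using avg_bound by (intro exI[of _ "2 * m + 1"]) auto
      qed
      \<comment> \<open>The error functions involve only one of the two coordinates, so their
        integrals under P are computed from the marginals.\<close>
      have i1: "\<bar>\<integral>z. ?ind (fst z) (snd z) * g (h z) \<partial>(P \<Otimes>\<^sub>M P)\<bar> \<le> (\<integral>z. \<bar>g z\<bar> \<partial>(N \<Otimes>\<^sub>M N))"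
          if h: "h \<in> measurable (P \<Otimes>\<^sub>M P) (N \<Otimes>\<^sub>M N)" "distr (P \<Otimes>\<^sub>M P) (N \<Otimes>\<^sub>M N) h = N \<Otimes>\<^sub>M N"
            and g: "integrable (N \<Otimes>\<^sub>M N) g" for h :: "_ \<Rightarrow> real \<times> real" and g and N :: "real measure"
      proof -
        have gh: "integrable (P \<Otimes>\<^sub>M P) (\<lambda>z. g (h z))"
          using integrable_distr[OF h(1)] g unfolding h(2) by blast
        have im: "(\<lambda>z. ?ind (fst z) (snd z)) \<in> borel_measurable (P \<Otimes>\<^sub>M P)"
          using Qs[of s q] Qs[of s' q'] by measurable
        have "\<bar>\<integral>z. ?ind (fst z) (snd z) * g (h z) \<partial>(P \<Otimes>\<^sub>M P)\<bar> \<le> (\<integral>z. \<bar>?ind (fst z) (snd z) * g (h z)\<bar> \<partial>(P \<Otimes>\<^sub>M P))"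
          by (rule integral_abs_bound)
        also have "\<dots> \<le> (\<integral>z. \<bar>g (h z)\<bar> \<partial>(P \<Otimes>\<^sub>M P))"
        proof (rule integral_mono')
          show "integrable (P \<Otimes>\<^sub>M P) (\<lambda>z. \<bar>g (h z)\<bar>)" using gh by simp
        qed (auto simp: abs_mult indicator_def)
        also have "\<dots> = (\<integral>z. \<bar>g z\<bar> \<partial>distr (P \<Otimes>\<^sub>M P) (N \<Otimes>\<^sub>M N) h)"
          using h(1) g by (subst integral_distr) auto
        finally show ?thesis unfolding h(2) .
      qed
      let ?R1 = "\<lambda>z. W1 (fst z) (snd z) - U1 m z" and ?R2 = "\<lambda>z. W2 (fst z) (snd z) - U2 m z"
      have R1: "integrable (M1 \<Otimes>\<^sub>M M1) ?R1"
        by (rule Bochner_Integration.integrable_diff[OF W1i MM1.integrable_bounded[OF U1m B1]])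
      have R2: "integrable (M2 \<Otimes>\<^sub>M M2) ?R2"
        by (rule Bochner_Integration.integrable_diff[OF W2i MM2.integrable_bounded[OF U2m B2]])
      define J1 where "J1 = (\<integral>z. ?ind (fst z) (snd z) * ?R1 (fst (fst z), fst (snd z)) \<partial>(P \<Otimes>\<^sub>M P))"
      define J2 where "J2 = (\<integral>z. ?ind (fst z) (snd z) * ?R2 (snd (fst z), snd (snd z)) \<partial>(P \<Otimes>\<^sub>M P))"
      have J1: "\<bar>J1\<bar> \<le> d1" using i1[OF m1 d1 R1] unfolding J1_def d1_def by blast
      have J2: "\<bar>J2\<bar> \<le> d2" using i1[OF m2 d2 R2] unfolding J2_def d2_def by blast
      have im: "(\<lambda>z. ?ind (fst z) (snd z)) \<in> borel_measurable (P \<Otimes>\<^sub>M P)"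
        using Qs[of s q] Qs[of s' q'] by measurable
      have iD: "integrable (P \<Otimes>\<^sub>M P) (\<lambda>z. ?D (fst z) (snd z))" using cD unfolding conv_def by blast
      have iR1: "integrable (P \<Otimes>\<^sub>M P) (\<lambda>z. ?ind (fst z) (snd z) * ?R1 (fst (fst z), fst (snd z)))"
      proof (rule Bochner_Integration.integrable_bound)
        show "integrable (P \<Otimes>\<^sub>M P) (\<lambda>z. ?R1 (fst (fst z), fst (snd z)))"
          using integrable_distr[OF m1, of ?R1] R1 unfolding d1 by blast
        then show "(\<lambda>z. ?ind (fst z) (snd z) * ?R1 (fst (fst z), fst (snd z))) \<in> borel_measurable (P \<Otimes>\<^sub>M P)"
          by (intro borel_measurable_times im) auto
      qed (auto simp: abs_mult indicator_def)
      have iR2: "integrable (P \<Otimes>\<^sub>M P) (\<lambda>z. ?ind (fst z) (snd z) * ?R2 (snd (fst z), snd (snd z)))"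
      proof (rule Bochner_Integration.integrable_bound)
        show "integrable (P \<Otimes>\<^sub>M P) (\<lambda>z. ?R2 (snd (fst z), snd (snd z)))"
          using integrable_distr[OF m2, of ?R2] R2 unfolding d2 by blast
        then show "(\<lambda>z. ?ind (fst z) (snd z) * ?R2 (snd (fst z), snd (snd z))) \<in> borel_measurable (P \<Otimes>\<^sub>M P)"
          by (intro borel_measurable_times im) auto
      qed (auto simp: abs_mult indicator_def)
      have "?I = (\<integral>z. (?D (fst z) (snd z) + ?ind (fst z) (snd z) * ?R1 (fst (fst z), fst (snd z)))
          - ?ind (fst z) (snd z) * ?R2 (snd (fst z), snd (snd z)) \<partial>(P \<Otimes>\<^sub>M P))"
        by (rule Bochner_Integration.integral_cong) (auto simp: f_def algebra_simps)
      also have "\<dots> = (\<integral>z. ?D (fst z) (snd z) \<partial>(P \<Otimes>\<^sub>M P)) + J1 - J2"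
        unfolding J1_def J2_def
        by (subst Bochner_Integration.integral_diff[OF Bochner_Integration.integrable_add[OF iD iR1] iR2],
            subst Bochner_Integration.integral_add[OF iD iR1]) simp
      finally have "?I = (\<integral>z. ?D (fst z) (snd z) \<partial>(P \<Otimes>\<^sub>M P)) + J1 - J2" .
      then have "\<bar>?I\<bar> \<le> 4 * ?e"
        using J1 J2 d \<open>\<bar>\<integral>z. ?D (fst z) (snd z) \<partial>(P \<Otimes>\<^sub>M P)\<bar> \<le> 2 * ?e\<close> by linarith
      then show ?thesis by simp
    qed
    \<comment> \<open>The integral does not depend on m, so m may tend to infinity.\<close>
    then have "\<bar>?I\<bar> \<le> 0"
      by (intro LIMSEQ_le_const[of "\<lambda>m. 4 / (real m + 1)"]) (real_asymp, auto)
    then show ?thesis by simp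
  qed
  let ?E4 = "{a \<times> b | a b. a \<in> ?EE \<and> b \<in> ?EE}"
  have "pi_generator P ?EE"
    by (rule pi_generator_cong[OF sP]) (intro pi_generator_pair pi_generator_rat_half_lines refl)
  then have gen4: "pi_generator (P \<Otimes>\<^sub>M P) ?E4" by (intro pi_generator_pair)
  have AEf: "AE z in P \<Otimes>\<^sub>M P. f z = 0"
  proof (rule PP.AE_eq_0_of_orthogonal[OF gen4 fm fb])
    fix A assume "A \<in> ?E4"
    then obtain s q s' q' where A: "A = Q s q \<times> Q s' q'" by (auto simp: rat_half_lines_def Q_def)
    show "(\<integral>z. indicator A z * f z \<partial>(P \<Otimes>\<^sub>M P)) = 0"
      using quad0[of s q s' q'] by (simp add: A ind_prod[unfolded fun_eq_iff, rule_format])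
  qed
  have PP: "P \<Otimes>\<^sub>M P = distr (?K \<Otimes>\<^sub>M ?K) (?B \<Otimes>\<^sub>M ?B) (\<lambda>(u, v). ((fst u, \<psi> u), (fst v, \<psi> v)))"
    unfolding P_def by (rule pair_measure_distr[OF jm jm]) (rule P.sigma_finite_measure_axioms[unfolded P_def])
  have jjm: "(\<lambda>(u, v). ((fst u, \<psi> u), (fst v, \<psi> v))) \<in> measurable (?K \<Otimes>\<^sub>M ?K) (?B \<Otimes>\<^sub>M ?B)"
    using jm by measurable
  have sPP: "sets (P \<Otimes>\<^sub>M P) = sets (?B \<Otimes>\<^sub>M ?B)" by (intro sets_pair_measure_cong sP)
  have "{z \<in> space (?B \<Otimes>\<^sub>M ?B). f z = 0} \<in> sets (?B \<Otimes>\<^sub>M ?B)"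
    using fm unfolding measurable_cong_sets[OF sPP refl] by measurable
  then have "AE p in ?K \<Otimes>\<^sub>M ?K. f (case p of (u, v) \<Rightarrow> ((fst u, \<psi> u), (fst v, \<psi> v))) = 0"
    using AEf unfolding PP by (subst (asm) AE_distr_iff[OF jjm]) auto
  then have "AE p in ?K \<Otimes>\<^sub>M ?K. W1 (fst (fst p)) (fst (snd p)) = W2 (\<psi> (fst p)) (\<psi> (snd p))"
    by eventually_elim (auto simp: f_def split: prod.splits)
  with \<psi>(1,2) show ?thesis by blast
qed

section \<open>The cut distance\<close>

lemma graph_edges_finite:
  assumes "pair_graph F"
  shows "finite (pverts F)" "finite (graph_edges F)"
    "\<And>e. e \<in> graph_edges F \<Longrightarrow> fst e \<in> pverts F \<and> snd e \<in> pverts F \<and> fst e < snd e"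
proof -
  interpret pair_graph F by fact
  show "finite (pverts F)" by (rule pair_finite_verts)
  show "finite (graph_edges F)"
    by (rule finite_subset[OF _ pair_finite_arcs]) (auto simp: graph_edges_def)
  show "fst e \<in> pverts F \<and> snd e \<in> pverts F \<and> fst e < snd e" if "e \<in> graph_edges F" for e
    using that in_arcsD1 in_arcsD2 by (auto simp: graph_edges_def)
qed

lemma graphon_density_alt:
  "graphon_density F M W = (\<integral>x. (\<Prod>e\<in>graph_edges F. W (x (fst e)) (x (snd e))) \<partial>(PiM (pverts F) (\<lambda>_. M)))"
  by (simp add: graphon_density_def case_prod_unfold)

lemma graphon_pullback:
  assumes W: "graphon M W" and \<phi>: "\<phi> \<in> measurable K M"
  shows "graphon K (\<lambda>x y. W (\<phi> x) (\<phi> y))"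
proof -
  have "(\<lambda>z. W (\<phi> (fst z)) (\<phi> (snd z))) \<in> borel_measurable (K \<Otimes>\<^sub>M K)"
    by (intro graphon_measurable[OF W] measurable_compose[OF _ \<phi>]) auto
  moreover have "W (\<phi> x) (\<phi> y) = W (\<phi> y) (\<phi> x) \<and> W (\<phi> x) (\<phi> y) \<in> {0..1}" if "x \<in> space K" "y \<in> space K" for x y
    using graphon_bounds[OF W measurable_space[OF \<phi> that(1)] measurable_space[OF \<phi> that(2)]] by auto
  ultimately show ?thesis by (simp add: graphon_def case_prod_unfold)
qed

lemma graphon_density_pullback:
  assumes K: "prob_space K" and W: "graphon M W" and \<phi>: "measure_preserving K M \<phi>" and F: "pair_graph F"
  shows "graphon_density F K (\<lambda>x y. W (\<phi> x) (\<phi> y)) = graphon_density F M W"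
proof -
  let ?V = "pverts F"
  have \<phi>m: "\<phi> \<in> measurable K M" and \<phi>d: "distr K M \<phi> = M"
    using \<phi> by (auto simp: measure_preserving_def)
  have M: "prob_space M" using prob_space.prob_space_distr[OF K \<phi>m] by (simp add: \<phi>d)
  note V = graph_edges_finite[OF F]
  have d: "distr (PiM ?V (\<lambda>_. K)) (PiM ?V (\<lambda>_. M)) (compose ?V \<phi>) = PiM ?V (\<lambda>_. M)"
    using distr_PiM_finite_prob_space'[OF V(1), of "\<lambda>_. K" "\<lambda>_. M" \<phi>] K M \<phi>m \<phi>d by simp
  have cm: "compose ?V \<phi> \<in> measurable (PiM ?V (\<lambda>_. K)) (PiM ?V (\<lambda>_. M))"
    unfolding compose_def by (intro measurable_restrict measurable_compose[OF _ \<phi>m] measurable_component_singleton)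
  have wm: "(\<lambda>x. \<Prod>e\<in>graph_edges F. W (x (fst e)) (x (snd e))) \<in> borel_measurable (PiM ?V (\<lambda>_. M))"
    by (rule prod_edges_measurable_bounded(1)[OF W V(2)]) (use V(3) in auto)
  have "graphon_density F M W =
      (\<integral>x. (\<Prod>e\<in>graph_edges F. W (x (fst e)) (x (snd e))) \<partial>distr (PiM ?V (\<lambda>_. K)) (PiM ?V (\<lambda>_. M)) (compose ?V \<phi>))"
    unfolding d graphon_density_alt ..
  also have "\<dots> = (\<integral>x. (\<Prod>e\<in>graph_edges F. W (compose ?V \<phi> x (fst e)) (compose ?V \<phi> x (snd e))) \<partial>(PiM ?V (\<lambda>_. K)))"
    by (rule integral_distr[OF cm wm])
  also have "\<dots> = graphon_density F K (\<lambda>x y. W (\<phi> x) (\<phi> y))"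
    unfolding graphon_density_alt
    by (intro Bochner_Integration.integral_cong prod.cong refl) (use V(3) in \<open>auto simp: compose_def\<close>)
  finally show ?thesis ..
qed

lemma graphon_density_cong_AE:
  assumes K: "prob_space K" and V1: "graphon K V1" and V2: "graphon K V2" and F: "pair_graph F"
    and eq: "AE z in K \<Otimes>\<^sub>M K. V1 (fst z) (snd z) = V2 (fst z) (snd z)"
  shows "graphon_density F K V1 = graphon_density F K V2"
  unfolding graphon_density_alt
proof (rule integral_cong_AE)
  let ?V = "pverts F"
  note V = graph_edges_finite[OF F]
  show "(\<lambda>x. \<Prod>e\<in>graph_edges F. V1 (x (fst e)) (x (snd e))) \<in> borel_measurable (PiM ?V (\<lambda>_. K))"
    by (rule prod_edges_measurable_bounded(1)[OF V1 V(2)]) (use V(3) in auto)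
  show "(\<lambda>x. \<Prod>e\<in>graph_edges F. V2 (x (fst e)) (x (snd e))) \<in> borel_measurable (PiM ?V (\<lambda>_. K))"
    by (rule prod_edges_measurable_bounded(1)[OF V2 V(2)]) (use V(3) in auto)
  have "AE x in PiM ?V (\<lambda>_. K). V1 (x (fst e)) (x (snd e)) = V2 (x (fst e)) (x (snd e))" if e: "e \<in> graph_edges F" for e
  proof -
    have ij: "fst e \<in> ?V" "snd e \<in> ?V" "fst e \<noteq> snd e" using V(3)[OF e] by auto
    have m: "(\<lambda>x. (x (fst e), x (snd e))) \<in> measurable (PiM ?V (\<lambda>_. K)) (K \<Otimes>\<^sub>M K)"
      using ij by (intro measurable_Pair measurable_component_singleton)
    have "AE z in distr (PiM ?V (\<lambda>_. K)) (K \<Otimes>\<^sub>M K) (\<lambda>x. (x (fst e), x (snd e))). V1 (fst z) (snd z) = V2 (fst z) (snd z)"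
      using eq unfolding distr_PiM_pair[OF K ij] .
    from AE_distrD[OF m this] show ?thesis by simp
  qed
  then have "AE x in PiM ?V (\<lambda>_. K). \<forall>e\<in>graph_edges F. V1 (x (fst e)) (x (snd e)) = V2 (x (fst e)) (x (snd e))"
    by (intro AE_finite_allI V(2))
  then show "AE x in PiM ?V (\<lambda>_. K). (\<Prod>e\<in>graph_edges F. V1 (x (fst e)) (x (snd e))) = (\<Prod>e\<in>graph_edges F. V2 (x (fst e)) (x (snd e)))"
    by eventually_elim (rule prod.cong, auto)
qed

text \<open>Densities are invariant under pullback along a measure preserving map and under changes
  on null sets. Every condition that provides maps from a common space, or a map between the two
  spaces, leads back to equal densities in this way.\<close>

lemma same_densities_of_common_pullback:
  assumes K: "prob_space K" and W: "graphon M1 W1" "graphon M2 W2"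
    and \<phi>: "measure_preserving K M1 \<phi>1" "measure_preserving K M2 \<phi>2"
    and eq: "AE z in K \<Otimes>\<^sub>M K. W1 (\<phi>1 (fst z)) (\<phi>1 (snd z)) = W2 (\<phi>2 (fst z)) (\<phi>2 (snd z))"
  shows "same_densities M1 W1 M2 W2"
  unfolding same_densities_def
proof (intro allI impI)
  fix F :: ngraph assume F: "pair_graph F"
  have m: "\<phi>1 \<in> measurable K M1" "\<phi>2 \<in> measurable K M2" using \<phi> by (auto simp: measure_preserving_def)
  show "graphon_density F M1 W1 = graphon_density F M2 W2"
    using graphon_density_cong_AE[OF K graphon_pullback[OF W(1) m(1)] graphon_pullback[OF W(2) m(2)] F eq]
    by (simp add: graphon_density_pullback[OF K W(1) \<phi>(1) F] graphon_density_pullback[OF K W(2) \<phi>(2) F])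
qed

section \<open>The counting lemma\<close>

lemma (in prob_space) integral_weight_le:
  assumes k: "k \<in> borel_measurable M" "\<And>x. x \<in> space M \<Longrightarrow> \<bar>k x\<bar> \<le> (C::real)"
    and le: "\<And>A. A \<in> sets M \<Longrightarrow> \<bar>\<integral>x. indicator A x * k x \<partial>M\<bar> \<le> \<epsilon>"
    and f: "f \<in> borel_measurable M" "\<And>x. x \<in> space M \<Longrightarrow> 0 \<le> f x \<and> f x \<le> 1"
  shows "\<bar>\<integral>x. f x * k x \<partial>M\<bar> \<le> \<epsilon>"
proof -
  have int: "integrable M (\<lambda>x. g x * k x)"
    if "g \<in> borel_measurable M" "\<And>x. x \<in> space M \<Longrightarrow> \<bar>g x\<bar> \<le> 1" for g
  proof (rule integrable_bounded[where C="1 * C"])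
    show "\<bar>g x * k x\<bar> \<le> 1 * C" if "x \<in> space M" for x
      unfolding abs_mult using that \<open>\<And>x. x \<in> space M \<Longrightarrow> \<bar>g x\<bar> \<le> 1\<close> k(2) by (intro mult_mono) auto
  qed (use that k in measurable)
  \<comment> \<open>Among weights with values in [0,1] the integral is largest for the indicator of
    \<open>?A\<close> and smallest for that of \<open>?B\<close>.\<close>
  let ?A = "{x \<in> space M. 0 < k x}" and ?B = "{x \<in> space M. k x < 0}"
  have AB: "?A \<in> sets M" "?B \<in> sets M" using k(1) by measurable
  have fi: "integrable M (\<lambda>x. f x * k x)" using f by (intro int) auto
  have "(\<integral>x. f x * k x \<partial>M) \<le> (\<integral>x. indicator ?A x * k x \<partial>M)"
  proof (rule integral_mono[OF fi int])
    fix x assume x: "x \<in> space M"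
    show "f x * k x \<le> indicator ?A x * k x"
      using f(2)[OF x] x by (auto simp: indicator_def mult_le_cancel_right1 mult_nonneg_nonpos)
  qed (use AB in \<open>auto simp: indicator_def\<close>)
  moreover have "(\<integral>x. indicator ?B x * k x \<partial>M) \<le> (\<integral>x. f x * k x \<partial>M)"
  proof (rule integral_mono[OF int fi])
    fix x assume x: "x \<in> space M"
    show "indicator ?B x * k x \<le> f x * k x"
      using f(2)[OF x] x by (auto simp: indicator_def mult_le_cancel_right1 mult_le_cancel_right2)
  qed (use AB in \<open>auto simp: indicator_def\<close>)
  ultimately show ?thesis using le[OF AB(1)] le[OF AB(2)] by linarith
qed

text \<open>The form is linear in each weight separately, so sets may be replaced by [0,1]-valued
  functions first in one variable and then in the other.\<close>

lemma (in prob_space) bilinear_weight_le: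
  assumes D: "D \<in> borel_measurable (M \<Otimes>\<^sub>M M)" "\<And>z. z \<in> space (M \<Otimes>\<^sub>M M) \<Longrightarrow> \<bar>D z\<bar> \<le> (1::real)"
    and le: "\<And>A B. A \<in> sets M \<Longrightarrow> B \<in> sets M \<Longrightarrow> \<bar>\<integral>z. indicator A (fst z) * indicator B (snd z) * D z \<partial>(M \<Otimes>\<^sub>M M)\<bar> \<le> \<epsilon>"
    and f: "f \<in> borel_measurable M" "\<And>x. x \<in> space M \<Longrightarrow> 0 \<le> f x \<and> f x \<le> 1"
    and g: "g \<in> borel_measurable M" "\<And>x. x \<in> space M \<Longrightarrow> 0 \<le> g x \<and> g x \<le> 1"
  shows "\<bar>\<integral>x. \<integral>y. f x * g y * D (x, y) \<partial>M \<partial>M\<bar> \<le> \<epsilon>"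
proof -
  interpret MM: pair_prob_space M M ..
  have bnd: "\<bar>u * v * d\<bar> \<le> 1" if "0 \<le> u" "u \<le> 1" "0 \<le> v" "v \<le> 1" "\<bar>d\<bar> \<le> 1" for u v d :: real
  proof -
    have "\<bar>u * v\<bar> \<le> 1" using that by (auto simp: abs_mult intro!: mult_le_one)
    then show ?thesis unfolding abs_mult[of "u * v"] using that by (intro mult_le_one) auto
  qed
  have intp: "integrable (M \<Otimes>\<^sub>M M) (\<lambda>z. u (fst z) * v (snd z) * D z)"
    if "u \<in> borel_measurable M" "\<And>x. x \<in> space M \<Longrightarrow> 0 \<le> u x \<and> u x \<le> 1"
      "v \<in> borel_measurable M" "\<And>x. x \<in> space M \<Longrightarrow> 0 \<le> v x \<and> v x \<le> 1" for u v
    by (rule MM.integrable_bounded[where C=1]) (use that D in \<open>auto simp: space_pair_measure intro!: bnd\<close>)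
  have slice: "(\<lambda>y. D (x, y)) \<in> borel_measurable M" "(\<lambda>y. D (y, x)) \<in> borel_measurable M" if "x \<in> space M" for x
    using that by (auto intro: measurable_compose[OF measurable_Pair1' D(1)] measurable_compose[OF measurable_Pair2' D(1)])
  have part: "\<bar>\<integral>z. u (fst z) * indicator B (snd z) * D z \<partial>(M \<Otimes>\<^sub>M M)\<bar> \<le> \<epsilon>"
    if B: "B \<in> sets M" and u: "u \<in> borel_measurable M" "\<And>x. x \<in> space M \<Longrightarrow> 0 \<le> u x \<and> u x \<le> 1" for B u
  proof -
    have iter: "(\<integral>z. w (fst z) * indicator B (snd z) * D z \<partial>(M \<Otimes>\<^sub>M M)) = (\<integral>x. w x * (\<integral>y. indicator B y * D (x, y) \<partial>M) \<partial>M)"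
      if w: "w \<in> borel_measurable M" "\<And>x. x \<in> space M \<Longrightarrow> 0 \<le> w x \<and> w x \<le> 1" for w
      using MM.integral_fst'[OF intp[OF w, of "indicator B"]] B by (simp add: mult.assoc indicator_def)
    have "\<bar>\<integral>x. u x * (\<integral>y. indicator B y * D (x, y) \<partial>M) \<partial>M\<bar> \<le> \<epsilon>"
    proof (rule integral_weight_le[OF _ _ _ u])
      show "(\<lambda>x. \<integral>y. indicator B y * D (x, y) \<partial>M) \<in> borel_measurable M"
        using B D(1) by measurable
      show "\<bar>\<integral>y. indicator B y * D (x, y) \<partial>M\<bar> \<le> 1" if x: "x \<in> space M" for x
        by (rule integral_abs_le) (use slice[OF x] D(2) x B in \<open>auto simp: space_pair_measure indicator_def\<close>)
      show "\<bar>\<integral>x. indicator A x * (\<integral>y. indicator B y * D (x, y) \<partial>M) \<partial>M\<bar> \<le> \<epsilon>" if A: "A \<in> sets M" for A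
        using le[OF A B] iter[of "indicator A"] A by (simp add: indicator_def)
    qed
    then show ?thesis using iter[OF u] by simp
  qed
  have iter2: "(\<integral>z. f (fst z) * w (snd z) * D z \<partial>(M \<Otimes>\<^sub>M M)) = (\<integral>y. w y * (\<integral>x. f x * D (x, y) \<partial>M) \<partial>M)"
    if w: "w \<in> borel_measurable M" "\<And>x. x \<in> space M \<Longrightarrow> 0 \<le> w x \<and> w x \<le> 1" for w
  proof -
    have "(\<integral>z. f (fst z) * w (snd z) * D z \<partial>(M \<Otimes>\<^sub>M M)) = (\<integral>y. \<integral>x. f x * w y * D (x, y) \<partial>M \<partial>M)"
      using MM.integral_snd[of "\<lambda>x y. f x * w y * D (x, y)"] intp[OF f w] by (simp add: case_prod_unfold)
    also have "\<dots> = (\<integral>y. w y * (\<integral>x. f x * D (x, y) \<partial>M) \<partial>M)"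
      by (intro Bochner_Integration.integral_cong refl) (simp add: mult_ac flip: integral_mult_right_zero)
    finally show ?thesis .
  qed
  have "\<bar>\<integral>y. g y * (\<integral>x. f x * D (x, y) \<partial>M) \<partial>M\<bar> \<le> \<epsilon>"
  proof (rule integral_weight_le[OF _ _ _ g])
    show "(\<lambda>y. \<integral>x. f x * D (x, y) \<partial>M) \<in> borel_measurable M"
      using f(1) D(1) by measurable
    show "\<bar>\<integral>x. f x * D (x, y) \<partial>M\<bar> \<le> 1" if y: "y \<in> space M" for y
    proof (rule integral_abs_le)
      show "\<bar>f x * D (x, y)\<bar> \<le> 1" if "x \<in> space M" for x
        using bnd[of "f x" 1 "D (x, y)"] f(2)[OF that] D(2)[of "(x, y)"] that y by (simp add: space_pair_measure)
    qed (use slice[OF y] f in measurable)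
    show "\<bar>\<integral>y. indicator A y * (\<integral>x. f x * D (x, y) \<partial>M) \<partial>M\<bar> \<le> \<epsilon>" if A: "A \<in> sets M" for A
      using part[OF A f] iter2[of "indicator A"] A by (simp add: indicator_def)
  qed
  then show ?thesis
    using MM.integral_fst'[OF intp[OF f g]] iter2[OF g] by simp
qed

text \<open>The edges of \<open>F\<close> are switched from V1 to V2 one at a time. For a single
  edge ij, all vertices other than i and j are frozen. No further edge joins i and j, so the
  remaining factors split into a function of the type of i and one of the type of j, and the change
  is a bilinear form bounded by \<epsilon>.\<close>

lemma counting_lemma:
  fixes \<epsilon> :: real
  assumes K: "prob_space K" and V1: "graphon K V1" and V2: "graphon K V2" and F: "pair_graph F"
    and le: "\<And>A B. A \<in> sets K \<Longrightarrow> B \<in> sets K \<Longrightarrow>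
      \<bar>\<integral>z. indicator A (fst z) * indicator B (snd z) * (V1 (fst z) (snd z) - V2 (fst z) (snd z)) \<partial>(K \<Otimes>\<^sub>M K)\<bar> \<le> \<epsilon>"
  shows "\<bar>graphon_density F K V1 - graphon_density F K V2\<bar> \<le> card (graph_edges F) * \<epsilon>"
proof -
  interpret K: prob_space K by fact
  interpret KK: pair_prob_space K K ..
  interpret product_sigma_finite "\<lambda>_. K" by unfold_locales
  let ?V = "pverts F"
  let ?X = "PiM ?V (\<lambda>_. K)"
  interpret X: prob_space ?X by (intro prob_space_PiM K)
  note V = graph_edges_finite[OF F]
  let ?D = "\<lambda>z. V1 (fst z) (snd z) - V2 (fst z) (snd z)"
  have Dm: "?D \<in> borel_measurable (K \<Otimes>\<^sub>M K)"
    by (intro borel_measurable_diff graphon_measurable[OF V1] graphon_measurable[OF V2]) auto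
  have Db: "\<bar>?D z\<bar> \<le> 1" if "z \<in> space (K \<Otimes>\<^sub>M K)" for z
    using graphon_bounds[OF V1, of "fst z" "snd z"] graphon_bounds[OF V2, of "fst z" "snd z"] that
    by (auto simp: space_pair_measure)
  let ?P = "\<lambda>S T x. (\<Prod>e\<in>S. V1 (x (fst e)) (x (snd e))) * (\<Prod>e\<in>T. V2 (x (fst e)) (x (snd e)))"
  have Pm: "?P S T \<in> borel_measurable (PiM I (\<lambda>_. K))"
    and Pb: "x \<in> space (PiM I (\<lambda>_. K)) \<Longrightarrow> 0 \<le> ?P S T x \<and> ?P S T x \<le> 1"
    if "finite S" "finite T" "\<And>e. e \<in> S \<union> T \<Longrightarrow> fst e \<in> I \<and> snd e \<in> I" for S T I x
  proof -
    have S: "\<And>e. e \<in> S \<Longrightarrow> fst e \<in> I \<and> snd e \<in> I" and T: "\<And>e. e \<in> T \<Longrightarrow> fst e \<in> I \<and> snd e \<in> I"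
      using that(3) by auto
    show "?P S T \<in> borel_measurable (PiM I (\<lambda>_. K))"
      by (intro borel_measurable_times prod_edges_measurable_bounded(1)[OF V1 that(1) S]
          prod_edges_measurable_bounded(1)[OF V2 that(2) T])
    assume x: "x \<in> space (PiM I (\<lambda>_. K))"
    show "0 \<le> ?P S T x \<and> ?P S T x \<le> 1"
      using prod_edges_measurable_bounded(2,3)[OF V1 that(1) S x] prod_edges_measurable_bounded(2,3)[OF V2 that(2) T x]
      by (auto intro: mult_le_one)
  qed
  have one: "\<bar>(\<integral>x. (V1 (x (fst e)) (x (snd e)) - V2 (x (fst e)) (x (snd e))) * ?P S T x \<partial>?X)\<bar> \<le> \<epsilon>"
    if e: "e \<in> graph_edges F" "e \<notin> S \<union> T" "S \<union> T \<subseteq> graph_edges F" for e S T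
  proof -
    obtain i j where ij: "e = (i, j)" by (cases e)
    have iV: "i \<in> ?V" "j \<in> ?V" "i < j" using V(3)[OF e(1)] ij by auto
    let ?I = "?V - {i, j}"
    have VI: "?V = insert j (insert i ?I)" using iV by auto
    have fin: "finite S" "finite T" using e(3) V(2) by (auto intro: finite_subset)
    have ends: "fst a \<in> ?V \<and> snd a \<in> ?V \<and> fst a < snd a \<and> a \<noteq> (i, j)" if "a \<in> S \<union> T" for a
      using V(3)[of a] that e ij by blast
    \<comment> \<open>The remaining edges are sorted by whether they meet j. Those that do not meet
      j form the weight for i, those that do form the weight for j.\<close>
    let ?S1 = "{a \<in> S. fst a \<noteq> j \<and> snd a \<noteq> j}" and ?S2 = "{a \<in> S. fst a = j \<or> snd a = j}"
    let ?T1 = "{a \<in> T. fst a \<noteq> j \<and> snd a \<noteq> j}" and ?T2 = "{a \<in> T. fst a = j \<or> snd a = j}"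
    have split: "?P S T x = ?P ?S1 ?T1 x * ?P ?S2 ?T2 x" for x
    proof -
      have "(\<Prod>e\<in>S. V1 (x (fst e)) (x (snd e))) = (\<Prod>e\<in>?S1. V1 (x (fst e)) (x (snd e))) * (\<Prod>e\<in>?S2. V1 (x (fst e)) (x (snd e)))"
        using fin by (subst prod.union_disjoint[symmetric]) (auto intro!: prod.cong)
      moreover have "(\<Prod>e\<in>T. V2 (x (fst e)) (x (snd e))) = (\<Prod>e\<in>?T1. V2 (x (fst e)) (x (snd e))) * (\<Prod>e\<in>?T2. V2 (x (fst e)) (x (snd e)))"
        using fin by (subst prod.union_disjoint[symmetric]) (auto intro!: prod.cong)
      ultimately show ?thesis by simp
    qed
    have Gm: "(\<lambda>x. (V1 (x i) (x j) - V2 (x i) (x j)) * ?P S T x) \<in> borel_measurable ?X"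
      using iV ends fin
      by (intro borel_measurable_times borel_measurable_diff graphon_measurable[OF V1] graphon_measurable[OF V2] Pm
          measurable_component_singleton) auto
    have Gb: "\<bar>(V1 (x i) (x j) - V2 (x i) (x j)) * ?P S T x\<bar> \<le> 1" if "x \<in> space ?X" for x
    proof -
      have d: "\<bar>V1 (x i) (x j) - V2 (x i) (x j)\<bar> \<le> 1"
        using Db[of "(x i, x j)"] that iV by (simp add: space_pair_measure space_PiM PiE_iff)
      have "0 \<le> ?P S T x \<and> ?P S T x \<le> 1" using ends by (intro Pb[OF fin _ that]) blast
      then have p: "\<bar>?P S T x\<bar> \<le> 1" by (subst abs_of_nonneg) blast+
      show ?thesis
        unfolding abs_mult[of "V1 (x i) (x j) - V2 (x i) (x j)"] by (rule mult_le_one[OF d abs_ge_zero p])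
    qed
    have Gi: "integrable ?X (\<lambda>x. (V1 (x i) (x j) - V2 (x i) (x j)) * ?P S T x)"
      by (rule X.integrable_bounded[OF Gm Gb])
    define G where "G x = (V1 (x i) (x j) - V2 (x i) (x j)) * ?P S T x" for x
    note Gm = Gm[folded G_def] and Gb = Gb[folded G_def] and Gi = Gi[folded G_def]
    let ?h = "\<lambda>x. \<integral>y. (\<integral>z. G (x(i := y, j := z)) \<partial>K) \<partial>K"
    interpret XI: prob_space "PiM ?I (\<lambda>_. K)" by (intro prob_space_PiM K)
    interpret XJ: prob_space "PiM (insert i ?I) (\<lambda>_. K)" by (intro prob_space_PiM K)
    have upd: "x(i := y, j := z) \<in> space ?X" if "x \<in> space (PiM ?I (\<lambda>_. K))" "y \<in> space K" "z \<in> space K" for x y z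
      using that iV by (auto simp: space_PiM PiE_iff extensional_def)
    have um: "(\<lambda>p. (fst (fst p))(i := snd (fst p), j := snd p)) \<in> measurable ((PiM ?I (\<lambda>_. K) \<Otimes>\<^sub>M K) \<Otimes>\<^sub>M K) ?X"
    proof (rule measurable_fun_upd[where J="insert i ?I"])
      show "(\<lambda>p. (fst (fst p))(i := snd (fst p))) \<in> measurable ((PiM ?I (\<lambda>_. K) \<Otimes>\<^sub>M K) \<Otimes>\<^sub>M K) (PiM (insert i ?I) (\<lambda>_. K))"
        by (rule measurable_fun_upd[where J="?I"]) auto
    qed (use VI in auto)
    have updm: "(\<lambda>w. x(i := fst w, j := snd w)) \<in> measurable (K \<Otimes>\<^sub>M K) ?X" if x: "x \<in> space (PiM ?I (\<lambda>_. K))" for x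
    proof -
      have "(\<lambda>w. ((x, fst w), snd w)) \<in> measurable (K \<Otimes>\<^sub>M K) ((PiM ?I (\<lambda>_. K) \<Otimes>\<^sub>M K) \<Otimes>\<^sub>M K)"
        using x by measurable
      from measurable_compose[OF this um] show ?thesis by simp
    qed
    have inner: "\<bar>?h x\<bar> \<le> \<epsilon>" if x: "x \<in> space (PiM ?I (\<lambda>_. K))" for x
    proof -
      \<comment> \<open>An arbitrary value for the vertex on which a factor does not depend: edges
        in the second group end in j, and their other end is not i, because ij itself is not among
        them.\<close>
      obtain k0 where k0: "k0 \<in> space K" using K.not_empty by auto
      let ?f = "\<lambda>y. ?P ?S1 ?T1 (x(i := y, j := k0))" and ?g = "\<lambda>z. ?P ?S2 ?T2 (x(i := k0, j := z))"
      have fg: "?P S T (x(i := y, j := z)) = ?f y * ?g z" for y z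
      proof -
        have "?P ?S1 ?T1 (x(i := y, j := z)) = ?f y"
          by (intro arg_cong2[where f="(*)"] prod.cong) auto
        moreover have "?P ?S2 ?T2 (x(i := y, j := z)) = ?g z"
          using ends iV(3) by (intro arg_cong2[where f="(*)"] prod.cong refl) fastforce+
        ultimately show ?thesis unfolding split by simp
      qed
      have ym: "(\<lambda>y. x(i := y, j := k0)) \<in> measurable K ?X"
        using measurable_compose[OF measurable_Pair2'[OF k0] updm[OF x]] by simp
      have zm: "(\<lambda>z. x(i := k0, j := z)) \<in> measurable K ?X"
        using measurable_compose[OF measurable_Pair1'[OF k0] updm[OF x]] by simp
      have fm: "?f \<in> borel_measurable K"
        by (rule measurable_compose[OF ym Pm]) (use fin ends in auto)
      have gm: "?g \<in> borel_measurable K"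
        by (rule measurable_compose[OF zm Pm]) (use fin ends in auto)
      have fb: "0 \<le> ?f y \<and> ?f y \<le> 1" if "y \<in> space K" for y
        by (rule Pb[OF _ _ _ upd[OF x that k0]]) (use fin ends in auto)
      have gb: "0 \<le> ?g z \<and> ?g z \<le> 1" if "z \<in> space K" for z
        by (rule Pb[OF _ _ _ upd[OF x k0 that]]) (use fin ends in auto)
      have "\<bar>\<integral>y. \<integral>z. ?f y * ?g z * ?D (y, z) \<partial>K \<partial>K\<bar> \<le> \<epsilon>"
        by (rule K.bilinear_weight_le[OF Dm Db le fm fb gm gb])
      moreover have "(\<integral>y. \<integral>z. ?f y * ?g z * ?D (y, z) \<partial>K \<partial>K) = ?h x"
      proof (intro Bochner_Integration.integral_cong refl)
        fix y z
        have "(x(i := y, j := z)) i = y" "(x(i := y, j := z)) j = z" using iV(3) by auto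
        then show "?f y * ?g z * ?D (y, z) = G (x(i := y, j := z))"
          unfolding G_def fg fst_conv snd_conv by (simp only: mult.commute)
      qed
      ultimately show ?thesis by simp
    qed
    have i: "i \<notin> ?I" and j: "j \<notin> insert i ?I" using iV(3) by auto
    have jm: "(\<lambda>p. (fst p)(j := snd p)) \<in> measurable (PiM (insert i ?I) (\<lambda>_. K) \<Otimes>\<^sub>M K) ?X"
      by (rule measurable_fun_upd[where J="insert i ?I"]) (use VI in auto)
    have "(\<integral>x. G x \<partial>?X) = (\<integral>x. G x \<partial>(PiM (insert j (insert i ?I)) (\<lambda>_. K)))" using VI by simp
    also have "\<dots> = (\<integral>x. (\<integral>z. G (x(j := z)) \<partial>K) \<partial>(PiM (insert i ?I) (\<lambda>_. K)))"
      using Gi VI V(1) j by (intro product_integral_insert) auto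
    also have "\<dots> = (\<integral>x. ?h x \<partial>(PiM ?I (\<lambda>_. K)))"
    proof (rule product_integral_insert[OF _ i])
      show "integrable (PiM (insert i ?I) (\<lambda>_. K)) (\<lambda>x. \<integral>z. G (x(j := z)) \<partial>K)"
      proof (rule XJ.integrable_bounded)
        show "(\<lambda>x. \<integral>z. G (x(j := z)) \<partial>K) \<in> borel_measurable (PiM (insert i ?I) (\<lambda>_. K))"
          using measurable_compose[OF jm Gm] by (intro K.borel_measurable_lebesgue_integral) (simp add: case_prod_unfold)
        fix x assume x: "x \<in> space (PiM (insert i ?I) (\<lambda>_. K))"
        have "(\<lambda>z. (x, z)) \<in> measurable K (PiM (insert i ?I) (\<lambda>_. K) \<Otimes>\<^sub>M K)" using x by simp
        from measurable_compose[OF measurable_compose[OF this jm] Gm]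
        show "\<bar>\<integral>z. G (x(j := z)) \<partial>K\<bar> \<le> 1"
        proof (intro K.integral_abs_le)
          fix z assume "z \<in> space K"
          then have "x(j := z) \<in> space ?X" using x iV by (auto simp: space_PiM PiE_iff extensional_def)
          then show "\<bar>G (x(j := z))\<bar> \<le> 1" by (rule Gb)
        qed simp
      qed
    qed (use V(1) in auto)
    also have "\<bar>\<dots>\<bar> \<le> \<epsilon>"
    proof (rule XI.integral_abs_le[OF _ inner])
      have "(\<lambda>p. \<integral>z. G ((fst p)(i := snd p, j := z)) \<partial>K) \<in> borel_measurable (PiM ?I (\<lambda>_. K) \<Otimes>\<^sub>M K)"
        using measurable_compose[OF um Gm] by (intro K.borel_measurable_lebesgue_integral) (simp add: case_prod_unfold)
      then show "?h \<in> borel_measurable (PiM ?I (\<lambda>_. K))"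
        by (intro K.borel_measurable_lebesgue_integral) (simp add: case_prod_unfold)
    qed
    finally show ?thesis by (simp add: ij G_def)
  qed
  \<comment> \<open>Hybrid argument: \<open>S\<close> holds the edges still weighted by V1 and
    \<open>T\<close> those already weighted by V2.\<close>
  have steps: "\<bar>(\<integral>x. ?P S T x \<partial>?X) - (\<integral>x. ?P {} (S \<union> T) x \<partial>?X)\<bar> \<le> card S * \<epsilon>"
    if "finite S" "S \<inter> T = {}" "S \<union> T \<subseteq> graph_edges F" for S T
    using that
  proof (induction S arbitrary: T rule: finite_induct)
    case (insert e S)
    have fT: "finite T" using insert.prems V(2) by (auto intro: finite_subset)
    have eT: "e \<notin> T" using insert.prems by auto
    have IH: "\<bar>(\<integral>x. ?P S (insert e T) x \<partial>?X) - (\<integral>x. ?P {} (S \<union> insert e T) x \<partial>?X)\<bar> \<le> card S * \<epsilon>"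
      using insert.prems insert.hyps by (intro insert.IH) auto
    have int: "integrable ?X (?P A B)" if "A \<union> B \<subseteq> insert e S \<union> T" for A B
    proof -
      have AB: "finite A" "finite B" "\<And>a. a \<in> A \<union> B \<Longrightarrow> fst a \<in> ?V \<and> snd a \<in> ?V"
      proof -
        have sub: "A \<union> B \<subseteq> graph_edges F" using that insert.prems(2) by blast
        then show "finite A" "finite B" using V(2) by (auto intro: finite_subset)
        show "fst a \<in> ?V \<and> snd a \<in> ?V" if "a \<in> A \<union> B" for a
          using V(3)[of a] that sub by blast
      qed
      show ?thesis
        by (rule X.integrable_bounded[where C=1, OF Pm[OF AB]]) (use Pb[OF AB] in auto)
    qed
    have "(\<integral>x. ?P (insert e S) T x \<partial>?X) - (\<integral>x. ?P S (insert e T) x \<partial>?X) =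
        (\<integral>x. ?P (insert e S) T x - ?P S (insert e T) x \<partial>?X)"
      by (rule Bochner_Integration.integral_diff[symmetric]) (rule int, auto)+
    also have "\<dots> = (\<integral>x. (V1 (x (fst e)) (x (snd e)) - V2 (x (fst e)) (x (snd e))) * ?P S T x \<partial>?X)"
      using insert.hyps fT eT by (intro Bochner_Integration.integral_cong refl) (simp add: algebra_simps)
    finally have "\<bar>(\<integral>x. ?P (insert e S) T x \<partial>?X) - (\<integral>x. ?P S (insert e T) x \<partial>?X)\<bar> \<le> \<epsilon>"
      using one[of e S T] insert.prems insert.hyps eT by auto
    with IH have "\<bar>(\<integral>x. ?P (insert e S) T x \<partial>?X) - (\<integral>x. ?P {} (S \<union> insert e T) x \<partial>?X)\<bar> \<le> card S * \<epsilon> + \<epsilon>"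
      by linarith
    then show ?case using insert.hyps by (simp add: algebra_simps)
  qed simp
  from steps[of "graph_edges F" "{}"] V(2) show ?thesis by (simp add: graphon_density_alt)
qed


section \<open>The cut distance and couplings\<close>

lemma couplingsD:
  assumes "P \<in> couplings M1 M2"
  shows "prob_space P" "sets P = sets (M1 \<Otimes>\<^sub>M M2)"
    "measure_preserving P M1 fst" "measure_preserving P M2 snd"
proof -
  show P: "prob_space P" "sets P = sets (M1 \<Otimes>\<^sub>M M2)" using assms by (auto simp: couplings_def)
  show "measure_preserving P M1 fst" "measure_preserving P M2 snd"
    using assms unfolding measure_preserving_def measurable_cong_sets[OF P(2) refl]
    by (auto simp: couplings_def)
qed

lemma cut_integral_eq:
  fixes W1 :: "'a \<Rightarrow> 'a \<Rightarrow> real" and W2 :: "'b \<Rightarrow> 'b \<Rightarrow> real"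
  shows "(LINT ((x1, x2), (y1, y2)) : A \<times> B | P \<Otimes>\<^sub>M P. W1 x1 y1 - W2 x2 y2) =
    (\<integral>z. indicator A (fst z) * indicator B (snd z) *
      (W1 (fst (fst z)) (fst (snd z)) - W2 (snd (fst z)) (snd (snd z))) \<partial>(P \<Otimes>\<^sub>M P))"
  unfolding set_lebesgue_integral_def
  by (rule Bochner_Integration.integral_cong) (auto simp: indicator_def)

context
  fixes M1 :: "'a measure" and M2 :: "'b measure"
    and W1 :: "'a \<Rightarrow> 'a \<Rightarrow> real" and W2 :: "'b \<Rightarrow> 'b \<Rightarrow> real"
  assumes W: "graphon M1 W1" "graphon M2 W2"
begin

abbreviation "cut_value P \<equiv> \<lambda>(A, B). \<bar>LINT ((x1, x2), (y1, y2)) : A \<times> B | P \<Otimes>\<^sub>M P. W1 x1 y1 - W2 x2 y2\<bar>"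

lemma cut_value_bounds:
  assumes P: "P \<in> couplings M1 M2" and AB: "p \<in> sets (M1 \<Otimes>\<^sub>M M2) \<times> sets (M1 \<Otimes>\<^sub>M M2)"
  shows "cut_value P p \<le> 1"
proof -
  note P' = couplingsD[OF P]
  interpret P: prob_space P by (rule P'(1))
  interpret PP: pair_prob_space P P ..
  obtain A B where p: "p = (A, B)" and AB: "A \<in> sets P" "B \<in> sets P" using AB P'(2) by auto
  have m: "fst \<in> measurable P M1" "snd \<in> measurable P M2" using P'(3,4) by (auto simp: measure_preserving_def)
  have Dm: "(\<lambda>z. W1 (fst (fst z)) (fst (snd z)) - W2 (snd (fst z)) (snd (snd z))) \<in> borel_measurable (P \<Otimes>\<^sub>M P)"
    by (intro borel_measurable_diff graphon_measurable[OF W(1)] graphon_measurable[OF W(2)]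
        measurable_compose[OF _ m(1)] measurable_compose[OF _ m(2)]) auto
  have "\<bar>\<integral>z. indicator A (fst z) * indicator B (snd z) *
      (W1 (fst (fst z)) (fst (snd z)) - W2 (snd (fst z)) (snd (snd z))) \<partial>(P \<Otimes>\<^sub>M P)\<bar> \<le> 1"
  proof (rule PP.integral_abs_le)
    show "(\<lambda>z. indicator A (fst z) * indicator B (snd z) *
      (W1 (fst (fst z)) (fst (snd z)) - W2 (snd (fst z)) (snd (snd z)))) \<in> borel_measurable (P \<Otimes>\<^sub>M P)"
      using AB Dm by measurable
    fix z assume "z \<in> space (P \<Otimes>\<^sub>M P)"
    then have z: "fst (fst z) \<in> space M1" "fst (snd z) \<in> space M1" "snd (fst z) \<in> space M2" "snd (snd z) \<in> space M2"
      using measurable_space[OF m(1)] measurable_space[OF m(2)] by (auto simp: space_pair_measure)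
    show "\<bar>indicator A (fst z) * indicator B (snd z) *
      (W1 (fst (fst z)) (fst (snd z)) - W2 (snd (fst z)) (snd (snd z)))\<bar> \<le> 1"
      using graphon_bounds[OF W(1) z(1,2)] graphon_bounds[OF W(2) z(3,4)] by (auto simp: indicator_def)
  qed
  then show ?thesis by (simp add: p cut_integral_eq)
qed

lemma cut_value_bdd:
  assumes "P \<in> couplings M1 M2"
  shows "bdd_above (cut_value P ` (sets (M1 \<Otimes>\<^sub>M M2) \<times> sets (M1 \<Otimes>\<^sub>M M2)))"
  by (rule bdd_aboveI2) (rule cut_value_bounds[OF assms])

lemma cut_sup_nonneg:
  assumes "P \<in> couplings M1 M2"
  shows "0 \<le> (SUP p\<in>sets (M1 \<Otimes>\<^sub>M M2) \<times> sets (M1 \<Otimes>\<^sub>M M2). cut_value P p)"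
  by (rule cSUP_upper2[OF cut_value_bdd[OF assms], of "({}, {})"]) auto

text \<open>A coupling with small cut value is a common space for both graphons. Pulled back to it
  they are close in cut norm, so the counting lemma applies, and pullbacks do not change
  densities.\<close>

lemma same_densities_of_cut_distance:
  assumes M: "prob_space M1" "prob_space M2" and cut: "cut_distance M1 W1 M2 W2 = 0"
  shows "same_densities M1 W1 M2 W2"
  unfolding same_densities_def
proof (intro allI impI)
  fix F :: ngraph assume F: "pair_graph F"
  interpret M1: prob_space M1 by fact
  interpret M2: prob_space M2 by fact
  interpret MM: pair_prob_space M1 M2 ..
  \<comment> \<open>The product coupling shows that the infimum is over a nonempty set; only then
    does its vanishing produce good couplings.\<close>
  have "M1 \<Otimes>\<^sub>M M2 \<in> couplings M1 M2"
  proof -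
    have "distr (M1 \<Otimes>\<^sub>M M2) M1 fst = M1" by (rule M2.distr_pair_fst)
    moreover have "distr (M1 \<Otimes>\<^sub>M M2) M2 snd = M2"
    proof (rule measure_eqI)
      fix A assume "A \<in> sets (distr (M1 \<Otimes>\<^sub>M M2) M2 snd)"
      then have A: "A \<in> sets M2" by simp
      have "snd -` A \<inter> space (M1 \<Otimes>\<^sub>M M2) = space M1 \<times> A"
        using sets.sets_into_space[OF A] by (auto simp: space_pair_measure)
      then show "emeasure (distr (M1 \<Otimes>\<^sub>M M2) M2 snd) A = emeasure M2 A"
        using A by (simp add: emeasure_distr M2.emeasure_pair_measure_Times M1.emeasure_space_1)
    qed simp
    ultimately show ?thesis using MM.prob_space_axioms by (simp add: couplings_def)
  qed
  then have ne: "couplings M1 M2 \<noteq> {}" by blast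
  let ?S = "sets (M1 \<Otimes>\<^sub>M M2)"
  have close: "\<bar>graphon_density F M1 W1 - graphon_density F M2 W2\<bar> \<le> card (graph_edges F) * \<epsilon>" if "0 < \<epsilon>" for \<epsilon> :: real
  proof -
    have "(INF P\<in>couplings M1 M2. SUP p\<in>?S \<times> ?S. cut_value P p) < \<epsilon>"
      using cut that by (simp add: cut_distance_def)
    from cInf_lessD[OF _ this] ne obtain P where P: "P \<in> couplings M1 M2" "(SUP p\<in>?S \<times> ?S. cut_value P p) < \<epsilon>"
      by auto
    note P' = couplingsD[OF P(1)]
    have m: "fst \<in> measurable P M1" "snd \<in> measurable P M2" using P'(3,4) by (auto simp: measure_preserving_def)
    have "\<bar>graphon_density F P (\<lambda>x y. W1 (fst x) (fst y)) - graphon_density F P (\<lambda>x y. W2 (snd x) (snd y))\<bar> \<le> card (graph_edges F) * \<epsilon>"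
    proof (rule counting_lemma[OF P'(1) graphon_pullback[OF W(1) m(1)] graphon_pullback[OF W(2) m(2)] F])
      fix A B assume "A \<in> sets P" "B \<in> sets P"
      then have "cut_value P (A, B) \<le> (SUP p\<in>?S \<times> ?S. cut_value P p)"
        by (intro cSUP_upper cut_value_bdd P) (simp add: P'(2))
      then show "\<bar>\<integral>z. indicator A (fst z) * indicator B (snd z) *
        (W1 (fst (fst z)) (fst (snd z)) - W2 (snd (fst z)) (snd (snd z))) \<partial>(P \<Otimes>\<^sub>M P)\<bar> \<le> \<epsilon>"
        using P(2) by (simp add: cut_integral_eq)
    qed
    then show ?thesis
      by (simp add: graphon_density_pullback[OF P'(1) W(1) P'(3) F] graphon_density_pullback[OF P'(1) W(2) P'(4) F])
  qed
  have "\<bar>graphon_density F M1 W1 - graphon_density F M2 W2\<bar> \<le> 0"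
  proof (rule field_le_epsilon)
    fix e :: real assume e: "0 < e"
    let ?c = "real (card (graph_edges F)) + 1"
    have "\<bar>graphon_density F M1 W1 - graphon_density F M2 W2\<bar> \<le> card (graph_edges F) * (e / ?c)"
      by (rule close) (use e in simp)
    also have "\<dots> \<le> e" using e by (simp add: field_simps)
    finally show "\<bar>graphon_density F M1 W1 - graphon_density F M2 W2\<bar> \<le> 0 + e" by simp
  qed
  then show "graphon_density F M1 W1 = graphon_density F M2 W2" by simp
qed

text \<open>The joint law of the two maps is a coupling under which the integrand vanishes almost
  everywhere, so the infimum is attained with value 0.\<close>

lemma cut_distance_eq_0:
  assumes K: "prob_space K" and \<phi>: "measure_preserving K M1 \<phi>1" "measure_preserving K M2 \<phi>2"
    and eq: "AE z in K \<Otimes>\<^sub>M K. W1 (\<phi>1 (fst z)) (\<phi>1 (snd z)) = W2 (\<phi>2 (fst z)) (\<phi>2 (snd z))"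
  shows "cut_distance M1 W1 M2 W2 = 0"
proof -
  interpret K: prob_space K by fact
  let ?S = "sets (M1 \<Otimes>\<^sub>M M2)"
  have m: "\<phi>1 \<in> measurable K M1" "\<phi>2 \<in> measurable K M2" using \<phi> by (auto simp: measure_preserving_def)
  define P where "P = distr K (M1 \<Otimes>\<^sub>M M2) (\<lambda>k. (\<phi>1 k, \<phi>2 k))"
  have jm: "(\<lambda>k. (\<phi>1 k, \<phi>2 k)) \<in> measurable K (M1 \<Otimes>\<^sub>M M2)" using m by measurable
  interpret P: prob_space P unfolding P_def by (rule K.prob_space_distr[OF jm])
  have P: "P \<in> couplings M1 M2"
    unfolding couplings_def using P.prob_space_axioms \<phi> jm
    by (auto simp: P_def measure_preserving_def distr_distr comp_def)
  note P' = couplingsD[OF P]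
  have mP: "fst \<in> measurable P M1" "snd \<in> measurable P M2" using P'(3,4) by (auto simp: measure_preserving_def)
  let ?D = "\<lambda>z. W1 (fst (fst z)) (fst (snd z)) - W2 (snd (fst z)) (snd (snd z))"
  have Dm: "?D \<in> borel_measurable (P \<Otimes>\<^sub>M P)"
    by (intro borel_measurable_diff graphon_measurable[OF W(1)] graphon_measurable[OF W(2)]
        measurable_compose[OF _ mP(1)] measurable_compose[OF _ mP(2)]) auto
  have PP: "P \<Otimes>\<^sub>M P = distr (K \<Otimes>\<^sub>M K) ((M1 \<Otimes>\<^sub>M M2) \<Otimes>\<^sub>M (M1 \<Otimes>\<^sub>M M2)) (\<lambda>(u, v). ((\<phi>1 u, \<phi>2 u), (\<phi>1 v, \<phi>2 v)))"
    unfolding P_def by (rule pair_measure_distr[OF jm jm]) (rule P.sigma_finite_measure_axioms[unfolded P_def])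
  have jjm: "(\<lambda>(u, v). ((\<phi>1 u, \<phi>2 u), (\<phi>1 v, \<phi>2 v))) \<in> measurable (K \<Otimes>\<^sub>M K) ((M1 \<Otimes>\<^sub>M M2) \<Otimes>\<^sub>M (M1 \<Otimes>\<^sub>M M2))"
    using jm by measurable
  have sPP: "sets (P \<Otimes>\<^sub>M P) = sets ((M1 \<Otimes>\<^sub>M M2) \<Otimes>\<^sub>M (M1 \<Otimes>\<^sub>M M2))" by (intro sets_pair_measure_cong P'(2))
  have "{z \<in> space ((M1 \<Otimes>\<^sub>M M2) \<Otimes>\<^sub>M (M1 \<Otimes>\<^sub>M M2)). ?D z = 0} \<in> sets ((M1 \<Otimes>\<^sub>M M2) \<Otimes>\<^sub>M (M1 \<Otimes>\<^sub>M M2))"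
    using Dm unfolding measurable_cong_sets[OF sPP refl] by measurable
  then have AED: "AE z in P \<Otimes>\<^sub>M P. ?D z = 0"
    unfolding PP using eq by (subst AE_distr_iff[OF jjm]) (auto simp: case_prod_unfold)
  have zero: "cut_value P p = 0" for p
  proof -
    obtain A B where p: "p = (A, B)" by (cases p)
    have "(\<integral>z. indicator A (fst z) * indicator B (snd z) * ?D z \<partial>(P \<Otimes>\<^sub>M P)) = 0"
      by (rule integral_eq_zero_AE) (use AED in eventually_elim, simp)
    then show ?thesis by (simp add: p cut_integral_eq)
  qed
  have "(INF P\<in>couplings M1 M2. SUP p\<in>?S \<times> ?S. cut_value P p) \<le> 0"
  proof (rule cINF_lower2[OF _ P])
    show "bdd_below ((\<lambda>P. SUP p\<in>?S \<times> ?S. cut_value P p) ` couplings M1 M2)"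
      by (rule bdd_belowI2[of _ 0]) (rule cut_sup_nonneg)
    show "(SUP p\<in>?S \<times> ?S. cut_value P p) \<le> 0"
    proof (rule cSUP_least)
      show "?S \<times> ?S \<noteq> {}" using sets.top by blast
    qed (rule order_eq_refl[OF zero])
  qed
  moreover have "0 \<le> (INF P\<in>couplings M1 M2. SUP p\<in>?S \<times> ?S. cut_value P p)"
    using P by (intro cINF_greatest cut_sup_nonneg) auto
  ultimately show ?thesis by (simp add: cut_distance_def)
qed

end

section \<open>Graph limits\<close>

lemma integral_prod_reindex:
  assumes M: "prob_space M" and W: "graphon M W" and \<phi>: "inj_on \<phi> V" "\<phi> ` V \<subseteq> I"
    and S: "finite S" "\<And>e. e \<in> S \<Longrightarrow> fst e \<in> V \<and> snd e \<in> V"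
  shows "(\<integral>x. (\<Prod>e\<in>S. W (x (\<phi> (fst e))) (x (\<phi> (snd e)))) \<partial>(PiM I (\<lambda>_. M))) =
    (\<integral>x. (\<Prod>e\<in>S. W (x (fst e)) (x (snd e))) \<partial>(PiM V (\<lambda>_. M)))"
proof -
  let ?r = "\<lambda>x. \<lambda>v\<in>V. x (\<phi> v)"
  have d: "distr (PiM I (\<lambda>_. M)) (PiM V (\<lambda>_. M)) ?r = PiM V (\<lambda>_. M)"
    using distr_PiM_reindex[of I "\<lambda>_. M" \<phi> V] M \<phi> by auto
  have m: "?r \<in> measurable (PiM I (\<lambda>_. M)) (PiM V (\<lambda>_. M))"
    using \<phi>(2) by (intro measurable_restrict measurable_component_singleton) auto
  have "(\<integral>x. (\<Prod>e\<in>S. W (x (fst e)) (x (snd e))) \<partial>(PiM V (\<lambda>_. M))) =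
      (\<integral>x. (\<Prod>e\<in>S. W (?r x (fst e)) (?r x (snd e))) \<partial>(PiM I (\<lambda>_. M)))"
    using integral_distr[OF m prod_edges_measurable_bounded(1)[OF W S]] unfolding d .
  also have "\<dots> = (\<integral>x. (\<Prod>e\<in>S. W (x (\<phi> (fst e))) (x (\<phi> (snd e)))) \<partial>(PiM I (\<lambda>_. M)))"
    by (intro Bochner_Integration.integral_cong prod.cong refl) (use S(2) in auto)
  finally show ?thesis ..
qed

text \<open>The endpoints are sorted again because a vertex map need not be monotone, while edges
  are encoded as increasing pairs.\<close>

definition edge_image :: "(nat \<Rightarrow> nat) \<Rightarrow> nat \<times> nat \<Rightarrow> nat \<times> nat" where
  "edge_image f e = (min (f (fst e)) (f (snd e)), max (f (fst e)) (f (snd e)))"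

definition sample_to_graph :: "nat \<Rightarrow> (nat \<times> nat \<Rightarrow> bool) \<Rightarrow> ngraph" where
  "sample_to_graph n g = symmetric_graph {..<n} {e \<in> vertex_pairs n. g e}"

lemma sample_to_graph:
  "pair_graph (sample_to_graph n g)" "pverts (sample_to_graph n g) = {..<n}"
  "parcs (sample_to_graph n g) = {e \<in> vertex_pairs n. g e} \<union> {e \<in> vertex_pairs n. g e}\<inverse>"
proof -
  have S: "{e \<in> vertex_pairs n. g e} \<subseteq> {(i, j). i \<in> {..<n} \<and> j \<in> {..<n} \<and> i < j}"
    by (auto simp: vertex_pairs_def)
  show "pair_graph (sample_to_graph n g)" "pverts (sample_to_graph n g) = {..<n}"
    "parcs (sample_to_graph n g) = {e \<in> vertex_pairs n. g e} \<union> {e \<in> vertex_pairs n. g e}\<inverse>"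
    unfolding sample_to_graph_def by (rule symmetric_graph[OF finite_lessThan S])+ (simp add: symmetric_graph_def)
qed

context
  fixes F :: ngraph and n :: nat
  assumes F: "pair_graph F"
begin

abbreviation "hom_ind f g \<equiv> (\<Prod>e\<in>edge_image f ` graph_edges F. of_bool (g e) :: real)"

lemma edge_image_props:
  assumes f: "f \<in> pverts F \<rightarrow>\<^sub>E {..<n}" "inj_on f (pverts F)"
  shows "edge_image f ` graph_edges F \<subseteq> vertex_pairs n" "inj_on (edge_image f) (graph_edges F)"
proof -
  note V = graph_edges_finite[OF F]
  have ne: "f (fst e) \<noteq> f (snd e)" "f (fst e) < n" "f (snd e) < n" if "e \<in> graph_edges F" for e
    using V(3)[OF that] f by (auto simp: inj_on_def)
  then show "edge_image f ` graph_edges F \<subseteq> vertex_pairs n"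
    by (fastforce simp: edge_image_def vertex_pairs_def min_def max_def)
  show "inj_on (edge_image f) (graph_edges F)"
  proof (rule inj_onI)
    fix e e' assume e: "e \<in> graph_edges F" "e' \<in> graph_edges F" "edge_image f e = edge_image f e'"
    have "{f (fst e), f (snd e)} = {f (fst e'), f (snd e')}"
      using e(3) by (auto simp: edge_image_def min_def max_def split: if_splits)
    then have "f ` {fst e, snd e} = f ` {fst e', snd e'}" by simp
    then have "{fst e, snd e} = {fst e', snd e'}"
      using V(3)[OF e(1)] V(3)[OF e(2)] by (subst (asm) inj_on_image_eq_iff[OF f(2)]) auto
    then show "e = e'" using V(3)[OF e(1)] V(3)[OF e(2)] by (auto simp: doubleton_eq_iff prod_eq_iff)
  qed
qed

lemma hom_indicator:
  assumes f: "f \<in> pverts F \<rightarrow>\<^sub>E {..<n}" "inj_on f (pverts F)"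
  shows "of_bool (f \<in> graph_homs F (sample_to_graph n g)) = hom_ind f g"
proof -
  interpret pair_graph F by (rule F)
  note V = graph_edges_finite[OF F]
  have sym: "(j, i) \<in> parcs F" if "(i, j) \<in> parcs F" for i j
    using pair_sym_arcs that by (auto simp: symmetric_def sym_def)
  have "f \<in> graph_homs F (sample_to_graph n g) \<longleftrightarrow> (\<forall>(i, j)\<in>parcs F. (f i, f j) \<in> parcs (sample_to_graph n g))"
    using f(1) by (auto simp: graph_homs_def sample_to_graph)
  also have "\<dots> \<longleftrightarrow> (\<forall>e\<in>graph_edges F. (f (fst e), f (snd e)) \<in> parcs (sample_to_graph n g))"
  proof safe
    fix a b assume *: "\<forall>e\<in>graph_edges F. (f (fst e), f (snd e)) \<in> parcs (sample_to_graph n g)"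
      and ab: "(a, b) \<in> parcs F"
    have "a \<noteq> b" using pair_no_loops[OF ab] by simp
    then consider "a < b" | "b < a" by linarith
    then show "(f a, f b) \<in> parcs (sample_to_graph n g)"
    proof cases
      case 1 then have "(a, b) \<in> graph_edges F" using ab by (simp add: graph_edges_def)
      with * show ?thesis by fastforce
    next
      case 2 then have "(b, a) \<in> graph_edges F" using sym[OF ab] by (simp add: graph_edges_def)
      with * have "(f b, f a) \<in> parcs (sample_to_graph n g)" by fastforce
      then show ?thesis by (auto simp: sample_to_graph(3))
    qed
  qed (auto simp: graph_edges_def)
  also have "\<dots> \<longleftrightarrow> (\<forall>e\<in>graph_edges F. g (edge_image f e))"
  proof (intro ball_cong refl)
    fix e assume e: "e \<in> graph_edges F"
    have "edge_image f e \<in> vertex_pairs n" using edge_image_props(1)[OF f] e by auto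
    then show "(f (fst e), f (snd e)) \<in> parcs (sample_to_graph n g) \<longleftrightarrow> g (edge_image f e)"
      by (auto simp: sample_to_graph(3) edge_image_def vertex_pairs_def min_def max_def split: if_splits)
  qed
  also have "of_bool \<dots> = hom_ind f g"
  proof (cases "\<forall>e\<in>graph_edges F. g (edge_image f e)")
    case True
    then have "hom_ind f g = (\<Prod>e\<in>edge_image f ` graph_edges F. 1)" by (intro prod.cong) auto
    with True show ?thesis by simp
  next
    case False
    then have "hom_ind f g = 0" using V(2) by (intro prod_zero) auto
    with False show ?thesis by auto
  qed
  finally show ?thesis .
qed

lemma hom_density_sample:
  "hom_density F (sample_to_graph n g) =
    (\<Sum>f\<in>pverts F \<rightarrow>\<^sub>E {..<n}. of_bool (f \<in> graph_homs F (sample_to_graph n g))) / real n ^ card (pverts F)"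
proof -
  have fin: "finite (pverts F)" by (rule graph_edges_finite(1)[OF F])
  have "graph_homs F (sample_to_graph n g) \<subseteq> pverts F \<rightarrow>\<^sub>E {..<n}"
    by (auto simp: graph_homs_def sample_to_graph)
  then have "(\<Sum>f\<in>pverts F \<rightarrow>\<^sub>E {..<n}. of_bool (f \<in> graph_homs F (sample_to_graph n g)) :: real) =
      card (graph_homs F (sample_to_graph n g))"
    using finite_PiE[OF fin, of "\<lambda>_. {..<n}"] by (simp add: Int_absorb1)
  then show ?thesis by (simp add: hom_density_def sample_to_graph card_PiE fin)
qed

text \<open>Pairs of vertex maps whose homomorphism events need not be independent, or one of which
  is not injective, so that its event may have a probability different from the density.\<close>

definition bad_pairs :: "((nat \<Rightarrow> nat) \<times> (nat \<Rightarrow> nat)) set" where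
  "bad_pairs = {(f, f'). f \<in> pverts F \<rightarrow>\<^sub>E {..<n} \<and> f' \<in> pverts F \<rightarrow>\<^sub>E {..<n} \<and>
     \<not> (inj_on f (pverts F) \<and> inj_on f' (pverts F) \<and> f ` pverts F \<inter> f' ` pverts F = {})}"

text \<open>There are three kinds of coincidence: inside the first map, inside the second one, or
  between them. Each occurs at one of at most m^2 pairs of vertices, with m the number of vertices
  of \<open>F\<close>, and each determines one value from another, which costs a factor n.\<close>

lemma card_bad_pairs:
  "real (card bad_pairs) \<le> 3 * real (card (pverts F)) ^ 2 * real n ^ (2 * card (pverts F) - 1)"
proof -
  let ?V = "pverts F" and ?m = "card (pverts F)"
  let ?T = "?V \<rightarrow>\<^sub>E {..<n}"
  have fin: "finite ?V" by (rule graph_edges_finite(1)[OF F])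
  have finT: "finite ?T" using fin by (intro finite_PiE) auto
  have cT: "card ?T = n ^ ?m" by (simp add: card_PiE fin)
  have cR: "card ((?V - {b}) \<rightarrow>\<^sub>E {..<n}) = n ^ (?m - 1)" if "b \<in> ?V" for b
    using that fin by (simp add: card_PiE)
  have c1: "card {f \<in> ?T. f a = f b} \<le> n ^ (?m - 1)" if ab: "a \<in> ?V" "b \<in> ?V" "a \<noteq> b" for a b
  proof -
    have "inj_on (\<lambda>f. restrict f (?V - {b})) {f \<in> ?T. f a = f b}"
    proof (rule inj_onI)
      fix f f' assume f: "f \<in> {f \<in> ?T. f a = f b}" "f' \<in> {f \<in> ?T. f a = f b}" "restrict f (?V - {b}) = restrict f' (?V - {b})"
      have eq: "f v = f' v" if "v \<in> ?V - {b}" for v using f(3) that by (metis restrict_apply')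
      then have "f b = f' b" using eq[of a] f(1,2) ab by auto
      with eq have "f v = f' v" if "v \<in> ?V" for v using that by (cases "v = b") auto
      then show "f = f'" using f(1,2) by (auto intro: PiE_ext)
    qed
    moreover have "(\<lambda>f. restrict f (?V - {b})) ` {f \<in> ?T. f a = f b} \<subseteq> (?V - {b}) \<rightarrow>\<^sub>E {..<n}"
    proof (rule image_subsetI)
      fix f assume "f \<in> {f \<in> ?T. f a = f b}"
      then have "\<forall>v\<in>?V. f v \<in> {..<n}" by auto
      then show "restrict f (?V - {b}) \<in> (?V - {b}) \<rightarrow>\<^sub>E {..<n}" unfolding restrict_PiE_iff by blast
    qed
    ultimately have "card {f \<in> ?T. f a = f b} \<le> card ((?V - {b}) \<rightarrow>\<^sub>E {..<n})"
      using fin by (intro card_inj_on_le) (auto intro!: finite_PiE)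
    then show ?thesis using cR[OF ab(2)] by simp
  qed
  have c2: "card {p \<in> ?T \<times> ?T. fst p a = snd p b} \<le> n ^ ?m * n ^ (?m - 1)" if ab: "a \<in> ?V" "b \<in> ?V" for a b
  proof -
    let ?r = "\<lambda>p. (fst p, restrict (snd p) (?V - {b}))"
    have "inj_on ?r {p \<in> ?T \<times> ?T. fst p a = snd p b}"
    proof (rule inj_onI)
      fix p q assume p: "p \<in> {p \<in> ?T \<times> ?T. fst p a = snd p b}" "q \<in> {p \<in> ?T \<times> ?T. fst p a = snd p b}" "?r p = ?r q"
      have f: "fst p = fst q" using p(3) by simp
      have eq: "snd p v = snd q v" if "v \<in> ?V - {b}" for v
        using p(3) that by (metis restrict_apply' snd_conv)
      have "snd p b = snd q b" using p(1,2) f by auto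
      with eq have "snd p v = snd q v" if "v \<in> ?V" for v using that by (cases "v = b") auto
      then have "snd p = snd q" using p(1,2) by (intro PiE_ext[of "snd p" ?V "\<lambda>_. {..<n}"]) auto
      with f show "p = q" by (simp add: prod_eq_iff)
    qed
    moreover have "?r ` {p \<in> ?T \<times> ?T. fst p a = snd p b} \<subseteq> ?T \<times> ((?V - {b}) \<rightarrow>\<^sub>E {..<n})"
    proof (rule image_subsetI)
      fix p assume p: "p \<in> {p \<in> ?T \<times> ?T. fst p a = snd p b}"
      then have "\<forall>v\<in>?V. snd p v \<in> {..<n}" by auto
      then have "restrict (snd p) (?V - {b}) \<in> (?V - {b}) \<rightarrow>\<^sub>E {..<n}" unfolding restrict_PiE_iff by blast
      with p show "?r p \<in> ?T \<times> ((?V - {b}) \<rightarrow>\<^sub>E {..<n})" by (simp add: mem_Times_iff)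
    qed
    ultimately have "card {p \<in> ?T \<times> ?T. fst p a = snd p b} \<le> card (?T \<times> ((?V - {b}) \<rightarrow>\<^sub>E {..<n}))"
      using fin finT by (intro card_inj_on_le) (auto intro!: finite_PiE)
    then show ?thesis using cR[OF ab(2)] cT by (simp add: card_cartesian_product)
  qed
  let ?VV = "{p \<in> ?V \<times> ?V. fst p \<noteq> snd p}"
  have cVV: "card ?VV \<le> card (?V \<times> ?V)" using fin by (intro card_mono) auto
  have "bad_pairs \<subseteq> (\<Union>p\<in>?VV. {f \<in> ?T. f (fst p) = f (snd p)} \<times> ?T) \<union> (\<Union>p\<in>?VV. ?T \<times> {f \<in> ?T. f (fst p) = f (snd p)})
      \<union> (\<Union>p\<in>?V \<times> ?V. {q \<in> ?T \<times> ?T. fst q (fst p) = snd q (snd p)})" (is "_ \<subseteq> ?A \<union> ?B \<union> ?C")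
  proof (rule subsetI)
    fix q assume "q \<in> bad_pairs"
    then obtain f f' where q: "q = (f, f')" "f \<in> ?T" "f' \<in> ?T"
      and bad: "\<not> inj_on f ?V \<or> \<not> inj_on f' ?V \<or> f ` ?V \<inter> f' ` ?V \<noteq> {}"
      unfolding bad_pairs_def by blast
    from bad consider "\<not> inj_on f ?V" | "\<not> inj_on f' ?V" | "f ` ?V \<inter> f' ` ?V \<noteq> {}" by blast
    then show "q \<in> ?A \<union> ?B \<union> ?C"
    proof cases
      case 1
      then obtain a b where "(a, b) \<in> ?VV" "f a = f b" by (auto simp: inj_on_def)
      with q have "q \<in> ?A" by (intro UN_I[of "(a, b)"]) auto
      then show ?thesis by blast
    next
      case 2
      then obtain a b where "(a, b) \<in> ?VV" "f' a = f' b" by (auto simp: inj_on_def)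
      with q have "q \<in> ?B" by (intro UN_I[of "(a, b)"]) auto
      then show ?thesis by blast
    next
      case 3
      then obtain a b where "a \<in> ?V" "b \<in> ?V" "f a = f' b" by auto
      with q have "q \<in> ?C" by (intro UN_I[of "(a, b)"]) auto
      then show ?thesis by blast
    qed
  qed
  moreover have finABC: "finite ?A" "finite ?B" "finite ?C" using fin finT by auto
  ultimately have "card bad_pairs \<le> card ?A + card ?B + card ?C"
    by (meson card_mono card_Un_le finite_UnI order_trans add_mono order_refl)
  also have "card ?A \<le> ?m ^ 2 * (n ^ (?m - 1) * n ^ ?m)"
  proof -
    have "card ?A \<le> (\<Sum>p\<in>?VV. card ({f \<in> ?T. f (fst p) = f (snd p)} \<times> ?T))"
      using fin by (intro card_UN_le) auto
    also have "\<dots> \<le> (\<Sum>p\<in>?VV. n ^ (?m - 1) * n ^ ?m)"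
      unfolding card_cartesian_product cT using c1 by (intro sum_mono mult_right_mono) auto
    also have "\<dots> = card ?VV * (n ^ (?m - 1) * n ^ ?m)" by simp
    also have "\<dots> \<le> card (?V \<times> ?V) * (n ^ (?m - 1) * n ^ ?m)" by (rule mult_right_mono[OF cVV]) simp
    finally show ?thesis by (simp add: card_cartesian_product power2_eq_square)
  qed
  also have "card ?B \<le> ?m ^ 2 * (n ^ (?m - 1) * n ^ ?m)"
  proof -
    have "card ?B \<le> (\<Sum>p\<in>?VV. card (?T \<times> {f \<in> ?T. f (fst p) = f (snd p)}))"
      using fin by (intro card_UN_le) auto
    also have "\<dots> \<le> (\<Sum>p\<in>?VV. n ^ ?m * n ^ (?m - 1))"
      unfolding card_cartesian_product cT using c1 by (intro sum_mono mult_left_mono) auto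
    also have "\<dots> = card ?VV * (n ^ (?m - 1) * n ^ ?m)" by (simp add: mult.commute)
    also have "\<dots> \<le> card (?V \<times> ?V) * (n ^ (?m - 1) * n ^ ?m)" by (rule mult_right_mono[OF cVV]) simp
    finally show ?thesis by (simp add: card_cartesian_product power2_eq_square)
  qed
  also have "card ?C \<le> ?m ^ 2 * (n ^ (?m - 1) * n ^ ?m)"
  proof -
    have "card ?C \<le> (\<Sum>p\<in>?V \<times> ?V. card {q \<in> ?T \<times> ?T. fst q (fst p) = snd q (snd p)})"
      using fin by (intro card_UN_le) auto
    also have "\<dots> \<le> (\<Sum>p\<in>?V \<times> ?V. n ^ ?m * n ^ (?m - 1))"
      using c2 by (intro sum_mono) auto
    finally show ?thesis by (simp add: card_cartesian_product power2_eq_square mult.commute)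
  qed
  finally have "card bad_pairs \<le> 3 * (?m ^ 2 * (n ^ (?m - 1) * n ^ ?m))" by simp
  \<comment> \<open>The case distinction is due to truncated subtraction; for a graph without
    vertices both sides are 0.\<close>
  also have "\<dots> \<le> 3 * ?m ^ 2 * n ^ (2 * ?m - 1)"
    by (cases ?m) (auto simp: power_add[symmetric] mult_2)
  finally have "real (card bad_pairs) \<le> real (3 * ?m ^ 2 * n ^ (2 * ?m - 1))" by (rule of_nat_mono)
  then show ?thesis by simp
qed

text \<open>An injective vertex map is a homomorphism with probability equal to the density. Two
  injective maps with disjoint images use disjoint sets of types and edges, hence are uncorrelated.
  Everything else is counted by \<open>bad_pairs\<close>.\<close>

lemma hom_density_second_moment:
  assumes M: "prob_space M" and W: "graphon M W"
  defines "Z \<equiv> \<lambda>f z. of_bool (f \<in> graph_homs F (sample_to_graph n (fst z))) - graphon_density F M W"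
  shows "(\<integral>z. (\<Sum>f\<in>pverts F \<rightarrow>\<^sub>E {..<n}. Z f z)\<^sup>2 \<partial>sampled_graph n M W) \<le>
      3 * real (card (pverts F)) ^ 2 * real n ^ (2 * card (pverts F) - 1)"
    and "\<And>f. Z f \<in> borel_measurable (sampled_graph n M W)" and "\<And>f z. \<bar>Z f z\<bar> \<le> 1"
proof -
  let ?V = "pverts F" and ?S = "sampled_graph n M W" and ?X = "PiM {..<n} (\<lambda>_. M)"
  let ?t = "graphon_density F M W"
  note V = graph_edges_finite[OF F]
  interpret S: prob_space ?S by (rule prob_space_sampled_graph[OF M W])
  interpret PV: prob_space "PiM ?V (\<lambda>_. M)" by (intro prob_space_PiM M)
  have ends: "\<And>e. e \<in> graph_edges F \<Longrightarrow> fst e \<in> ?V \<and> snd e \<in> ?V" using V(3) by auto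
  have edges: "(\<lambda>x. \<Prod>e\<in>graph_edges F. W (x (fst e)) (x (snd e))) \<in> borel_measurable (PiM ?V (\<lambda>_. M))"
      "\<And>x. x \<in> space (PiM ?V (\<lambda>_. M)) \<Longrightarrow> 0 \<le> (\<Prod>e\<in>graph_edges F. W (x (fst e)) (x (snd e)))"
      "\<And>x. x \<in> space (PiM ?V (\<lambda>_. M)) \<Longrightarrow> (\<Prod>e\<in>graph_edges F. W (x (fst e)) (x (snd e))) \<le> 1"
    using ends prod_edges_measurable_bounded[OF W V(2), of ?V] by blast+
  have t: "0 \<le> ?t" "?t \<le> 1"
  proof -
    show "0 \<le> ?t" unfolding graphon_density_alt by (intro integral_nonneg_AE AE_I2 edges(2))
    have "\<bar>?t\<bar> \<le> 1"
      unfolding graphon_density_alt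
    proof (rule PV.integral_abs_le[OF edges(1)])
      fix x assume x: "x \<in> space (PiM ?V (\<lambda>_. M))"
      show "\<bar>\<Prod>e\<in>graph_edges F. W (x (fst e)) (x (snd e))\<bar> \<le> 1"
        unfolding abs_of_nonneg[OF edges(2)[OF x]] by (rule edges(3)[OF x])
    qed
    then show "?t \<le> 1" by simp
  qed
  show bnd: "\<bar>Z f z\<bar> \<le> 1" for f z using t by (auto simp: Z_def)
  show meas: "Z f \<in> borel_measurable ?S" for f
  proof (rule integral_sampled_graph(2)[OF M W, where C=1])
    show "(\<lambda>x. Z f (g, x)) \<in> borel_measurable ?X" for g by (simp add: Z_def)
  qed (rule bnd)
  have edge_abs: "\<bar>\<Prod>e\<in>graph_edges F. W (x (fst e)) (x (snd e))\<bar> \<le> 1" if x: "x \<in> space (PiM ?V (\<lambda>_. M))" for x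
    unfolding abs_of_nonneg[OF edges(2)[OF x]] by (rule edges(3)[OF x])
  have prodW: "(\<Prod>e\<in>edge_image f ` graph_edges F. W (x (fst e)) (x (snd e))) =
      (\<Prod>e\<in>graph_edges F. W (x (f (fst e))) (x (f (snd e))))"
    if f: "f \<in> ?V \<rightarrow>\<^sub>E {..<n}" "inj_on f ?V" and x: "x \<in> space ?X" for f x
  proof -
    have "(\<Prod>e\<in>edge_image f ` graph_edges F. W (x (fst e)) (x (snd e))) =
        (\<Prod>e\<in>graph_edges F. W (x (fst (edge_image f e))) (x (snd (edge_image f e))))"
      by (rule prod.reindex_cong[OF edge_image_props(2)[OF f]]) auto
    also have "\<dots> = (\<Prod>e\<in>graph_edges F. W (x (f (fst e))) (x (f (snd e))))"
    proof (rule prod.cong[OF refl])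
      fix e assume "e \<in> graph_edges F"
      then have "f (fst e) < n" "f (snd e) < n" using ends[of e] f(1) by auto
      then have "x (f (fst e)) \<in> space M" "x (f (snd e)) \<in> space M" using x by (auto simp: space_PiM PiE_iff)
      from graphon_bounds(4)[OF W this]
      show "W (x (fst (edge_image f e))) (x (snd (edge_image f e))) = W (x (f (fst e))) (x (f (snd e)))"
        by (auto simp: edge_image_def min_def max_def)
    qed
    finally show ?thesis .
  qed
  have hind: "(\<integral>z. hom_ind f (fst z) \<partial>?S) = ?t" if f: "f \<in> ?V \<rightarrow>\<^sub>E {..<n}" "inj_on f ?V" for f
  proof -
    have "(\<integral>z. hom_ind f (fst z) \<partial>?S) = (\<integral>x. (\<Sum>g\<in>graphs_on n. graph_weight n W x g * hom_ind f g) \<partial>?X)"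
      by (subst integral_sampled_graph(1)[OF M W, where C=1]) (auto simp: abs_prod intro!: prod_le_1)
    also have "\<dots> = (\<integral>x. (\<Prod>e\<in>graph_edges F. W (x (f (fst e))) (x (f (snd e)))) \<partial>?X)"
      by (intro Bochner_Integration.integral_cong refl)
         (simp add: sum_graph_weight_subset[OF edge_image_props(1)[OF f]] prodW[OF f])
    also have "\<dots> = ?t"
      unfolding graphon_density_alt by (rule integral_prod_reindex[OF M W f(2) _ V(2) ends]) (use f(1) in auto)
    finally show ?thesis .
  qed
  have zero: "(\<integral>z. Z f z * Z f' z \<partial>?S) = 0"
    if ff: "f \<in> ?V \<rightarrow>\<^sub>E {..<n}" "f' \<in> ?V \<rightarrow>\<^sub>E {..<n}" "(f, f') \<notin> bad_pairs" for f f'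
  proof -
    have f: "f \<in> ?V \<rightarrow>\<^sub>E {..<n}" "inj_on f ?V" and f': "f' \<in> ?V \<rightarrow>\<^sub>E {..<n}" "inj_on f' ?V"
      and disj: "f ` ?V \<inter> f' ` ?V = {}" using ff by (auto simp: bad_pairs_def)
    let ?A = "edge_image f ` graph_edges F" and ?B = "edge_image f' ` graph_edges F"
    have AB: "?A \<inter> ?B = {}"
    proof -
      have "fst (edge_image f e) \<in> f ` ?V" "fst (edge_image f' e) \<in> f' ` ?V" if "e \<in> graph_edges F" for e
        using ends[OF that] by (auto simp: edge_image_def min_def)
      then show ?thesis using disj by (metis (no_types, lifting) disjoint_iff imageE)
    qed
    have hh: "(\<integral>z. hom_ind f (fst z) * hom_ind f' (fst z) \<partial>?S) = ?t * ?t"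
    proof -
      have "hom_ind f g * hom_ind f' g = (\<Prod>e\<in>?A \<union> ?B. of_bool (g e))" for g
        using V(2) AB by (intro prod.union_disjoint[symmetric]) auto
      then have "(\<integral>z. hom_ind f (fst z) * hom_ind f' (fst z) \<partial>?S) = (\<integral>z. (\<Prod>e\<in>?A \<union> ?B. of_bool (fst z e)) \<partial>?S)"
        by simp
      also have "\<dots> = (\<integral>x. (\<Sum>g\<in>graphs_on n. graph_weight n W x g * (\<Prod>e\<in>?A \<union> ?B. of_bool (g e))) \<partial>?X)"
        by (subst integral_sampled_graph(1)[OF M W, where C=1]) (auto simp: abs_prod intro!: prod_le_1)
      also have "\<dots> = (\<integral>x. (\<Prod>e\<in>?A \<union> ?B. W (x (fst e)) (x (snd e))) \<partial>?X)"
        using edge_image_props(1)[OF f] edge_image_props(1)[OF f']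
        by (subst sum_graph_weight_subset) auto
      also have "\<dots> = (\<integral>x. (\<Prod>e\<in>graph_edges F. W (x (f (fst e))) (x (f (snd e)))) *
          (\<Prod>e\<in>graph_edges F. W (x (f' (fst e))) (x (f' (snd e)))) \<partial>?X)"
      proof (intro Bochner_Integration.integral_cong refl)
        fix x assume x: "x \<in> space ?X"
        show "(\<Prod>e\<in>?A \<union> ?B. W (x (fst e)) (x (snd e))) = (\<Prod>e\<in>graph_edges F. W (x (f (fst e))) (x (f (snd e)))) *
          (\<Prod>e\<in>graph_edges F. W (x (f' (fst e))) (x (f' (snd e))))"
          using V(2) AB by (subst prod.union_disjoint) (auto simp: prodW[OF f x] prodW[OF f' x])
      qed
      also have "\<dots> = (\<integral>x. (\<lambda>y. \<Prod>e\<in>graph_edges F. W (y (fst e)) (y (snd e))) (\<lambda>v\<in>?V. x (f v)) *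
          (\<lambda>y. \<Prod>e\<in>graph_edges F. W (y (fst e)) (y (snd e))) (\<lambda>v\<in>?V. x (f' v)) \<partial>?X)"
        by (intro Bochner_Integration.integral_cong refl arg_cong2[where f="(*)"] prod.cong) (use ends in auto)
      also have "\<dots> = ?t * ?t"
        unfolding graphon_density_alt
        by (rule integral_PiM_disjoint[OF M V(1) V(1) f(2) f'(2) disj, where C=1 and C'=1])
           (use f(1) f'(1) edges(1) edge_abs in auto)
      finally show ?thesis .
    qed
    have him: "hom_ind h \<circ> fst \<in> borel_measurable ?S" and hib: "\<bar>hom_ind h g\<bar> \<le> 1" for h g
    proof -
      show b: "\<bar>hom_ind h g\<bar> \<le> 1" for g by (auto simp: abs_prod intro!: prod_le_1)
      show "hom_ind h \<circ> fst \<in> borel_measurable ?S"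
        by (rule integral_sampled_graph(2)[OF M W, where C=1]) (use b in \<open>auto simp: comp_def\<close>)
    qed
    have hi: "integrable ?S (\<lambda>z. hom_ind h (fst z))" for h
      by (rule S.integrable_bounded[where C=1]) (use him[of h] hib in \<open>auto simp: comp_def\<close>)
    have hhi: "integrable ?S (\<lambda>z. hom_ind f (fst z) * hom_ind f' (fst z))"
    proof (rule S.integrable_bounded[where C=1])
      show "(\<lambda>z. hom_ind f (fst z) * hom_ind f' (fst z)) \<in> borel_measurable ?S"
        using him[of f] him[of f'] unfolding comp_def by (rule borel_measurable_times)
      show "\<bar>hom_ind f (fst z) * hom_ind f' (fst z)\<bar> \<le> 1" for z :: "(nat \<times> nat \<Rightarrow> bool) \<times> (nat \<Rightarrow> 'a)"
        unfolding abs_mult[of "hom_ind f (fst z)"] by (rule mult_le_one[OF hib abs_ge_zero hib])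
    qed
    have "(\<integral>z. Z f z * Z f' z \<partial>?S) =
      (\<integral>z. (hom_ind f (fst z) * hom_ind f' (fst z) - ?t * hom_ind f (fst z)) - (?t * hom_ind f' (fst z) - ?t * ?t) \<partial>?S)"
      by (intro Bochner_Integration.integral_cong refl)
         (simp only: Z_def hom_indicator[OF f] hom_indicator[OF f'], simp add: algebra_simps)
    also have "\<dots> = (?t * ?t - ?t * ?t) - (?t * ?t - ?t * ?t)"
      using hi hhi by (simp add: hind[OF f] hind[OF f'] hh S.prob_space)
    finally show ?thesis by simp
  qed
  have "(\<integral>z. (\<Sum>f\<in>?V \<rightarrow>\<^sub>E {..<n}. Z f z)\<^sup>2 \<partial>?S) \<le> 1\<^sup>2 * real (card bad_pairs)"
    by (rule S.second_moment_sum) (use meas bnd zero V(1) in \<open>auto simp: bad_pairs_def intro!: finite_PiE\<close>)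
  then show "(\<integral>z. (\<Sum>f\<in>?V \<rightarrow>\<^sub>E {..<n}. Z f z)\<^sup>2 \<partial>?S) \<le> 3 * real (card ?V) ^ 2 * real n ^ (2 * card ?V - 1)"
    using card_bad_pairs by simp
qed

end

section \<open>Existence of the graph limit of a graphon\<close>

lemma exists_close_graph:
  assumes M: "prob_space M" and W: "graphon M W" and FS: "finite FS" "\<forall>F\<in>FS. pair_graph F" and \<epsilon>: "0 < (\<epsilon>::real)"
  shows "eventually (\<lambda>n. \<exists>g. \<forall>F\<in>FS. \<bar>hom_density F (sample_to_graph n g) - graphon_density F M W\<bar> \<le> \<epsilon>) sequentially"
proof -
  \<comment> \<open>The sum of the Chebyshev bounds over \<open>FS\<close>. Once it is below 1, some
    sample is good for all graphs in \<open>FS\<close> simultaneously.\<close>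
  let ?r = "\<lambda>n::nat. \<Sum>F\<in>FS. 3 * real (card (pverts F)) ^ 2 / (\<epsilon>\<^sup>2 * real n)"
  have "?r \<longlonglongrightarrow> (\<Sum>F\<in>FS. 0)"
    by (intro tendsto_sum) (use \<epsilon> in real_asymp)
  then have "eventually (\<lambda>n. ?r n < 1) sequentially" by (intro order_tendstoD(2)) auto
  with eventually_gt_at_top[of 0] show ?thesis
  proof eventually_elim
    case (elim n)
    let ?S = "sampled_graph n M W"
    interpret S: prob_space ?S by (rule prob_space_sampled_graph[OF M W])
    define Y where "Y F z = (\<Sum>f\<in>pverts F \<rightarrow>\<^sub>E {..<n}. of_bool (f \<in> graph_homs F (sample_to_graph n (fst z))) - graphon_density F M W)"
      for F and z :: "(nat \<times> nat \<Rightarrow> bool) \<times> (nat \<Rightarrow> 'a)"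
    define bad where "bad F = {z \<in> space ?S. \<epsilon> * real n ^ card (pverts F) \<le> \<bar>Y F z\<bar>}" for F
    have bad: "bad F \<in> sets ?S" "measure ?S (bad F) \<le> 3 * real (card (pverts F)) ^ 2 / (\<epsilon>\<^sup>2 * real n)" if "F \<in> FS" for F
    proof -
      have F: "pair_graph F" using FS that by blast
      let ?m = "card (pverts F)"
      note sm = hom_density_second_moment[OF F M W, where n=n]
      have fin: "finite (pverts F)" by (rule graph_edges_finite(1)[OF F])
      have m: "Y F \<in> borel_measurable ?S" unfolding Y_def[abs_def] by (intro borel_measurable_sum sm(2))
      then show "bad F \<in> sets ?S" unfolding bad_def by measurable
      have Yb: "\<bar>Y F z\<bar> \<le> real n ^ ?m" for z
      proof -
        have "\<bar>Y F z\<bar> \<le> (\<Sum>f\<in>pverts F \<rightarrow>\<^sub>E {..<n}. 1)"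
          unfolding Y_def by (intro order_trans[OF sum_abs] sum_mono sm(3))
        then show ?thesis by (simp add: card_PiE fin)
      qed
      have i: "integrable ?S (\<lambda>z. (Y F z)\<^sup>2)"
        by (rule S.integrable_bounded[where C="(real n ^ ?m)\<^sup>2"])
           (use m power_mono[OF Yb abs_ge_zero, where n=2] in auto)
      have "measure ?S (bad F) \<le> (\<integral>z. (Y F z)\<^sup>2 \<partial>?S) / (\<epsilon> * real n ^ ?m)\<^sup>2"
        unfolding bad_def by (rule S.second_moment_method[OF m i]) (use \<epsilon> elim in simp)
      also have "\<dots> \<le> 3 * real ?m ^ 2 * real n ^ (2 * ?m - 1) / (\<epsilon> * real n ^ ?m)\<^sup>2"
        using sm(1) unfolding Y_def by (intro divide_right_mono) auto
      also have "\<dots> = 3 * real ?m ^ 2 / (\<epsilon>\<^sup>2 * real n)"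
      proof (cases ?m)
        case (Suc k)
        then have "real n ^ (2 * ?m) = real n * real n ^ (2 * ?m - 1)" by simp
        moreover have "(\<epsilon> * real n ^ ?m)\<^sup>2 = \<epsilon>\<^sup>2 * real n ^ (2 * ?m)"
          by (simp add: power_mult_distrib power_mult[symmetric] mult.commute)
        ultimately show ?thesis using elim(1) by simp
      qed simp
      finally show "measure ?S (bad F) \<le> 3 * real ?m ^ 2 / (\<epsilon>\<^sup>2 * real n)" .
    qed
    have Bs: "(\<Union>F\<in>FS. bad F) \<in> sets ?S" by (intro sets.finite_UN FS(1) bad(1))
    have "measure ?S (\<Union>F\<in>FS. bad F) \<le> (\<Sum>F\<in>FS. measure ?S (bad F))"
      by (intro measure_UNION_le FS(1) bad(1))
    also have "\<dots> \<le> ?r n" by (intro sum_mono bad(2))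
    also have "\<dots> < 1" by (rule elim(2))
    finally have "(\<Union>F\<in>FS. bad F) \<noteq> space ?S" using S.prob_space by auto
    then obtain z where z: "z \<in> space ?S" "z \<notin> (\<Union>F\<in>FS. bad F)"
      using sets.sets_into_space[OF Bs] by blast
    have "\<bar>hom_density F (sample_to_graph n (fst z)) - graphon_density F M W\<bar> \<le> \<epsilon>" if "F \<in> FS" for F
    proof -
      have F: "pair_graph F" using FS that by blast
      have fin: "finite (pverts F)" by (rule graph_edges_finite(1)[OF F])
      have N: "real n ^ card (pverts F) > 0" using elim(1) by simp
      have "hom_density F (sample_to_graph n (fst z)) - graphon_density F M W = Y F z / real n ^ card (pverts F)"
        using N by (simp add: hom_density_sample[OF F] Y_def sum_subtractf card_PiE fin field_simps)
      moreover have "\<bar>Y F z\<bar> < \<epsilon> * real n ^ card (pverts F)" using z that by (auto simp: bad_def)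
      ultimately show ?thesis using N by (simp add: divide_le_eq)
    qed
    then show ?case by blast
  qed
qed

lemma countable_pair_graphs: "countable {F :: ngraph. pair_graph F}"
proof (rule countable_subset)
  show "{F :: ngraph. pair_graph F} \<subseteq> (\<lambda>(a, b). \<lparr>pverts = a, parcs = b\<rparr>) ` (Collect finite \<times> Collect finite)"
  proof
    fix F :: ngraph assume "F \<in> {F. pair_graph F}"
    then interpret pair_graph F by simp
    have "F = \<lparr>pverts = pverts F, parcs = parcs F\<rparr>" by simp
    then show "F \<in> (\<lambda>(a, b). \<lparr>pverts = a, parcs = b\<rparr>) ` (Collect finite \<times> Collect finite)"
      using pair_finite_verts pair_finite_arcs by (intro image_eqI[of _ _ "(pverts F, parcs F)"]) auto
  qed
  show "countable ((\<lambda>(a, b). \<lparr>pverts = a, parcs = b\<rparr>) ` (Collect finite \<times> Collect finite) :: ngraph set)"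
    by (intro countable_image countable_SIGMA countable_Collect_finite)
qed

text \<open>There are only countably many graphs, so a sequence whose k-th member is accurate up to
  1/(k + 1) for the first k + 1 of them converges for all. Only the existence of good samples is
  used, not a single infinite random experiment.\<close>

lemma exists_convergent_graphs:
  assumes M: "prob_space M" and W: "graphon M W"
  shows "\<exists>G\<in>convergent_graph_seqs. \<forall>F. pair_graph F \<longrightarrow> (\<lambda>n. hom_density F (G n)) \<longlonglongrightarrow> graphon_density F M W"
proof -
  let ?A = "{F :: ngraph. pair_graph F}"
  have "symmetric_graph {} {} \<in> ?A" using symmetric_graph(1)[of "{}" "{}"] by simp
  then have ne: "?A \<noteq> {}" by blast
  define Fs where "Fs = from_nat_into ?A"
  have Fs: "pair_graph (Fs k)" for k using from_nat_into[OF ne, of k] by (simp add: Fs_def)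
  have "\<forall>k. \<exists>n g. k \<le> n \<and> (\<forall>F\<in>Fs ` {..k}. \<bar>hom_density F (sample_to_graph n g) - graphon_density F M W\<bar> \<le> 1 / (real k + 1))"
  proof
    fix k
    have "eventually (\<lambda>n. \<exists>g. \<forall>F\<in>Fs ` {..k}. \<bar>hom_density F (sample_to_graph n g) - graphon_density F M W\<bar> \<le> 1 / (real k + 1)) sequentially"
      by (rule exists_close_graph[OF M W]) (use Fs in auto)
    from eventually_happens'[OF sequentially_bot eventually_conj[OF eventually_ge_at_top[of k] this]]
    show "\<exists>n g. k \<le> n \<and> (\<forall>F\<in>Fs ` {..k}. \<bar>hom_density F (sample_to_graph n g) - graphon_density F M W\<bar> \<le> 1 / (real k + 1))"
      by blast
  qed
  then obtain n g where ng: "\<And>k. k \<le> n k"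
    "\<And>k F. F \<in> Fs ` {..k} \<Longrightarrow> \<bar>hom_density F (sample_to_graph (n k) (g k)) - graphon_density F M W\<bar> \<le> 1 / (real k + 1)"
    by metis
  define G where "G k = sample_to_graph (n k) (g k)" for k
  have conv: "(\<lambda>k. hom_density F (G k)) \<longlonglongrightarrow> graphon_density F M W" if F: "pair_graph F" for F
  proof -
    obtain k0 where k0: "Fs k0 = F"
      using from_nat_into_surj[OF countable_pair_graphs, of F] F by (auto simp: Fs_def)
    have le: "\<bar>hom_density F (G k) - graphon_density F M W\<bar> \<le> 1 / (real k + 1)" if "k0 \<le> k" for k
      unfolding G_def by (rule ng(2)) (use k0 that in auto)
    show ?thesis
    proof (rule LIM_zero_cancel, rule tendsto_rabs_zero_cancel, rule tendsto_sandwich[of "\<lambda>_. 0"])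
      show "(\<lambda>k. 1 / (real k + 1)) \<longlonglongrightarrow> 0" by real_asymp
      show "\<forall>\<^sub>F k in sequentially. \<bar>hom_density F (G k) - graphon_density F M W\<bar> \<le> 1 / (real k + 1)"
        using eventually_ge_at_top[of k0] by eventually_elim (rule le)
    qed auto
  qed
  have "filterlim n at_top sequentially"
    by (rule filterlim_at_top_mono[OF filterlim_ident]) (use ng(1) in auto)
  then have "G \<in> convergent_graph_seqs"
    using conv unfolding convergent_graph_seqs_def
    by (auto simp: G_def sample_to_graph convergent_def)
  with conv show ?thesis by blast
qed

text \<open>This makes the definite description in \<open>graphon_limit\<close> meaningful: sampled
  graphs give existence, and two limits with the same densities are the same equivalence
  class.\<close>

lemma graphon_limit:
  assumes M: "prob_space M" and W: "graphon M W"
  shows "graphon_limit M W \<in> graph_limits" (is ?A)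
    and "\<forall>F. pair_graph F \<longrightarrow> limit_density F (graphon_limit M W) = graphon_density F M W" (is ?B)
proof -
  obtain G where G: "G \<in> convergent_graph_seqs" "\<And>F. pair_graph F \<Longrightarrow> (\<lambda>n. hom_density F (G n)) \<longlonglongrightarrow> graphon_density F M W"
    using exists_convergent_graphs[OF M W] by blast
  let ?\<Gamma> = "same_graph_limit `` {G}"
  have mem: "G \<in> ?\<Gamma>" using G(1) by (auto simp: same_graph_limit_def)
  have \<Gamma>: "?\<Gamma> \<in> graph_limits" unfolding graph_limits_def using G(1) by (rule quotientI)
  have dens: "limit_density F ?\<Gamma> = graphon_density F M W" if "pair_graph F" for F
    using LIMSEQ_unique[OF limit_density_tendsto[OF \<Gamma> mem that] G(2)[OF that]] .
  have uniq: "\<Gamma>' = ?\<Gamma>" if \<Gamma>': "\<Gamma>' \<in> graph_limits" "\<forall>F. pair_graph F \<longrightarrow> limit_density F \<Gamma>' = graphon_density F M W" for \<Gamma>'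
  proof -
    obtain H where H: "H \<in> convergent_graph_seqs" "\<Gamma>' = same_graph_limit `` {H}"
      using \<Gamma>'(1) unfolding graph_limits_def by (elim quotientE)
    have memH: "H \<in> \<Gamma>'" using H by (auto simp: same_graph_limit_def)
    have "lim (\<lambda>n. hom_density F (G n)) = lim (\<lambda>n. hom_density F (H n))" if F: "pair_graph F" for F
      using limit_density_tendsto[OF \<Gamma>'(1) memH F] G(2)[OF F] \<Gamma>'(2) F by (simp add: limI)
    then have "(H, G) \<in> same_graph_limit" using G(1) H(1) by (simp add: same_graph_limit_def)
    then show ?thesis using equiv_class_eq[OF equiv_same_graph_limit] H(2) by simp
  qed
  have "\<exists>!\<Gamma>. \<Gamma> \<in> graph_limits \<and> (\<forall>F. pair_graph F \<longrightarrow> limit_density F \<Gamma> = graphon_density F M W)"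
    using \<Gamma> dens uniq by blast
  from theI'[OF this] show ?A ?B unfolding graphon_limit_def by blast+
qed

lemma graphon_limit_eq_iff:
  assumes "prob_space M1" "graphon M1 W1" "prob_space M2" "graphon M2 W2"
  shows "graphon_limit M1 W1 = graphon_limit M2 W2 \<longleftrightarrow> same_densities M1 W1 M2 W2"
proof
  assume "graphon_limit M1 W1 = graphon_limit M2 W2"
  then show "same_densities M1 W1 M2 W2"
    using graphon_limit(2)[OF assms(1,2)] graphon_limit(2)[OF assms(3,4)] by (simp add: same_densities_def)
next
  assume "same_densities M1 W1 M2 W2"
  then have "(\<lambda>\<Gamma>. \<forall>F. pair_graph F \<longrightarrow> limit_density F \<Gamma> = graphon_density F M1 W1) =
      (\<lambda>\<Gamma>. \<forall>F. pair_graph F \<longrightarrow> limit_density F \<Gamma> = graphon_density F M2 W2)"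
    by (auto simp: same_densities_def fun_eq_iff)
  then show "graphon_limit M1 W1 = graphon_limit M2 W2" unfolding graphon_limit_def by meson
qed

section \<open>Random graphs\<close>

definition edge_space :: "(nat \<times> nat) set \<Rightarrow> (nat \<times> nat \<Rightarrow> bool) measure" where
  "edge_space I = (\<Pi>\<^sub>M e \<in> I. count_space UNIV)"

text \<open>The events \<open>all_edges\<close> generate the product \<open>\<sigma>\<close>-algebra, and their probabilities are densities.\<close>

definition all_edges :: "(nat \<times> nat) set \<Rightarrow> (nat \<times> nat) set \<Rightarrow> (nat \<times> nat \<Rightarrow> bool) set" where
  "all_edges I J = {\<omega> \<in> space (edge_space I). \<forall>e\<in>J. \<omega> e}"

lemma all_edges_sets:
  assumes "J \<subseteq> I" "finite J"
  shows "all_edges I J \<in> sets (edge_space I)"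
proof -
  have "{\<omega> \<in> space (edge_space I). \<omega> e} \<in> sets (edge_space I)" if "e \<in> J" for e
  proof -
    have [measurable]: "(\<lambda>\<omega>. \<omega> e) \<in> measurable (edge_space I) (count_space UNIV)"
      unfolding edge_space_def using that assms by (intro measurable_component_singleton) auto
    show ?thesis by measurable
  qed
  then have "{\<omega> \<in> space (edge_space I). \<forall>e\<in>J. \<omega> e} \<in> sets (edge_space I)"
    using assms(2) by (intro sets.sets_Collect_finite_All) auto
  then show ?thesis by (simp add: all_edges_def)
qed

lemma sets_edge_space:
  "sets (edge_space I) = sigma_sets (space (edge_space I)) {all_edges I J | J. finite J \<and> J \<subseteq> I}" (is "_ = sigma_sets ?\<Omega> ?G")
proof (rule antisym)
  have G: "?G \<subseteq> Pow ?\<Omega>" by (auto simp: all_edges_def)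
  interpret sigma_algebra ?\<Omega> "sigma_sets ?\<Omega> ?G" by (rule sigma_algebra_sigma_sets[OF G])
  have \<Omega>: "?\<Omega> = (\<Pi>\<^sub>E i\<in>I. space (count_space (UNIV :: bool set)))" by (simp add: edge_space_def space_PiM)
  have "sets (edge_space I) = sigma_sets ?\<Omega> {{f \<in> \<Pi>\<^sub>E i\<in>I. space (count_space UNIV). f i \<in> A} | i A. i \<in> I \<and> A \<in> sets (count_space (UNIV :: bool set))}"
    unfolding edge_space_def sets_PiM_single by (simp add: space_PiM)
  also have "\<dots> \<subseteq> sigma_sets ?\<Omega> ?G"
  proof (rule sigma_sets_mono, rule subsetI)
    fix B assume "B \<in> {{f \<in> \<Pi>\<^sub>E i\<in>I. space (count_space UNIV). f i \<in> A} | i A. i \<in> I \<and> A \<in> sets (count_space (UNIV :: bool set))}"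
    then obtain i A where i: "i \<in> I" and B: "B = {f \<in> ?\<Omega>. f i \<in> A}" unfolding \<Omega> by blast
    have T: "{f \<in> ?\<Omega>. f i} \<in> sigma_sets ?\<Omega> ?G"
    proof (rule sigma_sets.Basic)
      show "{f \<in> ?\<Omega>. f i} \<in> ?G" using i by (intro CollectI exI[of _ "{i}"]) (auto simp: all_edges_def)
    qed
    \<comment> \<open>The generating events speak only of edges being present. An event about one
      edge is trivial, such an event, or its complement.\<close>
    have "A = {} \<or> A = UNIV \<or> A = {True} \<or> A = {False}"
    proof -
      have "A \<in> Pow {False, True}" using UNIV_bool by auto
      then show ?thesis by (auto simp: Pow_insert UNIV_bool)
    qed
    then have "B = {} \<or> B = ?\<Omega> \<or> B = {f \<in> ?\<Omega>. f i} \<or> B = ?\<Omega> - {f \<in> ?\<Omega>. f i}"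
      unfolding B by auto
    then show "B \<in> sigma_sets ?\<Omega> ?G" using T
      by (elim disjE) (auto intro: sigma_sets.Empty sigma_sets_top sigma_sets.Compl)
  qed
  finally show "sets (edge_space I) \<subseteq> sigma_sets ?\<Omega> ?G" .
  show "sigma_sets ?\<Omega> ?G \<subseteq> sets (edge_space I)"
    by (rule sets.sigma_sets_subset) (auto intro: all_edges_sets)
qed

lemma edge_space_eqI:
  assumes P: "prob_space P" "sets P = sets (edge_space I)" and Q: "sets Q = sets (edge_space I)"
    and eq: "\<And>J. finite J \<Longrightarrow> J \<subseteq> I \<Longrightarrow> emeasure P (all_edges I J) = emeasure Q (all_edges I J)"
  shows "P = Q"
proof -
  interpret P: prob_space P by fact
  let ?G = "{all_edges I J | J. finite J \<and> J \<subseteq> I}" and ?\<Omega> = "space (edge_space I)"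
  show ?thesis
  proof (rule measure_eqI_generator_eq[where E="?G" and \<Omega>="?\<Omega>" and A="\<lambda>_. ?\<Omega>"])
    show "Int_stable ?G"
    proof (rule Int_stableI)
      fix a b assume "a \<in> ?G" "b \<in> ?G"
      then obtain J J' where "a = all_edges I J" "b = all_edges I J'" "finite J" "J \<subseteq> I" "finite J'" "J' \<subseteq> I" by blast
      then have "a \<inter> b = all_edges I (J \<union> J')" "finite (J \<union> J')" "J \<union> J' \<subseteq> I" by (auto simp: all_edges_def)
      then show "a \<inter> b \<in> ?G" by blast
    qed
    show "?G \<subseteq> Pow ?\<Omega>" by (auto simp: all_edges_def)
    show "emeasure P X = emeasure Q X" if "X \<in> ?G" for X using that eq by blast
    show "sets P = sigma_sets ?\<Omega> ?G" "sets Q = sigma_sets ?\<Omega> ?G" using P(2) Q sets_edge_space by auto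
    have "?\<Omega> = all_edges I {}" by (simp add: all_edges_def)
    then show "range (\<lambda>_::nat. ?\<Omega>) \<subseteq> ?G" by blast
  qed auto
qed

lemma random_graph_prob:
  assumes M: "prob_space M" and W: "graphon M W"
  shows "prob_space (random_graph n M W)" and "sets (random_graph n M W) = sets (edge_space (rg_pairs n))"
    and "finite J \<Longrightarrow> J \<subseteq> rg_pairs n \<Longrightarrow> emeasure (random_graph n M W) (all_edges (rg_pairs n) J) =
      ennreal (\<integral>x. (\<Prod>e\<in>J. W (x (fst e)) (x (snd e))) \<partial>(PiM (rg_vertices n) (\<lambda>_. M)))"
proof -
  let ?X = "PiM (rg_vertices n) (\<lambda>_. M)"
  let ?K = "\<lambda>x. \<Pi>\<^sub>M e \<in> rg_pairs n. measure_pmf (bernoulli_pmf (W (x (fst e)) (x (snd e))))"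
  interpret X: prob_space ?X by (intro prob_space_PiM M)
  have K: "?K \<in> measurable ?X (prob_algebra (edge_space (rg_pairs n)))"
    unfolding edge_space_def by (rule edge_kernel_measurable[OF W])
  have Ks: "?K \<in> measurable ?X (subprob_algebra (edge_space (rg_pairs n)))"
    by (rule measurable_prob_algebraD[OF K])
  have X: "?X \<in> space (prob_algebra ?X)" by (simp add: space_prob_algebra X.prob_space_axioms)
  have "random_graph n M W \<in> space (prob_algebra (edge_space (rg_pairs n)))"
  proof -
    have "(\<lambda>_. ?X) \<in> measurable (count_space {()}) (prob_algebra ?X)" using X by simp
    then have "(\<lambda>_. ?X \<bind> ?K) \<in> measurable (count_space {()}) (prob_algebra (edge_space (rg_pairs n)))"
      by (rule measurable_bind_prob_space[OF _ K])
    from measurable_space[OF this, of "()"] show ?thesis by (simp add: random_graph_def)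
  qed
  then show "prob_space (random_graph n M W)" and s: "sets (random_graph n M W) = sets (edge_space (rg_pairs n))"
    by (auto simp: space_prob_algebra)
  assume J: "finite J" "J \<subseteq> rg_pairs n"
  have ends: "\<And>e. e \<in> J \<Longrightarrow> fst e \<in> rg_vertices n \<and> snd e \<in> rg_vertices n" using J(2) by (auto simp: rg_pairs_def)
  have "emeasure (random_graph n M W) (all_edges (rg_pairs n) J) = (\<integral>\<^sup>+x. emeasure (?K x) (all_edges (rg_pairs n) J) \<partial>?X)"
    unfolding random_graph_def by (rule emeasure_bind[OF X.not_empty Ks all_edges_sets[OF J(2,1)]])
  also have "\<dots> = (\<integral>\<^sup>+x. ennreal (\<Prod>e\<in>J. W (x (fst e)) (x (snd e))) \<partial>?X)"
  proof (rule nn_integral_cong)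
    fix x assume x: "x \<in> space ?X"
    let ?B = "\<lambda>e. measure_pmf (bernoulli_pmf (W (x (fst e)) (x (snd e))))"
    interpret B: product_prob_space ?B "rg_pairs n" by unfold_locales
    have "all_edges (rg_pairs n) J = prod_emb (rg_pairs n) ?B J (\<Pi>\<^sub>E j\<in>J. {True})"
    proof -
      have "restrict \<omega> J \<in> (\<Pi>\<^sub>E j\<in>J. {True}) \<longleftrightarrow> (\<forall>e\<in>J. \<omega> e)" for \<omega>
        unfolding restrict_PiE_iff by simp
      then show ?thesis
        unfolding all_edges_def edge_space_def prod_emb_def space_PiM by (auto simp del: PiE_singleton)
    qed
    then have "emeasure (?K x) (all_edges (rg_pairs n) J) = (\<Prod>e\<in>J. emeasure (?B e) {True})"
      using B.emeasure_PiM_emb[OF J(2,1), of "\<lambda>_. {True}"] by simp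
    also have "\<dots> = (\<Prod>e\<in>J. ennreal (W (x (fst e)) (x (snd e))))"
    proof (rule prod.cong[OF refl])
      fix e assume "e \<in> J"
      then have "x (fst e) \<in> space M" "x (snd e) \<in> space M" using x ends by (auto simp: space_PiM PiE_iff)
      from graphon_bounds[OF W this]
      show "emeasure (?B e) {True} = ennreal (W (x (fst e)) (x (snd e)))" by (simp add: emeasure_pmf_single)
    qed
    also have "\<dots> = ennreal (\<Prod>e\<in>J. W (x (fst e)) (x (snd e)))"
    proof (rule prod_ennreal)
      fix e assume "e \<in> J"
      then have "x (fst e) \<in> space M" "x (snd e) \<in> space M" using x ends by (auto simp: space_PiM PiE_iff)
      from graphon_bounds[OF W this] show "0 \<le> W (x (fst e)) (x (snd e))" by simp
    qed
    finally show "emeasure (?K x) (all_edges (rg_pairs n) J) = ennreal (\<Prod>e\<in>J. W (x (fst e)) (x (snd e)))" .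
  qed
  also have "\<dots> = ennreal (\<integral>x. (\<Prod>e\<in>J. W (x (fst e)) (x (snd e))) \<partial>?X)"
  proof (rule nn_integral_eq_integral)
    have e: "(\<lambda>x. \<Prod>e\<in>J. W (x (fst e)) (x (snd e))) \<in> borel_measurable ?X"
      "\<And>x. x \<in> space ?X \<Longrightarrow> 0 \<le> (\<Prod>e\<in>J. W (x (fst e)) (x (snd e)))"
      "\<And>x. x \<in> space ?X \<Longrightarrow> (\<Prod>e\<in>J. W (x (fst e)) (x (snd e))) \<le> 1"
      using ends prod_edges_measurable_bounded[OF W J(1), of "rg_vertices n"] by blast+
    show "AE x in ?X. 0 \<le> (\<Prod>e\<in>J. W (x (fst e)) (x (snd e)))" using e(2) by (rule AE_I2)
    show "integrable ?X (\<lambda>x. \<Prod>e\<in>J. W (x (fst e)) (x (snd e)))"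
    proof (rule X.integrable_bounded[OF e(1)])
      fix x assume x: "x \<in> space ?X"
      show "\<bar>\<Prod>e\<in>J. W (x (fst e)) (x (snd e))\<bar> \<le> 1" unfolding abs_of_nonneg[OF e(2)[OF x]] by (rule e(3)[OF x])
    qed
  qed
  finally show "emeasure (random_graph n M W) (all_edges (rg_pairs n) J) =
      ennreal (\<integral>x. (\<Prod>e\<in>J. W (x (fst e)) (x (snd e))) \<partial>?X)" .
qed

text \<open>The probability that all edges of a finite set \<open>J\<close> are present is the
  density of the graph formed by \<open>J\<close> and its endpoints. The argument is the same for
  finite and infinite n.\<close>

lemma random_graph_cong:
  assumes M: "prob_space M1" "graphon M1 W1" "prob_space M2" "graphon M2 W2"
    and same: "same_densities M1 W1 M2 W2"
  shows "random_graph n M1 W1 = random_graph n M2 W2"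
proof (rule edge_space_eqI)
  show "prob_space (random_graph n M1 W1)" "sets (random_graph n M1 W1) = sets (edge_space (rg_pairs n))"
    "sets (random_graph n M2 W2) = sets (edge_space (rg_pairs n))"
    by (rule random_graph_prob(1)[OF M(1,2)], rule random_graph_prob(2)[OF M(1,2)], rule random_graph_prob(2)[OF M(3,4)])
  fix J assume J: "finite J" "J \<subseteq> rg_pairs n"
  let ?V = "fst ` J \<union> snd ` J"
  let ?F = "symmetric_graph ?V J"
  have V: "finite ?V" "J \<subseteq> {(i, j). i \<in> ?V \<and> j \<in> ?V \<and> i < j}"
    using J by (force simp: rg_pairs_def)+
  have sub: "?V \<subseteq> rg_vertices n" using J by (auto simp: rg_pairs_def)
  have dens: "(\<integral>x. (\<Prod>e\<in>J. W (x (fst e)) (x (snd e))) \<partial>(PiM (rg_vertices n) (\<lambda>_. M))) = graphon_density ?F M W"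
    if "prob_space M" "graphon M W" for M :: "'c measure" and W
    unfolding graphon_density_alt symmetric_graph(2,3)[OF V]
    using integral_prod_reindex[OF that, of "\<lambda>i. i" ?V "rg_vertices n" J] sub J(1) by auto
  have "graphon_density ?F M1 W1 = graphon_density ?F M2 W2"
    using same symmetric_graph(1)[OF V] by (simp add: same_densities_def)
  then show "emeasure (random_graph n M1 W1) (all_edges (rg_pairs n) J) =
      emeasure (random_graph n M2 W2) (all_edges (rg_pairs n) J)"
    unfolding random_graph_prob(3)[OF M(1,2) J] random_graph_prob(3)[OF M(3,4) J]
    by (simp add: dens[OF M(1,2)] dens[OF M(3,4)])
qed

lemma graphon_density_of_random_graph:
  assumes M: "prob_space M1" "graphon M1 W1" "prob_space M2" "graphon M2 W2"
    and eq: "random_graph n M1 W1 = random_graph n M2 W2"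
    and F: "pair_graph F" "Suc ` pverts F \<subseteq> rg_vertices n"
  shows "graphon_density F M1 W1 = graphon_density F M2 W2"
proof -
  note V = graph_edges_finite[OF F(1)]
  \<comment> \<open>Vertices of \<open>F\<close> may be 0, whereas the random graph starts at vertex
    1.\<close>
  let ?s = "map_prod Suc Suc"
  let ?J = "?s ` graph_edges F"
  have J: "finite ?J" "?J \<subseteq> rg_pairs n"
    using V F(2) by (auto simp: rg_pairs_def)
  have inj: "inj_on ?s (graph_edges F)" by (intro prod.inj_map[THEN inj_on_subset]) auto
  have dens: "(\<integral>x. (\<Prod>e\<in>?J. W (x (fst e)) (x (snd e))) \<partial>(PiM (rg_vertices n) (\<lambda>_. M))) = graphon_density F M W \<and>
      0 \<le> graphon_density F M W"
    if "prob_space M" "graphon M W" for M :: "'c measure" and W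
  proof -
    have ends: "\<And>e. e \<in> graph_edges F \<Longrightarrow> fst e \<in> pverts F \<and> snd e \<in> pverts F" using V(3) by auto
    have "0 \<le> graphon_density F M W"
      unfolding graphon_density_alt
      using ends prod_edges_measurable_bounded(2)[OF that(2) V(2), of "pverts F"] by (intro integral_nonneg_AE AE_I2) blast
    moreover have "(\<integral>x. (\<Prod>e\<in>?J. W (x (fst e)) (x (snd e))) \<partial>(PiM (rg_vertices n) (\<lambda>_. M))) =
        (\<integral>x. (\<Prod>e\<in>graph_edges F. W (x (Suc (fst e))) (x (Suc (snd e)))) \<partial>(PiM (rg_vertices n) (\<lambda>_. M)))"
      by (simp add: prod.reindex[OF inj])
    ultimately show ?thesis
      unfolding graphon_density_alt
      using integral_prod_reindex[OF that, of Suc "pverts F" "rg_vertices n" "graph_edges F"] F(2) V(2) ends by auto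
  qed
  have "ennreal (graphon_density F M1 W1) = ennreal (graphon_density F M2 W2)"
    using random_graph_prob(3)[OF M(1,2) J] random_graph_prob(3)[OF M(3,4) J] dens[OF M(1,2)] dens[OF M(3,4)] eq by simp
  then show ?thesis using dens[OF M(1,2)] dens[OF M(3,4)] by simp
qed

lemma random_graph_infinite_iff:
  assumes M: "prob_space M1" "graphon M1 W1" "prob_space M2" "graphon M2 W2"
  shows "random_graph \<infinity> M1 W1 = random_graph \<infinity> M2 W2 \<longleftrightarrow> same_densities M1 W1 M2 W2"
proof
  assume eq: "random_graph \<infinity> M1 W1 = random_graph \<infinity> M2 W2"
  show "same_densities M1 W1 M2 W2"
    unfolding same_densities_def
    by (intro allI impI graphon_density_of_random_graph[OF M eq]) (auto simp: rg_vertices_def)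
qed (rule random_graph_cong[OF M])

lemma random_graph_finite_iff:
  assumes M: "prob_space M1" "graphon M1 W1" "prob_space M2" "graphon M2 W2"
  shows "(\<forall>n::nat. random_graph (enat n) M1 W1 = random_graph (enat n) M2 W2) \<longleftrightarrow> same_densities M1 W1 M2 W2"
proof
  assume eq: "\<forall>n::nat. random_graph (enat n) M1 W1 = random_graph (enat n) M2 W2"
  show "same_densities M1 W1 M2 W2"
    unfolding same_densities_def
  proof (intro allI impI)
    fix F :: ngraph assume F: "pair_graph F"
    have fin: "finite (pverts F)" by (rule graph_edges_finite(1)[OF F])
    \<comment> \<open>Inserting 0 gives the maximum a value also for the graph without
      vertices.\<close>
    have "Suc ` pverts F \<subseteq> rg_vertices (enat (Suc (Max (insert 0 (pverts F)))))"
      using fin by (auto simp: rg_vertices_def)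
    then show "graphon_density F M1 W1 = graphon_density F M2 W2"
      using eq F by (intro graphon_density_of_random_graph[OF M]) auto
  qed
qed (use random_graph_cong[OF M] in blast)

section \<open>Measure preserving maps\<close>

lemma measure_preserving_distr: "measure_preserving M N \<phi> \<Longrightarrow> distr M N \<phi> = N"
  by (simp add: measure_preserving_def)

lemma measure_preserving_measurable: "measure_preserving M N \<phi> \<Longrightarrow> \<phi> \<in> measurable M N"
  by (simp add: measure_preserving_def)

lemma measure_preserving_comp:
  "measure_preserving A B f \<Longrightarrow> measure_preserving B C g \<Longrightarrow> measure_preserving A C (\<lambda>x. g (f x))"
  unfolding measure_preserving_def
  by (auto intro: measurable_compose simp: distr_distr[of g B C f A, symmetric, unfolded comp_def] simp flip: distr_distr)

lemma measure_preserving_id: "measure_preserving M M (\<lambda>x. x)"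
  by (simp add: measure_preserving_def distr_id)

lemma measure_preserving_pair:
  assumes f: "measure_preserving A B f" and g: "measure_preserving C D g" and "prob_space D"
  shows "measure_preserving (A \<Otimes>\<^sub>M C) (B \<Otimes>\<^sub>M D) (\<lambda>(x, y). (f x, g y))"
proof -
  interpret D: prob_space D by fact
  have m: "f \<in> measurable A B" "g \<in> measurable C D" using f g by (auto simp: measure_preserving_def)
  have "distr (A \<Otimes>\<^sub>M C) (B \<Otimes>\<^sub>M D) (\<lambda>(x, y). (f x, g y)) = distr A B f \<Otimes>\<^sub>M distr C D g"
    by (rule pair_measure_distr[symmetric, OF m])
       (use g D.sigma_finite_measure_axioms in \<open>simp add: measure_preserving_def\<close>)
  also have "\<dots> = B \<Otimes>\<^sub>M D" by (simp only: measure_preserving_distr[OF f] measure_preserving_distr[OF g])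
  finally have d: "distr (A \<Otimes>\<^sub>M C) (B \<Otimes>\<^sub>M D) (\<lambda>(x, y). (f x, g y)) = B \<Otimes>\<^sub>M D" .
  have "(\<lambda>(x, y). (f x, g y)) \<in> measurable (A \<Otimes>\<^sub>M C) (B \<Otimes>\<^sub>M D)" using m by measurable
  with d show ?thesis unfolding measure_preserving_def by blast
qed

lemma AE_measure_preserving:
  assumes "measure_preserving A B f" "AE y in B. P y"
  shows "AE x in A. P (f x)"
proof -
  have "AE y in distr A B f. P y" using assms(2) by (simp only: measure_preserving_distr[OF assms(1)])
  then show ?thesis by (rule AE_distrD[OF measure_preserving_measurable[OF assms(1)]])
qed

lemma AE_measure_preserving_iff:
  assumes "measure_preserving A B f" "{y \<in> space B. P y} \<in> sets B"
  shows "(AE x in A. P (f x)) \<longleftrightarrow> (AE y in B. P y)"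
  using AE_distr_iff[OF measure_preserving_measurable[OF assms(1)] assms(2)]
  unfolding measure_preserving_distr[OF assms(1)] by simp

text \<open>Exchanges the two inner factors. The coupling is stated for pairs of points (x, t1) and
  (y, t2), while the almost everywhere statement of the theorem groups the two types and the two
  uniform variables.\<close>

lemma measure_preserving_shuffle:
  assumes M: "prob_space M" and N: "prob_space N" and U: "prob_space U" and V: "prob_space V"
  shows "measure_preserving ((M \<Otimes>\<^sub>M N) \<Otimes>\<^sub>M (U \<Otimes>\<^sub>M V)) ((M \<Otimes>\<^sub>M U) \<Otimes>\<^sub>M (N \<Otimes>\<^sub>M V))
    (\<lambda>p. ((fst (fst p), fst (snd p)), (snd (fst p), snd (snd p))))" (is "measure_preserving ?P ?Q ?s")
proof -
  interpret M: prob_space M by fact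
  interpret N: prob_space N by fact
  interpret U: prob_space U by fact
  interpret V: prob_space V by fact
  interpret MU: pair_prob_space M U ..
  interpret NV: pair_prob_space N V ..
  interpret MN: pair_prob_space M N ..
  interpret UV: pair_prob_space U V ..
  have s: "?s \<in> measurable ?P ?Q" by measurable
  have "?Q = distr ?P ?Q ?s"
  proof (rule pair_measure_eqI)
    show "sigma_finite_measure (M \<Otimes>\<^sub>M U)" "sigma_finite_measure (N \<Otimes>\<^sub>M V)" by unfold_locales
    fix A B assume A: "A \<in> sets (M \<Otimes>\<^sub>M U)" and B: "B \<in> sets (N \<Otimes>\<^sub>M V)"
    have AB: "?s -` (A \<times> B) \<inter> space ?P \<in> sets ?P" using s A B by (intro measurable_sets[OF s]) auto
    have mA: "(\<lambda>x. emeasure U (Pair x -` A)) \<in> borel_measurable M" by (rule U.measurable_emeasure_Pair[OF A])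
    have mB: "(\<lambda>y. emeasure V (Pair y -` B)) \<in> borel_measurable N" by (rule V.measurable_emeasure_Pair[OF B])
    have "emeasure (distr ?P ?Q ?s) (A \<times> B) = emeasure ?P (?s -` (A \<times> B) \<inter> space ?P)"
      using A B by (intro emeasure_distr[OF s]) auto
    also have "\<dots> = (\<integral>\<^sup>+z. emeasure (U \<Otimes>\<^sub>M V) (Pair z -` (?s -` (A \<times> B) \<inter> space ?P)) \<partial>(M \<Otimes>\<^sub>M N))"
      by (rule UV.emeasure_pair_measure_alt[OF AB])
    also have "\<dots> = (\<integral>\<^sup>+z. emeasure U (Pair (fst z) -` A) * emeasure V (Pair (snd z) -` B) \<partial>(M \<Otimes>\<^sub>M N))"
    proof (rule nn_integral_cong)
      fix z assume z: "z \<in> space (M \<Otimes>\<^sub>M N)"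
      have "Pair z -` (?s -` (A \<times> B) \<inter> space ?P) = (Pair (fst z) -` A) \<times> (Pair (snd z) -` B)"
        using z sets.sets_into_space[OF A] sets.sets_into_space[OF B] by (auto simp: space_pair_measure)
      then show "emeasure (U \<Otimes>\<^sub>M V) (Pair z -` (?s -` (A \<times> B) \<inter> space ?P)) = emeasure U (Pair (fst z) -` A) * emeasure V (Pair (snd z) -` B)"
        using A B by (simp add: V.emeasure_pair_measure_Times sets_Pair1)
    qed
    also have "\<dots> = (\<integral>\<^sup>+x. \<integral>\<^sup>+y. emeasure U (Pair x -` A) * emeasure V (Pair y -` B) \<partial>N \<partial>M)"
      using mA mB by (subst N.nn_integral_fst[symmetric]) auto
    also have "\<dots> = (\<integral>\<^sup>+x. emeasure U (Pair x -` A) * (\<integral>\<^sup>+y. emeasure V (Pair y -` B) \<partial>N) \<partial>M)"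
      using mB by (simp add: nn_integral_cmult)
    also have "\<dots> = (\<integral>\<^sup>+x. emeasure U (Pair x -` A) \<partial>M) * (\<integral>\<^sup>+y. emeasure V (Pair y -` B) \<partial>N)"
      using mA by (simp add: nn_integral_multc)
    also have "\<dots> = emeasure (M \<Otimes>\<^sub>M U) A * emeasure (N \<Otimes>\<^sub>M V) B"
      by (simp add: U.emeasure_pair_measure_alt[OF A] V.emeasure_pair_measure_alt[OF B])
    finally show "emeasure (M \<Otimes>\<^sub>M U) A * emeasure (N \<Otimes>\<^sub>M V) B = emeasure (distr ?P ?Q ?s) (A \<times> B)" ..
  qed simp
  then show ?thesis using s by (simp add: measure_preserving_def)
qed

lemma AE_shuffle_iff:
  assumes "prob_space M" "prob_space N" "prob_space U" "prob_space V"
  shows "(AE ((x, y), (s, t)) in (M \<Otimes>\<^sub>M N) \<Otimes>\<^sub>M (U \<Otimes>\<^sub>M V). P x y s t) \<longleftrightarrow>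
    (AE p in (M \<Otimes>\<^sub>M U) \<Otimes>\<^sub>M (N \<Otimes>\<^sub>M V). P (fst (fst p)) (fst (snd p)) (snd (fst p)) (snd (snd p)))"
proof
  assume "AE ((x, y), (s, t)) in (M \<Otimes>\<^sub>M N) \<Otimes>\<^sub>M (U \<Otimes>\<^sub>M V). P x y s t"
  from AE_measure_preserving[OF measure_preserving_shuffle[OF assms(1,3,2,4)] this]
  show "AE p in (M \<Otimes>\<^sub>M U) \<Otimes>\<^sub>M (N \<Otimes>\<^sub>M V). P (fst (fst p)) (fst (snd p)) (snd (fst p)) (snd (snd p))" by simp
next
  assume "AE p in (M \<Otimes>\<^sub>M U) \<Otimes>\<^sub>M (N \<Otimes>\<^sub>M V). P (fst (fst p)) (fst (snd p)) (snd (fst p)) (snd (snd p))"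
  from AE_measure_preserving[OF measure_preserving_shuffle[OF assms] this]
  show "AE ((x, y), (s, t)) in (M \<Otimes>\<^sub>M N) \<Otimes>\<^sub>M (U \<Otimes>\<^sub>M V). P x y s t" by (simp add: case_prod_unfold)
qed

section \<open>Coding Borel spaces by real numbers\<close>

lemma Borel_prob_space_coding:
  assumes "Borel_prob_space M"
  obtains f :: "'a \<Rightarrow> real" and g where "f \<in> borel_measurable M" "g \<in> measurable borel M"
    "\<And>x. x \<in> space M \<Longrightarrow> g (f x) = x" "\<And>x. x \<in> space M \<Longrightarrow> 0 \<le> f x \<and> f x \<le> 1"
proof -
  from assms obtain B :: "real set" and f where M: "prob_space M" and B: "B \<in> sets borel" "B \<subseteq> {0..1}"
    and f: "bij_betw f (space M) B" "f \<in> measurable M (restrict_space borel B)"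
      "inv_into (space M) f \<in> measurable (restrict_space borel B) M"
    by (auto simp: Borel_prob_space_def bimeasurable_bij_def space_restrict_space)
  interpret prob_space M by fact
  obtain x0 where x0: "x0 \<in> space M" using not_empty by blast
  \<comment> \<open>The default \<open>x0\<close> outside \<open>B\<close> makes the decoding total,
    so that image measures on the whole line can be used.\<close>
  define g where "g r = (if r \<in> B then inv_into (space M) f r else x0)" for r
  show thesis
  proof
    show "f \<in> borel_measurable M" using f(2) by (simp add: measurable_restrict_space2_iff)
    show "g \<in> measurable borel M"
      unfolding g_def using B(1) f(3) x0 by (subst measurable_If_restrict_space_iff) auto
    show "g (f x) = x" if "x \<in> space M" for x
      using f(1) that by (auto simp: g_def bij_betw_def)
    show "0 \<le> f x \<and> f x \<le> 1" if "x \<in> space M" for x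
      using f(1) that B(2) by (auto simp: bij_betw_def)
  qed
qed

lemma measure_preserving_coding:
  assumes f: "f \<in> borel_measurable M" and g: "g \<in> measurable borel M" and gf: "\<And>x. x \<in> space M \<Longrightarrow> g (f x) = x"
  shows "measure_preserving M (distr M borel f) f" "measure_preserving (distr M borel f) M g"
proof -
  show "measure_preserving M (distr M borel f) f" using f by (simp add: measure_preserving_def cong: distr_cong)
  have "distr (distr M borel f) M g = distr M M (g \<circ> f)" by (rule distr_distr[OF g f])
  also have "\<dots> = distr M M (\<lambda>x. x)" by (rule distr_cong) (auto simp: gf)
  finally show "measure_preserving (distr M borel f) M g" using g by (simp add: measure_preserving_def distr_id)
qed

lemma same_densities_pullback:
  assumes K: "prob_space K1" "prob_space K2" and W: "graphon M1 W1" "graphon M2 W2"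
    and g: "measure_preserving K1 M1 g1" "measure_preserving K2 M2 g2"
    and same: "same_densities M1 W1 M2 W2"
  shows "same_densities K1 (\<lambda>x y. W1 (g1 x) (g1 y)) K2 (\<lambda>x y. W2 (g2 x) (g2 y))"
  using same unfolding same_densities_def
  by (simp add: graphon_density_pullback[OF K(1) W(1) g(1)] graphon_density_pullback[OF K(2) W(2) g(2)])

text \<open>Transfer from the line: both graphons are pulled back along the decodings to the laws of
  the codes, and the kernel found there is conjugated with the codings. Decoding after coding is the
  identity, so \<open>W1\<close> reappears unchanged.\<close>

theorem graphon_kernel:
  assumes B: "Borel_prob_space M1" "Borel_prob_space M2" and W: "graphon M1 W1" "graphon M2 W2"
    and same: "same_densities M1 W1 M2 W2"
  shows "\<exists>\<psi>. measure_preserving (M1 \<Otimes>\<^sub>M unit_interval) M2 \<psi> \<and>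
    (AE p in (M1 \<Otimes>\<^sub>M unit_interval) \<Otimes>\<^sub>M (M1 \<Otimes>\<^sub>M unit_interval). W1 (fst (fst p)) (fst (snd p)) = W2 (\<psi> (fst p)) (\<psi> (snd p)))"
proof -
  obtain f1 :: "'a \<Rightarrow> real" and g1 where fg1: "f1 \<in> borel_measurable M1" "g1 \<in> measurable borel M1" "\<And>x. x \<in> space M1 \<Longrightarrow> g1 (f1 x) = x"
    using Borel_prob_space_coding[OF B(1)] by metis
  obtain f2 :: "'b \<Rightarrow> real" and g2 where fg2: "f2 \<in> borel_measurable M2" "g2 \<in> measurable borel M2" "\<And>x. x \<in> space M2 \<Longrightarrow> g2 (f2 x) = x"
    using Borel_prob_space_coding[OF B(2)] by metis
  interpret M1: prob_space M1 using B(1) by (simp add: Borel_prob_space_def)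
  interpret M2: prob_space M2 using B(2) by (simp add: Borel_prob_space_def)
  interpret U: prob_space unit_interval by (rule prob_space_unit_interval)
  let ?N1 = "distr M1 borel f1" and ?N2 = "distr M2 borel f2"
  interpret N1: prob_space ?N1 by (rule M1.prob_space_distr[OF fg1(1)])
  interpret N2: prob_space ?N2 by (rule M2.prob_space_distr[OF fg2(1)])
  interpret NU: pair_prob_space ?N1 unit_interval ..
  note c1 = measure_preserving_coding[OF fg1] and c2 = measure_preserving_coding[OF fg2]
  let ?V1 = "\<lambda>x y. W1 (g1 x) (g1 y)" and ?V2 = "\<lambda>x y. W2 (g2 x) (g2 y)"
  note V = graphon_pullback[OF W(1) measure_preserving_measurable[OF c1(2)]]
    graphon_pullback[OF W(2) measure_preserving_measurable[OF c2(2)]]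
  have "same_densities ?N1 ?V1 ?N2 ?V2"
    by (rule same_densities_pullback[OF N1.prob_space_axioms N2.prob_space_axioms W c1(2) c2(2) same])
  from real_graphon_coupling[OF N1.prob_space_axioms V(1) N2.prob_space_axioms V(2) _ _ this]
  obtain \<psi>0 where \<psi>0: "\<psi>0 \<in> borel_measurable (?N1 \<Otimes>\<^sub>M unit_interval)" "distr (?N1 \<Otimes>\<^sub>M unit_interval) borel \<psi>0 = ?N2"
    "AE p in (?N1 \<Otimes>\<^sub>M unit_interval) \<Otimes>\<^sub>M (?N1 \<Otimes>\<^sub>M unit_interval). ?V1 (fst (fst p)) (fst (snd p)) = ?V2 (\<psi>0 (fst p)) (\<psi>0 (snd p))"
    by auto
  have "measure_preserving (?N1 \<Otimes>\<^sub>M unit_interval) ?N2 \<psi>0"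
    using \<psi>0(1,2) unfolding measure_preserving_def by (simp cong: distr_cong)
  note \<psi>0_mp = measure_preserving_comp[OF this c2(2)]
  let ?e = "\<lambda>(x, t). (f1 x, t)"
  have e: "measure_preserving (M1 \<Otimes>\<^sub>M unit_interval) (?N1 \<Otimes>\<^sub>M unit_interval) ?e"
    using measure_preserving_pair[OF c1(1) measure_preserving_id U.prob_space_axioms] .
  define \<psi> where "\<psi> z = g2 (\<psi>0 (f1 (fst z), snd z))" for z
  have "measure_preserving (M1 \<Otimes>\<^sub>M unit_interval) M2 \<psi>"
    using measure_preserving_comp[OF e \<psi>0_mp] by (simp add: \<psi>_def[abs_def] case_prod_unfold)
  moreover have "AE p in (M1 \<Otimes>\<^sub>M unit_interval) \<Otimes>\<^sub>M (M1 \<Otimes>\<^sub>M unit_interval). W1 (fst (fst p)) (fst (snd p)) = W2 (\<psi> (fst p)) (\<psi> (snd p))"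
    using AE_measure_preserving[OF measure_preserving_pair[OF e e NU.prob_space_axioms] \<psi>0(3)] AE_space
    by eventually_elim (auto simp: \<psi>_def space_pair_measure fg1(3) case_prod_unfold)
  ultimately show ?thesis by blast
qed

text \<open>Any law on the line is the image of the uniform law under its quantile function; the
  decoding \<open>d\<close> then leads to the given space.\<close>

lemma measure_preserving_from_unit:
  fixes e :: "'a \<Rightarrow> real"
  assumes N: "prob_space N" and e: "e \<in> borel_measurable N" and d: "d \<in> measurable borel N"
    and de: "\<And>x. x \<in> space N \<Longrightarrow> d (e x) = x"
  shows "\<exists>\<phi>. measure_preserving unit_interval N \<phi>"
proof -
  interpret N: prob_space N by fact
  let ?R = "distr N borel e"
  interpret R: real_distribution ?R by (rule N.real_distribution_distr[OF e])
  interpret R: cdf_distribution ?R by unfold_locales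
  let ?O = "restrict_space lborel {0<..<1::real}"
  \<comment> \<open>The quantile function is used only on the open interval; the value 0 elsewhere
    concerns a null set of the unit interval.\<close>
  define \<phi> where "\<phi> t = (if 0 < t \<and> t < 1 then R.I t else 0)" for t
  have "R.I \<in> borel_measurable ?O" using R.measurable_CI by simp
  then have \<phi>m: "\<phi> \<in> borel_measurable borel"
    unfolding \<phi>_def
    by (subst measurable_If_restrict_space_iff) (auto simp: measurable_cong_sets[OF sets_restrict_space_cong[OF sets_lborel] refl] greaterThanLessThan_def greaterThan_def lessThan_def Collect_conj_eq[symmetric])
  have \<phi>U: "\<phi> \<in> borel_measurable unit_interval"
    using measurable_compose[OF measurable_ident_unit_interval \<phi>m] .
  have "distr unit_interval borel \<phi> = ?R"
  proof -
    have "distr unit_interval borel \<phi> = distr ?O borel R.I"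
    proof (rule measure_eqI)
      fix A assume "A \<in> sets (distr unit_interval borel \<phi>)"
      then have A: "A \<in> sets borel" by simp
      have B: "\<phi> -` A \<inter> {0<..<1} \<in> sets borel" using measurable_sets[OF \<phi>m A] by auto
      have "emeasure (distr unit_interval borel \<phi>) A = emeasure unit_interval (\<phi> -` A \<inter> {0..1})"
        using emeasure_distr[OF \<phi>U A] by simp
      also have "\<dots> = emeasure unit_interval (\<phi> -` A \<inter> {0<..<1})"
      proof (rule emeasure_eq_AE)
        show "AE t in unit_interval. (t \<in> \<phi> -` A \<inter> {0..1}) = (t \<in> \<phi> -` A \<inter> {0<..<1})"
          using AE_unit_interval_open by eventually_elim auto
        show "\<phi> -` A \<inter> {0..1} \<in> sets unit_interval" using measurable_sets[OF \<phi>U A] by simp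
        show "\<phi> -` A \<inter> {0<..<1} \<in> sets unit_interval"
          unfolding sets_unit_interval sets_restrict_space using B by (auto intro!: image_eqI[of _ _ "\<phi> -` A \<inter> {0<..<1}"])
      qed
      also have "\<dots> = emeasure lborel (\<phi> -` A \<inter> {0<..<1})" using B by (intro emeasure_unit_interval) auto
      also have "\<dots> = emeasure ?O (\<phi> -` A \<inter> {0<..<1})" using B by (subst emeasure_restrict_space) auto
      also have "\<phi> -` A \<inter> {0<..<1} = R.I -` A \<inter> space ?O"
        by (auto simp: \<phi>_def space_restrict_space)
      also have "emeasure ?O (R.I -` A \<inter> space ?O) = emeasure (distr ?O borel R.I) A"
        using \<open>R.I \<in> borel_measurable ?O\<close> A by (subst emeasure_distr) auto
      finally show "emeasure (distr unit_interval borel \<phi>) A = emeasure (distr ?O borel R.I) A" .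
    qed simp
    also have "\<dots> = ?R" by (rule R.distr_I_eq_M)
    finally show ?thesis .
  qed
  then have "measure_preserving unit_interval ?R \<phi>"
    using \<phi>U by (simp add: measure_preserving_def cong: distr_cong)
  from measure_preserving_comp[OF this measure_preserving_coding(2)[OF e d de]] show ?thesis by blast
qed

text \<open>A Borel injection of the plane into the line: the base-8 digits of \<open>plane_code (x, y)\<close> record
  the comparisons of \<open>x\<close> and \<open>y\<close> with the \<open>n\<close>-th rational; iterating \<open>r \<mapsto> frac (8 r)\<close> reads them off.\<close>

definition plane_digit :: "real \<times> real \<Rightarrow> nat \<Rightarrow> real" where
  "plane_digit z n = of_bool (fst z \<le> of_rat (from_nat n)) + 2 * of_bool (snd z \<le> of_rat (from_nat n))"

text \<open>What is left of the code after \<open>n\<close> digits have been read, rescaled; this is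
  the state that \<open>digit_state n\<close> reaches.\<close>

definition plane_tail :: "real \<times> real \<Rightarrow> nat \<Rightarrow> real" where
  "plane_tail z n = (\<Sum>k. plane_digit z (n + k) * (1/8) ^ Suc k)"

definition plane_code :: "real \<times> real \<Rightarrow> real" where
  "plane_code z = plane_tail z 0"

primrec digit_state :: "nat \<Rightarrow> real \<Rightarrow> real" where
  "digit_state 0 r = r"
| "digit_state (Suc n) r = frac (8 * digit_state n r)"

definition digit_of :: "nat \<Rightarrow> real \<Rightarrow> int" where
  "digit_of n r = \<lfloor>8 * digit_state n r\<rfloor>"

definition plane_decode :: "real \<Rightarrow> real \<times> real" where
  "plane_decode r =
    (real_of_ereal (INF n. if digit_of n r \<in> {1, 3} then ereal (of_rat (from_nat n)) else \<infinity>),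
     real_of_ereal (INF n. if digit_of n r \<in> {2, 3} then ereal (of_rat (from_nat n)) else \<infinity>))"

lemma plane_digit_bounds: "0 \<le> plane_digit z n" "plane_digit z n \<le> 3"
  by (auto simp: plane_digit_def)

lemma plane_tail_summable: "summable (\<lambda>k. plane_digit z (n + k) * (1/8) ^ Suc k)"
proof (rule summable_comparison_test')
  show "summable (\<lambda>k. 3 * (1/8 :: real) ^ Suc k)" by (intro summable_mult) (simp add: summable_Suc_iff)
  show "norm (plane_digit z (n + k) * (1/8) ^ Suc k) \<le> 3 * (1/8) ^ Suc k" if "0 \<le> k" for k
    using plane_digit_bounds[of z "n + k"] by (simp add: abs_mult)
qed

lemma plane_tail_Suc: "8 * plane_tail z n = plane_digit z n + plane_tail z (Suc n)"
proof -
  have "plane_tail z n = plane_digit z n * (1/8) + (\<Sum>k. plane_digit z (n + Suc k) * (1/8) ^ Suc (Suc k))"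
    unfolding plane_tail_def using suminf_split_head[OF plane_tail_summable[of z n]] by simp
  also have "(\<Sum>k. plane_digit z (n + Suc k) * (1/8) ^ Suc (Suc k)) = (1/8) * plane_tail z (Suc n)"
    unfolding plane_tail_def by (subst suminf_mult[symmetric, OF plane_tail_summable]) (simp add: mult_ac)
  finally show ?thesis by simp
qed

text \<open>The digits are at most 3 in base 8, so a tail is at most 3/7. Staying below 1 lets the
  floor read off the digit and rules out ambiguous expansions.\<close>

lemma plane_tail_bounds: "0 \<le> plane_tail z n" "plane_tail z n < 1"
proof -
  show "0 \<le> plane_tail z n"
    unfolding plane_tail_def by (intro suminf_nonneg plane_tail_summable) (simp add: plane_digit_bounds)
  have *: "(\<lambda>k. 3 * (1/8 :: real) ^ Suc k) sums (3/7)"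
    using sums_mult[OF geometric_sums[of "1/8 :: real"], of "3/8"] by simp
  have "plane_tail z n \<le> (\<Sum>k. 3 * (1/8 :: real) ^ Suc k)"
    unfolding plane_tail_def
    by (intro suminf_le plane_tail_summable sums_summable[OF *] mult_right_mono plane_digit_bounds) simp
  also have "\<dots> < 1" using sums_unique[OF *] by simp
  finally show "plane_tail z n < 1" .
qed

lemma floor_plane_tail: "\<lfloor>8 * plane_tail z n\<rfloor> = of_bool (fst z \<le> of_rat (from_nat n)) + 2 * of_bool (snd z \<le> of_rat (from_nat n))"
  unfolding plane_tail_Suc using plane_tail_bounds[of z "Suc n"]
  by (intro floor_unique) (auto simp: plane_digit_def)

lemma digit_state_plane_code: "digit_state n (plane_code z) = plane_tail z n"
proof (induction n)
  case (Suc n)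
  have "frac (8 * plane_tail z n) = plane_tail z (Suc n)"
    unfolding frac_def floor_plane_tail unfolding plane_tail_Suc by (simp add: plane_digit_def)
  then show ?case by (simp add: Suc)
qed (simp add: plane_code_def)

text \<open>A real number is recovered from its comparisons with all rationals. Extended reals keep
  the infimum a countable one over all indices.\<close>

lemma INF_rat_above: "(INF n. if x \<le> real_of_rat (from_nat n) then ereal (of_rat (from_nat n)) else \<infinity>) = ereal x"
proof (rule antisym)
  show "ereal x \<le> (INF n. if x \<le> real_of_rat (from_nat n) then ereal (of_rat (from_nat n)) else \<infinity>)"
    by (rule INF_greatest) auto
  show "(INF n. if x \<le> real_of_rat (from_nat n) then ereal (of_rat (from_nat n)) else \<infinity>) \<le> ereal x"
  proof (rule dense_ge)
    fix y assume "ereal x < y"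
    then obtain b where b: "ereal x < ereal b" "ereal b < y" using ereal_dense2 by blast
    then obtain q where q: "x < of_rat q" "of_rat q < b" using of_rat_dense[of x b] by auto
    have "(INF n. if x \<le> real_of_rat (from_nat n) then ereal (of_rat (from_nat n)) else \<infinity>) \<le> ereal (of_rat q)"
      by (rule INF_lower2[of "to_nat q"]) (use q in auto)
    also have "\<dots> \<le> y" using q b by (meson ereal_less_eq(3) less_imp_le order_trans)
    finally show "(INF n. if x \<le> real_of_rat (from_nat n) then ereal (of_rat (from_nat n)) else \<infinity>) \<le> y" .
  qed
qed

lemma plane_decode_code: "plane_decode (plane_code z) = z"
proof -
  have d: "digit_of n (plane_code z) = of_bool (fst z \<le> of_rat (from_nat n)) + 2 * of_bool (snd z \<le> of_rat (from_nat n))" for n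
    by (simp add: digit_of_def digit_state_plane_code floor_plane_tail)
  have "digit_of n (plane_code z) \<in> {1, 3} \<longleftrightarrow> fst z \<le> of_rat (from_nat n)"
    "digit_of n (plane_code z) \<in> {2, 3} \<longleftrightarrow> snd z \<le> of_rat (from_nat n)" for n
    by (auto simp: d)
  then show ?thesis unfolding plane_decode_def by (simp only: INF_rat_above) (simp add: prod_eq_iff)
qed

lemma plane_code_measurable: "plane_code \<in> borel_measurable (borel \<Otimes>\<^sub>M borel)"
  unfolding plane_code_def[abs_def] plane_tail_def plane_digit_def by measurable

lemma plane_decode_measurable: "plane_decode \<in> measurable borel (borel \<Otimes>\<^sub>M borel)"
proof -
  have [measurable]: "digit_state n \<in> borel_measurable borel" for n
  proof (induction n)
    case 0 then show ?case by (simp add: id_def[symmetric] fun_eq_iff cong: measurable_cong)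
  next
    case (Suc n)
    then show ?case unfolding digit_state.simps frac_def by measurable
  qed
  have d: "digit_of n \<in> measurable borel (count_space UNIV)" for n
    unfolding digit_of_def[abs_def] by measurable
  have [measurable]: "Measurable.pred borel (\<lambda>r. digit_of n r \<in> A)" for n A
    by (rule measurable_compose[OF d, of "\<lambda>i. i \<in> A"]) simp
  show ?thesis unfolding plane_decode_def[abs_def] by measurable
qed

text \<open>The product with the unit interval is coded into the plane and then into the line. A
  kernel that uses an auxiliary uniform variable thereby turns into a pair of maps defined on the
  unit interval alone.\<close>

lemma measure_preserving_unit_times_unit:
  assumes M: "Borel_prob_space M"
  shows "\<exists>\<theta>. measure_preserving unit_interval (M \<Otimes>\<^sub>M unit_interval) \<theta>"
proof -
  obtain f :: "'a \<Rightarrow> real" and g where f: "f \<in> borel_measurable M" and g: "g \<in> measurable borel M" and gf: "\<And>x. x \<in> space M \<Longrightarrow> g (f x) = x"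
    using Borel_prob_space_coding[OF M] by metis
  interpret M: prob_space M using M by (simp add: Borel_prob_space_def)
  interpret U: prob_space unit_interval by (rule prob_space_unit_interval)
  interpret MU: pair_prob_space M unit_interval ..
  \<comment> \<open>Clamping makes the second component of the decoding land in the unit interval
    for every real argument.\<close>
  define c where "c t = max 0 (min 1 t)" for t :: real
  have c: "c \<in> measurable borel unit_interval"
    unfolding measurable_cong_sets[OF refl sets_unit_interval] measurable_restrict_space2_iff
    by (auto simp: c_def[abs_def])
  show ?thesis
  proof (rule measure_preserving_from_unit[OF MU.prob_space_axioms])
    have "(\<lambda>z. (f (fst z), snd z)) \<in> measurable (M \<Otimes>\<^sub>M unit_interval) (borel \<Otimes>\<^sub>M borel)"
      by (intro measurable_Pair measurable_compose[OF measurable_fst f]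
          measurable_compose[OF measurable_snd measurable_ident_unit_interval])
    from measurable_compose[OF this plane_code_measurable]
    show "(\<lambda>z. plane_code (f (fst z), snd z)) \<in> borel_measurable (M \<Otimes>\<^sub>M unit_interval)" .
    have "fst \<circ> plane_decode \<in> borel_measurable borel" "snd \<circ> plane_decode \<in> borel_measurable borel"
      by (rule measurable_comp[OF plane_decode_measurable measurable_fst],
          rule measurable_comp[OF plane_decode_measurable measurable_snd])
    then show "(\<lambda>r. (g (fst (plane_decode r)), c (snd (plane_decode r)))) \<in> measurable borel (M \<Otimes>\<^sub>M unit_interval)"
      using g c by (intro measurable_Pair) (auto simp: comp_def intro: measurable_compose[OF _ g] measurable_compose[OF _ c])
    show "(g (fst (plane_decode (plane_code (f (fst z), snd z)))), c (snd (plane_decode (plane_code (f (fst z), snd z))))) = z"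
      if "z \<in> space (M \<Otimes>\<^sub>M unit_interval)" for z
      using that by (auto simp: plane_decode_code gf c_def space_pair_measure)
  qed
qed

lemma measure_preserving_fst: "prob_space N \<Longrightarrow> measure_preserving (M \<Otimes>\<^sub>M N) M fst"
  by (simp add: measure_preserving_def prob_space.distr_pair_fst)

lemma measure_preserving_snd:
  assumes "prob_space M" "prob_space N"
  shows "measure_preserving (M \<Otimes>\<^sub>M N) N snd"
proof -
  interpret M: prob_space M by fact
  interpret N: prob_space N by fact
  interpret pair_prob_space M N ..
  have "distr (M \<Otimes>\<^sub>M N) N snd = distr (N \<Otimes>\<^sub>M M) N fst"
    by (subst distr_pair_swap) (simp add: distr_distr comp_def case_prod_unfold)
  then show ?thesis by (simp add: measure_preserving_def M.distr_pair_fst)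
qed

section \<open>Twin-free graphons\<close>

lemma graphon_sections_eq_sets:
  assumes "graphon M W" "a \<in> space M" "b \<in> space M"
  shows "{y \<in> space M. W a y = W b y} \<in> sets M"
proof -
  have W: "(\<lambda>(x, y). W x y) \<in> borel_measurable (M \<Otimes>\<^sub>M M)" using assms(1) by (simp add: graphon_def)
  have "(\<lambda>y. W a y) \<in> borel_measurable M" "(\<lambda>y. W b y) \<in> borel_measurable M"
    using measurable_compose[OF measurable_Pair1'[OF assms(2)] W] measurable_compose[OF measurable_Pair1'[OF assms(3)] W] by simp_all
  then show ?thesis by measurable
qed

lemma graphon_eq_pullback_sets:
  assumes W: "graphon M1 W1" "graphon M2 W2" and \<phi>: "\<phi> \<in> measurable M1 M2"
  shows "{z \<in> space (M1 \<Otimes>\<^sub>M M1). W1 (fst z) (snd z) = W2 (\<phi> (fst z)) (\<phi> (snd z))} \<in> sets (M1 \<Otimes>\<^sub>M M1)"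
proof -
  have "(\<lambda>z. W1 (fst z) (snd z)) \<in> borel_measurable (M1 \<Otimes>\<^sub>M M1)"
    using W(1) by (simp add: graphon_def case_prod_unfold)
  moreover have "(\<lambda>z. W2 (\<phi> (fst z)) (\<phi> (snd z))) \<in> borel_measurable (M1 \<Otimes>\<^sub>M M1)"
    using graphon_pullback[OF W(2) \<phi>] by (simp add: graphon_def case_prod_unfold)
  ultimately show ?thesis by measurable
qed

text \<open>Equality of two maps is tested on their real codes, which are injective; the space
  carries no topology of its own.\<close>

lemma Borel_prob_space_eq_sets:
  assumes M: "Borel_prob_space M" and h: "h \<in> measurable K M" "k \<in> measurable K M"
  shows "{z \<in> space K. h z = k z} \<in> sets K"
proof -
  obtain f :: "_ \<Rightarrow> real" and g where f: "f \<in> borel_measurable M" "\<And>x. x \<in> space M \<Longrightarrow> g (f x) = x"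
    using Borel_prob_space_coding[OF M] by metis
  have "(\<lambda>z. f (h z)) \<in> borel_measurable K" "(\<lambda>z. f (k z)) \<in> borel_measurable K"
    using measurable_compose[OF h(1) f(1)] measurable_compose[OF h(2) f(1)] .
  then have "{z \<in> space K. f (h z) = f (k z)} \<in> sets K" by measurable
  also have "{z \<in> space K. f (h z) = f (k z)} = {z \<in> space K. h z = k z}"
    using f(2)[OF measurable_space[OF h(1)]] f(2)[OF measurable_space[OF h(2)]] by auto metis
  finally show ?thesis .
qed

text \<open>Both \<psi> (x, s) and \<psi> (x, t) have sections that coincide with the section of
  \<open>W1\<close> at x, so for typical x, s and t they are twins, hence equal. What remains is to
  choose the common value measurably in x.\<close>

lemma twin_collapse:
  assumes M1: "prob_space M1" and B2: "Borel_prob_space M2" and W: "graphon M1 W1" "graphon M2 W2"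
    and \<psi>: "measure_preserving (M1 \<Otimes>\<^sub>M unit_interval) M2 \<psi>"
    and eq: "AE p in (M1 \<Otimes>\<^sub>M unit_interval) \<Otimes>\<^sub>M (M1 \<Otimes>\<^sub>M unit_interval). W1 (fst (fst p)) (fst (snd p)) = W2 (\<psi> (fst p)) (\<psi> (snd p))"
    and tf: "almost_twin_free M2 W2"
  obtains \<phi> where "measure_preserving M1 M2 \<phi>" "AE z in M1 \<Otimes>\<^sub>M unit_interval. \<psi> z = \<phi> (fst z)"
    "AE z in M1 \<Otimes>\<^sub>M M1. W1 (fst z) (snd z) = W2 (\<phi> (fst z)) (\<phi> (snd z))"
proof -
  let ?MU = "M1 \<Otimes>\<^sub>M unit_interval"
  obtain f2 :: "'b \<Rightarrow> real" and g2 where fg: "f2 \<in> borel_measurable M2" "g2 \<in> measurable borel M2" "\<And>x. x \<in> space M2 \<Longrightarrow> g2 (f2 x) = x"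
    using Borel_prob_space_coding[OF B2] by metis
  interpret M1: prob_space M1 by fact
  interpret M2: prob_space M2 using B2 by (simp add: Borel_prob_space_def)
  interpret U: prob_space unit_interval by (rule prob_space_unit_interval)
  interpret MU: pair_prob_space M1 unit_interval ..
  interpret P: pair_prob_space ?MU ?MU ..
  note \<psi>m = measure_preserving_measurable[OF \<psi>]
  obtain N where N: "N \<in> null_sets M2" "\<And>x1 x2. x1 \<in> space M2 - N \<Longrightarrow> x2 \<in> space M2 - N \<Longrightarrow> twins M2 W2 x1 x2 \<Longrightarrow> x1 = x2"
    using tf unfolding almost_twin_free_def by blast
  \<comment> \<open>The typical points of the product: outside the exceptional set of twin-freeness,
    and with a section relation that holds for almost all partners.\<close>
  define G where "G z \<longleftrightarrow> \<psi> z \<notin> N \<and> \<psi> z \<in> space M2 \<and> (AE w in ?MU. W1 (fst z) (fst w) = W2 (\<psi> z) (\<psi> w))" for z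
  have "AE z in ?MU. \<psi> z \<notin> N" by (rule AE_measure_preserving[OF \<psi> AE_not_in[OF N(1)]])
  moreover have "AE z in ?MU. AE w in ?MU. W1 (fst z) (fst w) = W2 (\<psi> z) (\<psi> w)"
    using P.AE_pair[OF eq] by simp
  ultimately have "AE z in ?MU. G z" unfolding G_def using AE_space
    by eventually_elim (auto intro: measurable_space[OF \<psi>m])
  from MU.AE_pair[OF this] have G: "AE x in M1. AE t in unit_interval. G (x, t)" .
  have Geq: "\<psi> (x, s) = \<psi> (x, t)" if "G (x, s)" "G (x, t)" for x s t
  proof (rule N(2))
    show "\<psi> (x, s) \<in> space M2 - N" "\<psi> (x, t) \<in> space M2 - N" using that by (auto simp: G_def)
    have "AE w in ?MU. W1 x (fst w) = W2 (\<psi> (x, s)) (\<psi> w)" "AE w in ?MU. W1 x (fst w) = W2 (\<psi> (x, t)) (\<psi> w)"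
      using that by (auto simp: G_def)
    then have "AE w in ?MU. W2 (\<psi> (x, s)) (\<psi> w) = W2 (\<psi> (x, t)) (\<psi> w)" by eventually_elim simp
    then show "twins M2 W2 (\<psi> (x, s)) (\<psi> (x, t))" unfolding twins_def
      using AE_measure_preserving_iff[OF \<psi> graphon_sections_eq_sets[OF W(2)]] that by (auto simp: G_def)
  qed
  \<comment> \<open>Averaging the codes over t gives a function measurable in x. For almost every x
    the code is almost surely constant in t, so decoding the mean returns the common value.\<close>
  define \<phi> where "\<phi> x = g2 (\<integral>t. f2 (\<psi> (x, t)) \<partial>unit_interval)" for x
  have f\<psi>: "(\<lambda>z. f2 (\<psi> z)) \<in> borel_measurable ?MU" by (rule measurable_compose[OF \<psi>m fg(1)])
  then have "(\<lambda>x. \<integral>t. f2 (\<psi> (x, t)) \<partial>unit_interval) \<in> borel_measurable M1"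
    by (intro U.borel_measurable_lebesgue_integral) (simp add: case_prod_unfold)
  then have \<phi>m: "\<phi> \<in> measurable M1 M2" unfolding \<phi>_def by (rule measurable_compose[OF _ fg(2)])
  have "AE x in M1. AE t in unit_interval. \<psi> (x, t) = \<phi> x"
    using G AE_space
  proof eventually_elim
    case (elim x)
    have "\<exists>t. G (x, t)"
    proof (rule ccontr)
      assume "\<nexists>t. G (x, t)"
      then have "AE t in unit_interval. False" using elim(1) by simp
      then show False by simp
    qed
    then obtain t0 where t0: "G (x, t0)" ..
    have *: "AE t in unit_interval. \<psi> (x, t) = \<psi> (x, t0)" using elim(1) by eventually_elim (rule Geq[OF _ t0])
    have "(\<integral>t. f2 (\<psi> (x, t)) \<partial>unit_interval) = (\<integral>t. f2 (\<psi> (x, t0)) \<partial>unit_interval)"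
    proof (rule integral_cong_AE)
      show "(\<lambda>t. f2 (\<psi> (x, t))) \<in> borel_measurable unit_interval"
        by (rule measurable_compose[OF measurable_Pair1'[OF elim(2)] f\<psi>])
      show "AE t in unit_interval. f2 (\<psi> (x, t)) = f2 (\<psi> (x, t0))" using * by eventually_elim simp
    qed simp
    moreover have "U.prob {0..1} = 1" using U.prob_space by simp
    ultimately have "\<phi> x = \<psi> (x, t0)" using t0 by (simp add: \<phi>_def fg(3) G_def)
    with * show ?case by simp
  qed
  moreover have "{z \<in> space ?MU. \<psi> z = \<phi> (fst z)} \<in> sets ?MU"
    by (rule Borel_prob_space_eq_sets[OF B2 \<psi>m measurable_compose[OF measurable_fst \<phi>m]])
  ultimately have \<psi>\<phi>: "AE z in ?MU. \<psi> z = \<phi> (fst z)"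
    by (intro MU.AE_pair_measure) simp_all
  note fst_mp = measure_preserving_fst[OF U.prob_space_axioms, of M1]
  have "distr M1 M2 \<phi> = distr (distr ?MU M1 fst) M2 \<phi>" by (simp only: measure_preserving_distr[OF fst_mp])
  also have "\<dots> = distr ?MU M2 (\<phi> \<circ> fst)" by (rule distr_distr[OF \<phi>m]) simp
  also have "\<dots> = distr ?MU M2 \<psi>"
    using \<psi>\<phi> by (intro distr_cong_AE) (auto intro: \<psi>m measurable_comp[OF measurable_fst \<phi>m])
  finally have "measure_preserving M1 M2 \<phi>"
    using \<phi>m by (simp add: measure_preserving_def measure_preserving_distr[OF \<psi>])
  moreover have "AE z in M1 \<Otimes>\<^sub>M M1. W1 (fst z) (snd z) = W2 (\<phi> (fst z)) (\<phi> (snd z))"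
  proof -
    have "AE p in ?MU \<Otimes>\<^sub>M ?MU. W1 (fst (fst p)) (fst (snd p)) = W2 (\<phi> (fst (fst p))) (\<phi> (fst (snd p)))"
      using eq AE_measure_preserving[OF measure_preserving_fst[OF MU.prob_space_axioms] \<psi>\<phi>]
        AE_measure_preserving[OF measure_preserving_snd[OF MU.prob_space_axioms MU.prob_space_axioms] \<psi>\<phi>]
      by eventually_elim simp
    then show ?thesis
      using AE_measure_preserving_iff[OF measure_preserving_pair[OF fst_mp fst_mp M1.prob_space_axioms] graphon_eq_pullback_sets[OF W \<phi>m]]
      by (simp add: case_prod_unfold)
  qed
  ultimately show thesis using \<psi>\<phi> by (intro that)
qed


text \<open>Points with the same image under \<phi> have, up to null sets, the same sections of
  \<open>W1\<close>, so twin-freeness makes \<phi> essentially injective. The inverse is not chosen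
  pointwise; it is the map to which a kernel in the opposite direction collapses, and thus
  measurable.\<close>

lemma almost_inverse:
  assumes B: "Borel_prob_space M1" "Borel_prob_space M2" and W: "graphon M1 W1" "graphon M2 W2"
    and \<phi>: "measure_preserving M1 M2 \<phi>"
    and eq: "AE z in M1 \<Otimes>\<^sub>M M1. W1 (fst z) (snd z) = W2 (\<phi> (fst z)) (\<phi> (snd z))"
    and tf: "almost_twin_free M1 W1"
  obtains \<phi>' where "measure_preserving M2 M1 \<phi>'" "AE x in M1. \<phi>' (\<phi> x) = x" "AE y in M2. \<phi> (\<phi>' y) = y"
proof -
  obtain f :: "'a \<Rightarrow> real" and g where fg: "f \<in> borel_measurable M1" "g \<in> measurable borel M1" "\<And>x. x \<in> space M1 \<Longrightarrow> g (f x) = x"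
    using Borel_prob_space_coding[OF B(1)] by metis
  interpret M1: prob_space M1 using B(1) by (simp add: Borel_prob_space_def)
  interpret M2: prob_space M2 using B(2) by (simp add: Borel_prob_space_def)
  interpret U: prob_space unit_interval by (rule prob_space_unit_interval)
  interpret MU: pair_prob_space M2 unit_interval ..
  note \<phi>m = measure_preserving_measurable[OF \<phi>]
  let ?MU = "M2 \<Otimes>\<^sub>M unit_interval"
  \<comment> \<open>The law of (\<phi> x, x) with x replaced by its code. It is reached both from
    \<open>M1\<close> and, through the disintegration, from \<open>M2\<close> with a uniform
    variable, so almost everywhere statements can be moved between the two.\<close>
  define J where "J = distr M1 (M2 \<Otimes>\<^sub>M borel) (\<lambda>k. (\<phi> k, f k))"
  have sJ: "sets J = sets (M2 \<Otimes>\<^sub>M borel)" by (simp add: J_def)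
  \<comment> \<open>Disintegrate \<open>x\<close> over \<open>\<phi> x\<close>: since \<open>W1\<close> is twin-free, the conditional law of \<open>x\<close> is a Dirac measure.\<close>
  obtain \<psi>0 where \<psi>0: "\<psi>0 \<in> borel_measurable ?MU" "distr ?MU (M2 \<Otimes>\<^sub>M borel) (\<lambda>z. (fst z, \<psi>0 z)) = J"
    using disintegration[OF M1.prob_space_axioms \<phi>m measure_preserving_distr[OF \<phi>] fg(1)] unfolding J_def by blast
  have Am: "(\<lambda>k. (\<phi> k, f k)) \<in> measurable M1 (M2 \<Otimes>\<^sub>M borel)" using \<phi>m fg(1) by measurable
  then have A: "measure_preserving M1 J (\<lambda>k. (\<phi> k, f k))"
    by (simp add: measure_preserving_def J_def measurable_cong_sets[OF refl sJ[unfolded J_def]] cong: distr_cong)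
  have Bm: "(\<lambda>z. (fst z, \<psi>0 z)) \<in> measurable ?MU (M2 \<Otimes>\<^sub>M borel)" using \<psi>0(1) by measurable
  have D: "measure_preserving ?MU J (\<lambda>z. (fst z, \<psi>0 z))"
  proof -
    have "distr ?MU J (\<lambda>z. (fst z, \<psi>0 z)) = distr ?MU (M2 \<Otimes>\<^sub>M borel) (\<lambda>z. (fst z, \<psi>0 z))"
      by (rule distr_cong) (simp_all add: sJ)
    then show ?thesis using Bm by (simp add: measure_preserving_def \<psi>0(2) measurable_cong_sets[OF refl sJ])
  qed
  interpret J: prob_space J unfolding J_def by (rule M1.prob_space_distr[OF Am])
  define h where "h j = g (snd j)" for j :: "'b \<times> real"
  have hm: "h \<in> measurable J M1" unfolding h_def measurable_cong_sets[OF sJ refl]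
    by (rule measurable_compose[OF measurable_snd fg(2)])
  have Jfst: "fst \<in> measurable J M2" unfolding measurable_cong_sets[OF sJ refl] by (rule measurable_fst)
  have "distr J M1 h = distr M1 M1 (h \<circ> (\<lambda>k. (\<phi> k, f k)))"
    by (subst measure_preserving_distr[OF A, symmetric], rule distr_distr[OF hm measure_preserving_measurable[OF A]])
  also have "\<dots> = distr M1 M1 (\<lambda>x. x)" by (rule distr_cong) (auto simp: h_def fg(3))
  finally have h: "measure_preserving J M1 h" using hm by (simp add: measure_preserving_def distr_id)
  define \<psi> where "\<psi> z = g (\<psi>0 z)" for z
  have \<psi>: "measure_preserving ?MU M1 \<psi>"
    using measure_preserving_comp[OF D h] by (simp add: h_def \<psi>_def[abs_def])
  let ?W = "\<lambda>x y. W2 (fst x) (fst y)"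
  have Js: "{z \<in> space (J \<Otimes>\<^sub>M J). ?W (fst z) (snd z) = W1 (h (fst z)) (h (snd z))} \<in> sets (J \<Otimes>\<^sub>M J)"
    by (rule graphon_eq_pullback_sets[OF graphon_pullback[OF W(2) Jfst] W(1) hm])
  have "AE p in M1 \<Otimes>\<^sub>M M1. W2 (\<phi> (fst p)) (\<phi> (snd p)) = W1 (g (f (fst p))) (g (f (snd p)))"
    using eq AE_space by eventually_elim (simp add: space_pair_measure fg(3) mem_Times_iff)
  then have "AE p in J \<Otimes>\<^sub>M J. W2 (fst (fst p)) (fst (snd p)) = W1 (h (fst p)) (h (snd p))"
    using AE_measure_preserving_iff[OF measure_preserving_pair[OF A A J.prob_space_axioms] Js]
    by (simp add: case_prod_unfold h_def)
  from AE_measure_preserving[OF measure_preserving_pair[OF D D J.prob_space_axioms] this]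
  have "AE p in ?MU \<Otimes>\<^sub>M ?MU. W2 (fst (fst p)) (fst (snd p)) = W1 (\<psi> (fst p)) (\<psi> (snd p))"
    by (simp add: case_prod_unfold h_def \<psi>_def)
  from twin_collapse[OF M2.prob_space_axioms B(1) W(2,1) \<psi> this tf]
  obtain \<phi>' where \<phi>': "measure_preserving M2 M1 \<phi>'" "AE z in ?MU. \<psi> z = \<phi>' (fst z)" by blast
  note \<phi>'m = measure_preserving_measurable[OF \<phi>'(1)]
  \<comment> \<open>The collapse says that under \<open>J\<close> the second coordinate is a
    function of the first. Read along x, this is the left inverse property.\<close>
  have "AE j in J. h j = \<phi>' (fst j)"
    using AE_measure_preserving_iff[OF D Borel_prob_space_eq_sets[OF B(1) hm measurable_compose[OF Jfst \<phi>'m]]] \<phi>'(2)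
    by (simp add: h_def \<psi>_def)
  from AE_measure_preserving[OF A this] AE_space
  have inv: "AE x in M1. \<phi>' (\<phi> x) = x" by eventually_elim (simp add: h_def fg(3))
  then have "AE x in M1. \<phi> (\<phi>' (\<phi> x)) = \<phi> x" by eventually_elim simp
  then have "AE y in M2. \<phi> (\<phi>' y) = y"
    using AE_measure_preserving_iff[OF \<phi> Borel_prob_space_eq_sets[OF B(2) measurable_compose[OF \<phi>'m \<phi>m] measurable_ident]]
    by (simp add: id_def)
  with \<phi>'(1) inv show thesis by (rule that)
qed

lemma bimeasurable_bijI:
  assumes "f \<in> measurable M N" "g \<in> measurable N M"
    "\<And>x. x \<in> space M \<Longrightarrow> g (f x) = x" "\<And>y. y \<in> space N \<Longrightarrow> f (g y) = y"
  shows "bimeasurable_bij M N f"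
proof -
  have bij: "bij_betw f (space M) (space N)"
    by (rule bij_betwI[of _ _ _ g]) (use assms measurable_space[OF assms(1)] measurable_space[OF assms(2)] in auto)
  have "inv_into (space M) f y = g y" if "y \<in> space N" for y
    using assms(3,4) that measurable_space[OF assms(2) that] bij
    by (metis bij_betw_inv_into_left)
  then have "inv_into (space M) f \<in> measurable N M" using assms(2) by (simp cong: measurable_cong)
  with bij assms(1) show ?thesis by (simp add: bimeasurable_bij_def)
qed

text \<open>If \<phi>' (\<phi> x) = x, then \<phi> (\<phi>' (\<phi> x)) = \<phi> x. So removing the
  points that fail to return on either side leaves two sets that the maps exchange.\<close>

lemma almost_inverse_bimeasurable_bij:
  assumes "\<phi> \<in> measurable M1 M2" "\<phi>' \<in> measurable M2 M1"
  shows "bimeasurable_bij (restrict_space M1 (space M1 - {x \<in> space M1. \<phi>' (\<phi> x) \<noteq> x}))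
    (restrict_space M2 (space M2 - {y \<in> space M2. \<phi> (\<phi>' y) \<noteq> y})) \<phi>"
  by (rule bimeasurable_bijI[of _ _ _ \<phi>'])
    (use assms measurable_space[OF assms(1)] measurable_space[OF assms(2)] in
      \<open>auto simp: space_restrict_space measurable_restrict_space2_iff intro!: measurable_restrict_space1\<close>)

lemma null_set_of_AE_eq:
  assumes "Borel_prob_space M" "h \<in> measurable M M" "AE x in M. h x = x"
  shows "{x \<in> space M. h x \<noteq> x} \<in> null_sets M"
proof -
  have "{x \<in> space M. h x \<noteq> x} = space M - {x \<in> space M. h x = x}" by auto
  also have "\<dots> \<in> sets M" using Borel_prob_space_eq_sets[OF assms(1,2) measurable_ident] by (simp add: id_def)
  finally show ?thesis using assms(3) by (simp add: AE_iff_null_sets)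
qed

section \<open>Null sets of atomless spaces\<close>

text \<open>The quantile function of a distribution without atoms is injective, with the
  distribution function as left inverse, and its values lie in any closed set of full measure. The
  arctangent transports the line to the open unit interval.\<close>

lemma continuous_distribution_embedding:
  fixes K :: "real set"
  assumes D: "real_distribution D" and cont: "\<And>x. measure D {x} = 0" and K: "closed K" "measure D K = 1"
  obtains a c :: "real \<Rightarrow> real" where "a \<in> borel_measurable borel" "c \<in> borel_measurable borel"
    "\<And>r. a r \<in> K" "\<And>r. c (a r) = r"
proof -
  interpret D: real_distribution D by fact
  interpret D: cdf_distribution D by unfold_locales
  define s where "s r = 1/2 + arctan r / pi" for r
  have s01: "0 < s r" "s r < 1" for r
    using arctan_lbound[of r] arctan_ubound[of r] by (auto simp: s_def field_simps)
  have s: "s \<in> measurable borel (restrict_space borel {0<..<1})"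
    using s01 unfolding s_def by (intro measurable_restrict_space2) (auto simp: field_simps)
  have a: "(\<lambda>r. D.I (s r)) \<in> borel_measurable borel"
    by (rule measurable_compose[OF s]) (use D.measurable_CI in \<open>simp add: measurable_lborel2\<close>)
  have below: "cdf D y < s r" if "y < D.I (s r)" for y r
    using D.pseudoinverse[OF s01[of r], of y] that by auto
  have cdf_le: "s r \<le> cdf D (D.I (s r))" for r using D.pseudoinverse[OF s01[of r], of "D.I (s r)"] by auto
  have cdfI: "cdf D (D.I (s r)) = s r" for r
  proof (rule antisym[OF _ cdf_le])
    have "(cdf D \<longlongrightarrow> cdf D (D.I (s r))) (at_left (D.I (s r)))"
      using D.isCont_cdf cont by (auto simp: isCont_def intro: filterlim_mono[OF _ order_refl at_le])
    then show "cdf D (D.I (s r)) \<le> s r"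
      by (rule tendsto_upperbound) (auto simp: eventually_at_left_field intro!: exI[of _ "D.I (s r) - 1"] less_imp_le below)
  qed
  have "D.I (s r) \<in> closure K" for r
  proof (rule ccontr)
    assume "D.I (s r) \<notin> closure K"
    then obtain e where e: "0 < e" "\<And>y. y \<in> K \<Longrightarrow> e \<le> dist y (D.I (s r))"
      unfolding closure_approachable by (auto simp: not_less)
    let ?x = "D.I (s r)" let ?A = "{?x - e/2<..?x}"
    \<comment> \<open>If a quantile had a positive distance from \<open>K\<close>, a short interval
      ending at it would carry no mass, while the distribution function is strictly smaller to the
      left of a quantile.\<close>
    have "K \<inter> ?A = {}" using e by (force simp: dist_real_def)
    then have "measure D (K \<union> ?A) = measure D K + measure D ?A"
      using K(1) by (intro D.finite_measure_Union) auto
    then have "measure D ?A \<le> 0" using K(2) D.prob_le_1[of "K \<union> ?A"] by simp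
    moreover have "cdf D ?x - cdf D (?x - e/2) = measure D ?A" using e(1) by (intro D.cdf_diff_eq) auto
    ultimately show False using below[of "?x - e/2" r] cdf_le[of r] e(1) by auto
  qed
  then have inK: "D.I (s r) \<in> K" for r using K(1) by simp
  define c where "c y = tan (pi * (cdf D y - 1/2))" for y
  have "mono (cdf D)" by (auto simp: mono_def D.cdf_nondecreasing)
  then have "cdf D \<in> borel_measurable borel" by (rule borel_measurable_mono)
  then have "c \<in> borel_measurable borel" unfolding c_def tan_def by measurable
  moreover have "c (D.I (s r)) = r" for r
    unfolding c_def cdfI by (simp add: s_def arctan)
  ultimately show thesis using a inK by (intro that)
qed

lemma atomless_singleton:
  assumes "atomless M" "{x} \<in> sets M"
  shows "emeasure M {x} = 0"
proof (rule ccontr)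
  assume "emeasure M {x} \<noteq> 0"
  then have "0 < emeasure M {x}" by (simp add: zero_less_iff_neq_zero)
  moreover have "\<forall>B\<in>sets M. B \<subseteq> {x} \<longrightarrow> emeasure M B = 0 \<or> emeasure M B = emeasure M {x}"
    by (auto simp: subset_singleton_iff)
  ultimately show False using assms unfolding atomless_def by blast
qed

text \<open>The embedding has to avoid \<open>N\<close>, and the values of a quantile function are
  only known to lie in a closed set. Inner regularity provides a compact set of positive measure
  among the codes of points outside \<open>N\<close>, and the law of the codes is conditioned on
  it.\<close>

lemma real_line_embedding:
  assumes B: "Borel_prob_space M" and at: "atomless M" and N: "N \<in> null_sets M"
  obtains a :: "real \<Rightarrow> 'a" and c where "a \<in> measurable borel M" "c \<in> borel_measurable M"
    "\<And>r. a r \<in> space M - N" "\<And>r. c (a r) = r"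
proof -
  obtain f :: "'a \<Rightarrow> real" and g where fg: "f \<in> borel_measurable M" "g \<in> measurable borel M" "\<And>x. x \<in> space M \<Longrightarrow> g (f x) = x"
    using Borel_prob_space_coding[OF B] by metis
  interpret M: prob_space M using B by (simp add: Borel_prob_space_def)
  let ?D = "distr M borel f"
  interpret D: real_distribution ?D by (rule M.real_distribution_distr[OF fg(1)])
  have sing: "emeasure ?D {r} = 0" for r
  proof -
    have e: "emeasure ?D {r} = emeasure M (f -` {r} \<inter> space M)" using fg(1) by (simp add: emeasure_distr)
    have m: "f -` {r} \<inter> space M \<in> sets M" using fg(1) by measurable
    have "f -` {r} \<inter> space M \<subseteq> {g r}" using fg(3) by auto
    then have "f -` {r} \<inter> space M = {} \<or> f -` {r} \<inter> space M = {g r}" by (rule subset_singletonD)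
    then show ?thesis using e m atomless_singleton[OF at, of "g r"] by auto
  qed
  \<comment> \<open>The codes of points outside \<open>N\<close>.\<close>
  let ?E = "{r. g r \<in> space M - N \<and> f (g r) = r}"
  have E: "?E \<in> sets borel"
  proof -
    have "(\<lambda>r. f (g r)) \<in> borel_measurable borel" by (rule measurable_compose[OF fg(2,1)])
    then have "{r \<in> space borel. f (g r) = r} \<in> sets borel" by measurable
    moreover have "g -` (space M - N) \<inter> space borel \<in> sets borel" using N by (intro measurable_sets[OF fg(2)]) auto
    ultimately have "{r \<in> space borel. f (g r) = r} \<inter> (g -` (space M - N) \<inter> space borel) \<in> sets borel" by (rule sets.Int)
    then show ?thesis by (rule back_subst[of "\<lambda>S. S \<in> sets borel"]) auto
  qed
  have "AE x in M. f x \<in> ?E" using AE_not_in[OF N] AE_space by eventually_elim (simp add: fg(3))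
  then have "AE r in ?D. r \<in> ?E" using E by (subst AE_distr_iff[OF fg(1)]) auto
  then have "emeasure ?D ?E = 1" using E by (intro D.emeasure_eq_1_AE) auto
  moreover have "emeasure ?D ?E = (SUP K\<in>{K. K \<subseteq> ?E \<and> compact K}. emeasure ?D K)"
    using E by (intro inner_regular) auto
  ultimately have "0 < (SUP K\<in>{K. K \<subseteq> ?E \<and> compact K}. emeasure ?D K)" by simp
  then obtain K where K: "K \<subseteq> ?E" "compact K" "0 < emeasure ?D K" unfolding less_SUP_iff by blast
  have Kc: "closed K" by (rule compact_imp_closed[OF K(2)])
  then have Ks: "K \<in> sets borel" by simp
  let ?U = "uniform_measure ?D K"
  have U: "real_distribution ?U"
    unfolding real_distribution_def real_distribution_axioms_def
    using K(3) D.emeasure_finite[of K] by (simp add: prob_space_uniform_measure)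
  have "measure ?U {x} = 0" for x
  proof -
    have "emeasure ?D (K \<inter> {x}) \<le> emeasure ?D {x}" by (rule emeasure_mono) auto
    then have "emeasure ?D (K \<inter> {x}) = 0" by (simp add: sing)
    then show ?thesis using Ks by (simp add: measure_def)
  qed
  moreover have "measure ?U K = 1"
  proof -
    have "emeasure ?D K / emeasure ?D K = 1"
      using K(3) D.emeasure_finite[of K] by (intro ennreal_divide_self) (simp_all add: less_top[symmetric])
    then show ?thesis using Ks by (simp only: measure_def emeasure_uniform_measure[OF Ks[folded sets_distr] Ks[folded sets_distr]] Int_absorb) simp
  qed
  ultimately obtain a c :: "real \<Rightarrow> real" where ac: "a \<in> borel_measurable borel" "c \<in> borel_measurable borel"
    "\<And>r. a r \<in> K" "\<And>r. c (a r) = r"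
    using continuous_distribution_embedding[OF U _ Kc] by metis
  have aE: "g (a r) \<in> space M - N" "f (g (a r)) = a r" for r using ac(3)[of r] K(1) by auto
  show thesis
  proof
    show "(\<lambda>r. g (a r)) \<in> measurable borel M" by (rule measurable_compose[OF ac(1) fg(2)])
    show "(\<lambda>x. c (f x)) \<in> borel_measurable M" by (rule measurable_compose[OF fg(1) ac(2)])
  qed (simp_all add: aE ac(4) aE(1)[simplified])
qed

text \<open>A copy of the plane inside a null set provides room that may be rearranged without
  affecting almost everywhere statements. The plane is used because a room of the hotel needs a real
  coordinate for the guest and another for its number.\<close>

lemma null_plane_embedding:
  assumes B: "Borel_prob_space M" and at: "atomless M" and N: "N \<in> null_sets M"
  obtains e :: "real \<times> real \<Rightarrow> 'a" and k Z where "e \<in> measurable (borel \<Otimes>\<^sub>M borel) M" "k \<in> measurable M (borel \<Otimes>\<^sub>M borel)"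
    "\<And>p. k (e p) = p" "Z \<in> null_sets M" "\<And>p. e p \<in> Z - N"
proof -
  interpret M: prob_space M using B by (simp add: Borel_prob_space_def)
  obtain a :: "real \<Rightarrow> 'a" and c where ac: "a \<in> measurable borel M" "c \<in> borel_measurable M"
    "\<And>r. a r \<in> space M - N" "\<And>r. c (a r) = r"
    using real_line_embedding[OF assms] by metis
  have km: "(\<lambda>y. plane_decode (c y)) \<in> measurable M (borel \<Otimes>\<^sub>M borel)"
    by (rule measurable_compose[OF ac(2) plane_decode_measurable])
  let ?h = "\<lambda>y. fst (plane_decode (c y))"
  have hm: "?h \<in> borel_measurable M" by (rule measurable_compose[OF km measurable_fst])
  interpret D: prob_space "distr M borel ?h" by (rule M.prob_space_distr[OF hm])
  have "countable {s. measure (distr M borel ?h) {s} \<noteq> 0}" by (rule D.countable_support)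
  moreover have "\<not> countable (UNIV :: real set)" by (simp add: uncountable_UNIV_real)
  ultimately have "{s. measure (distr M borel ?h) {s} \<noteq> 0} \<noteq> UNIV" by metis
  then obtain s where "measure (distr M borel ?h) {s} = 0" by blast
  then have s: "emeasure (distr M borel ?h) {s} = 0" by (simp add: D.emeasure_eq_measure)
  define Z where "Z = ?h -` {s} \<inter> space M"
  \<comment> \<open>The images of the lines \<open>{s} \<times> \<real>\<close> are disjoint, so all but countably many of them are null.\<close>
  define e where "e p = a (plane_code (s, plane_code p))" for p
  define k where "k y = plane_decode (snd (plane_decode (c y)))" for y
  show thesis
  proof
    show "Z \<in> null_sets M" using s hm by (auto simp: Z_def emeasure_distr intro!: null_setsI measurable_sets[OF hm])
    have "(\<lambda>p. (s, plane_code p)) \<in> measurable (borel \<Otimes>\<^sub>M borel) (borel \<Otimes>\<^sub>M borel)"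
      using plane_code_measurable by measurable
    from measurable_compose[OF measurable_compose[OF this plane_code_measurable] ac(1)]
    show "e \<in> measurable (borel \<Otimes>\<^sub>M borel) M" by (simp add: e_def[abs_def])
    show "k \<in> measurable M (borel \<Otimes>\<^sub>M borel)"
      unfolding k_def by (rule measurable_compose[OF measurable_compose[OF km measurable_snd] plane_decode_measurable])
    show "k (e p) = p" for p by (simp add: k_def e_def ac(4) plane_decode_code)
    show "e p \<in> Z - N" for p using ac(3)[of "plane_code (s, plane_code p)"] by (simp add: Z_def e_def ac(4) plane_decode_code)
  qed
qed

text \<open>Hilbert's hotel: each \<open>x \<in> N\<close> is the first of the countably many points \<open>e (f x, n)\<close> of \<open>Z\<close>, which are
  shifted by one to make room for it; \<open>f\<close> is a coding of \<open>M\<close> by real numbers.\<close>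

lemma null_set_absorption:
  fixes e :: "real \<times> real \<Rightarrow> 'a"
  assumes B: "Borel_prob_space M" and N: "N \<in> sets M"
    and e: "e \<in> measurable (borel \<Otimes>\<^sub>M borel) M" and k: "k \<in> measurable M (borel \<Otimes>\<^sub>M borel)"
    and ke: "\<And>p. k (e p) = p" and eZ: "\<And>p. e p \<in> Z - N"
  obtains \<beta> \<beta>' where "\<beta> \<in> measurable M M" "\<beta>' \<in> measurable M M" "\<And>x. x \<in> space M \<Longrightarrow> \<beta> x \<notin> N \<and> \<beta>' (\<beta> x) = x"
    "\<And>y. y \<in> space M - N \<Longrightarrow> \<beta> (\<beta>' y) = y" "\<And>x. x \<notin> N \<union> Z \<Longrightarrow> \<beta> x = x \<and> \<beta>' x = x"
proof -
  obtain f :: "'a \<Rightarrow> real" and g where fg: "f \<in> borel_measurable M" "g \<in> measurable borel M" "\<And>x. x \<in> space M \<Longrightarrow> g (f x) = x"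
    using Borel_prob_space_coding[OF B] by metis
  \<comment> \<open>The occupied rooms \<open>e (f x, n)\<close> with x in \<open>N\<close> and n a
    natural number. They are described through the left inverse \<open>k\<close> rather than as an
    image, which makes the set measurable.\<close>
  define H where "H = {y \<in> space M. e (k y) = y \<and> snd (k y) \<in> \<nat> \<and> g (fst (k y)) \<in> N \<and> f (g (fst (k y))) = fst (k y)}"
  have k1: "(\<lambda>y. fst (k y)) \<in> borel_measurable M" and k2: "(\<lambda>y. snd (k y)) \<in> borel_measurable M"
    by (rule measurable_compose[OF k measurable_fst] measurable_compose[OF k measurable_snd])+
  have gk: "(\<lambda>y. g (fst (k y))) \<in> measurable M M" by (rule measurable_compose[OF k1 fg(2)])
  have H: "H \<in> sets M"
  proof -
    have "{y \<in> space M. e (k y) = y} \<in> sets M"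
      using Borel_prob_space_eq_sets[OF B measurable_compose[OF k e] measurable_ident] by (simp add: id_def)
    moreover have "(\<lambda>y. snd (k y)) -` \<nat> \<inter> space M \<in> sets M"
    proof (rule measurable_sets[OF k2])
      show "(\<nat> :: real set) \<in> sets borel" unfolding Nats_def by (rule sets.countable) simp_all
    qed
    moreover have "(\<lambda>y. g (fst (k y))) -` N \<inter> space M \<in> sets M" by (rule measurable_sets[OF gk N])
    moreover have "{y \<in> space M. f (g (fst (k y))) = fst (k y)} \<in> sets M"
      using measurable_compose[OF gk fg(1)] k1 by measurable
    ultimately have "{y \<in> space M. e (k y) = y} \<inter> ((\<lambda>y. snd (k y)) -` \<nat> \<inter> space M) \<inter>
      ((\<lambda>y. g (fst (k y))) -` N \<inter> space M) \<inter> {y \<in> space M. f (g (fst (k y))) = fst (k y)} \<in> sets M"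
      by (rule sets.Int[OF sets.Int[OF sets.Int]])
    then show ?thesis by (rule back_subst[of "\<lambda>S. S \<in> sets M"]) (auto simp: H_def)
  qed
  have es: "e p \<in> space M" for p using measurable_space[OF e, of p] by (simp add: space_pair_measure)
  have NS: "N \<subseteq> space M" by (rule sets.sets_into_space[OF N])
  have eH: "e (f x, n) \<in> H" if "x \<in> N" "n \<in> \<nat>" for x n
    using that es NS by (auto simp: H_def ke fg(3))
  have HE: "\<exists>x n. y = e (f x, real n) \<and> x \<in> N" if "y \<in> H" for y
  proof -
    from that obtain n where n: "snd (k y) = real n" by (auto simp: H_def Nats_def)
    have "y = e (f (g (fst (k y))), real n)" using that n[symmetric] by (simp add: H_def)
    moreover have "g (fst (k y)) \<in> N" using that by (simp add: H_def)
    ultimately show ?thesis by blast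
  qed
  have HN: "H \<inter> N = {}" "H \<subseteq> Z" using HE eZ by blast+
  define \<beta> where "\<beta> x = (if x \<in> N then e (f x, 0) else if x \<in> H then e (fst (k x), snd (k x) + 1) else x)" for x
  define \<beta>' where "\<beta>' y = (if y \<in> H then if snd (k y) = 0 then g (fst (k y)) else e (fst (k y), snd (k y) - 1) else y)" for y
  have \<beta>N: "\<beta> x = e (f x, 0)" if "x \<in> N" for x using that by (simp add: \<beta>_def)
  have \<beta>H: "\<beta> (e (f x, real n)) = e (f x, real (Suc n))" if "x \<in> N" for x n
    using eH[OF that, of "real n"] HN by (auto simp: \<beta>_def ke add.commute)
  have \<beta>'0: "\<beta>' (e (f x, 0)) = x" if "x \<in> N" for x
    using eH[OF that, of 0] that NS by (auto simp: \<beta>'_def ke fg(3))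
  have \<beta>'S: "\<beta>' (e (f x, real (Suc n))) = e (f x, real n)" if "x \<in> N" for x n
    using eH[OF that, of "real (Suc n)"] by (auto simp: \<beta>'_def ke)
  have id: "\<beta> x = x" "\<beta>' x = x" if "x \<notin> N" "x \<notin> H" for x using that by (auto simp: \<beta>_def \<beta>'_def)
  show thesis
  proof
    have "(\<lambda>x. e (f x, 0)) \<in> measurable M M" "(\<lambda>x. e (fst (k x), snd (k x) + 1)) \<in> measurable M M"
      "(\<lambda>x. e (fst (k x), snd (k x) - 1)) \<in> measurable M M"
      by (rule measurable_compose[OF _ e], use fg(1) k1 k2 in measurable)+
    moreover have "{x \<in> space M. snd (k x) = 0} \<in> sets M" using k2 by measurable
    moreover have "{x \<in> space M. x \<in> N} = N" "{x \<in> space M. x \<in> H} = H" using NS by (auto simp: H_def)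
    ultimately show "\<beta> \<in> measurable M M" "\<beta>' \<in> measurable M M"
      unfolding \<beta>_def \<beta>'_def using N H gk by (auto intro!: measurable_If)
    show "\<beta> x \<notin> N \<and> \<beta>' (\<beta> x) = x" if "x \<in> space M" for x
    proof -
      consider "x \<in> N" | "x \<in> H" | "x \<notin> N" "x \<notin> H" by blast
      then show ?thesis
      proof cases
        case 1 then show ?thesis using \<beta>N[OF 1] \<beta>'0[OF 1] eZ by auto
      next
        case 2
        then obtain y n where y: "x = e (f y, real n)" "y \<in> N" using HE by blast
        show ?thesis unfolding y(1) \<beta>H[OF y(2)] using \<beta>'S[OF y(2)] eZ by blast
      next
        case 3 then show ?thesis by (simp add: id)
      qed
    qed
    show "\<beta> (\<beta>' y) = y" if y: "y \<in> space M - N" for y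
    proof (cases "y \<in> H")
      case True
      then obtain x n where x: "y = e (f x, real n)" "x \<in> N" using HE by blast
      show ?thesis
      proof (cases n)
        case 0 then show ?thesis using x \<beta>N \<beta>'0 by simp
      next
        case (Suc m)
        show ?thesis unfolding x(1) Suc \<beta>'S[OF x(2)] by (rule \<beta>H[OF x(2)])
      qed
    qed (use y id in auto)
    show "\<beta> x = x \<and> \<beta>' x = x" if "x \<notin> N \<union> Z" for x using that id HN(2) by auto
  qed
qed

text \<open>On an atom the conditional distribution function takes only the values 0 and 1. It is
  continuous because points have Lebesgue measure 0, so the intermediate value theorem gives a
  contradiction.\<close>

lemma atomless_unit_interval: "atomless unit_interval"
  unfolding atomless_def
proof (intro notI, elim bexE conjE)
  fix A assume A: "A \<in> sets unit_interval" "0 < emeasure unit_interval A"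
    and atom: "\<forall>B\<in>sets unit_interval. B \<subseteq> A \<longrightarrow> emeasure unit_interval B = 0 \<or> emeasure unit_interval B = emeasure unit_interval A"
  have A': "A \<in> sets borel" "A \<subseteq> {0..1}"
    using A(1) by (auto simp: unit_interval_def sets_restrict_space)
  have em: "emeasure unit_interval B = emeasure lborel B" if "B \<in> sets borel" "B \<subseteq> A" for B
    using that A'(2) unfolding unit_interval_def by (subst emeasure_restrict_space) auto
  let ?D = "uniform_measure lborel A"
  have fin: "emeasure lborel A \<noteq> \<infinity>" "emeasure lborel A \<noteq> 0"
    using A(2) em[OF A'(1)] emeasure_mono[of A "{0..1::real}" lborel] A' by (auto simp: top_unique)
  interpret D: real_distribution ?D
    unfolding real_distribution_def real_distribution_axioms_def
    using fin by (auto intro!: prob_space_uniform_measure)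
  have cdf: "cdf ?D t = 0 \<or> cdf ?D t = 1" for t
  proof -
    have s: "A \<inter> {..t} \<in> sets borel" using A' by auto
    have "A \<inter> {..t} \<in> sets unit_interval"
      using s A'(2) unfolding unit_interval_def by (auto simp: sets_restrict_space intro!: image_eqI[of _ _ "A \<inter> {..t}"])
    then have "emeasure lborel (A \<inter> {..t}) = 0 \<or> emeasure lborel (A \<inter> {..t}) = emeasure lborel A"
      using atom em[OF s] em[OF A'(1)] by auto
    then show ?thesis
      using A'(1) fin unfolding cdf_def measure_def by (auto simp: ennreal_divide_self less_top)
  qed
  have "isCont (cdf ?D) t" for t
  proof -
    have "emeasure lborel (A \<inter> {t}) \<le> emeasure lborel {t}" by (rule emeasure_mono) auto
    then have "measure ?D {t} = 0" using A'(1) by (simp add: measure_def)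
    then show ?thesis by (simp add: D.isCont_cdf)
  qed
  then have cont: "\<And>a b. continuous_on {a..b} (cdf ?D)" by (simp add: continuous_at_imp_continuous_on)
  have "eventually (\<lambda>t. cdf ?D t < 1/2) at_bot" using D.cdf_lim_at_bot by (rule order_tendstoD(2)) simp
  then obtain a where a: "cdf ?D a < 1/2" by (auto simp: eventually_at_bot_linorder)
  have "eventually (\<lambda>t. 1/2 < cdf ?D t) at_top" using D.cdf_lim_at_top_prob by (rule order_tendstoD(1)) simp
  then obtain b where b: "1/2 < cdf ?D b" by (auto simp: eventually_at_top_linorder)
  have "a \<le> b" using a b D.cdf_nondecreasing[of b a] by (cases "a \<le> b") auto
  from IVT'[of "cdf ?D" a "1/2" b, OF _ _ this cont] a b obtain t where "cdf ?D t = 1/2" by auto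
  with cdf[of t] show False by auto
qed

text \<open>The maps are inverse to each other between the complements of two null sets
  \<open>N1\<close> and \<open>N2\<close>. Each null set is absorbed by its own Hilbert hotel. The
  hotel in \<open>M2\<close> comes from the absence of atoms, the one in \<open>M1\<close> is its
  image under \<phi>'.\<close>

lemma atomless_isomorphism:
  assumes B: "Borel_prob_space M1" "Borel_prob_space M2" and at: "atomless M2"
    and \<phi>: "measure_preserving M1 M2 \<phi>" "measure_preserving M2 M1 \<phi>'"
    and inv: "AE x in M1. \<phi>' (\<phi> x) = x" "AE y in M2. \<phi> (\<phi>' y) = y"
  obtains \<kappa> where "measure_preserving M1 M2 \<kappa>" "bimeasurable_bij M1 M2 \<kappa>" "AE x in M1. \<kappa> x = \<phi> x"
proof -
  note m1 = measure_preserving_measurable[OF \<phi>(1)] and m2 = measure_preserving_measurable[OF \<phi>(2)]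
  note sp = measurable_space[OF m1] measurable_space[OF m2]
  define N1 where "N1 = {x \<in> space M1. \<phi>' (\<phi> x) \<noteq> x}"
  define N2 where "N2 = {y \<in> space M2. \<phi> (\<phi>' y) \<noteq> y}"
  have N1: "N1 \<in> null_sets M1" unfolding N1_def by (rule null_set_of_AE_eq[OF B(1) measurable_compose[OF m1 m2] inv(1)])
  have N2: "N2 \<in> null_sets M2" unfolding N2_def by (rule null_set_of_AE_eq[OF B(2) measurable_compose[OF m2 m1] inv(2)])
  have inv1: "\<phi>' (\<phi> x) = x" "\<phi> x \<in> space M2 - N2" if "x \<in> space M1" "x \<notin> N1" for x
    using that sp by (auto simp: N1_def N2_def)
  have inv2: "\<phi> (\<phi>' y) = y" "\<phi>' y \<in> space M1 - N1" if "y \<in> space M2" "y \<notin> N2" for y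
    using that sp by (auto simp: N1_def N2_def)
  obtain e :: "real \<times> real \<Rightarrow> 'b" and k Z where e: "e \<in> measurable (borel \<Otimes>\<^sub>M borel) M2" "k \<in> measurable M2 (borel \<Otimes>\<^sub>M borel)"
    "\<And>p. k (e p) = p" "Z \<in> null_sets M2" "\<And>p. e p \<in> Z - N2"
    using null_plane_embedding[OF B(2) at N2] by metis
  have es: "e p \<in> space M2" "e p \<notin> N2" "e p \<in> Z" for p using e(5)[of p] null_setsD2[OF e(4), THEN sets.sets_into_space] by auto
  define Z1 where "Z1 = \<phi> -` Z \<inter> space M1"
  have Z1: "Z1 \<in> null_sets M1"
    using AE_measure_preserving[OF \<phi>(1) AE_not_in[OF e(4)]] measurable_sets[OF m1 null_setsD2[OF e(4)]]
    by (subst AE_iff_null_sets) (auto simp: Z1_def elim: eventually_mono)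
  have e1: "\<phi>' (e p) \<in> Z1 - N1" "k (\<phi> (\<phi>' (e p))) = p" for p
    using inv2[OF es(1,2)] es(3)[of p] by (auto simp: Z1_def e(3))
  obtain \<beta>1 \<beta>1' where \<beta>1: "\<beta>1 \<in> measurable M1 M1" "\<beta>1' \<in> measurable M1 M1" "\<And>x. x \<in> space M1 \<Longrightarrow> \<beta>1 x \<notin> N1 \<and> \<beta>1' (\<beta>1 x) = x"
    "\<And>y. y \<in> space M1 - N1 \<Longrightarrow> \<beta>1 (\<beta>1' y) = y" "\<And>x. x \<notin> N1 \<union> Z1 \<Longrightarrow> \<beta>1 x = x \<and> \<beta>1' x = x"
    using null_set_absorption[OF B(1) null_setsD2[OF N1] measurable_compose[OF e(1) m2] measurable_compose[OF m1 e(2)] e1(2,1)] by blast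
  obtain \<beta>2 \<beta>2' where \<beta>2: "\<beta>2 \<in> measurable M2 M2" "\<beta>2' \<in> measurable M2 M2" "\<And>x. x \<in> space M2 \<Longrightarrow> \<beta>2 x \<notin> N2 \<and> \<beta>2' (\<beta>2 x) = x"
    "\<And>y. y \<in> space M2 - N2 \<Longrightarrow> \<beta>2 (\<beta>2' y) = y" "\<And>x. x \<notin> N2 \<union> Z \<Longrightarrow> \<beta>2 x = x \<and> \<beta>2' x = x"
    using null_set_absorption[OF B(2) null_setsD2[OF N2] e(1,2,3,5)] by blast
  note s1 = measurable_space[OF \<beta>1(1)] and s2 = measurable_space[OF \<beta>2(1)]
  \<comment> \<open>Moves \<open>M1\<close> bijectively off \<open>N1\<close>, crosses over by
    \<phi>, and spreads the complement of \<open>N2\<close> over all of \<open>M2\<close>. The two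
    outer maps differ from the identity only on null sets.\<close>
  define \<kappa> where "\<kappa> x = \<beta>2' (\<phi> (\<beta>1 x))" for x
  define \<kappa>' where "\<kappa>' y = \<beta>1' (\<phi>' (\<beta>2 y))" for y
  have \<kappa>m: "\<kappa> \<in> measurable M1 M2" "\<kappa>' \<in> measurable M2 M1" unfolding \<kappa>_def \<kappa>'_def
    by (rule measurable_compose[OF measurable_compose[OF \<beta>1(1) m1] \<beta>2(2)], rule measurable_compose[OF measurable_compose[OF \<beta>2(1) m2] \<beta>1(2)])
  have "bimeasurable_bij M1 M2 \<kappa>"
  proof (rule bimeasurable_bijI[OF \<kappa>m])
    fix x assume x: "x \<in> space M1"
    note * = inv1[OF s1[OF x] conjunct1[OF \<beta>1(3)[OF x]]]
    show "\<kappa>' (\<kappa> x) = x" unfolding \<kappa>_def \<kappa>'_def \<beta>2(4)[OF *(2)] *(1) using \<beta>1(3)[OF x] by blast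
  next
    fix y assume y: "y \<in> space M2"
    note * = inv2[OF s2[OF y] conjunct1[OF \<beta>2(3)[OF y]]]
    show "\<kappa> (\<kappa>' y) = y" unfolding \<kappa>_def \<kappa>'_def \<beta>1(4)[OF *(2)] *(1) using \<beta>2(3)[OF y] by blast
  qed
  moreover have eq: "AE x in M1. \<kappa> x = \<phi> x"
    using AE_not_in[OF N1] AE_not_in[OF Z1] AE_measure_preserving[OF \<phi>(1) AE_not_in[OF N2]] AE_measure_preserving[OF \<phi>(1) AE_not_in[OF e(4)]]
    by eventually_elim (simp add: \<kappa>_def \<beta>1(5) \<beta>2(5))
  moreover have "measure_preserving M1 M2 \<kappa>"
    using distr_cong_AE[OF refl refl eq \<kappa>m(1) m1] \<kappa>m(1) measure_preserving_distr[OF \<phi>(1)] by (simp add: measure_preserving_def)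
  ultimately show thesis by (intro that)
qed

lemma graphon_eq_cong_AE:
  assumes M: "prob_space M1" and eq: "AE z in M1 \<Otimes>\<^sub>M M1. W1 (fst z) (snd z) = W2 (\<phi> (fst z)) (\<phi> (snd z))"
    and \<kappa>: "AE x in M1. \<kappa> x = \<phi> x"
  shows "AE z in M1 \<Otimes>\<^sub>M M1. W1 (fst z) (snd z) = W2 (\<kappa> (fst z)) (\<kappa> (snd z))"
  using eq AE_measure_preserving[OF measure_preserving_fst[OF M] \<kappa>] AE_measure_preserving[OF measure_preserving_snd[OF M M] \<kappa>]
  by eventually_elim simp

theorem theorem8p1:
  fixes M1 :: "'a measure" and M2 :: "'b measure"
    and W1 :: "'a \<Rightarrow> 'a \<Rightarrow> real" and W2 :: "'b \<Rightarrow> 'b \<Rightarrow> real"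
    and \<Gamma>1 \<Gamma>2 :: graph_limit
  assumes "Borel_prob_space M1" and "Borel_prob_space M2"
    and "graphon M1 W1" and "graphon M2 W2"
    and "\<Gamma>1 = graphon_limit M1 W1" and "\<Gamma>2 = graphon_limit M2 W2"
  shows
    "(\<Gamma>1 = \<Gamma>2 \<longleftrightarrow>
        (\<forall>F. pair_graph F \<longrightarrow> limit_density F \<Gamma>1 = limit_density F \<Gamma>2)) \<and>
     (\<Gamma>1 = \<Gamma>2 \<longleftrightarrow> random_graph \<infinity> M1 W1 = random_graph \<infinity> M2 W2) \<and>
     (\<Gamma>1 = \<Gamma>2 \<longleftrightarrow>
        (\<forall>n::nat. random_graph (enat n) M1 W1 = random_graph (enat n) M2 W2)) \<and>
     (\<Gamma>1 = \<Gamma>2 \<longleftrightarrow>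
        (\<exists>\<phi>1 \<phi>2. measure_preserving unit_interval M1 \<phi>1 \<and> measure_preserving unit_interval M2 \<phi>2 \<and>
           (AE (x, y) in unit_interval \<Otimes>\<^sub>M unit_interval.
              W1 (\<phi>1 x) (\<phi>1 y) = W2 (\<phi>2 x) (\<phi>2 y)))) \<and>
     (\<Gamma>1 = \<Gamma>2 \<longleftrightarrow>
        (\<exists>\<psi>. measure_preserving (M1 \<Otimes>\<^sub>M unit_interval) M2 \<psi> \<and>
           (AE ((x, y), (t1, t2)) in (M1 \<Otimes>\<^sub>M M1) \<Otimes>\<^sub>M (unit_interval \<Otimes>\<^sub>M unit_interval).
              W1 x y = W2 (\<psi> (x, t1)) (\<psi> (y, t2))))) \<and>
     (\<Gamma>1 = \<Gamma>2 \<longleftrightarrow> cut_distance M1 W1 M2 W2 = 0) \<and>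
     (almost_twin_free M2 W2 \<longrightarrow>
     (\<Gamma>1 = \<Gamma>2 \<longleftrightarrow>
        (\<exists>\<phi>. measure_preserving M1 M2 \<phi> \<and>
           (AE (x, y) in M1 \<Otimes>\<^sub>M M1. W1 x y = W2 (\<phi> x) (\<phi> y))))) \<and>
     (almost_twin_free M1 W1 \<and> almost_twin_free M2 W2 \<longrightarrow>
     (\<Gamma>1 = \<Gamma>2 \<longleftrightarrow>
        (\<exists>\<phi>. measure_preserving M1 M2 \<phi> \<and>
           (\<exists>N1 \<in> null_sets M1. \<exists>N2 \<in> null_sets M2.
              bimeasurable_bij (restrict_space M1 (space M1 - N1))
                (restrict_space M2 (space M2 - N2)) \<phi>) \<and>
           (AE (x, y) in M1 \<Otimes>\<^sub>M M1. W1 x y = W2 (\<phi> x) (\<phi> y))))) \<and>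
     (almost_twin_free M1 W1 \<and> almost_twin_free M2 W2 \<and> atomless M2 \<longrightarrow>
     (\<Gamma>1 = \<Gamma>2 \<longleftrightarrow>
        (\<exists>\<phi>. measure_preserving M1 M2 \<phi> \<and> bimeasurable_bij M1 M2 \<phi> \<and>
           (AE (x, y) in M1 \<Otimes>\<^sub>M M1. W1 x y = W2 (\<phi> x) (\<phi> y))))) \<and>
     atomless unit_interval"
    (is "(_ \<longleftrightarrow> ?ii) \<and> (_ \<longleftrightarrow> ?iii) \<and> (_ \<longleftrightarrow> ?iv) \<and> (_ \<longleftrightarrow> (\<exists>\<phi>1 \<phi>2. ?v \<phi>1 \<phi>2)) \<and>
      (_ \<longleftrightarrow> (\<exists>\<psi>. ?vi \<psi>)) \<and> (_ \<longleftrightarrow> ?vii) \<and> (?tf2 \<longrightarrow> (_ \<longleftrightarrow> (\<exists>\<phi>. ?mp \<phi> \<and> ?eq \<phi>))) \<and>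
      (?tf1 \<and> _ \<longrightarrow> (_ \<longleftrightarrow> (\<exists>\<phi>. _ \<phi> \<and> ?null_bij \<phi> \<and> _ \<phi>))) \<and>
      (_ \<and> _ \<and> ?atomless \<longrightarrow> (_ \<longleftrightarrow> (\<exists>\<phi>. _ \<phi> \<and> ?bij \<phi> \<and> _ \<phi>))) \<and> _")
proof -
  note B = assms(1,2) and W = assms(3,4)
  have P: "prob_space M1" "prob_space M2" using B by (auto simp: Borel_prob_space_def)
  note U = prob_space_unit_interval
  interpret M1: prob_space M1 by fact
  interpret M2: prob_space M2 by fact
  interpret U: prob_space unit_interval by (rule U)
  interpret MU: pair_prob_space M1 unit_interval ..
  note MU = MU.prob_space_axioms
  let ?same = "same_densities M1 W1 M2 W2"
  \<comment> \<open>Equality of densities is the hub: every condition is compared with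
    \<open>?same\<close>, so no direct passage between two conditions has to be found.\<close>
  have i: "\<Gamma>1 = \<Gamma>2 \<longleftrightarrow> ?same"
    unfolding assms(5,6) by (rule graphon_limit_eq_iff[OF P(1) W(1) P(2) W(2)])
  have ii: "?same \<longleftrightarrow> ?ii"
    unfolding assms(5,6) same_densities_def
    using graphon_limit(2)[OF P(1) W(1)] graphon_limit(2)[OF P(2) W(2)] by simp
  have iii: "?same \<longleftrightarrow> ?iii" by (rule random_graph_infinite_iff[OF P(1) W(1) P(2) W(2), symmetric])
  have iv: "?same \<longleftrightarrow> ?iv" by (rule random_graph_finite_iff[OF P(1) W(1) P(2) W(2), symmetric])
  \<comment> \<open>Regroups the four variables into two independent points of the product of
    \<open>M1\<close> with the unit interval.\<close>
  have vi_iff: "?vi \<psi> \<longleftrightarrow> measure_preserving (M1 \<Otimes>\<^sub>M unit_interval) M2 \<psi> \<and>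
    (AE p in (M1 \<Otimes>\<^sub>M unit_interval) \<Otimes>\<^sub>M (M1 \<Otimes>\<^sub>M unit_interval). W1 (fst (fst p)) (fst (snd p)) = W2 (\<psi> (fst p)) (\<psi> (snd p)))" for \<psi>
    using AE_shuffle_iff[OF P(1,1) U U, of "\<lambda>x y t1 t2. W1 x y = W2 (\<psi> (x, t1)) (\<psi> (y, t2))"] by simp
  note kernel = graphon_kernel[OF B W]
  note common = same_densities_of_common_pullback[OF _ W]
  have vi: "?same \<longleftrightarrow> (\<exists>\<psi>. ?vi \<psi>)"
    unfolding vi_iff using kernel common[OF MU measure_preserving_fst[OF U]] by blast
  have v: "?same \<longleftrightarrow> (\<exists>\<phi>1 \<phi>2. ?v \<phi>1 \<phi>2)"
  proof
    assume ?same
    then obtain \<psi> where \<psi>: "measure_preserving (M1 \<Otimes>\<^sub>M unit_interval) M2 \<psi>"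
      "AE p in (M1 \<Otimes>\<^sub>M unit_interval) \<Otimes>\<^sub>M (M1 \<Otimes>\<^sub>M unit_interval). W1 (fst (fst p)) (fst (snd p)) = W2 (\<psi> (fst p)) (\<psi> (snd p))"
      using kernel by blast
    obtain \<theta> where \<theta>: "measure_preserving unit_interval (M1 \<Otimes>\<^sub>M unit_interval) \<theta>"
      using measure_preserving_unit_times_unit[OF B(1)] by blast
    \<comment> \<open>Both maps factor through the same point \<open>\<theta> x\<close>: its first
      component gives the type for \<open>W1\<close>, its image under \<psi> the type for
      \<open>W2\<close>.\<close>
    have "?v (\<lambda>x. fst (\<theta> x)) (\<lambda>x. \<psi> (\<theta> x))"
      using measure_preserving_comp[OF \<theta> measure_preserving_fst[OF U]] measure_preserving_comp[OF \<theta> \<psi>(1)]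
        AE_measure_preserving[OF measure_preserving_pair[OF \<theta> \<theta> MU] \<psi>(2)]
      by (simp add: case_prod_unfold)
    then show "\<exists>\<phi>1 \<phi>2. ?v \<phi>1 \<phi>2" by blast
  next
    assume "\<exists>\<phi>1 \<phi>2. ?v \<phi>1 \<phi>2"
    then show ?same using common[OF U] by (auto simp: case_prod_unfold)
  qed
  have vii: "?same \<longleftrightarrow> ?vii"
  proof
    assume ?same
    then obtain \<phi>1 \<phi>2 where "?v \<phi>1 \<phi>2" using v by blast
    then show ?vii using cut_distance_eq_0[OF W U, of \<phi>1 \<phi>2] by (simp add: case_prod_unfold)
  qed (rule same_densities_of_cut_distance[OF W P])
  have from_map: "?same" if "?mp \<phi>" "?eq \<phi>" for \<phi>
    using common[OF P(1) measure_preserving_id that(1)] that(2) by (simp add: case_prod_unfold)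
  have viii: "\<exists>\<phi>. ?mp \<phi> \<and> ?eq \<phi>" if same: ?same and tf: ?tf2
  proof -
    obtain \<psi> where \<psi>: "measure_preserving (M1 \<Otimes>\<^sub>M unit_interval) M2 \<psi>"
      "AE p in (M1 \<Otimes>\<^sub>M unit_interval) \<Otimes>\<^sub>M (M1 \<Otimes>\<^sub>M unit_interval). W1 (fst (fst p)) (fst (snd p)) = W2 (\<psi> (fst p)) (\<psi> (snd p))"
      using kernel same by blast
    show ?thesis using twin_collapse[OF P(1) B(2) W \<psi> tf] by (auto simp: case_prod_unfold)
  qed
  have inverse: "\<exists>\<phi> \<phi>'. ?mp \<phi> \<and> ?eq \<phi> \<and> measure_preserving M2 M1 \<phi>' \<and>
      (AE x in M1. \<phi>' (\<phi> x) = x) \<and> (AE y in M2. \<phi> (\<phi>' y) = y)" if same: ?same and tf: ?tf1 ?tf2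
  proof -
    obtain \<phi> where \<phi>: "?mp \<phi>" "?eq \<phi>" using viii[OF same tf(2)] by blast
    then have "AE z in M1 \<Otimes>\<^sub>M M1. W1 (fst z) (snd z) = W2 (\<phi> (fst z)) (\<phi> (snd z))"
      by (simp add: case_prod_unfold)
    from almost_inverse[OF B W \<phi>(1) this tf(1)] \<phi> show ?thesis by blast
  qed
  have ix: "\<exists>\<phi>. ?mp \<phi> \<and> ?null_bij \<phi> \<and> ?eq \<phi>" if same: ?same ?tf1 ?tf2
  proof -
    obtain \<phi> \<phi>' where \<phi>: "?mp \<phi>" "?eq \<phi>" "measure_preserving M2 M1 \<phi>'" "AE x in M1. \<phi>' (\<phi> x) = x" "AE y in M2. \<phi> (\<phi>' y) = y"
      using inverse[OF same] by blast
    note m = measure_preserving_measurable[OF \<phi>(1)] measure_preserving_measurable[OF \<phi>(3)]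
    have "?null_bij \<phi>"
      using null_set_of_AE_eq[OF B(1) measurable_compose[OF m] \<phi>(4)] null_set_of_AE_eq[OF B(2) measurable_compose[OF m(2,1)] \<phi>(5)]
        almost_inverse_bimeasurable_bij[OF m] by blast
    with \<phi>(1,2) show ?thesis by blast
  qed
  have ix': "\<exists>\<phi>. ?mp \<phi> \<and> ?bij \<phi> \<and> ?eq \<phi>" if same: ?same ?tf1 ?tf2 and at: ?atomless
  proof -
    obtain \<phi> \<phi>' where \<phi>: "?mp \<phi>" "?eq \<phi>" "measure_preserving M2 M1 \<phi>'" "AE x in M1. \<phi>' (\<phi> x) = x" "AE y in M2. \<phi> (\<phi>' y) = y"
      using inverse[OF same] by blast
    obtain \<kappa> where \<kappa>: "?mp \<kappa>" "?bij \<kappa>" "AE x in M1. \<kappa> x = \<phi> x"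
      using atomless_isomorphism[OF B at \<phi>(1,3,4,5)] by blast
    have "?eq \<kappa>" using graphon_eq_cong_AE[OF P(1) _ \<kappa>(3), of W1 W2] \<phi>(2) by (simp add: case_prod_unfold)
    with \<kappa>(1,2) show ?thesis by blast
  qed
  show ?thesis
    unfolding i using ii iii iv v vi vii from_map viii ix ix' atomless_unit_interval
    by (intro conjI impI) blast+
qed

end
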